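(* Set Packing with Matroid Constraints (SPMC), restricted to instances in which all sets of the family $\mathcal H$ have size at most $\gamma$ and there are $m$ matroids of rank at most $r$ with given representations over a field $\mathbb F=\mathbb F_{p^d}$, is solvable in time of $$2^{O(\alpha\gamma m)}\cdot|\mathcal H|^2\cdot\mathrm{poly}(r)+m^2n\cdot\mathrm{poly}(r,\alpha,\gamma,p,d)$$ operations over $\mathbb F$.
   Context: SPMC is the following problem. Input: matroids $\{(U,\mathcal I_i)\}_{i=1}^m$ over a common finite ground set $U$ with $n=|U|$, a family $\mathcal H\subseteq 2^U$, a function $w\colon\mathcal H\to\mathbb R$, and $\alpha\in\mathbb N$. Task: find sets $H_1,\dots,H_\alpha\in\mathcal H$ such that $\biguplus_{i=1}^\alpha H_i\in\bigcap_{i=1}^m\mathcal I_i$, maximizing $\sum_{i=1}^\alpha w(H_i)$ (or report that no such sets exist). Here $\uplus$ denotes a union of sets that are required to be pairwise disjoint. $\mathbb F_{p^d}$ is the finite field with $p^d$ elements, $p$ prime. An $(r\times n)$-representation of a matroid $(U,\mathcal I)$ over $\mathbb F$ is a matrix in $\mathbb F^{r\times n}$ with columns labeled by the elements of $U$ such that $S\in\mathcal I$ iff the columns labeled by $S$ are linearly independent over $\mathbb F$; representations are assumed to have as many rows as the rank of the matroid. *)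

theory Defs
  imports
    "HOL-Algebra.Ring"
    "HOL-Library.Disjoint_Sets"
    "HOL-Computational_Algebra.Polynomial"
    "HOL-Computational_Algebra.Primes"
begin

section \<open>Matroids and their representations\<close>

definition matroid :: "'a set \<Rightarrow> 'a set set \<Rightarrow> bool" where
  "matroid U \<I> \<longleftrightarrow>
     finite U \<and> \<I> \<subseteq> Pow U \<and> {} \<in> \<I> \<and>
     (\<forall>S T. S \<in> \<I> \<longrightarrow> T \<subseteq> S \<longrightarrow> T \<in> \<I>) \<and>
     (\<forall>S T. S \<in> \<I> \<longrightarrow> T \<in> \<I> \<longrightarrow> card T < card S \<longrightarrow> (\<exists>x \<in> S - T. insert x T \<in> \<I>))"

definition matroid_rank :: "'a set set \<Rightarrow> nat" where
  "matroid_rank \<I> = Max (card ` \<I>)"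

text \<open>A matrix with \<open>k\<close> rows and columns labelled by \<open>U\<close> is a function \<open>A\<close>; its entry in row
  \<open>i < k\<close> and column \<open>u\<close> is \<open>A i u\<close>. Independence is that of the family of columns indexed
  by \<open>S\<close>: two distinct labels carrying the same column are dependent.\<close>

definition columns_independent ::
    "('f, 'b) ring_scheme \<Rightarrow> nat \<Rightarrow> (nat \<Rightarrow> 'a \<Rightarrow> 'f) \<Rightarrow> 'a set \<Rightarrow> bool" where
  "columns_independent F k A S \<longleftrightarrow>
     (\<forall>c \<in> S \<rightarrow> carrier F.
        (\<forall>i<k. (\<Oplus>\<^bsub>F\<^esub>u\<in>S. c u \<otimes>\<^bsub>F\<^esub> A i u) = \<zero>\<^bsub>F\<^esub>) \<longrightarrow> (\<forall>u\<in>S. c u = \<zero>\<^bsub>F\<^esub>))"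

text \<open>The number of rows of a representation is the rank of the matroid.\<close>

definition represents ::
    "('f, 'b) ring_scheme \<Rightarrow> 'a set \<Rightarrow> 'a set set \<Rightarrow> (nat \<Rightarrow> 'a \<Rightarrow> 'f) \<Rightarrow> bool" where
  "represents F U \<I> A \<longleftrightarrow>
     (\<forall>i<matroid_rank \<I>. \<forall>u\<in>U. A i u \<in> carrier F) \<and>
     (\<forall>S\<subseteq>U. S \<in> \<I> \<longleftrightarrow> columns_independent F (matroid_rank \<I>) A S)"

section \<open>Set Packing with Matroid Constraints\<close>

text \<open>The matroids are indexed by \<open>{..<num_matroids X}\<close>. Only the values of \<open>weight X\<close> on
  \<open>family X\<close> matter.\<close>

record 'a spmc =
  ground :: "'a set"
  num_matroids :: nat
  indeps :: "nat \<Rightarrow> 'a set set"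
  family :: "'a set set"
  weight :: "'a set \<Rightarrow> real"
  alpha :: nat

definition spmc_instance :: "'a spmc \<Rightarrow> bool" where
  "spmc_instance X \<longleftrightarrow>
     finite (ground X) \<and> family X \<subseteq> Pow (ground X) \<and>
     (\<forall>i<num_matroids X. matroid (ground X) (indeps X i))"

text \<open>Disjointness is required of the members at different positions, so the empty set
  may be chosen repeatedly while a nonempty set may not.\<close>

definition feasible :: "'a spmc \<Rightarrow> 'a set list \<Rightarrow> bool" where
  "feasible X Hs \<longleftrightarrow>
     length Hs = alpha X \<and> set Hs \<subseteq> family X \<and>
     disjoint_family_on (\<lambda>j. Hs ! j) {..<length Hs} \<and>
     (\<forall>i<num_matroids X. \<Union>(set Hs) \<in> indeps X i)"

definition optimal :: "'a spmc \<Rightarrow> 'a set list \<Rightarrow> bool" where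
  "optimal X Hs \<longleftrightarrow>
     feasible X Hs \<and>
     (\<forall>Hs'. feasible X Hs' \<longrightarrow> sum_list (map (weight X) Hs') \<le> sum_list (map (weight X) Hs))"

section \<open>Machine model\<close>

text \<open>A deterministic random access machine with three memories, holding natural numbers,
  elements of \<open>F\<close> and real numbers. Each instruction costs one unit, so that the running time
  bounds the number of operations over \<open>F\<close> together with all the bookkeeping. On natural
  numbers there are, as usual for unit cost, only addition, truncated subtraction and
  comparison (no multiplication); \<open>F\<close> is accessed only through its arithmetic and equality
  tests; real numbers (weights) can only be added and compared. Programs contain no field
  elements, so one program runs over every field; a single program for all finite fields (up
  to isomorphism) is obtained when the type of field elements is infinite, e.g. \<open>nat\<close>.

  \<open>Dir k\<close> is cell \<open>k\<close>; \<open>Ind k\<close> is the cell whose number is stored in cell \<open>k\<close> of the memory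
  of natural numbers. The first operand is the target; the \<open>nat\<close> operand of a jump is the
  target line.\<close>

datatype addr = Dir nat | Ind nat

datatype instr =
    NConst addr nat
  | NCopy addr addr
  | NAdd addr addr addr
  | NSub addr addr addr
  | NJumpLe addr addr nat
  | FZero addr
  | FOne addr
  | FCopy addr addr
  | FAdd addr addr addr
  | FSub addr addr addr
  | FMul addr addr addr
  | FInv addr addr
  | FJumpEq addr addr nat
  | RZero addr
  | RCopy addr addr
  | RAdd addr addr addr
  | RJumpLe addr addr nat

type_synonym prog = "instr list"

record 'f state =
  pc :: nat
  nmem :: "nat \<Rightarrow> nat"
  fmem :: "nat \<Rightarrow> 'f"
  rmem :: "nat \<Rightarrow> real"

fun loc :: "'f state \<Rightarrow> addr \<Rightarrow> nat" where
  "loc s (Dir k) = k"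
| "loc s (Ind k) = nmem s k"

definition setN :: "'f state \<Rightarrow> addr \<Rightarrow> nat \<Rightarrow> 'f state" where
  "setN s a v = s\<lparr>nmem := (nmem s)(loc s a := v), pc := Suc (pc s)\<rparr>"

definition setF :: "'f state \<Rightarrow> addr \<Rightarrow> 'f \<Rightarrow> 'f state" where
  "setF s a v = s\<lparr>fmem := (fmem s)(loc s a := v), pc := Suc (pc s)\<rparr>"

definition setR :: "'f state \<Rightarrow> addr \<Rightarrow> real \<Rightarrow> 'f state" where
  "setR s a v = s\<lparr>rmem := (rmem s)(loc s a := v), pc := Suc (pc s)\<rparr>"

definition jump_if :: "bool \<Rightarrow> nat \<Rightarrow> 'f state \<Rightarrow> 'f state" where
  "jump_if b l s = s\<lparr>pc := (if b then l else Suc (pc s))\<rparr>"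

abbreviation getN :: "'f state \<Rightarrow> addr \<Rightarrow> nat" where
  "getN s a \<equiv> nmem s (loc s a)"

abbreviation getF :: "'f state \<Rightarrow> addr \<Rightarrow> 'f" where
  "getF s a \<equiv> fmem s (loc s a)"

abbreviation getR :: "'f state \<Rightarrow> addr \<Rightarrow> real" where
  "getR s a \<equiv> rmem s (loc s a)"

text \<open>As in HOL's type classes, the inverse of zero is zero.\<close>

fun exec :: "('f, 'b) ring_scheme \<Rightarrow> instr \<Rightarrow> 'f state \<Rightarrow> 'f state" where
  "exec F (NConst a v) s = setN s a v"
| "exec F (NCopy a b) s = setN s a (getN s b)"
| "exec F (NAdd a b c) s = setN s a (getN s b + getN s c)"
| "exec F (NSub a b c) s = setN s a (getN s b - getN s c)"
| "exec F (NJumpLe a b l) s = jump_if (getN s a \<le> getN s b) l s"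
| "exec F (FZero a) s = setF s a \<zero>\<^bsub>F\<^esub>"
| "exec F (FOne a) s = setF s a \<one>\<^bsub>F\<^esub>"
| "exec F (FCopy a b) s = setF s a (getF s b)"
| "exec F (FAdd a b c) s = setF s a (getF s b \<oplus>\<^bsub>F\<^esub> getF s c)"
| "exec F (FSub a b c) s = setF s a (getF s b \<ominus>\<^bsub>F\<^esub> getF s c)"
| "exec F (FMul a b c) s = setF s a (getF s b \<otimes>\<^bsub>F\<^esub> getF s c)"
| "exec F (FInv a b) s =
     setF s a (if getF s b = \<zero>\<^bsub>F\<^esub> then \<zero>\<^bsub>F\<^esub> else inv\<^bsub>F\<^esub> (getF s b))"
| "exec F (FJumpEq a b l) s = jump_if (getF s a = getF s b) l s"
| "exec F (RZero a) s = setR s a 0"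
| "exec F (RCopy a b) s = setR s a (getR s b)"
| "exec F (RAdd a b c) s = setR s a (getR s b + getR s c)"
| "exec F (RJumpLe a b l) s = jump_if (getR s a \<le> getR s b) l s"

definition halted :: "prog \<Rightarrow> 'f state \<Rightarrow> bool" where
  "halted P s \<longleftrightarrow> length P \<le> pc s"

definition step :: "('f, 'b) ring_scheme \<Rightarrow> prog \<Rightarrow> 'f state \<Rightarrow> 'f state" where
  "step F P s = (if halted P s then s else exec F (P ! pc s) s)"

section \<open>Input and output\<close>

text \<open>The input presents the ground set by an enumeration \<open>us\<close> and the family by a list \<open>hs\<close>
  without repetitions, whose entries list the positions in \<open>us\<close> of the elements of a member.\<close>

definition set_at :: "'a list \<Rightarrow> nat list \<Rightarrow> 'a set" where
  "set_at us h = (\<lambda>k. us ! k) ` set h"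

definition encodes :: "'a list \<Rightarrow> nat list list \<Rightarrow> 'a spmc \<Rightarrow> bool" where
  "encodes us hs X \<longleftrightarrow>
     distinct us \<and> set us = ground X \<and>
     (\<forall>h \<in> set hs. distinct h \<and> set h \<subseteq> {..<length us}) \<and>
     distinct (map (set_at us) hs) \<and> set (map (set_at us) hs) = family X"

text \<open>In each memory the cells below \<open>R\<close> are working registers, initially zero; the input starts
  at cell \<open>R\<close>. The number \<open>R\<close> belongs to the program and must not depend on the input.\<close>

definition memory_of :: "'v \<Rightarrow> nat \<Rightarrow> 'v list \<Rightarrow> nat \<Rightarrow> 'v" where
  "memory_of z R xs k = (if R \<le> k \<and> k < R + length xs then xs ! (k - R) else z)"

text \<open>The matrices are stored one after the other, each column by column.\<close>

definition init_state ::
    "nat \<Rightarrow> ('f, 'b) ring_scheme \<Rightarrow> nat \<Rightarrow> nat \<Rightarrow> 'a spmc \<Rightarrow> (nat \<Rightarrow> nat \<Rightarrow> 'a \<Rightarrow> 'f)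
      \<Rightarrow> 'a list \<Rightarrow> nat list list \<Rightarrow> 'f state" where
  "init_state R F p d X A us hs =
     \<lparr>pc = 0,
      nmem = memory_of 0 R
        ([num_matroids X, length us, alpha X, p, d, length hs]
         @ map (\<lambda>i. matroid_rank (indeps X i)) [0..<num_matroids X]
         @ concat (map (\<lambda>h. length h # h) hs)),
      fmem = memory_of \<zero>\<^bsub>F\<^esub> R
        (concat (map (\<lambda>i. concat (map (\<lambda>u. map (\<lambda>k. A i k u) [0..<matroid_rank (indeps X i)]) us))
           [0..<num_matroids X])),
      rmem = memory_of 0 R (map (\<lambda>h. weight X (set_at us h)) hs)\<rparr>"

text \<open>Cell 0 of the final memory is 0 if the machine reports that there is no solution;
  otherwise the \<open>alpha X\<close> cells from cell \<open>R\<close> on contain the positions in \<open>hs\<close> of the chosen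
  sets.\<close>

definition correct_output :: "nat \<Rightarrow> 'a spmc \<Rightarrow> 'a list \<Rightarrow> nat list list \<Rightarrow> 'f state \<Rightarrow> bool" where
  "correct_output R X us hs s \<longleftrightarrow>
     (if nmem s 0 = 0 then \<not> (\<exists>Hs. feasible X Hs)
      else (\<forall>j<alpha X. nmem s (R + j) < length hs) \<and>
           optimal X (map (\<lambda>j. set_at us (hs ! nmem s (R + j))) [0..<alpha X]))"

definition solves_within ::
    "prog \<Rightarrow> nat \<Rightarrow> ('f, 'b) ring_scheme \<Rightarrow> nat \<Rightarrow> nat \<Rightarrow> 'a spmc \<Rightarrow> (nat \<Rightarrow> nat \<Rightarrow> 'a \<Rightarrow> 'f)
      \<Rightarrow> 'a list \<Rightarrow> nat list list \<Rightarrow> nat \<Rightarrow> bool" where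
  "solves_within P R F p d X A us hs T \<longleftrightarrow>
     (\<exists>t\<le>T. let s = (step F P ^^ t) (init_state R F p d X A us hs)
            in halted P s \<and> correct_output R X us hs s)"

end

theory Submission imports Defs begin

text \<open>Column \<open>u\<close> of matroid \<open>i\<close> is turned into a polynomial \<open>f\<close> over the field whose coefficients
  are the entries of the column, different matroids occupying disjoint ranges of exponents. A
  selection is feasible iff its labels \<open>(i, u)\<close> are distinct and have linearly independent
  polynomials. If there are at most \<open>N\<close> of them, this holds iff the wedge product of the vectors
  \<open>(f(x), f(x\<^sup>2), \<dots>, f(x\<^sup>N))\<close> over the polynomial ring does not vanish: the product is alternating,
  so one may pass to polynomials of strictly decreasing degrees, and then the leading terms do not
  cancel. Such a product has \<open>2\<^sup>N\<close> polynomial coordinates, hence lies in a space over the field of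
  dimension \<open>L = 2\<^sup>N E\<close> for a polynomially bounded \<open>E\<close>. Dynamic programming over the number of chosen sets
  keeps at most \<open>L\<close> partial selections: Gaussian elimination that always takes a heaviest pivot
  retains, for every linear functional that is nonzero at some partial selection, one that is at
  least as heavy. The algorithm is written in a small language of bounded loops, for which a
  compiler to the random access machine is verified together with a bound on the running time.\<close>

section \<open>Exterior products\<close>

text \<open>The obstacle is that the polynomials have \<open>D\<close> coefficients, and
  \<open>D\<close> is not bounded in terms of \<open>N\<close>: an exterior power of that space
  would be far too large. Substituting x, x^2, ..., x^N compresses each polynomial to
  \<open>N\<close> entries and loses no independence among at most \<open>N\<close> of them. For
  degrees d1 > d2 > ... a minor contains a term of degree d1 t1 + d2 t2 + ... with t1 > t2 > ...,
  and by the rearrangement inequality no other term reaches this degree. Since x stays an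
  indeterminate, this works over every field, however small, without extensions or random choices;
  the price is the factor \<open>E\<close>, which is \<open>N * N * D + 1\<close> because the
  relevant degrees are at most \<open>N * N * D\<close>. The machine cannot multiply numbers, so
  addresses are products formed by repeated addition, and the nesting of these loops decides whether
  the time stays quadratic in the family and linear in \<open>n\<close>. The cost is read off the
  syntax of the program. To make this sound, no piece of the program assigns a variable that bounds
  one of its own loops.\<close>

context cring begin

section \<open>Finite sums, multiplication by f(x^s), and the alternating product\<close>

lemma sub_smult_distrib:
  "a \<in> carrier R \<Longrightarrow> a' \<in> carrier R \<Longrightarrow> b \<in> carrier R \<Longrightarrow> b' \<in> carrier R \<Longrightarrow> c \<in> carrier R \<Longrightarrow>
    a \<ominus> c \<otimes> a' \<ominus> (b \<ominus> c \<otimes> b') = a \<ominus> b \<ominus> c \<otimes> (a' \<ominus> b')"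
  by algebra

lemma sub_swap_neg:
  "x \<in> carrier R \<Longrightarrow> y \<in> carrier R \<Longrightarrow> z \<in> carrier R \<Longrightarrow> x \<ominus> (y \<ominus> \<ominus> z) = \<ominus> (y \<ominus> (x \<ominus> z))"
  by algebra

text \<open>A recursion instead of a sum over a set, since its step is exactly one round of the loop
  \<open>jloop\<close>.\<close>

primrec fsum :: "nat \<Rightarrow> (nat \<Rightarrow> 'a) \<Rightarrow> 'a" where
  "fsum 0 g = \<zero>"
| "fsum (Suc n) g = fsum n g \<oplus> g n"

lemma fsum_closed [simp]: "(\<And>i. i < n \<Longrightarrow> g i \<in> carrier R) \<Longrightarrow> fsum n g \<in> carrier R"
  by (induction n) auto

lemma fsum_cong: "(\<And>i. i < n \<Longrightarrow> g i = g' i) \<Longrightarrow> fsum n g = fsum n g'"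
  by (induction n) auto

lemma fsum_zero: "(\<And>i. i < n \<Longrightarrow> g i = \<zero>) \<Longrightarrow> fsum n g = \<zero>"
  by (induction n) auto

lemma fsum_add:
  "(\<And>i. i < n \<Longrightarrow> g i \<in> carrier R) \<Longrightarrow> (\<And>i. i < n \<Longrightarrow> g' i \<in> carrier R) \<Longrightarrow>
    fsum n (\<lambda>i. g i \<oplus> g' i) = fsum n g \<oplus> fsum n g'"
  by (induction n) (auto simp: a_ac)

lemma fsum_smult:
  "c \<in> carrier R \<Longrightarrow> (\<And>i. i < n \<Longrightarrow> g i \<in> carrier R) \<Longrightarrow>
    fsum n (\<lambda>i. c \<otimes> g i) = c \<otimes> fsum n g"
  by (induction n) (auto simp: r_distr)

text \<open>Linearity is stated throughout for \<open>a \<ominus> c \<otimes> b\<close>: this single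
  form yields multiples and differences, and it is the shape of the elimination step.\<close>

lemma fsum_sub_smult:
  assumes "c \<in> carrier R" "\<And>i. i < n \<Longrightarrow> g i \<in> carrier R" "\<And>i. i < n \<Longrightarrow> g' i \<in> carrier R"
  shows "fsum n (\<lambda>i. g i \<ominus> c \<otimes> g' i) = fsum n g \<ominus> c \<otimes> fsum n g'"
  using assms
proof (induction n)
  case 0 then show ?case by (simp add: minus_eq)
next
  case (Suc n)
  have "g n \<in> carrier R" "g' n \<in> carrier R" "fsum n g \<in> carrier R" "fsum n g' \<in> carrier R"
    using Suc.prems by auto
  then show ?case using Suc by (simp, algebra)
qed

lemma fsum_swap:
  assumes "\<And>i j. i < n \<Longrightarrow> j < m \<Longrightarrow> g i j \<in> carrier R"
  shows "fsum n (\<lambda>i. fsum m (g i)) = fsum m (\<lambda>j. fsum n (\<lambda>i. g i j))"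
  using assms
proof (induction n)
  case 0 then show ?case by (simp add: fsum_zero)
next
  case (Suc n)
  then show ?case by (simp add: fsum_add)
qed

lemma fsum_single:
  assumes "k < n" "g k \<in> carrier R" "\<And>i. i < n \<Longrightarrow> i \<noteq> k \<Longrightarrow> g i = \<zero>"
  shows "fsum n g = g k"
  using assms
proof (induction n)
  case (Suc n)
  show ?case
  proof (cases "k = n")
    case True
    then have "fsum n g = \<zero>" using Suc.prems by (intro fsum_zero) auto
    then show ?thesis using True Suc.prems by simp
  next
    case False
    then show ?thesis using Suc by auto
  qed
qed simp

text \<open>Coefficient functions stand for polynomials in \<open>x\<close>: this is the product of \<open>f(x\<^sup>s)\<close>, where
  \<open>f\<close> has degree less than \<open>D\<close>, and \<open>v\<close>.\<close>

definition mulx :: "nat \<Rightarrow> nat \<Rightarrow> (nat \<Rightarrow> 'a) \<Rightarrow> (nat \<Rightarrow> 'a) \<Rightarrow> nat \<Rightarrow> 'a" where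
  "mulx D s f v e = fsum D (\<lambda>j. if j * s \<le> e then f j \<otimes> v (e - j * s) else \<zero>)"

lemma mulx_closed [simp]:
  "(\<And>j. f j \<in> carrier R) \<Longrightarrow> (\<And>e. v e \<in> carrier R) \<Longrightarrow> mulx D s f v e \<in> carrier R"
  by (simp add: mulx_def)

lemma mulx_cong: "(\<And>e'. e' \<le> e \<Longrightarrow> v e' = v' e') \<Longrightarrow> mulx D s f v e = mulx D s f v' e"
  unfolding mulx_def by (intro fsum_cong) auto

lemma mulx_zero [simp]: "(\<And>j. f j \<in> carrier R) \<Longrightarrow> mulx D s f (\<lambda>e. \<zero>) e = \<zero>"
  unfolding mulx_def by (intro fsum_zero) auto

lemma mulx_sub_smult:
  assumes "\<And>j. f j \<in> carrier R" "\<And>e. v e \<in> carrier R" "\<And>e. v' e \<in> carrier R" "c \<in> carrier R"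
  shows "mulx D s f (\<lambda>e. v e \<ominus> c \<otimes> v' e) e = mulx D s f v e \<ominus> c \<otimes> mulx D s f v' e"
proof -
  have "mulx D s f (\<lambda>e. v e \<ominus> c \<otimes> v' e) e =
    fsum D (\<lambda>j. (if j * s \<le> e then f j \<otimes> v (e - j * s) else \<zero>) \<ominus>
      c \<otimes> (if j * s \<le> e then f j \<otimes> v' (e - j * s) else \<zero>))"
    unfolding mulx_def
  proof (intro fsum_cong)
    fix j
    have "f j \<in> carrier R" "v (e - j * s) \<in> carrier R" "v' (e - j * s) \<in> carrier R" using assms by auto
    then show "(if j * s \<le> e then f j \<otimes> (v (e - j * s) \<ominus> c \<otimes> v' (e - j * s)) else \<zero>) =
      (if j * s \<le> e then f j \<otimes> v (e - j * s) else \<zero>) \<ominus>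
      c \<otimes> (if j * s \<le> e then f j \<otimes> v' (e - j * s) else \<zero>)"
      using assms(4) by (simp, algebra)
  qed
  then show ?thesis using assms by (simp add: mulx_def fsum_sub_smult)
qed

lemma mulx_sub_smult_left:
  assumes "\<And>j. f j \<in> carrier R" "\<And>j. g j \<in> carrier R" "\<And>e. v e \<in> carrier R" "c \<in> carrier R"
  shows "mulx D s (\<lambda>j. f j \<ominus> c \<otimes> g j) v e = mulx D s f v e \<ominus> c \<otimes> mulx D s g v e"
proof -
  have "mulx D s (\<lambda>j. f j \<ominus> c \<otimes> g j) v e =
    fsum D (\<lambda>j. (if j * s \<le> e then f j \<otimes> v (e - j * s) else \<zero>) \<ominus>
      c \<otimes> (if j * s \<le> e then g j \<otimes> v (e - j * s) else \<zero>))"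
    unfolding mulx_def
  proof (intro fsum_cong)
    fix j
    have "f j \<in> carrier R" "g j \<in> carrier R" "v (e - j * s) \<in> carrier R" using assms by auto
    then show "(if j * s \<le> e then (f j \<ominus> c \<otimes> g j) \<otimes> v (e - j * s) else \<zero>) =
      (if j * s \<le> e then f j \<otimes> v (e - j * s) else \<zero>) \<ominus>
      c \<otimes> (if j * s \<le> e then g j \<otimes> v (e - j * s) else \<zero>)"
      using assms(4) by (simp, algebra)
  qed
  then show ?thesis using assms by (simp add: mulx_def fsum_sub_smult)
qed

text \<open>Both sides are double sums of the same terms: the nested guards combine to the symmetric
  condition \<open>j * s + i * s' \<le> e\<close>, so only the order of summation differs.\<close>

lemma mulx_commute:
  assumes f: "\<And>j. f j \<in> carrier R" and g: "\<And>j. g j \<in> carrier R" and v: "\<And>e. v e \<in> carrier R"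
  shows "mulx D s f (mulx D s' g v) e = mulx D s' g (mulx D s f v) e"
proof -
  let ?h = "\<lambda>j i. if j * s + i * s' \<le> e then f j \<otimes> (g i \<otimes> v (e - (j * s + i * s'))) else \<zero>"
  have "mulx D s f (mulx D s' g v) e = fsum D (\<lambda>j. fsum D (?h j))"
    unfolding mulx_def
  proof (intro fsum_cong)
    fix j
    show "(if j * s \<le> e then f j \<otimes> fsum D (\<lambda>i. if i * s' \<le> e - j * s
        then g i \<otimes> v (e - j * s - i * s') else \<zero>) else \<zero>) = fsum D (?h j)"
    proof (cases "j * s \<le> e")
      case True
      then show ?thesis using f g v
        by (subst fsum_smult[symmetric]) (auto intro!: fsum_cong)
    next
      case False
      then have "fsum D (?h j) = \<zero>" by (intro fsum_zero) auto
      then show ?thesis using False by simp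
    qed
  qed
  moreover have "mulx D s' g (mulx D s f v) e = fsum D (\<lambda>i. fsum D (\<lambda>j. ?h j i))"
    unfolding mulx_def
  proof (intro fsum_cong)
    fix i
    show "(if i * s' \<le> e then g i \<otimes> fsum D (\<lambda>j. if j * s \<le> e - i * s'
        then f j \<otimes> v (e - i * s' - j * s) else \<zero>) else \<zero>) = fsum D (\<lambda>j. ?h j i)"
    proof (cases "i * s' \<le> e")
      case True
      then show ?thesis using f g v
        by (subst fsum_smult[symmetric]) (auto intro!: fsum_cong simp: m_lcomm add.commute)
    next
      case False
      then have "fsum D (\<lambda>j. ?h j i) = \<zero>" by (intro fsum_zero) auto
      then show ?thesis using False by simp
    qed
  qed
  moreover have "fsum D (\<lambda>j. fsum D (?h j)) = fsum D (\<lambda>i. fsum D (\<lambda>j. ?h j i))"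
    using f g v by (intro fsum_swap) auto
  ultimately show ?thesis by simp
qed

text \<open>Elements of the exterior algebra over \<open>R[x]\<close> on \<open>N\<close> generators: \<open>v T e\<close> is the coefficient
  of \<open>x\<^sup>e\<close> at the basis element given by the subset whose characteristic list is \<open>T\<close>, read
  from generator \<open>N - 1\<close> down to generator \<open>0\<close>. The vector that is multiplied has component
  \<open>f(x\<^sup>t\<^sup>+\<^sup>1)\<close> at generator \<open>t\<close>.\<close>

fun wedge :: "nat \<Rightarrow> (nat \<Rightarrow> 'a) \<Rightarrow> (bool list \<Rightarrow> nat \<Rightarrow> 'a) \<Rightarrow> bool list \<Rightarrow> nat \<Rightarrow> 'a" where
  "wedge D f v [] e = \<zero>"
| "wedge D f v (False # bs) e = wedge D f (\<lambda>S. v (False # S)) bs e"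
| "wedge D f v (True # bs) e =
     mulx D (Suc (length bs)) f (v (False # bs)) e \<ominus> wedge D f (\<lambda>S. v (True # S)) bs e"

lemma wedge_closed [simp]:
  "(\<And>j. f j \<in> carrier R) \<Longrightarrow> (\<And>S e. v S e \<in> carrier R) \<Longrightarrow> wedge D f v T e \<in> carrier R"
  by (induction D f v T e rule: wedge.induct) auto

text \<open>Exponents only grow under multiplication, so a coefficient at \<open>e\<close> never
  uses one above \<open>e\<close>. This is why truncating all polynomials at a common degree is
  harmless.\<close>

lemma wedge_cong:
  "(\<And>S e'. length S = length T \<Longrightarrow> e' \<le> e \<Longrightarrow> v S e' = v' S e') \<Longrightarrow>
    wedge D f v T e = wedge D f v' T e"
proof (induction T arbitrary: v v')
  case (Cons b bs)
  have "wedge D f (\<lambda>S. v (b # S)) bs e = wedge D f (\<lambda>S. v' (b # S)) bs e"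
    by (rule Cons.IH) (simp add: Cons.prems)
  then show ?case
    using Cons.prems by (cases b) (auto intro!: mulx_cong arg_cong2[where f = "\<lambda>a b. a \<ominus> b"])
qed simp

lemma wedge_zero [simp]:
  "(\<And>j. f j \<in> carrier R) \<Longrightarrow> wedge D f (\<lambda>S e. \<zero>) T e = \<zero>"
proof (induction T)
  case (Cons b bs)
  then show ?case by (cases b) (auto simp: minus_eq)
qed simp

lemma wedge_sub_smult:
  assumes "\<And>j. f j \<in> carrier R" "c \<in> carrier R"
    "\<And>S e. v S e \<in> carrier R" "\<And>S e. v' S e \<in> carrier R"
  shows "wedge D f (\<lambda>S e. v S e \<ominus> c \<otimes> v' S e) T e = wedge D f v T e \<ominus> c \<otimes> wedge D f v' T e"
  using assms(3,4)
proof (induction T arbitrary: v v')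
  case Nil then show ?case using assms by (simp add: minus_eq)
next
  case (Cons b bs)
  let ?a = "mulx D (Suc (length bs)) f (v (False # bs)) e"
  let ?a' = "mulx D (Suc (length bs)) f (v' (False # bs)) e"
  let ?b = "wedge D f (\<lambda>S. v (True # S)) bs e" let ?b' = "wedge D f (\<lambda>S. v' (True # S)) bs e"
  have cl: "?a \<in> carrier R" "?a' \<in> carrier R" "?b \<in> carrier R" "?b' \<in> carrier R"
    using assms Cons.prems by auto
  have IH: "wedge D f (\<lambda>S e. v (b # S) e \<ominus> c \<otimes> v' (b # S) e) bs e =
     wedge D f (\<lambda>S. v (b # S)) bs e \<ominus> c \<otimes> wedge D f (\<lambda>S. v' (b # S)) bs e"
    by (rule Cons.IH) (auto simp: Cons.prems)
  show ?case
  proof (cases b)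
    case True
    have "?a \<ominus> c \<otimes> ?a' \<ominus> (?b \<ominus> c \<otimes> ?b') = ?a \<ominus> ?b \<ominus> c \<otimes> (?a' \<ominus> ?b')"
      using cl assms(2) by (intro sub_smult_distrib)
    then show ?thesis using True IH assms Cons.prems by (simp add: mulx_sub_smult)
  next
    case False
    then show ?thesis using IH by simp
  qed
qed

lemma wedge_sub_smult_left:
  assumes "\<And>j. f j \<in> carrier R" "\<And>j. g j \<in> carrier R" "c \<in> carrier R" "\<And>S e. v S e \<in> carrier R"
  shows "wedge D (\<lambda>j. f j \<ominus> c \<otimes> g j) v T e = wedge D f v T e \<ominus> c \<otimes> wedge D g v T e"
  using assms(4)
proof (induction T arbitrary: v)
  case Nil then show ?case using assms by (simp add: minus_eq)
next
  case (Cons b bs)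
  let ?a = "mulx D (Suc (length bs)) f (v (False # bs)) e"
  let ?a' = "mulx D (Suc (length bs)) g (v (False # bs)) e"
  let ?b = "wedge D f (\<lambda>S. v (True # S)) bs e" let ?b' = "wedge D g (\<lambda>S. v (True # S)) bs e"
  have cl: "?a \<in> carrier R" "?a' \<in> carrier R" "?b \<in> carrier R" "?b' \<in> carrier R"
    using assms Cons.prems by auto
  have IH: "wedge D (\<lambda>j. f j \<ominus> c \<otimes> g j) (\<lambda>S. v (b # S)) bs e =
     wedge D f (\<lambda>S. v (b # S)) bs e \<ominus> c \<otimes> wedge D g (\<lambda>S. v (b # S)) bs e"
    by (rule Cons.IH) (auto simp: Cons.prems)
  show ?case
  proof (cases b)
    case True
    have "?a \<ominus> c \<otimes> ?a' \<ominus> (?b \<ominus> c \<otimes> ?b') = ?a \<ominus> ?b \<ominus> c \<otimes> (?a' \<ominus> ?b')"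
      using cl assms(3) by (intro sub_smult_distrib)
    then show ?thesis using True IH assms Cons.prems by (simp add: mulx_sub_smult_left)
  next
    case False
    then show ?thesis using IH by simp
  qed
qed

text \<open>Multiplication by a scalar of the polynomial ring commutes with the product. The next
  two lemmas need this to compare their mixed terms.\<close>

lemma wedge_mulx:
  assumes "\<And>j. f j \<in> carrier R" "\<And>j. g j \<in> carrier R" "\<And>S e. v S e \<in> carrier R"
  shows "wedge D f (\<lambda>S. mulx D s g (v S)) T e = mulx D s g (wedge D f v T) e"
  using assms(3)
proof (induction T arbitrary: v e)
  case Nil then show ?case using assms by (simp add: ext[of "wedge D f v []" "\<lambda>e. \<zero>"])
next
  case (Cons b bs)
  have IH: "wedge D f (\<lambda>S. mulx D s g (v (b # S))) bs e = mulx D s g (wedge D f (\<lambda>S. v (b # S)) bs) e" for e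
    by (rule Cons.IH) (auto simp: Cons.prems)
  show ?case
  proof (cases b)
    case True
    let ?w = "wedge D f (\<lambda>S. v (True # S)) bs"
    let ?m = "mulx D (Suc (length bs)) f (v (False # bs))"
    have cl: "?w e \<in> carrier R" "?m e \<in> carrier R" for e using assms Cons.prems by auto
    have "wedge D f v (True # bs) = (\<lambda>e. ?m e \<ominus> \<one> \<otimes> ?w e)" using cl by auto
    moreover have "mulx D s g (\<lambda>e. ?m e \<ominus> \<one> \<otimes> ?w e) e = mulx D s g ?m e \<ominus> \<one> \<otimes> mulx D s g ?w e"
      using assms cl by (intro mulx_sub_smult) auto
    moreover have "mulx D (Suc (length bs)) f (mulx D s g (v (False # bs))) e = mulx D s g ?m e"
      using assms Cons.prems by (intro mulx_commute) auto
    ultimately show ?thesis using True IH[of e] assms cl by simp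
  next
    case False
    then have "wedge D f v (b # bs) = wedge D f (\<lambda>S. v (False # S)) bs" by auto
    then show ?thesis using False IH by simp
  qed
qed

text \<open>Split off the top generator. If it occurs, there are two mixed terms, in which one
  factor takes it and the other acts below it; exchanging \<open>f\<close> and \<open>g\<close>
  swaps them with opposite sign. The term in which neither takes it is the induction
  hypothesis.\<close>

lemma wedge_anticommute:
  assumes "\<And>j. f j \<in> carrier R" "\<And>j. g j \<in> carrier R" "\<And>S e. v S e \<in> carrier R"
  shows "wedge D f (wedge D g v) T e = \<ominus> wedge D g (wedge D f v) T e"
  using assms(3)
proof (induction T arbitrary: v e)
  case Nil then show ?case by simp
next
  case (Cons b bs)
  show ?case
  proof (cases b)
    case False
    have eq: "(\<lambda>S. wedge D h v (False # S)) = wedge D h (\<lambda>S. v (False # S))" for h by (auto intro!: ext)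
    show ?thesis using False Cons.IH[of "\<lambda>S. v (False # S)"] Cons.prems by (simp add: eq)
  next
    case True
    let ?v0 = "\<lambda>S. v (False # S)" let ?v1 = "\<lambda>S. v (True # S)"
    have *: "wedge D f (\<lambda>S. wedge D g v (True # S)) bs e =
        mulx D (Suc (length bs)) g (wedge D f ?v0 bs) e \<ominus> wedge D f (wedge D g ?v1) bs e"
      if f: "\<And>j. f j \<in> carrier R" and g: "\<And>j. g j \<in> carrier R" for f g
    proof -
      have "wedge D f (\<lambda>S. wedge D g v (True # S)) bs e =
         wedge D f (\<lambda>S e. mulx D (Suc (length bs)) g (?v0 S) e \<ominus> \<one> \<otimes> wedge D g ?v1 S e) bs e"
        using f g Cons.prems by (intro wedge_cong) simp
      also have "\<dots> = wedge D f (\<lambda>S. mulx D (Suc (length bs)) g (?v0 S)) bs e \<ominus>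
          \<one> \<otimes> wedge D f (wedge D g ?v1) bs e"
        using f g Cons.prems by (intro wedge_sub_smult) auto
      finally show ?thesis using f g Cons.prems by (simp add: wedge_mulx)
    qed
    have eq0: "wedge D h v (False # bs) = wedge D h ?v0 bs" for h by auto
    let ?x = "mulx D (Suc (length bs)) f (wedge D g ?v0 bs) e"
    let ?y = "mulx D (Suc (length bs)) g (wedge D f ?v0 bs) e"
    let ?z = "wedge D f (wedge D g ?v1) bs e" let ?z' = "wedge D g (wedge D f ?v1) bs e"
    have cl: "?x \<in> carrier R" "?y \<in> carrier R" "?z' \<in> carrier R" using assms Cons.prems by auto
    have "?z = \<ominus> ?z'" using Cons.IH[of ?v1] Cons.prems by simp
    moreover have "?x \<ominus> (?y \<ominus> \<ominus> ?z') = \<ominus> (?y \<ominus> (?x \<ominus> ?z'))" using cl by (intro sub_swap_neg)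
    ultimately show ?thesis using True *[OF assms(1,2)] *[OF assms(2,1)] by (simp add: eq0)
  qed
qed

text \<open>Not a consequence of \<open>wedge_anticommute\<close> in characteristic 2. The two mixed
  terms are now equal and cancel, and the remaining term vanishes by induction.\<close>

lemma wedge_twice:
  assumes "\<And>j. f j \<in> carrier R" "\<And>S e. v S e \<in> carrier R"
  shows "wedge D f (wedge D f v) T e = \<zero>"
  using assms(2)
proof (induction T arbitrary: v e)
  case Nil then show ?case by simp
next
  case (Cons b bs)
  show ?case
  proof (cases b)
    case False
    have eq: "(\<lambda>S. wedge D h v (False # S)) = wedge D h (\<lambda>S. v (False # S))" for h by (auto intro!: ext)
    show ?thesis using False Cons.IH[of "\<lambda>S. v (False # S)"] Cons.prems by (simp add: eq)
  next
    case True
    let ?v0 = "\<lambda>S. v (False # S)" let ?v1 = "\<lambda>S. v (True # S)"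
    have "wedge D f (\<lambda>S. wedge D f v (True # S)) bs e =
         wedge D f (\<lambda>S e. mulx D (Suc (length bs)) f (?v0 S) e \<ominus> \<one> \<otimes> wedge D f ?v1 S e) bs e"
      using assms Cons.prems by (intro wedge_cong) simp
    also have "\<dots> = wedge D f (\<lambda>S. mulx D (Suc (length bs)) f (?v0 S)) bs e \<ominus>
          \<one> \<otimes> wedge D f (wedge D f ?v1) bs e"
      using assms Cons.prems by (intro wedge_sub_smult) auto
    finally have *: "wedge D f (\<lambda>S. wedge D f v (True # S)) bs e =
        mulx D (Suc (length bs)) f (wedge D f ?v0 bs) e"
      using assms Cons.prems Cons.IH[of ?v1] by (simp add: wedge_mulx minus_eq)
    have eq0: "wedge D f v (False # bs) = wedge D f ?v0 bs" by auto
    show ?thesis using True * assms Cons.prems by (simp add: eq0 r_neg minus_eq)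
  qed
qed

end

section \<open>Iterated products and linear independence\<close>

context cring begin

primrec wedges :: "nat \<Rightarrow> (nat \<Rightarrow> 'a) list \<Rightarrow> bool list \<Rightarrow> nat \<Rightarrow> 'a" where
  "wedges D [] = (\<lambda>T e. if e = 0 \<and> True \<notin> set T then \<one> else \<zero>)"
| "wedges D (f # fs) = wedge D f (wedges D fs)"

lemma wedges_closed [simp]:
  "(\<And>f j. f \<in> set fs \<Longrightarrow> f j \<in> carrier R) \<Longrightarrow> wedges D fs T e \<in> carrier R"
  by (induction fs arbitrary: T e) auto

lemma wedge_smult:
  assumes "\<And>j. f j \<in> carrier R" "c \<in> carrier R" "\<And>S e. v S e \<in> carrier R"
  shows "wedge D f (\<lambda>S e. c \<otimes> v S e) T e = c \<otimes> wedge D f v T e"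
proof -
  have *: "\<zero> \<ominus> (\<ominus> c) \<otimes> x = c \<otimes> x" if "x \<in> carrier R" for x
    using that assms(2) by (simp add: minus_eq l_minus)
  have "wedge D f (\<lambda>S e. c \<otimes> v S e) T e = wedge D f (\<lambda>S e. \<zero> \<ominus> (\<ominus> c) \<otimes> v S e) T e"
    using assms by (intro wedge_cong) (simp add: *)
  also have "\<dots> = wedge D f (\<lambda>S e. \<zero>) T e \<ominus> (\<ominus> c) \<otimes> wedge D f v T e"
    using assms by (intro wedge_sub_smult) auto
  finally show ?thesis using assms by (simp add: *)
qed

lemma wedge_zero_left: "(\<And>S e. v S e \<in> carrier R) \<Longrightarrow> wedge D (\<lambda>j. \<zero>) v T e = \<zero>"
proof (induction T arbitrary: v)
  case (Cons b bs)
  have "mulx D s (\<lambda>j. \<zero>) (v S) e = \<zero>" for s S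
    unfolding mulx_def using Cons.prems by (intro fsum_zero) auto
  then show ?case using Cons by (cases b) (auto simp: minus_eq)
qed simp

lemma wedges_append_zero:
  assumes "\<And>T e. wedges D fs T e = \<zero>" "\<And>f j. f \<in> set gs \<Longrightarrow> f j \<in> carrier R"
  shows "wedges D (gs @ fs) T e = \<zero>"
  using assms(2)
proof (induction gs arbitrary: T e)
  case (Cons g gs)
  then have "wedges D (gs @ fs) = (\<lambda>T e. \<zero>)" by auto
  then show ?case using Cons.prems by simp
qed (simp add: assms)

text \<open>Anticommutation moves \<open>g\<close> inwards one factor at a time until it meets its
  other copy, where \<open>wedge_twice\<close> applies.\<close>

lemma wedges_repeat:
  assumes "g \<in> set rs" "\<And>f j. f \<in> set rs \<Longrightarrow> f j \<in> carrier R"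
  shows "wedges D (g # rs) T e = \<zero>"
  using assms
proof (induction rs arbitrary: T e)
  case (Cons h rs)
  show ?case
  proof (cases "g = h")
    case True
    then show ?thesis using Cons.prems by (auto intro!: wedge_twice)
  next
    case False
    then have "wedge D g (wedges D rs) = (\<lambda>T e. \<zero>)" using Cons by auto
    then show ?thesis using Cons.prems False
      by (simp add: wedge_anticommute[of g h])
  qed
qed simp

text \<open>Each factor of \<open>as\<close> that \<open>f\<close> passes costs one sign. The parity
  is not tracked, because later arguments use no more than that the sign squares to one.\<close>

lemma wedges_front:
  assumes "\<And>g j. g \<in> set (as @ f # bs) \<Longrightarrow> g j \<in> carrier R"
  obtains s where "s = \<one> \<or> s = \<ominus> \<one>"
    "\<And>T e. wedges D (as @ f # bs) T e = s \<otimes> wedges D (f # as @ bs) T e"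
proof -
  have "\<exists>s. (s = \<one> \<or> s = \<ominus> \<one>) \<and> (\<forall>T e. wedges D (as @ f # bs) T e = s \<otimes> wedges D (f # as @ bs) T e)"
    using assms
  proof (induction as)
    case Nil
    then show ?case by (intro exI[of _ \<one>]) auto
  next
    case (Cons a as)
    then obtain s where s: "s = \<one> \<or> s = \<ominus> \<one>"
      "\<And>T e. wedges D (as @ f # bs) T e = s \<otimes> wedges D (f # as @ bs) T e" by force
    then have sc: "s \<in> carrier R" by auto
    have "wedges D ((a # as) @ f # bs) T e = \<ominus> s \<otimes> wedges D (f # (a # as) @ bs) T e" for T e
    proof -
      have "wedges D (as @ f # bs) = (\<lambda>T e. s \<otimes> wedges D (f # as @ bs) T e)" using s(2) by (intro ext)
      moreover have "wedge D a (\<lambda>T e. s \<otimes> wedges D (f # as @ bs) T e) T e =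
          s \<otimes> wedge D a (wedges D (f # as @ bs)) T e"
        by (rule wedge_smult[OF _ sc wedges_closed]) (use Cons.prems in auto)
      ultimately have "wedges D ((a # as) @ f # bs) T e = s \<otimes> wedge D a (wedges D (f # as @ bs)) T e"
        by simp
      also have "\<dots> = s \<otimes> (\<ominus> wedge D f (wedges D (a # as @ bs)) T e)"
      proof -
        have "wedge D a (wedge D f (wedges D (as @ bs))) T e = \<ominus> wedge D f (wedge D a (wedges D (as @ bs))) T e"
          by (rule wedge_anticommute[OF _ _ wedges_closed]) (use Cons.prems in auto)
        then show ?thesis by simp
      qed
      moreover have "wedge D f (wedge D a (wedges D (as @ bs))) T e \<in> carrier R"
        by (rule wedge_closed[OF _ wedge_closed[OF _ wedges_closed]]) (use Cons.prems in auto)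
      ultimately show ?thesis using sc by (simp add: l_minus r_minus)
    qed
    then show ?case using s(1) by (intro exI[of _ "\<ominus> s"]) auto
  qed
  then show ?thesis using that by blast
qed

fun comb :: "'a list \<Rightarrow> (nat \<Rightarrow> 'a) list \<Rightarrow> nat \<Rightarrow> 'a" where
  "comb (c # cs) (f # fs) j = comb cs fs j \<oplus> c \<otimes> f j"
| "comb _ _ j = \<zero>"

lemma comb_closed [simp]:
  "set cs \<subseteq> carrier R \<Longrightarrow> (\<And>f j. f \<in> set fs \<Longrightarrow> f j \<in> carrier R) \<Longrightarrow> comb cs fs j \<in> carrier R"
  by (induction cs fs j rule: comb.induct) auto

lemma comb_append:
  assumes "length ca = length as" "set (ca @ cb) \<subseteq> carrier R"
    "\<And>f j. f \<in> set (as @ bs) \<Longrightarrow> f j \<in> carrier R"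
  shows "comb (ca @ cb) (as @ bs) j = comb ca as j \<oplus> comb cb bs j"
  using assms by (induction ca as rule: list_induct2) (auto simp: a_ac)

lemma wedge_comb_zero:
  assumes "\<And>g. g \<in> set fs \<Longrightarrow> wedge D g v T e = \<zero>" "set cs \<subseteq> carrier R"
    "\<And>f j. f \<in> set fs \<Longrightarrow> f j \<in> carrier R" "\<And>S e. v S e \<in> carrier R"
  shows "wedge D (comb cs fs) v T e = \<zero>"
  using assms
proof (induction cs fs j \<equiv> "0::nat" rule: comb.induct)
  case (1 c cs f fs)
  have "comb (c # cs) (f # fs) = (\<lambda>j. comb cs fs j \<ominus> (\<ominus> c) \<otimes> f j)"
    using 1 by (auto simp: minus_eq l_minus intro!: ext)
  then have "wedge D (comb (c # cs) (f # fs)) v T e = wedge D (comb cs fs) v T e \<ominus> (\<ominus> c) \<otimes> wedge D f v T e"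
    using 1 by (simp add: wedge_sub_smult_left)
  then show ?case using 1 by (simp add: minus_eq)
qed (auto simp: wedge_zero_left ext[of "comb _ _" "\<lambda>j. \<zero>"])

text \<open>Coefficients are attached to positions, so a list with a repeated polynomial is
  dependent. This is how overlapping members are detected.\<close>

definition lin_indep :: "(nat \<Rightarrow> 'a) list \<Rightarrow> bool" where
  "lin_indep fs \<longleftrightarrow> (\<forall>cs. length cs = length fs \<longrightarrow> set cs \<subseteq> carrier R \<longrightarrow>
     (\<forall>j. comb cs fs j = \<zero>) \<longrightarrow> set cs \<subseteq> {\<zero>})"

section \<open>Degrees of the coordinates of a product of polynomials in echelon form\<close>

definition leading :: "(nat \<Rightarrow> 'a) list \<Rightarrow> nat list \<Rightarrow> bool" where
  "leading fs ds \<longleftrightarrow> list_all2 (\<lambda>f d. f d \<noteq> \<zero> \<and> (\<forall>j>d. f j = \<zero>)) fs ds \<and> sorted_wrt (>) ds"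

text \<open>The top degree in x, at the basis element \<open>T\<close>, of a product of polynomials
  of decreasing degrees \<open>ds\<close>: generator t weighs t + 1, and the largest degree is
  paired with the largest generator of \<open>T\<close>. It is the maximal pairing of the
  rearrangement inequality.\<close>

fun phi :: "nat list \<Rightarrow> bool list \<Rightarrow> nat" where
  "phi [] T = 0"
| "phi (d # ds) [] = 0"
| "phi (d # ds) (False # bs) = phi (d # ds) bs"
| "phi (d # ds) (True # bs) = d * Suc (length bs) + phi ds bs"

lemma phi_False [simp]: "phi ds (False # bs) = phi ds bs"
  by (cases ds) auto

text \<open>A generator of \<open>bs\<close> weighs at most \<open>length bs\<close>, one less than
  the generator just above \<open>bs\<close>. This gap of one makes an exchange in the pairing
  strictly unfavourable.\<close>

lemma phi_mono: "d2 \<le> d \<Longrightarrow> phi (d # ds) bs \<le> phi (d2 # ds) bs + (d - d2) * length bs"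
proof (induction bs)
  case (Cons b bs)
  then show ?case by (cases b) (auto simp: algebra_simps dest: le_Suc_ex)
qed simp

lemma phi_le: "(\<And>d. d \<in> set ds \<Longrightarrow> d \<le> M) \<Longrightarrow> phi ds T \<le> length ds * (M * length T)"
proof (induction ds T rule: phi.induct)
  case (3 d ds bs)
  then have "phi (d # ds) bs \<le> length (d # ds) * (M * length bs)" by simp
  also have "\<dots> \<le> length (d # ds) * (M * length (False # bs))" by (intro mult_left_mono) auto
  finally show ?case by simp
next
  case (4 d ds bs)
  then have "phi ds bs \<le> length ds * (M * length bs)" by simp
  also have "\<dots> \<le> length ds * (M * Suc (length bs))" by (intro mult_left_mono) auto
  finally have "phi ds bs \<le> length ds * (M * Suc (length bs))" .
  moreover have "d * Suc (length bs) \<le> M * Suc (length bs)" using 4 by (intro mult_right_mono) auto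
  ultimately show ?case by simp
qed auto

text \<open>The slack \<open>K\<close> is there for the induction: when the top generator is
  occupied by a term of \<open>v\<close> instead of being taken by \<open>f\<close>, its share of
  the degree moves into \<open>K\<close>, and the induction continues with the remaining
  degrees.\<close>

lemma wedge_support:
  assumes "\<And>j. d < j \<Longrightarrow> f j = \<zero>" "\<And>j. f j \<in> carrier R"
    "\<And>d'. d' \<in> set ds \<Longrightarrow> d' < d"
    "\<And>S e. length S = length T \<Longrightarrow> v S e \<noteq> \<zero> \<Longrightarrow> count_list S True = length ds \<and> e \<le> K + phi ds S"
    "\<And>S e. v S e \<in> carrier R"
    "wedge D f v T e \<noteq> \<zero>"
  shows "count_list T True = Suc (length ds) \<and> e \<le> K + phi (d # ds) T"
  using assms(3-6)
proof (induction T arbitrary: v K ds)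
  case Nil then show ?case by simp
next
  case (Cons b bs)
  show ?case
  proof (cases b)
    case False
    have "count_list bs True = Suc (length ds) \<and> e \<le> K + phi (d # ds) bs"
    proof (rule Cons.IH[of _ "\<lambda>S. v (False # S)"])
      fix S e assume "length S = length bs" "v (False # S) e \<noteq> \<zero>"
      then show "count_list S True = length ds \<and> e \<le> K + phi ds S"
        using Cons.prems(2)[of "False # S" e] by simp
    qed (use Cons.prems False in auto)
    then show ?thesis using False by simp
  next
    case True
    have "mulx D (Suc (length bs)) f (v (False # bs)) e \<noteq> \<zero> \<or> wedge D f (\<lambda>S. v (True # S)) bs e \<noteq> \<zero>"
      using Cons.prems(4) True by (intro notI disjCI) (simp add: minus_eq)
    then consider "mulx D (Suc (length bs)) f (v (False # bs)) e \<noteq> \<zero>"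
      | "wedge D f (\<lambda>S. v (True # S)) bs e \<noteq> \<zero>" by blast
    then show ?thesis
    proof cases
      case 1
      then obtain j where j: "j * Suc (length bs) \<le> e" "f j \<otimes> v (False # bs) (e - j * Suc (length bs)) \<noteq> \<zero>"
        unfolding mulx_def using fsum_zero[of D "\<lambda>j. if j * Suc (length bs) \<le> e
          then f j \<otimes> v (False # bs) (e - j * Suc (length bs)) else \<zero>"] by meson
      then have "f j \<noteq> \<zero>" and nz: "v (False # bs) (e - j * Suc (length bs)) \<noteq> \<zero>"
        using Cons.prems(3) assms(2) by auto
      then have "j \<le> d" using assms(1) not_less by blast
      then have "j * Suc (length bs) \<le> d * Suc (length bs)" by (rule mult_right_mono) simp
      moreover have "count_list bs True = length ds" "e - j * Suc (length bs) \<le> K + phi ds bs"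
        using Cons.prems(2)[OF _ nz] by auto
      moreover have "phi (d # ds) (True # bs) = d * Suc (length bs) + phi ds bs" by simp
      ultimately show ?thesis using True j(1) by (auto simp del: phi.simps)
    next
      case 2
      show ?thesis
      proof (cases ds)
        case Nil
        have "v (True # S) e' = \<zero>" if "length S = length bs" for S e'
          using Cons.prems(2)[of "True # S" e'] that Nil by auto
        then have "wedge D f (\<lambda>S. v (True # S)) bs e = wedge D f (\<lambda>S e. \<zero>) bs e"
          by (intro wedge_cong)
        then show ?thesis using 2 assms(2) by simp
      next
        case (Cons d2 ds2)
        \<comment> \<open>The exchange: the smaller degree \<open>d2\<close> has the top generator
          and \<open>f\<close> is matched further down. By \<open>phi_mono\<close> this does not
          exceed the pairing that gives the top generator to \<open>d\<close>.\<close>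
        have "count_list bs True = Suc (length ds2) \<and> e \<le> (K + d2 * Suc (length bs)) + phi (d # ds2) bs"
        proof (rule Cons.IH[of _ "\<lambda>S. v (True # S)"])
          fix S e assume "length S = length bs" "v (True # S) e \<noteq> \<zero>"
          then show "count_list S True = length ds2 \<and> e \<le> K + d2 * Suc (length bs) + phi ds2 S"
            using Cons.prems(2)[of "True # S" e] Cons by simp
        qed (use Cons.prems 2 Cons in auto)
        moreover have "d2 < d" using Cons.prems(1) Cons by simp
        moreover have "phi (d # ds2) bs \<le> phi (d2 # ds2) bs + (d - d2) * length bs"
          using \<open>d2 < d\<close> by (intro phi_mono) simp
        ultimately show ?thesis using True Cons
          by (auto simp: algebra_simps dest!: less_imp_Suc_add)
      qed
    qed
  qed
qed

lemma wedges_support: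
  assumes "leading fs ds" "\<And>f j. f \<in> set fs \<Longrightarrow> f j \<in> carrier R" "wedges D fs T e \<noteq> \<zero>"
  shows "count_list T True = length ds \<and> e \<le> phi ds T"
  using assms
proof (induction fs arbitrary: ds T e)
  case Nil
  then have "ds = []" "e = 0" "True \<notin> set T" by (auto simp: leading_def split: if_splits)
  then show ?case by (simp add: count_notin)
next
  case (Cons f fs)
  then obtain d ds' where ds: "ds = d # ds'" "leading fs ds'" "\<And>j. d < j \<Longrightarrow> f j = \<zero>"
    "\<And>d'. d' \<in> set ds' \<Longrightarrow> d' < d"
    by (auto simp: leading_def list_all2_Cons1)
  have "count_list T True = Suc (length ds') \<and> e \<le> 0 + phi (d # ds') T"
  proof (rule wedge_support[where f = f and v = "wedges D fs" and D = D])
    fix S e' assume "wedges D fs S e' \<noteq> \<zero>"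
    then show "count_list S True = length ds' \<and> e' \<le> 0 + phi ds' S"
      using Cons.IH[OF ds(2)] Cons.prems(2) by force
  next
    fix S e' show "wedges D fs S e' \<in> carrier R" using Cons.prems(2) by (intro wedges_closed) simp
  qed (use ds Cons.prems in auto)
  then show ?case using ds by simp
qed

lemma wedges_False: "wedges D fs (False # bs) e = wedges D fs bs e"
proof (induction fs arbitrary: bs e)
  case (Cons f fs)
  then have "(\<lambda>S. wedges D fs (False # S)) = wedges D fs" by (intro ext)
  then show ?case by simp
qed simp

end

section \<open>The product vanishes exactly for dependent factors\<close>

context domain begin

text \<open>At exponent \<open>phi ds T\<close> a single term of the expansion survives, the product
  of the leading coefficients under the optimal pairing, and in a domain it is nonzero. The outer
  induction is on the factors, the inner one on \<open>T\<close> skips top generators that do not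
  occur.\<close>

lemma wedges_leading_nonzero:
  assumes "leading fs ds" "\<And>f j. f \<in> set fs \<Longrightarrow> f j \<in> carrier R" "\<And>d. d \<in> set ds \<Longrightarrow> d < D"
    "count_list T True = length ds"
  shows "wedges D fs T (phi ds T) \<noteq> \<zero>"
  using assms
proof (induction fs arbitrary: ds T)
  case Nil
  then have "True \<notin> set T" by (simp add: leading_def count_list_0_iff)
  then show ?case using Nil by (simp add: leading_def)
next
  case (Cons f fs)
  then obtain d ds' where ds: "ds = d # ds'" "leading fs ds'" "\<And>j. d < j \<Longrightarrow> f j = \<zero>" "f d \<noteq> \<zero>"
    "\<And>d'. d' \<in> set ds' \<Longrightarrow> d' < d"
    by (auto simp: leading_def list_all2_Cons1)
  note outer = Cons.IH Cons.prems(2)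
  from Cons.prems(4) show ?case unfolding ds(1)
  proof (induction T)
    case Nil then show ?case by simp
  next
    case (Cons b bs)
    show ?case
    proof (cases b)
      case False
      then show ?thesis using Cons by (simp only: wedges_False phi_False) simp
    next
      case True
      let ?s = "Suc (length bs)" let ?e = "d * ?s + phi ds' bs"
      have cnt: "count_list bs True = length ds'" using Cons.prems True by simp
      have cl: "\<And>j. f j \<in> carrier R" "\<And>T e. wedges D fs T e \<in> carrier R" using outer(2) by auto
      \<comment> \<open>Only the leading coefficient of \<open>f\<close> contributes: a smaller
        index would leave an exponent above the degree bound \<open>phi ds' bs\<close> of the
        remaining product.\<close>
      have "mulx D ?s f (wedges D fs (False # bs)) ?e =
          (if d * ?s \<le> ?e then f d \<otimes> wedges D fs (False # bs) (?e - d * ?s) else \<zero>)"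
        unfolding mulx_def
      proof (rule fsum_single)
        show "d < D" using \<open>\<And>d. d \<in> set ds \<Longrightarrow> d < D\<close> ds by simp
        fix i assume "i \<noteq> d"
        show "(if i * ?s \<le> ?e then f i \<otimes> wedges D fs (False # bs) (?e - i * ?s) else \<zero>) = \<zero>"
        proof (cases "i < d")
          case True
          then have "phi ds' bs < ?e - i * ?s"
            using mult_strict_right_mono[of i d ?s] by linarith
          then have "wedges D fs (False # bs) (?e - i * ?s) = \<zero>"
            using wedges_support[OF ds(2), of D "False # bs" "?e - i * ?s"] outer(2)
            by (metis list.set_intros(2) not_less phi_False)
          then show ?thesis using cl by simp
        next
          case False
          then show ?thesis using \<open>i \<noteq> d\<close> ds(3)[of i] cl by simp
        qed
      qed (use cl in simp)
      then have m: "mulx D ?s f (wedges D fs (False # bs)) ?e = f d \<otimes> wedges D fs bs (phi ds' bs)"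
        by (simp add: wedges_False)
      have "wedges D fs bs (phi ds' bs) \<noteq> \<zero>"
        using \<open>\<And>d. d \<in> set ds \<Longrightarrow> d < D\<close> ds cnt outer(2)
        by (intro outer(1)) auto
      then have mnz: "mulx D ?s f (wedges D fs (False # bs)) ?e \<noteq> \<zero>"
        unfolding m using ds(4) cl integral by blast
      \<comment> \<open>If another factor takes the top generator, the degree stays strictly below
        \<open>?e\<close>: the exchange estimate is strict because \<open>d2 < d\<close>.\<close>
      have "wedge D f (\<lambda>S. wedges D fs (True # S)) bs ?e = \<zero>"
      proof (rule ccontr)
        assume nz: "wedge D f (\<lambda>S. wedges D fs (True # S)) bs ?e \<noteq> \<zero>"
        show False
        proof (cases ds')
          case Nil
          have "wedge D f (\<lambda>S. wedges D fs (True # S)) bs ?e = wedge D f (\<lambda>S e. \<zero>) bs ?e"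
          proof (rule wedge_cong)
            fix S e'
            show "wedges D fs (True # S) e' = \<zero>"
              using wedges_support[OF ds(2), of D "True # S" e'] Nil outer(2)
              by force
          qed
          then show False using nz cl by simp
        next
          case (Cons d2 ds2)
          have "count_list bs True = Suc (length ds2) \<and> ?e \<le> d2 * ?s + phi (d # ds2) bs"
          proof (rule wedge_support[where v = "\<lambda>S. wedges D fs (True # S)" and f = f and D = D])
            fix S e' assume "length S = length bs" "wedges D fs (True # S) e' \<noteq> \<zero>"
            then show "count_list S True = length ds2 \<and> e' \<le> d2 * ?s + phi ds2 S"
              using wedges_support[OF ds(2), of D "True # S" e'] Cons outer(2)
              by force
          qed (use ds Cons cl nz in auto)
          moreover have "d2 < d" using ds Cons by simp
          moreover have "phi (d # ds2) bs \<le> phi (d2 # ds2) bs + (d - d2) * length bs"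
            using \<open>d2 < d\<close> by (intro phi_mono) simp
          ultimately show False using Cons
            by (auto simp: algebra_simps dest!: less_imp_Suc_add)
        qed
      qed
      then show ?thesis using True m mnz cl by (simp add: minus_eq)
    qed
  qed
qed

text \<open>A nonzero coefficient \<open>c\<close> singles out a factor \<open>f\<close> such that
  \<open>c \<otimes> f\<close> is minus a combination of the other factors. That combination times
  the product of the others is zero by repetition, hence so is \<open>c\<close> times the whole
  product, and \<open>c\<close> cancels in a domain.\<close>

lemma wedges_dependent:
  assumes "\<And>f j. f \<in> set fs \<Longrightarrow> f j \<in> carrier R" "\<not> lin_indep fs"
  shows "wedges D fs T e = \<zero>"
proof -
  obtain cs where cs: "length cs = length fs" "set cs \<subseteq> carrier R" "\<And>j. comb cs fs j = \<zero>" "\<not> set cs \<subseteq> {\<zero>}"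
    using assms(2) by (auto simp: lin_indep_def)
  then obtain c where "c \<in> set cs" "c \<noteq> \<zero>" by auto
  then obtain ca cb where ca: "cs = ca @ c # cb" by (meson split_list)
  define as where "as = take (length ca) fs"
  obtain f bs where "drop (length ca) fs = f # bs"
    using cs(1) ca by (cases "drop (length ca) fs") auto
  then have fs: "fs = as @ f # bs" "length as = length ca"
    using cs(1) ca append_take_drop_id[of "length ca" fs] by (auto simp: as_def)
  have c: "c \<in> carrier R" using cs ca by auto
  have cl: "\<And>j. f j \<in> carrier R" "\<And>g j. g \<in> set (as @ bs) \<Longrightarrow> g j \<in> carrier R" using assms(1) fs by auto
  have csc: "set ca \<subseteq> carrier R" "set cb \<subseteq> carrier R" using cs(2) ca by auto
  have clc: "comb (ca @ cb) (as @ bs) j \<in> carrier R" "comb ca as j \<in> carrier R" "comb cb bs j \<in> carrier R" for j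
    by (rule comb_closed; use csc cl(2) in auto)+
  let ?v = "wedges D (as @ bs)"
  have v: "\<And>T e. ?v T e \<in> carrier R" by (rule wedges_closed) (erule cl(2))
  have z: "(\<lambda>j. comb (ca @ cb) (as @ bs) j \<ominus> (\<ominus> c) \<otimes> f j) = (\<lambda>j. \<zero>)"
  proof
    fix j
    have "\<zero> = comb ca as j \<oplus> (comb cb bs j \<oplus> c \<otimes> f j)"
      using cs(3)[of j] comb_append[of ca as "c # cb" "f # bs" j] cs ca fs assms(1) by simp
    moreover have "comb (ca @ cb) (as @ bs) j = comb ca as j \<oplus> comb cb bs j"
      using cs ca fs cl by (intro comb_append) auto
    ultimately show "comb (ca @ cb) (as @ bs) j \<ominus> (\<ominus> c) \<otimes> f j = \<zero>"
      using clc cl c by (simp add: minus_eq l_minus a_assoc)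
  qed
  have w: "wedge D f ?v T e = \<zero>" for T e
  proof -
    have "\<zero> = wedge D (\<lambda>j. comb (ca @ cb) (as @ bs) j \<ominus> (\<ominus> c) \<otimes> f j) ?v T e"
      unfolding z using v by (simp add: wedge_zero_left)
    also have "\<dots> = wedge D (comb (ca @ cb) (as @ bs)) ?v T e \<ominus> (\<ominus> c) \<otimes> wedge D f ?v T e"
      using c cl clc v by (intro wedge_sub_smult_left) auto
    also have "wedge D (comb (ca @ cb) (as @ bs)) ?v T e = \<zero>"
    proof (rule wedge_comb_zero)
      fix g assume "g \<in> set (as @ bs)"
      then show "wedge D g ?v T e = \<zero>" using wedges_repeat[of g "as @ bs" D T e] cl by simp
    qed (use cs ca cl v in auto)
    finally have "c \<otimes> wedge D f ?v T e = \<zero>" using c cl v by (simp add: minus_eq l_minus)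
    then show ?thesis using \<open>c \<noteq> \<zero>\<close> c cl v by (simp add: integral_iff)
  qed
  have "\<And>g j. g \<in> set (as @ f # bs) \<Longrightarrow> g j \<in> carrier R" using assms(1) fs by simp
  then obtain s where s: "s = \<one> \<or> s = \<ominus> \<one>"
    "\<And>T e. wedges D (as @ f # bs) T e = s \<otimes> wedges D (f # as @ bs) T e"
    using wedges_front[of as f bs D] by metis
  then have "s \<in> carrier R" by auto
  then show ?thesis using s(2)[of T e] fs w by simp
qed

end

context field begin

text \<open>Gaussian elimination from the top degree downwards. Its two moves, bringing the pivot to
  the front and subtracting multiples of it from the other factors, change the product at most by a
  sign, so a nonzero scalar \<open>k\<close> is all that has to be remembered.\<close>

lemma lin_indep_leading:
  assumes "\<forall>f\<in>set fs. \<forall>j. f j \<in> carrier R" "\<forall>f\<in>set fs. \<forall>j\<ge>D'. f j = \<zero>" "lin_indep fs"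
  shows "\<exists>gs ds k. leading gs ds \<and> (\<forall>f\<in>set gs. \<forall>j. f j \<in> carrier R) \<and> length gs = length fs \<and>
    (\<forall>d\<in>set ds. d < D') \<and> k \<in> carrier R \<and> k \<noteq> \<zero> \<and>
    (\<forall>T e. wedges D gs T e = k \<otimes> wedges D fs T e)"
  using assms
proof (induction D' arbitrary: fs)
  case 0
  \<comment> \<open>With degree bound 0 all polynomials vanish, and coefficients that are all one
    would contradict the independence of a nonempty list.\<close>
  have "fs = []"
  proof (rule ccontr)
    assume "fs \<noteq> []"
    have fz: "\<forall>f\<in>set fs. \<forall>j. f j = \<zero>" using 0(2) by blast
    have z: "comb cs fs' j = \<zero>" if "set cs \<subseteq> carrier R" "set fs' \<subseteq> set fs" for cs fs' j
      using that fz by (induction cs fs' j rule: comb.induct) auto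
    have "set (replicate (length fs) \<one>) \<subseteq> {\<zero>}"
      using 0(3) z[of "replicate (length fs) \<one>" fs] unfolding lin_indep_def
      by (metis length_replicate one_closed order_refl set_replicate_conv_if subset_iff singletonD empty_iff)
    then show False using \<open>fs \<noteq> []\<close> by auto
  qed
  then show ?case by (intro exI[of _ "[]"] exI[of _ \<one>]) (auto simp: leading_def)
next
  case (Suc D')
  show ?case
  proof (cases "\<forall>f\<in>set fs. f D' = \<zero>")
    case True
    have "f j = \<zero>" if "f \<in> set fs" "D' \<le> j" for f j
      using Suc.prems(2) that True by (cases "j = D'") auto
    then have "\<forall>f\<in>set fs. \<forall>j\<ge>D'. f j = \<zero>" by blast
    from Suc.IH[OF Suc.prems(1) this Suc.prems(3)] obtain gs ds k where "leading gs ds" "\<forall>f\<in>set gs. \<forall>j. f j \<in> carrier R" "length gs = length fs"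
      "\<forall>d\<in>set ds. d < D'" "k \<in> carrier R" "k \<noteq> \<zero>"
      "\<forall>T e. wedges D gs T e = k \<otimes> wedges D fs T e"
      by blast
    then show ?thesis by (intro exI[of _ gs] exI[of _ ds] exI[of _ k]) auto
  next
    case False
    then obtain f where "f \<in> set fs" and fD: "f D' \<noteq> \<zero>" by auto
    then obtain as bs where fs: "fs = as @ f # bs" by (meson split_list)
    define rs where "rs = as @ bs"
    have cl: "f j \<in> carrier R" "\<And>g j. g \<in> set rs \<Longrightarrow> g j \<in> carrier R" for j
      using Suc.prems(1) fs by (auto simp: rs_def)
    have fU: "f D' \<in> Units R" using cl(1) fD by (simp add: field_Units)
    define q where "q g = g D' \<otimes> inv (f D')" for g
    define red where "red g = (\<lambda>j. g j \<ominus> q g \<otimes> f j)" for g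
    have q: "q g \<in> carrier R" if "g \<in> set rs" for g using cl that fU by (simp add: q_def)
    have red_cl: "red g j \<in> carrier R" if "g \<in> set rs" for g j using cl that q by (simp add: red_def)
    have red_zero: "red g j = \<zero>" if "g \<in> set rs" "D' \<le> j" for g j
    proof (cases "j = D'")
      case True
      have "q g \<otimes> f D' = g D'" using cl that fU by (simp add: q_def m_assoc)
      then show ?thesis using True cl that by (simp add: red_def minus_eq r_neg)
    next
      case False
      then have "g j = \<zero>" "f j = \<zero>"
        using Suc.prems(2) that \<open>f \<in> set fs\<close> fs by (auto simp: rs_def)
      then show ?thesis using q[OF that(1)] by (simp add: red_def minus_eq)
    qed
    \<comment> \<open>Behind the pivot \<open>f\<close>, the correction
      \<open>q g \<otimes> f\<close> of a factor contributes a product that contains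
      \<open>f\<close> twice.\<close>
    have wred: "wedges D (f # map red rs') T e = wedges D (f # rs') T e" if "set rs' \<subseteq> set rs" for rs' T e
      using that
    proof (induction rs' arbitrary: T e)
      case (Cons g rs')
      have g: "g \<in> set rs" "\<And>g j. g \<in> set rs' \<Longrightarrow> g j \<in> carrier R" using Cons.prems cl by auto
      have mcl: "\<And>T e. wedges D (map red rs') T e \<in> carrier R"
        using red_cl Cons.prems by (intro wedges_closed) auto
      have rcl: "\<And>T e. wedges D rs' T e \<in> carrier R" using g(2) by (rule wedges_closed)
      let ?w = "wedges D (map red rs')"
      have gcl: "g j \<in> carrier R" for j using cl(2) g(1) by blast
      have redg: "red g = (\<lambda>j. g j \<ominus> q g \<otimes> f j)" by (simp add: red_def)
      have IH: "wedge D f ?w = wedge D f (wedges D rs')"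
        using Cons.IH Cons.prems by (intro ext) simp
      have "wedge D (red g) ?w = (\<lambda>T e. wedge D g ?w T e \<ominus> q g \<otimes> wedge D f ?w T e)"
        unfolding redg
      proof (intro ext)
        fix T e
        show "wedge D (\<lambda>j. g j \<ominus> q g \<otimes> f j) ?w T e = wedge D g ?w T e \<ominus> q g \<otimes> wedge D f ?w T e"
          by (rule wedge_sub_smult_left[of g f "q g" ?w]) (fact gcl cl(1) q[OF g(1)] mcl)+
      qed
      then have "wedges D (f # map red (g # rs')) T e =
          wedge D f (\<lambda>T e. wedge D g ?w T e \<ominus> q g \<otimes> wedge D f ?w T e) T e" by simp
      also have "\<dots> = wedge D f (wedge D g ?w) T e \<ominus> q g \<otimes> wedge D f (wedge D f ?w) T e"
        by (rule wedge_sub_smult) (use gcl cl(1) q g mcl in auto)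
      also have "\<dots> = wedge D f (wedge D g ?w) T e"
        using wedge_twice[of f ?w D T e] wedge_closed[OF cl(1) wedge_closed[OF gcl mcl]] cl(1) mcl q g
        by (simp add: minus_eq)
      also have "\<dots> = \<ominus> wedge D g (wedge D f (wedges D rs')) T e"
        using wedge_anticommute[of f g ?w D T e] cl(1) gcl mcl by (simp add: IH)
      also have "\<dots> = wedge D f (wedge D g (wedges D rs')) T e"
        using wedge_anticommute[of f g "wedges D rs'" D T e] cl(1) gcl rcl by simp
      finally show ?case by simp
    qed simp
    \<comment> \<open>A relation among the reduced polynomials becomes one among the original ones:
      the corrections are collected in the coefficient \<open>c\<close> of \<open>f\<close>.\<close>
    have indep: "lin_indep (map red rs)"
      unfolding lin_indep_def
    proof (intro allI impI)
      fix cs assume cs: "length cs = length (map red rs)" "set cs \<subseteq> carrier R" "\<forall>j. comb cs (map red rs) j = \<zero>"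
      define ca cb where "ca = take (length as) cs" and "cb = drop (length as) cs"
      have cab: "cs = ca @ cb" "length ca = length as" "length cb = length bs"
        using cs(1) by (auto simp: ca_def cb_def rs_def)
      have "\<exists>c\<in>carrier R. \<forall>j. comb cs' (map red rs') j = comb cs' rs' j \<oplus> c \<otimes> f j"
        if "length cs' = length rs'" "set cs' \<subseteq> carrier R" "set rs' \<subseteq> set rs" for cs' rs'
        using that
      proof (induction cs' rs' rule: list_induct2)
        case Nil
        then show ?case using cl by (intro bexI[of _ \<zero>]) auto
      next
        case (Cons c cs' g rs')
        then obtain c' where c': "c' \<in> carrier R"
          "\<And>j. comb cs' (map red rs') j = comb cs' rs' j \<oplus> c' \<otimes> f j" by auto
        have gcl: "g j \<in> carrier R" for j using cl(2) Cons.prems by simp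
        have ccl: "comb cs' rs' j \<in> carrier R" for j
          by (rule comb_closed) (use Cons.prems cl(2) in auto)
        have "comb (c # cs') (map red (g # rs')) j = comb (c # cs') (g # rs') j \<oplus> (c' \<ominus> c \<otimes> q g) \<otimes> f j" for j
        proof -
          have *: "(x \<oplus> c' \<otimes> y) \<oplus> c \<otimes> (z \<ominus> w \<otimes> y) = (x \<oplus> c \<otimes> z) \<oplus> (c' \<ominus> c \<otimes> w) \<otimes> y"
            if "x \<in> carrier R" "y \<in> carrier R" "z \<in> carrier R" "w \<in> carrier R" "c \<in> carrier R" "c' \<in> carrier R"
            for x y z w c c' using that by algebra
          show ?thesis using *[OF ccl cl(1) gcl, of "q g" c c' j j j] Cons.prems q c' by (simp add: red_def)
        qed
        moreover have "c' \<ominus> c \<otimes> q g \<in> carrier R" using c' q Cons.prems by simp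
        ultimately show ?case by blast
      qed
      from this[of cs rs] obtain c where c: "c \<in> carrier R"
        "\<And>j. comb cs (map red rs) j = comb cs rs j \<oplus> c \<otimes> f j" using cs by auto
      have cab_cl: "set ca \<subseteq> carrier R" "set cb \<subseteq> carrier R" using cs(2) cab by auto
      have "comb (ca @ c # cb) fs j = \<zero>" for j
      proof -
        have comb_cl: "comb ca as j \<in> carrier R" "comb cb bs j \<in> carrier R"
          by (rule comb_closed; use cab_cl cl(2) rs_def in auto)+
        have 1: "comb (ca @ c # cb) fs j = comb ca as j \<oplus> comb (c # cb) (f # bs) j"
          unfolding fs by (rule comb_append) (use cab cab_cl c Suc.prems(1) fs in auto)
        have 2: "comb cs rs j = comb ca as j \<oplus> comb cb bs j"
          unfolding rs_def cab(1) by (rule comb_append) (use cab cab_cl cl(2) rs_def in auto)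
        have "\<zero> = comb cs rs j \<oplus> c \<otimes> f j" using cs(3) c(2) by simp
        then show ?thesis unfolding 1 2 using comb_cl c cl(1) by (simp add: a_assoc)
      qed
      moreover have "length (ca @ c # cb) = length fs" "set (ca @ c # cb) \<subseteq> carrier R"
        using cab fs cab_cl c by auto
      ultimately have "set (ca @ c # cb) \<subseteq> {\<zero>}" using Suc.prems(3) unfolding lin_indep_def by blast
      then show "set cs \<subseteq> {\<zero>}" using cab by auto
    qed
    have "\<forall>g\<in>set (map red rs). \<forall>j. g j \<in> carrier R"
      "\<forall>g\<in>set (map red rs). \<forall>j\<ge>D'. g j = \<zero>" using red_cl red_zero by auto
    from Suc.IH[OF this indep] obtain gs ds k where gs: "leading gs ds" "\<forall>f\<in>set gs. \<forall>j. f j \<in> carrier R"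
      "length gs = length rs" "\<forall>d\<in>set ds. d < D'" "k \<in> carrier R" "k \<noteq> \<zero>"
      "\<forall>T e. wedges D gs T e = k \<otimes> wedges D (map red rs) T e" by auto
    obtain s where s: "s = \<one> \<or> s = \<ominus> \<one>"
      "\<And>T e. wedges D fs T e = s \<otimes> wedges D (f # rs) T e"
      using wedges_front[of as f bs D] Suc.prems(1) unfolding fs rs_def by blast
    have scl: "s \<in> carrier R" and ss: "s \<otimes> s = \<one>" using s by (auto simp: l_minus r_minus)
    then have snz: "s \<noteq> \<zero>" by auto
    have "leading (f # gs) (D' # ds)"
      using gs(1,4) fD Suc.prems(2) \<open>f \<in> set fs\<close> by (auto simp: leading_def)
    moreover have "wedges D (f # gs) T e = (k \<otimes> s) \<otimes> wedges D fs T e" for T e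
    proof -
      have mcl: "\<And>T e. wedges D (map red rs) T e \<in> carrier R"
        using red_cl by (intro wedges_closed) auto
      have rcl: "wedges D (f # rs) T e \<in> carrier R" using cl by (intro wedges_closed) auto
      have "wedges D gs = (\<lambda>T e. k \<otimes> wedges D (map red rs) T e)" using gs(7) by (intro ext) simp
      then have "wedges D (f # gs) T e = k \<otimes> wedge D f (wedges D (map red rs)) T e"
        using wedge_smult[of f k "wedges D (map red rs)" D T e] cl(1) gs(5) mcl by simp
      also have "\<dots> = k \<otimes> wedges D (f # rs) T e" using wred[of rs T e] by simp
      also have "\<dots> = k \<otimes> ((s \<otimes> s) \<otimes> wedges D (f # rs) T e)" using ss rcl by simp
      also have "\<dots> = (k \<otimes> s) \<otimes> (s \<otimes> wedges D (f # rs) T e)" using rcl scl gs(5) by (simp only: m_assoc m_closed)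
      finally show ?thesis by (simp only: s(2))
    qed
    moreover have "k \<otimes> s \<in> carrier R" "k \<otimes> s \<noteq> \<zero>" using scl snz gs(5,6) by (auto simp: integral_iff)
    ultimately show ?thesis using gs cl(1) fs
      by (intro exI[of _ "f # gs"] exI[of _ "D' # ds"] exI[of _ "k \<otimes> s"]) (auto simp: rs_def less_SucI)
  qed
qed

text \<open>One direction is \<open>wedges_dependent\<close>; for the other, echelon form reduces to
  \<open>wedges_leading_nonzero\<close>. The bound on the exponent comes from \<open>phi_le\<close>
  with at most \<open>N\<close> factors, degrees at most \<open>D\<close> and weights at most
  \<open>N\<close>.\<close>

theorem wedges_nonzero_iff:
  assumes "\<And>f j. f \<in> set fs \<Longrightarrow> f j \<in> carrier R" "\<And>f j. f \<in> set fs \<Longrightarrow> D \<le> j \<Longrightarrow> f j = \<zero>"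
    and len: "length fs \<le> N"
  shows "(\<exists>T e. length T = N \<and> e < N * N * D + 1 \<and> wedges D fs T e \<noteq> \<zero>) \<longleftrightarrow> lin_indep fs"
proof
  assume "\<exists>T e. length T = N \<and> e < N * N * D + 1 \<and> wedges D fs T e \<noteq> \<zero>"
  then show "lin_indep fs" using wedges_dependent[of fs] assms(1) by blast
next
  assume "lin_indep fs"
  with lin_indep_leading[of fs D D] assms(1,2) have "\<exists>gs ds k. leading gs ds \<and>
    (\<forall>f\<in>set gs. \<forall>j. f j \<in> carrier R) \<and> length gs = length fs \<and> (\<forall>d\<in>set ds. d < D) \<and>
    k \<in> carrier R \<and> k \<noteq> \<zero> \<and> (\<forall>T e. wedges D gs T e = k \<otimes> wedges D fs T e)" by blast
  then obtain gs ds k where gs: "leading gs ds"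
    "\<forall>f\<in>set gs. \<forall>j. f j \<in> carrier R" "length gs = length fs" "\<forall>d\<in>set ds. d < D" "k \<in> carrier R"
    "\<And>T e. wedges D gs T e = k \<otimes> wedges D fs T e" by blast
  \<comment> \<open>As many generators as there are factors, here the lowest ones, which stand at
    the end of the list.\<close>
  define T where "T = replicate (N - length fs) False @ replicate (length fs) True"
  have ds: "length ds = length fs" using gs by (auto simp: leading_def dest: list_all2_lengthD)
  have "count_list (replicate n True) True = n" for n by (induction n) auto
  then have T: "length T = N" "count_list T True = length ds"
    using len ds by (auto simp: T_def count_list_append count_notin)
  have "wedges D gs T (phi ds T) \<noteq> \<zero>"
    using gs T by (intro wedges_leading_nonzero) auto
  then have "wedges D fs T (phi ds T) \<noteq> \<zero>" using gs(5,6) by auto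
  have "phi ds T \<le> length ds * (D * length T)" using gs(4) by (intro phi_le) (auto simp: less_imp_le)
  also have "length ds * (D * length T) \<le> N * (D * N)" using T ds len by (intro mult_mono) auto
  finally have "phi ds T < N * N * D + 1" by (simp add: algebra_simps)
  with \<open>wedges D fs T (phi ds T) \<noteq> \<zero>\<close> show "\<exists>T e. length T = N \<and> e < N * N * D + 1 \<and> wedges D fs T e \<noteq> \<zero>"
    using T by (intro exI[of _ T] exI[of _ "phi ds T"]) auto
qed

end

section \<open>A structured language and its compiler\<close>

datatype nexp = NC nat | NV nat | NA nat nexp | NI nexp | NPlus nexp nexp | NMinus nexp nexp

datatype fexp = F0 | F1 | FV nat | FA nat nexp | FI nexp
  | FPlus fexp fexp | FMinus fexp fexp | FTimes fexp fexp | FInverse fexp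

datatype rexp = RA nat nexp | RI nexp | RPlus rexp rexp

datatype bexp = BLe nexp nexp | BFEq fexp fexp | BRLe rexp rexp

text \<open>Only bounded loops, so that the time can be read off: \<open>For x y c\<close> runs
  \<open>c\<close> as often as variable \<open>y\<close> says, counting in \<open>x\<close>.
  \<open>Out\<close> writes into the region of the input, since the answer is expected from the
  first input cell on.\<close>

datatype com = Skip | SetN nat nexp | SetNA nat nexp nexp | Out nexp nexp
  | SetF nat fexp | SetFA nat nexp fexp | SetRA nat nexp rexp
  | Seq com com (infixr \<open>;;\<close> 60) | Cond bexp com com | For nat nat com

text \<open>Variables and arrays, the input region of each memory, and the addresses where the input
  regions end and the arrays begin.\<close>

record 'f store =
  nv :: "nat \<Rightarrow> nat"
  na :: "nat \<Rightarrow> nat \<Rightarrow> nat"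
  ni :: "nat \<Rightarrow> nat"
  fv :: "nat \<Rightarrow> 'f"
  fa :: "nat \<Rightarrow> nat \<Rightarrow> 'f"
  fi :: "nat \<Rightarrow> 'f"
  ra :: "nat \<Rightarrow> nat \<Rightarrow> real"
  ri :: "nat \<Rightarrow> real"
  bn :: nat
  bf :: nat
  br :: nat

text \<open>Memory layout: working registers below 100, then the input up to the address \<open>b\<close>, then
  sixteen interleaved arrays. The number variables occupy the cells below 43, where cells 40, 41 and
  42 hold the three addresses \<open>b\<close>; the field variables occupy the cells below 8.\<close>

definition cell :: "nat \<Rightarrow> (nat \<Rightarrow> 'v) \<Rightarrow> (nat \<Rightarrow> nat \<Rightarrow> 'v) \<Rightarrow> nat \<Rightarrow> 'v" where
  "cell b inp arr k = (if k < b then inp (k - 100) else arr ((k - b) mod 16) ((k - b) div 16))"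

primrec evN :: "nexp \<Rightarrow> 'f store \<Rightarrow> nat" where
  "evN (NC c) h = c"
| "evN (NV x) h = nv h x"
| "evN (NA a e) h = na h a (evN e h)"
| "evN (NI e) h = cell (bn h) (ni h) (na h) (evN e h + 100)"
| "evN (NPlus e1 e2) h = evN e1 h + evN e2 h"
| "evN (NMinus e1 e2) h = evN e1 h - evN e2 h"

primrec evF :: "('f, 'b) ring_scheme \<Rightarrow> fexp \<Rightarrow> 'f store \<Rightarrow> 'f" where
  "evF F F0 h = \<zero>\<^bsub>F\<^esub>"
| "evF F F1 h = \<one>\<^bsub>F\<^esub>"
| "evF F (FV x) h = fv h x"
| "evF F (FA a e) h = fa h a (evN e h)"
| "evF F (FI e) h = cell (bf h) (fi h) (fa h) (evN e h + 100)"
| "evF F (FPlus e1 e2) h = evF F e1 h \<oplus>\<^bsub>F\<^esub> evF F e2 h"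
| "evF F (FMinus e1 e2) h = evF F e1 h \<ominus>\<^bsub>F\<^esub> evF F e2 h"
| "evF F (FTimes e1 e2) h = evF F e1 h \<otimes>\<^bsub>F\<^esub> evF F e2 h"
| "evF F (FInverse e) h =
     (if evF F e h = \<zero>\<^bsub>F\<^esub> then \<zero>\<^bsub>F\<^esub> else inv\<^bsub>F\<^esub> (evF F e h))"

primrec evR :: "rexp \<Rightarrow> 'f store \<Rightarrow> real" where
  "evR (RA a e) h = ra h a (evN e h)"
| "evR (RI e) h = cell (br h) (ri h) (ra h) (evN e h + 100)"
| "evR (RPlus e1 e2) h = evR e1 h + evR e2 h"

primrec evB :: "('f, 'b) ring_scheme \<Rightarrow> bexp \<Rightarrow> 'f store \<Rightarrow> bool" where
  "evB F (BLe e1 e2) h = (evN e1 h \<le> evN e2 h)"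
| "evB F (BFEq e1 e2) h = (evF F e1 h = evF F e2 h)"
| "evB F (BRLe e1 e2) h = (evR e1 h \<le> evR e2 h)"

definition upd2 :: "(nat \<Rightarrow> nat \<Rightarrow> 'v) \<Rightarrow> nat \<Rightarrow> nat \<Rightarrow> 'v \<Rightarrow> nat \<Rightarrow> nat \<Rightarrow> 'v" where
  "upd2 f a k v = f(a := (f a)(k := v))"

lemma upd2_simps [simp]: "upd2 f a k v a = (f a)(k := v)" "b \<noteq> a \<Longrightarrow> upd2 f a k v b = f b"
  by (auto simp: upd2_def)

text \<open>An \<open>Out\<close> beyond the input region lands in one of the interleaved arrays,
  just as it does on the machine; the semantics has to follow it there for the simulation to
  hold.\<close>

primrec ex :: "('f, 'b) ring_scheme \<Rightarrow> com \<Rightarrow> 'f store \<Rightarrow> 'f store" where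
  "ex F Skip h = h"
| "ex F (SetN x e) h = h\<lparr>nv := (nv h)(x := evN e h)\<rparr>"
| "ex F (SetNA a e1 e2) h = h\<lparr>na := upd2 (na h) a (evN e1 h) (evN e2 h)\<rparr>"
| "ex F (Out e1 e2) h = (let k = evN e1 h; v = evN e2 h in
     if k + 100 < bn h then h\<lparr>ni := (ni h)(k := v)\<rparr>
     else h\<lparr>na := upd2 (na h) ((k + 100 - bn h) mod 16) ((k + 100 - bn h) div 16) v\<rparr>)"
| "ex F (SetF x e) h = h\<lparr>fv := (fv h)(x := evF F e h)\<rparr>"
| "ex F (SetFA a e1 e2) h = h\<lparr>fa := upd2 (fa h) a (evN e1 h) (evF F e2 h)\<rparr>"
| "ex F (SetRA a e1 e2) h = h\<lparr>ra := upd2 (ra h) a (evN e1 h) (evR e2 h)\<rparr>"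
| "ex F (c1 ;; c2) h = ex F c2 (ex F c1 h)"
| "ex F (Cond b c1 c2) h = (if evB F b h then ex F c1 h else ex F c2 h)"
| "ex F (For x y c) h =
     ((\<lambda>g. let g' = ex F c g in g'\<lparr>nv := (nv g')(x := Suc (nv g' x))\<rparr>) ^^ nv h y)
       (h\<lparr>nv := (nv h)(x := 0)\<rparr>)"

primrec wN :: "com \<Rightarrow> nat set" where
  "wN Skip = {}"
| "wN (SetN x e) = {x}"
| "wN (SetNA a e1 e2) = {}"
| "wN (Out e1 e2) = {}"
| "wN (SetF x e) = {}"
| "wN (SetFA a e1 e2) = {}"
| "wN (SetRA a e1 e2) = {}"
| "wN (c1 ;; c2) = wN c1 \<union> wN c2"
| "wN (Cond b c1 c2) = wN c1 \<union> wN c2"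
| "wN (For x y c) = insert x (wN c)"

text \<open>The loop bounds are the only variables on which \<open>scost\<close> depends.\<close>

primrec bvars :: "com \<Rightarrow> nat set" where
  "bvars Skip = {}"
| "bvars (SetN x e) = {}"
| "bvars (SetNA a e1 e2) = {}"
| "bvars (Out e1 e2) = {}"
| "bvars (SetF x e) = {}"
| "bvars (SetFA a e1 e2) = {}"
| "bvars (SetRA a e1 e2) = {}"
| "bvars (c1 ;; c2) = bvars c1 \<union> bvars c2"
| "bvars (Cond b c1 c2) = bvars c1 \<union> bvars c2"
| "bvars (For x y c) = insert y (bvars c)"

subsection \<open>Compilation\<close>

text \<open>Turns the index in cell \<open>k\<close> into base + 16 index + \<open>a\<close>. Four
  doublings replace the multiplication, and \<open>b\<close> is the cell that holds the
  base.\<close>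

definition aidx :: "nat \<Rightarrow> nat \<Rightarrow> nat \<Rightarrow> instr list" where
  "aidx b a k =
     [NAdd (Dir k) (Dir k) (Dir k), NAdd (Dir k) (Dir k) (Dir k),
      NAdd (Dir k) (Dir k) (Dir k), NAdd (Dir k) (Dir k) (Dir k),
      NConst (Dir (Suc k)) a, NAdd (Dir k) (Dir k) (Dir (Suc k)), NAdd (Dir k) (Dir k) (Dir b)]"

definition iidx :: "nat \<Rightarrow> instr list" where
  "iidx k = [NConst (Dir (Suc k)) 100, NAdd (Dir k) (Dir k) (Dir (Suc k))]"

text \<open>The cells from \<open>k\<close> on serve as an expression stack: the value ends in cell
  \<open>k\<close>, and lower cells are left alone.\<close>

primrec cN :: "nexp \<Rightarrow> nat \<Rightarrow> instr list" where
  "cN (NC c) k = [NConst (Dir k) c]"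
| "cN (NV x) k = [NCopy (Dir k) (Dir x)]"
| "cN (NA a e) k = cN e k @ aidx 40 a k @ [NCopy (Dir k) (Ind k)]"
| "cN (NI e) k = cN e k @ iidx k @ [NCopy (Dir k) (Ind k)]"
| "cN (NPlus e1 e2) k = cN e1 k @ cN e2 (Suc k) @ [NAdd (Dir k) (Dir k) (Dir (Suc k))]"
| "cN (NMinus e1 e2) k = cN e1 k @ cN e2 (Suc k) @ [NSub (Dir k) (Dir k) (Dir (Suc k))]"

primrec cF :: "fexp \<Rightarrow> nat \<Rightarrow> nat \<Rightarrow> instr list" where
  "cF F0 k l = [FZero (Dir l)]"
| "cF F1 k l = [FOne (Dir l)]"
| "cF (FV x) k l = [FCopy (Dir l) (Dir x)]"
| "cF (FA a e) k l = cN e k @ aidx 41 a k @ [FCopy (Dir l) (Ind k)]"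
| "cF (FI e) k l = cN e k @ iidx k @ [FCopy (Dir l) (Ind k)]"
| "cF (FPlus e1 e2) k l = cF e1 k l @ cF e2 k (Suc l) @ [FAdd (Dir l) (Dir l) (Dir (Suc l))]"
| "cF (FMinus e1 e2) k l = cF e1 k l @ cF e2 k (Suc l) @ [FSub (Dir l) (Dir l) (Dir (Suc l))]"
| "cF (FTimes e1 e2) k l = cF e1 k l @ cF e2 k (Suc l) @ [FMul (Dir l) (Dir l) (Dir (Suc l))]"
| "cF (FInverse e) k l = cF e k l @ [FInv (Dir l) (Dir l)]"

primrec cR :: "rexp \<Rightarrow> nat \<Rightarrow> nat \<Rightarrow> instr list" where
  "cR (RA a e) k l = cN e k @ aidx 42 a k @ [RCopy (Dir l) (Ind k)]"
| "cR (RI e) k l = cN e k @ iidx k @ [RCopy (Dir l) (Ind k)]"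
| "cR (RPlus e1 e2) k l = cR e1 k l @ cR e2 k (Suc l) @ [RAdd (Dir l) (Dir l) (Dir (Suc l))]"

primrec cB :: "bexp \<Rightarrow> instr list" where
  "cB (BLe e1 e2) = cN e1 43 @ cN e2 44"
| "cB (BFEq e1 e2) = cF e1 43 8 @ cF e2 43 9"
| "cB (BRLe e1 e2) = cR e1 43 0 @ cR e2 43 1"

primrec jB :: "bexp \<Rightarrow> nat \<Rightarrow> instr" where
  "jB (BLe e1 e2) = NJumpLe (Dir 43) (Dir 44)"
| "jB (BFEq e1 e2) = FJumpEq (Dir 8) (Dir 9)"
| "jB (BRLe e1 e2) = RJumpLe (Dir 0) (Dir 1)"

abbreviation goto :: "nat \<Rightarrow> instr" where
  "goto l \<equiv> NJumpLe (Dir 0) (Dir 0) l"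

primrec clen :: "com \<Rightarrow> nat" where
  "clen Skip = 0"
| "clen (SetN x e) = length (cN e 43) + 1"
| "clen (SetNA a e1 e2) = length (cN e1 43) + length (cN e2 44) + 8"
| "clen (Out e1 e2) = length (cN e1 43) + length (cN e2 44) + 3"
| "clen (SetF x e) = length (cF e 43 8) + 1"
| "clen (SetFA a e1 e2) = length (cN e1 43) + length (cF e2 44 8) + 8"
| "clen (SetRA a e1 e2) = length (cN e1 43) + length (cR e2 44 0) + 8"
| "clen (c1 ;; c2) = clen c1 + clen c2"
| "clen (Cond b c1 c2) = length (cB b) + clen c1 + clen c2 + 2"
| "clen (For x y c) = clen c + 5"

text \<open>Jump targets are absolute, hence the load address \<open>p\<close>. In a conditional the
  code of the false branch comes first and is reached by falling through.\<close>

primrec comp :: "com \<Rightarrow> nat \<Rightarrow> instr list" where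
  "comp Skip p = []"
| "comp (SetN x e) p = cN e 43 @ [NCopy (Dir x) (Dir 43)]"
| "comp (SetNA a e1 e2) p = cN e1 43 @ aidx 40 a 43 @ cN e2 44 @ [NCopy (Ind 43) (Dir 44)]"
| "comp (Out e1 e2) p = cN e1 43 @ iidx 43 @ cN e2 44 @ [NCopy (Ind 43) (Dir 44)]"
| "comp (SetF x e) p = cF e 43 8 @ [FCopy (Dir x) (Dir 8)]"
| "comp (SetFA a e1 e2) p = cN e1 43 @ aidx 41 a 43 @ cF e2 44 8 @ [FCopy (Ind 43) (Dir 8)]"
| "comp (SetRA a e1 e2) p = cN e1 43 @ aidx 42 a 43 @ cR e2 44 0 @ [RCopy (Ind 43) (Dir 0)]"
| "comp (c1 ;; c2) p = comp c1 p @ comp c2 (p + clen c1)"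
| "comp (Cond b c1 c2) p =
     cB b @ [jB b (p + length (cB b) + clen c2 + 2)] @ comp c2 (p + length (cB b) + 1) @
     [goto (p + clen (Cond b c1 c2))] @ comp c1 (p + length (cB b) + clen c2 + 2)"
| "comp (For x y c) p =
     [NConst (Dir x) 0, NJumpLe (Dir y) (Dir x) (p + clen c + 5)] @ comp c (p + 2) @
     [NConst (Dir 43) 1, NAdd (Dir x) (Dir x) (Dir 43), goto (p + 1)]"

text \<open>An upper bound evaluated in a single store: both branches of a conditional are charged,
  and a loop bound is taken to keep its value. In \<open>For\<close>, the 4 pays for the test, the
  increment in two instructions and the jump back, the 2 for the initialization and the last
  test.\<close>

primrec scost :: "com \<Rightarrow> (nat \<Rightarrow> nat) \<Rightarrow> nat" where
  "scost Skip \<sigma> = 0"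
| "scost (SetN x e) \<sigma> = clen (SetN x e)"
| "scost (SetNA a e1 e2) \<sigma> = clen (SetNA a e1 e2)"
| "scost (Out e1 e2) \<sigma> = clen (Out e1 e2)"
| "scost (SetF x e) \<sigma> = clen (SetF x e)"
| "scost (SetFA a e1 e2) \<sigma> = clen (SetFA a e1 e2)"
| "scost (SetRA a e1 e2) \<sigma> = clen (SetRA a e1 e2)"
| "scost (c1 ;; c2) \<sigma> = scost c1 \<sigma> + scost c2 \<sigma>"
| "scost (Cond b c1 c2) \<sigma> = length (cB b) + 2 + scost c1 \<sigma> + scost c2 \<sigma>"
| "scost (For x y c) \<sigma> = 2 + \<sigma> y * (scost c \<sigma> + 4)"

text \<open>The flag \<open>ar\<close> permits array accesses and in return forbids assignments to the cells 40, 41 and 42.\<close>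

primrec okN :: "bool \<Rightarrow> nexp \<Rightarrow> nat \<Rightarrow> bool" where
  "okN ar (NC c) k = (k < 99)"
| "okN ar (NV x) k = (k < 99 \<and> x < 43)"
| "okN ar (NA a e) k = (ar \<and> a < 16 \<and> okN ar e k)"
| "okN ar (NI e) k = okN ar e k"
| "okN ar (NPlus e1 e2) k = (okN ar e1 k \<and> okN ar e2 (Suc k))"
| "okN ar (NMinus e1 e2) k = (okN ar e1 k \<and> okN ar e2 (Suc k))"

primrec okF :: "bool \<Rightarrow> fexp \<Rightarrow> nat \<Rightarrow> nat \<Rightarrow> bool" where
  "okF ar F0 k l = (l < 99)"
| "okF ar F1 k l = (l < 99)"
| "okF ar (FV x) k l = (l < 99 \<and> x < 8)"
| "okF ar (FA a e) k l = (ar \<and> a < 16 \<and> okN ar e k \<and> l < 99)"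
| "okF ar (FI e) k l = (okN ar e k \<and> l < 99)"
| "okF ar (FPlus e1 e2) k l = (okF ar e1 k l \<and> okF ar e2 k (Suc l))"
| "okF ar (FMinus e1 e2) k l = (okF ar e1 k l \<and> okF ar e2 k (Suc l))"
| "okF ar (FTimes e1 e2) k l = (okF ar e1 k l \<and> okF ar e2 k (Suc l))"
| "okF ar (FInverse e) k l = okF ar e k l"

primrec okR :: "bool \<Rightarrow> rexp \<Rightarrow> nat \<Rightarrow> nat \<Rightarrow> bool" where
  "okR ar (RA a e) k l = (ar \<and> a < 16 \<and> okN ar e k \<and> l < 99)"
| "okR ar (RI e) k l = (okN ar e k \<and> l < 99)"
| "okR ar (RPlus e1 e2) k l = (okR ar e1 k l \<and> okR ar e2 k (Suc l))"

primrec okB :: "bool \<Rightarrow> bexp \<Rightarrow> bool" where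
  "okB ar (BLe e1 e2) = (okN ar e1 43 \<and> okN ar e2 44)"
| "okB ar (BFEq e1 e2) = (okF ar e1 43 8 \<and> okF ar e2 43 9)"
| "okB ar (BRLe e1 e2) = (okR ar e1 43 0 \<and> okR ar e2 43 1)"

primrec okC :: "bool \<Rightarrow> com \<Rightarrow> bool" where
  "okC ar Skip = True"
| "okC ar (SetN x e) = (okN ar e 43 \<and> x < 43 \<and> (ar \<longrightarrow> x < 40))"
| "okC ar (SetNA a e1 e2) = (ar \<and> a < 16 \<and> okN ar e1 43 \<and> okN ar e2 44)"
| "okC ar (Out e1 e2) = (okN ar e1 43 \<and> okN ar e2 44)"
| "okC ar (SetF x e) = (okF ar e 43 8 \<and> x < 8)"
| "okC ar (SetFA a e1 e2) = (ar \<and> a < 16 \<and> okN ar e1 43 \<and> okF ar e2 44 8)"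
| "okC ar (SetRA a e1 e2) = (ar \<and> a < 16 \<and> okN ar e1 43 \<and> okR ar e2 44 0)"
| "okC ar (c1 ;; c2) = (okC ar c1 \<and> okC ar c2)"
| "okC ar (Cond b c1 c2) = (okB ar b \<and> okC ar c1 \<and> okC ar c2)"
| "okC ar (For x y c) = (okC ar c \<and> x < 40 \<and> y < 43 \<and> x \<noteq> y \<and> x \<notin> wN c \<and> y \<notin> wN c)"

section \<open>The simulation relation and the correctness of straight-line code\<close>

definition sim :: "'f store \<Rightarrow> 'f state \<Rightarrow> bool" where
  "sim h s \<longleftrightarrow>
     (\<forall>x<43. nmem s x = nv h x) \<and> (\<forall>k\<ge>100. nmem s k = cell (bn h) (ni h) (na h) k) \<and>
     (\<forall>x<8. fmem s x = fv h x) \<and> (\<forall>k\<ge>100. fmem s k = cell (bf h) (fi h) (fa h) k) \<and>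
     (\<forall>k\<ge>100. rmem s k = cell (br h) (ri h) (ra h) k)"

text \<open>The array bases depend on the input and are known only after the first pieces of the
  program have computed them, so those pieces must do without arrays and this condition cannot be
  part of \<open>sim\<close>.\<close>

definition based :: "'f store \<Rightarrow> bool" where
  "based h \<longleftrightarrow> nv h 40 = bn h \<and> nv h 41 = bf h \<and> nv h 42 = br h"

definition inputs_first :: "'f store \<Rightarrow> bool" where
  "inputs_first h \<longleftrightarrow> 100 \<le> bn h \<and> 100 \<le> bf h \<and> 100 \<le> br h"

definition chg :: "nat \<Rightarrow> nat \<Rightarrow> nat \<Rightarrow> 'f state \<Rightarrow> 'f state \<Rightarrow> bool" where
  "chg k l m s s' \<longleftrightarrow> (\<forall>x. x < k \<or> 100 \<le> x \<longrightarrow> nmem s' x = nmem s x) \<and>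
     (\<forall>x. x < l \<or> 100 \<le> x \<longrightarrow> fmem s' x = fmem s x) \<and> (\<forall>x. x < m \<or> 100 \<le> x \<longrightarrow> rmem s' x = rmem s x)"

lemma chg_sim: "chg k l m s s' \<Longrightarrow> sim h s \<Longrightarrow> 43 \<le> k \<Longrightarrow> 8 \<le> l \<Longrightarrow> sim h s'"
  unfolding chg_def sim_def by auto

lemma chg_trans:
  "chg k l m s s' \<Longrightarrow> chg k' l' m' s' s'' \<Longrightarrow> k \<le> k' \<Longrightarrow> l \<le> l' \<Longrightarrow> m \<le> m' \<Longrightarrow> chg k l m s s''"
  unfolding chg_def by simp

definition exs :: "('f, 'b) ring_scheme \<Rightarrow> instr list \<Rightarrow> 'f state \<Rightarrow> 'f state" where
  "exs F code s = fold (exec F) code s"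

lemma exs_simps [simp]:
  "exs F [] s = s" "exs F (i # code) s = exs F code (exec F i s)"
  "exs F (code1 @ code2) s = exs F code2 (exs F code1 s)"
  by (auto simp: exs_def)

lemmas exec_defs = setN_def setF_def setR_def jump_if_def

lemma aidx_correct:
  assumes "k < 99" "43 \<le> k" "b < 43"
  shows "chg k 100 100 s (exs F (aidx b a k) s)"
    "nmem (exs F (aidx b a k) s) k = nmem s b + 16 * nmem s k + a"
  using assms by (auto simp: aidx_def exec_defs chg_def)

lemma iidx_correct:
  assumes "k < 99"
  shows "chg k 100 100 s (exs F (iidx k) s)" "nmem (exs F (iidx k) s) k = nmem s k + 100"
  using assms by (auto simp: iidx_def exec_defs chg_def)

lemma okN_less: "okN ar e k \<Longrightarrow> k < 99"
  by (induction e arbitrary: k) auto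

lemma okF_less: "okF ar e k l \<Longrightarrow> l < 99"
  by (induction e arbitrary: l) auto

lemma okR_less: "okR ar e k l \<Longrightarrow> l < 99"
  by (induction e arbitrary: l) auto

lemma cell_array: "a < 16 \<Longrightarrow> cell b inp arr (b + 16 * i + a) = arr a i"
  by (simp add: cell_def)

lemma cN_correct:
  assumes "okN ar e k" "43 \<le> k" "sim h s" "ar \<Longrightarrow> based h" "inputs_first h"
  shows "chg k 100 100 s (exs F (cN e k) s) \<and> nmem (exs F (cN e k) s) k = evN e h"
  using assms(1-3)
proof (induction e arbitrary: k s)
  case (NC c)
  then show ?case by (auto simp: exec_defs chg_def)
next
  case (NV x)
  then show ?case by (auto simp: exec_defs chg_def sim_def)
next
  case (NA a e)
  let ?s1 = "exs F (cN e k) s" let ?s2 = "exs F (aidx 40 a k) ?s1"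
  have 1: "chg k 100 100 s ?s1" "nmem ?s1 k = evN e h" using NA by auto
  have k: "k < 99" using NA okN_less by auto
  have 2: "chg k 100 100 ?s1 ?s2" "nmem ?s2 k = nmem ?s1 40 + 16 * nmem ?s1 k + a"
    using aidx_correct[where k = k and b = 40 and F = F and a = a and s = ?s1] k NA.prems by auto
  have 3: "chg k 100 100 s ?s2" using chg_trans[OF 1(1) 2(1)] by simp
  have "sim h ?s2" "sim h ?s1" using chg_sim[OF 3] chg_sim[OF 1(1)] NA.prems by auto
  moreover have b: "nmem ?s1 40 = bn h" using \<open>sim h ?s1\<close> assms(4) NA.prems by (simp add: sim_def based_def)
  ultimately have "nmem ?s2 (bn h + 16 * evN e h + a) = na h a (evN e h)"
    using assms(5) NA.prems by (simp add: sim_def inputs_first_def cell_array)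
  then show ?case using 2 3 1 b k NA.prems by (auto simp: exec_defs chg_def)
next
  case (NI e)
  let ?s1 = "exs F (cN e k) s" let ?s2 = "exs F (iidx k) ?s1"
  have 1: "chg k 100 100 s ?s1" "nmem ?s1 k = evN e h" using NI by auto
  have k: "k < 99" using NI okN_less by auto
  have 2: "chg k 100 100 ?s1 ?s2" "nmem ?s2 k = nmem ?s1 k + 100"
    using iidx_correct[where k = k and F = F and s = ?s1] k NI.prems by auto
  have 3: "chg k 100 100 s ?s2" using chg_trans[OF 1(1) 2(1)] by simp
  have "sim h ?s2" using chg_sim[OF 3] NI.prems by auto
  then show ?case using 2 3 1 k NI.prems by (auto simp: exec_defs chg_def sim_def)
next
  case (NPlus e1 e2)
  let ?s1 = "exs F (cN e1 k) s" let ?s2 = "exs F (cN e2 (Suc k)) ?s1"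
  have 1: "chg k 100 100 s ?s1" "nmem ?s1 k = evN e1 h" using NPlus by auto
  have "sim h ?s1" using chg_sim[OF 1(1)] NPlus.prems by auto
  then have 2: "chg (Suc k) 100 100 ?s1 ?s2" "nmem ?s2 (Suc k) = evN e2 h" using NPlus by auto
  have "chg k 100 100 s ?s2" using chg_trans[OF 1(1) 2(1)] by simp
  moreover have "nmem ?s2 k = evN e1 h" using 1 2 by (simp add: chg_def)
  ultimately show ?case using 2 okN_less[of ar e1 k] NPlus.prems by (auto simp: exec_defs chg_def)
next
  case (NMinus e1 e2)
  let ?s1 = "exs F (cN e1 k) s" let ?s2 = "exs F (cN e2 (Suc k)) ?s1"
  have 1: "chg k 100 100 s ?s1" "nmem ?s1 k = evN e1 h" using NMinus by auto
  have "sim h ?s1" using chg_sim[OF 1(1)] NMinus.prems by auto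
  then have 2: "chg (Suc k) 100 100 ?s1 ?s2" "nmem ?s2 (Suc k) = evN e2 h" using NMinus by auto
  have "chg k 100 100 s ?s2" using chg_trans[OF 1(1) 2(1)] by simp
  moreover have "nmem ?s2 k = evN e1 h" using 1 2 by (simp add: chg_def)
  ultimately show ?case using 2 okN_less[of ar e1 k] NMinus.prems by (auto simp: exec_defs chg_def)
qed

lemma aref_correct:
  fixes F a
  assumes "okN ar e k" "43 \<le> k" "sim h s" "based h" "inputs_first h" "b = 40 \<or> b = 41 \<or> b = 42"
  defines "s' \<equiv> exs F (cN e k @ aidx b a k) s"
  shows "chg k 100 100 s s'" "nmem s' k = nv h b + 16 * evN e h + a" "sim h s'"
proof -
  let ?s1 = "exs F (cN e k) s"
  have 1: "chg k 100 100 s ?s1" "nmem ?s1 k = evN e h" using cN_correct[of ar e k h s F] assms by auto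
  have k: "k < 99" using assms okN_less by auto
  have 2: "chg k 100 100 ?s1 s'" "nmem s' k = nmem ?s1 b + 16 * nmem ?s1 k + a"
    using aidx_correct[where k = k and b = b and F = F and a = a and s = ?s1] k assms by auto
  show "chg k 100 100 s s'" using chg_trans[OF 1(1) 2(1)] by simp
  from chg_sim[OF this] show "sim h s'" using assms by auto
  have "sim h ?s1" using chg_sim[OF 1(1)] assms by auto
  then have "nmem ?s1 b = nv h b" using assms(6) by (auto simp: sim_def)
  then show "nmem s' k = nv h b + 16 * evN e h + a" using 1 2 by simp
qed

lemma iref_correct:
  fixes F
  assumes "okN ar e k" "43 \<le> k" "sim h s" "ar \<Longrightarrow> based h" "inputs_first h"
  defines "s' \<equiv> exs F (cN e k @ iidx k) s"
  shows "chg k 100 100 s s'" "nmem s' k = evN e h + 100" "sim h s'"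
proof -
  let ?s1 = "exs F (cN e k) s"
  have 1: "chg k 100 100 s ?s1" "nmem ?s1 k = evN e h" using cN_correct[of ar e k h s F] assms by auto
  have k: "k < 99" using assms okN_less by auto
  have 2: "chg k 100 100 ?s1 s'" "nmem s' k = nmem ?s1 k + 100"
    using iidx_correct[where k = k and F = F and s = ?s1] k assms by auto
  show "chg k 100 100 s s'" using chg_trans[OF 1(1) 2(1)] by simp
  from chg_sim[OF this] show "sim h s'" using assms by auto
  show "nmem s' k = evN e h + 100" using 1 2 by simp
qed

lemma cF_correct:
  assumes "okF ar e k l" "43 \<le> k" "8 \<le> l" "sim h s" "ar \<Longrightarrow> based h" "inputs_first h"
  shows "chg k l 100 s (exs F (cF e k l) s) \<and> fmem (exs F (cF e k l) s) l = evF F e h"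
  using assms(1-4)
proof (induction e arbitrary: l s)
  case (FA a e)
  note A = aref_correct[where ar = ar and e = e and k = k and h = h and s = s and b = 41 and F = F and a = a, simplified]
  have "okN ar e k" "based h" "l < 99" "a < 16" using FA.prems assms by auto
  note A = A[OF this(1) FA.prems(2,4) this(2) assms(6)] this
  have "fmem (exs F (aidx 41 a k) (exs F (cN e k) s)) (bf h + 16 * evN e h + a) = fa h a (evN e h)"
    using A assms(6) by (simp add: sim_def inputs_first_def cell_array)
  then show ?case using A by (auto simp: exec_defs chg_def based_def)
next
  case (FI e)
  note A = iref_correct[where ar = ar and e = e and k = k and h = h and s = s and F = F, simplified]
  have "okN ar e k" "l < 99" using FI.prems assms by auto
  note A = A[OF this(1) FI.prems(2,4) assms(5,6)] this
  show ?case using A by (auto simp: exec_defs chg_def sim_def)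
next
  case (FPlus e1 e2)
  let ?s1 = "exs F (cF e1 k l) s" let ?s2 = "exs F (cF e2 k (Suc l)) ?s1"
  have 1: "chg k l 100 s ?s1" "fmem ?s1 l = evF F e1 h" using FPlus by auto
  have "sim h ?s1" using chg_sim[OF 1(1)] FPlus.prems by auto
  then have 2: "chg k (Suc l) 100 ?s1 ?s2" "fmem ?s2 (Suc l) = evF F e2 h" using FPlus by auto
  have "chg k l 100 s ?s2" using chg_trans[OF 1(1) 2(1)] by simp
  moreover have "fmem ?s2 l = evF F e1 h" using 1 2 by (simp add: chg_def)
  ultimately show ?case using 2 okF_less[of ar e1 k l] FPlus.prems by (auto simp: exec_defs chg_def)
next
  case (FMinus e1 e2)
  let ?s1 = "exs F (cF e1 k l) s" let ?s2 = "exs F (cF e2 k (Suc l)) ?s1"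
  have 1: "chg k l 100 s ?s1" "fmem ?s1 l = evF F e1 h" using FMinus by auto
  have "sim h ?s1" using chg_sim[OF 1(1)] FMinus.prems by auto
  then have 2: "chg k (Suc l) 100 ?s1 ?s2" "fmem ?s2 (Suc l) = evF F e2 h" using FMinus by auto
  have "chg k l 100 s ?s2" using chg_trans[OF 1(1) 2(1)] by simp
  moreover have "fmem ?s2 l = evF F e1 h" using 1 2 by (simp add: chg_def)
  ultimately show ?case using 2 okF_less[of ar e1 k l] FMinus.prems by (auto simp: exec_defs chg_def)
next
  case (FTimes e1 e2)
  let ?s1 = "exs F (cF e1 k l) s" let ?s2 = "exs F (cF e2 k (Suc l)) ?s1"
  have 1: "chg k l 100 s ?s1" "fmem ?s1 l = evF F e1 h" using FTimes by auto
  have "sim h ?s1" using chg_sim[OF 1(1)] FTimes.prems by auto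
  then have 2: "chg k (Suc l) 100 ?s1 ?s2" "fmem ?s2 (Suc l) = evF F e2 h" using FTimes by auto
  have "chg k l 100 s ?s2" using chg_trans[OF 1(1) 2(1)] by simp
  moreover have "fmem ?s2 l = evF F e1 h" using 1 2 by (simp add: chg_def)
  ultimately show ?case using 2 okF_less[of ar e1 k l] FTimes.prems by (auto simp: exec_defs chg_def)
next
  case (FInverse e)
  then have "chg k l 100 s (exs F (cF e k l) s)" "fmem (exs F (cF e k l) s) l = evF F e h" "l < 99"
    using okF_less by auto
  then show ?case by (auto simp: exec_defs chg_def)
qed (auto simp: exec_defs chg_def sim_def)

lemma cR_correct:
  assumes "okR ar e k l" "43 \<le> k" "sim h s" "ar \<Longrightarrow> based h" "inputs_first h"
  shows "chg k 100 l s (exs F (cR e k l) s) \<and> rmem (exs F (cR e k l) s) l = evR e h"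
  using assms(1-3)
proof (induction e arbitrary: l s)
  case (RA a e)
  note A = aref_correct[where ar = ar and e = e and k = k and h = h and s = s and b = 42 and F = F and a = a, simplified]
  have "okN ar e k" "based h" "l < 99" "a < 16" using RA.prems assms by auto
  note A = A[OF this(1) RA.prems(2,3) this(2) assms(5)] this
  have "rmem (exs F (aidx 42 a k) (exs F (cN e k) s)) (br h + 16 * evN e h + a) = ra h a (evN e h)"
    using A assms(5) by (simp add: sim_def inputs_first_def cell_array)
  then show ?case using A by (auto simp: exec_defs chg_def based_def)
next
  case (RI e)
  note A = iref_correct[where ar = ar and e = e and k = k and h = h and s = s and F = F, simplified]
  have "okN ar e k" "l < 99" using RI.prems assms by auto
  note A = A[OF this(1) RI.prems(2,3) assms(4,5)] this
  show ?case using A by (auto simp: exec_defs chg_def sim_def)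
next
  case (RPlus e1 e2)
  let ?s1 = "exs F (cR e1 k l) s" let ?s2 = "exs F (cR e2 k (Suc l)) ?s1"
  have 1: "chg k 100 l s ?s1" "rmem ?s1 l = evR e1 h" using RPlus by auto
  have "sim h ?s1" using chg_sim[OF 1(1)] RPlus.prems by auto
  then have 2: "chg k 100 (Suc l) ?s1 ?s2" "rmem ?s2 (Suc l) = evR e2 h" using RPlus by auto
  have "chg k 100 l s ?s2" using chg_trans[OF 1(1) 2(1)] by simp
  moreover have "rmem ?s2 l = evR e1 h" using 1 2 by (simp add: chg_def)
  ultimately show ?case using 2 okR_less[of ar e1 k l] RPlus.prems by (auto simp: exec_defs chg_def)
qed

lemma cB_correct:
  assumes "okB ar b" "sim h s" "ar \<Longrightarrow> based h" "inputs_first h"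
  shows "sim h (exs F (cB b) s)"
    "exec F (jB b l) (exs F (cB b) s) = jump_if (evB F b h) l (exs F (cB b) s)"
proof -
  have "sim h (exs F (cB b) s) \<and>
    exec F (jB b l) (exs F (cB b) s) = jump_if (evB F b h) l (exs F (cB b) s)"
  proof (cases b)
    case (BLe e1 e2)
    let ?s1 = "exs F (cN e1 43) s" let ?s2 = "exs F (cN e2 44) ?s1"
    have 1: "chg 43 100 100 s ?s1 \<and> nmem ?s1 43 = evN e1 h"
      by (rule cN_correct[where ar = ar]) (use assms BLe in auto)
    then have "sim h ?s1" using chg_sim[of 43 100 100 s ?s1] assms by auto
    then have 2: "chg 44 100 100 ?s1 ?s2 \<and> nmem ?s2 44 = evN e2 h"
      by (intro cN_correct[where ar = ar]) (use assms BLe in auto)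
    then have "sim h ?s2" using chg_sim[of 44 100 100 ?s1 ?s2] \<open>sim h ?s1\<close> by auto
    moreover have "nmem ?s2 43 = evN e1 h" using 1 2 by (simp add: chg_def)
    ultimately show ?thesis using 2 BLe by simp
  next
    case (BFEq e1 e2)
    let ?s1 = "exs F (cF e1 43 8) s" let ?s2 = "exs F (cF e2 43 9) ?s1"
    have 1: "chg 43 8 100 s ?s1 \<and> fmem ?s1 8 = evF F e1 h"
      by (rule cF_correct[where ar = ar]) (use assms BFEq in auto)
    then have "sim h ?s1" using chg_sim[of 43 8 100 s ?s1] assms by auto
    then have 2: "chg 43 9 100 ?s1 ?s2 \<and> fmem ?s2 9 = evF F e2 h"
      by (intro cF_correct[where ar = ar]) (use assms BFEq in auto)
    then have "sim h ?s2" using chg_sim[of 43 9 100 ?s1 ?s2] \<open>sim h ?s1\<close> by auto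
    moreover have "fmem ?s2 8 = evF F e1 h" using 1 2 by (simp add: chg_def)
    ultimately show ?thesis using 2 BFEq by simp
  next
    case (BRLe e1 e2)
    let ?s1 = "exs F (cR e1 43 0) s" let ?s2 = "exs F (cR e2 43 1) ?s1"
    have 1: "chg 43 100 0 s ?s1 \<and> rmem ?s1 0 = evR e1 h"
      by (rule cR_correct[where ar = ar]) (use assms BRLe in auto)
    then have "sim h ?s1" using chg_sim[of 43 100 0 s ?s1] assms by auto
    then have 2: "chg 43 100 1 ?s1 ?s2 \<and> rmem ?s2 1 = evR e2 h"
      by (intro cR_correct[where ar = ar]) (use assms BRLe in auto)
    then have "sim h ?s2" using chg_sim[of 43 100 1 ?s1 ?s2] \<open>sim h ?s1\<close> by auto
    moreover have "rmem ?s2 0 = evR e1 h" using 1 2 by (simp add: chg_def)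
    ultimately show ?thesis using 2 BRLe by simp
  qed
  then show "sim h (exs F (cB b) s)"
    "exec F (jB b l) (exs F (cB b) s) = jump_if (evB F b h) l (exs F (cB b) s)" by auto
qed

subsection \<open>Execution of compiled code\<close>

definition reach :: "('f, 'b) ring_scheme \<Rightarrow> prog \<Rightarrow> 'f state \<Rightarrow> nat \<Rightarrow> 'f state \<Rightarrow> bool" where
  "reach F P s t s' \<longleftrightarrow> (step F P ^^ t) s = s'"

lemma reach_refl: "reach F P s 0 s"
  by (simp add: reach_def)

lemma reach_trans: "reach F P s t s' \<Longrightarrow> reach F P s' t' s'' \<Longrightarrow> reach F P s (t + t') s''"
  unfolding reach_def by (subst add.commute) (simp add: funpow_add)

definition loaded :: "prog \<Rightarrow> nat \<Rightarrow> instr list \<Rightarrow> bool" where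
  "loaded P p code \<longleftrightarrow> (\<forall>i<length code. p + i < length P \<and> P ! (p + i) = code ! i)"

lemma loaded_append:
  "loaded P p (a @ b) \<longleftrightarrow> loaded P p a \<and> loaded P (p + length a) b"
proof
  assume l: "loaded P p (a @ b)"
  have "loaded P p a" unfolding loaded_def
  proof (intro allI impI)
    fix i assume "i < length a"
    then show "p + i < length P \<and> P ! (p + i) = a ! i"
      using l[unfolded loaded_def, rule_format, of i] by (simp add: nth_append)
  qed
  moreover have "loaded P (p + length a) b" unfolding loaded_def
  proof (intro allI impI)
    fix i assume "i < length b"
    then show "p + length a + i < length P \<and> P ! (p + length a + i) = b ! i"
      using l[unfolded loaded_def, rule_format, of "length a + i"] by (simp add: nth_append add.assoc)
  qed
  ultimately show "loaded P p a \<and> loaded P (p + length a) b" ..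
next
  assume l: "loaded P p a \<and> loaded P (p + length a) b"
  show "loaded P p (a @ b)" unfolding loaded_def
  proof (intro allI impI)
    fix i assume i: "i < length (a @ b)"
    show "p + i < length P \<and> P ! (p + i) = (a @ b) ! i"
    proof (cases "i < length a")
      case True
      then show ?thesis using l by (simp add: loaded_def nth_append)
    next
      case False
      then show ?thesis
        using conjunct2[OF l, unfolded loaded_def, rule_format, of "i - length a"] i by (simp add: nth_append)
    qed
  qed
qed

lemma loaded_Nil: "loaded P p []"
  by (simp add: loaded_def)

lemma loaded_Cons: "loaded P p (i # b) \<longleftrightarrow> p < length P \<and> P ! p = i \<and> loaded P (Suc p) b"
  using loaded_append[of P p "[i]" b] by (auto simp: loaded_def)

primrec simple :: "instr \<Rightarrow> bool" where
  "simple (NConst a v) = True"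
| "simple (NCopy a b) = True"
| "simple (NAdd a b c) = True"
| "simple (NSub a b c) = True"
| "simple (NJumpLe a b l) = False"
| "simple (FZero a) = True"
| "simple (FOne a) = True"
| "simple (FCopy a b) = True"
| "simple (FAdd a b c) = True"
| "simple (FSub a b c) = True"
| "simple (FMul a b c) = True"
| "simple (FInv a b) = True"
| "simple (FJumpEq a b l) = False"
| "simple (RZero a) = True"
| "simple (RCopy a b) = True"
| "simple (RAdd a b c) = True"
| "simple (RJumpLe a b l) = False"

lemma exec_simple: "simple i \<Longrightarrow> pc (exec F i s) = Suc (pc s)"
  by (cases i) (auto simp: exec_defs)

lemma reach_step: "loaded P (pc s) (i # b) \<Longrightarrow> reach F P s 1 (exec F i s)"
  by (auto simp: reach_def loaded_Cons step_def halted_def)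

lemma reach_simple:
  "loaded P (pc s) code \<Longrightarrow> list_all simple code \<Longrightarrow>
    reach F P s (length code) (exs F code s) \<and> pc (exs F code s) = pc s + length code"
proof (induction code arbitrary: s)
  case Nil
  then show ?case by (simp add: reach_refl)
next
  case (Cons i code)
  have "reach F P s 1 (exec F i s)" using Cons.prems reach_step by auto
  moreover have "pc (exec F i s) = Suc (pc s)" using Cons.prems exec_simple by auto
  ultimately show ?case using Cons.IH[of "exec F i s"] Cons.prems reach_trans[of F P s 1 "exec F i s"]
    by (auto simp: loaded_Cons)
qed

lemma simple_idx [simp]: "list_all simple (aidx b a k)" "list_all simple (iidx k)"
  by (auto simp: aidx_def iidx_def)

lemma simple_cN [simp]: "list_all simple (cN e k)"
  by (induction e arbitrary: k) auto

lemma simple_cF [simp]: "list_all simple (cF e k l)"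
  by (induction e arbitrary: k l) auto

lemma simple_cR [simp]: "list_all simple (cR e k l)"
  by (induction e arbitrary: k l) auto

lemma simple_cB [simp]: "list_all simple (cB b)"
  by (cases b) auto

lemma sim_pc [simp]: "sim h (s\<lparr>pc := p\<rparr>) = sim h s"
  by (simp add: sim_def)

lemma cell_upd2:
  assumes "a < 16" "100 \<le> b" "\<forall>k\<ge>100. m k = cell b inp arr k"
  shows "\<forall>k\<ge>100. (m(b + 16 * i + a := v)) k = cell b inp (upd2 arr a i v) k"
proof (intro allI impI)
  fix k :: nat assume k: "100 \<le> k"
  show "(m(b + 16 * i + a := v)) k = cell b inp (upd2 arr a i v) k"
  proof (cases "k < b")
    case True
    then show ?thesis using assms k by (simp add: cell_def)
  next
    case False
    define j where "j = k - b"
    have kj: "k = b + j" using False by (simp add: j_def)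
    have "j = 16 * i + a \<longleftrightarrow> j mod 16 = a \<and> j div 16 = i"
    proof
      assume "j = 16 * i + a"
      then show "j mod 16 = a \<and> j div 16 = i" using assms(1) by simp
    next
      assume "j mod 16 = a \<and> j div 16 = i"
      then show "j = 16 * i + a" using mult_div_mod_eq[of 16 j] by simp
    qed
    then show ?thesis using assms(3) k unfolding kj by (simp add: cell_def upd2_def)
  qed
qed

lemma sim_upd_na:
  assumes "sim h s" "a < 16" "100 \<le> bn h"
  shows "sim (h\<lparr>na := upd2 (na h) a i v\<rparr>) (s\<lparr>nmem := (nmem s)(bn h + 16 * i + a := v), pc := l\<rparr>)"
  using assms cell_upd2[OF assms(2,3), of "nmem s" "ni h" "na h" i v] unfolding sim_def by simp

lemma sim_upd_fa:
  assumes "sim h s" "a < 16" "100 \<le> bf h"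
  shows "sim (h\<lparr>fa := upd2 (fa h) a i v\<rparr>) (s\<lparr>fmem := (fmem s)(bf h + 16 * i + a := v), pc := l\<rparr>)"
  using assms cell_upd2[OF assms(2,3), of "fmem s" "fi h" "fa h" i v] unfolding sim_def by simp

lemma sim_upd_ra:
  assumes "sim h s" "a < 16" "100 \<le> br h"
  shows "sim (h\<lparr>ra := upd2 (ra h) a i v\<rparr>) (s\<lparr>rmem := (rmem s)(br h + 16 * i + a := v), pc := l\<rparr>)"
  using assms cell_upd2[OF assms(2,3), of "rmem s" "ri h" "ra h" i v] unfolding sim_def by simp

lemma clen_comp: "length (comp c p) = clen c"
  by (induction c arbitrary: p) (auto simp: aidx_def iidx_def)

lemma ex_bases [simp]: "bn (ex F c h) = bn h" "bf (ex F c h) = bf h" "br (ex F c h) = br h"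
proof -
  have "bn (ex F c h) = bn h \<and> bf (ex F c h) = bf h \<and> br (ex F c h) = br h"
  proof (induction c arbitrary: h)
    case (For x y c)
    have "bn (((\<lambda>g. let g' = ex F c g in g'\<lparr>nv := (nv g')(x := Suc (nv g' x))\<rparr>) ^^ n) g) = bn g \<and>
      bf (((\<lambda>g. let g' = ex F c g in g'\<lparr>nv := (nv g')(x := Suc (nv g' x))\<rparr>) ^^ n) g) = bf g \<and>
      br (((\<lambda>g. let g' = ex F c g in g'\<lparr>nv := (nv g')(x := Suc (nv g' x))\<rparr>) ^^ n) g) = br g" for n g
      by (induction n) (auto simp: For Let_def)
    then show ?case by simp
  qed (auto simp: Let_def)
  then show "bn (ex F c h) = bn h" "bf (ex F c h) = bf h" "br (ex F c h) = br h" by auto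
qed

lemma ex_nv: "z \<notin> wN c \<Longrightarrow> nv (ex F c h) z = nv h z"
proof (induction c arbitrary: h)
  case (For x y c)
  have "nv (((\<lambda>g. let g' = ex F c g in g'\<lparr>nv := (nv g')(x := Suc (nv g' x))\<rparr>) ^^ n) g) z = nv g z" for n g
    using For by (induction n) (auto simp: Let_def)
  then show ?case using For by simp
qed (auto simp: Let_def)

lemma okC_wN: "okC True c \<Longrightarrow> 40 \<notin> wN c \<and> 41 \<notin> wN c \<and> 42 \<notin> wN c"
  by (induction c) auto

lemma based_ex: "okC True c \<Longrightarrow> based h \<Longrightarrow> based (ex F c h)"
  using okC_wN[of c] by (auto simp: based_def ex_nv)

lemma scost_cong: "(\<And>y. y \<in> bvars c \<Longrightarrow> \<sigma> y = \<sigma>' y) \<Longrightarrow> scost c \<sigma> = scost c \<sigma>'"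
  by (induction c) auto

lemma sim_nv:
  "sim h s \<Longrightarrow> x < 43 \<Longrightarrow> nmem s' = (nmem s)(x := v) \<Longrightarrow> fmem s' = fmem s \<Longrightarrow> rmem s' = rmem s \<Longrightarrow>
    sim (h\<lparr>nv := (nv h)(x := v)\<rparr>) s'"
  by (auto simp: sim_def)

lemma straight_correct:
  assumes "loaded P (pc s) code" "list_all simple code" "sim h' (exs F code s)" "length code = n"
  shows "\<exists>t s'. t \<le> n \<and> reach F P s t s' \<and> pc s' = pc s + n \<and> sim h' s'"
  using reach_simple[OF assms(1,2), of F] assms(3,4) by blast

text \<open>A forward simulation with time, by induction on the command. As no loop bound is
  assigned anywhere in \<open>c\<close>, the cost of every part can be evaluated in the initial
  store \<open>h\<close>.\<close>

theorem comp_correct: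
  assumes "okC ar c" "loaded P (pc s) (comp c (pc s))" "sim h s" "ar \<Longrightarrow> based h" "inputs_first h"
    "bvars c \<inter> wN c = {}"
  shows "\<exists>t s'. t \<le> scost c (nv h) \<and> reach F P s t s' \<and> pc s' = pc s + clen c \<and> sim (ex F c h) s'"
  using assms
proof (induction c arbitrary: h s)
  case Skip
  then show ?case using reach_refl by fastforce
next
  case (SetN x e)
  let ?s1 = "exs F (cN e 43) s"
  have "chg 43 100 100 s ?s1 \<and> nmem ?s1 43 = evN e h"
    by (rule cN_correct[where ar = ar]) (use SetN.prems in auto)
  then have "sim h ?s1" "nmem ?s1 43 = evN e h" using chg_sim[of 43 100 100 s ?s1] SetN.prems by auto
  then have "sim (ex F (SetN x e) h) (exs F (comp (SetN x e) (pc s)) s)"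
    using SetN.prems by (auto simp: exec_defs intro!: sim_nv)
  moreover have "list_all simple (comp (SetN x e) (pc s))" by simp
  ultimately show ?case unfolding scost.simps
    by (intro straight_correct[OF SetN.prems(2)]) (simp_all only: clen_comp)
next
  case (SetNA a e1 e2)
  let ?s1 = "exs F (cN e1 43 @ aidx 40 a 43) s" let ?s2 = "exs F (cN e2 44) ?s1"
  have based: "based h" and a: "a < 16" using SetNA.prems by auto
  note A = aref_correct[where ar = ar and e = e1 and k = 43 and h = h and s = s and b = 40 and F = F and a = a]
  have 1: "nmem ?s1 43 = bn h + 16 * evN e1 h + a" "sim h ?s1"
    using A SetNA.prems based by (auto simp: based_def)
  have 2: "chg 44 100 100 ?s1 ?s2 \<and> nmem ?s2 44 = evN e2 h"
    by (rule cN_correct[where ar = ar]) (use SetNA.prems 1 in auto)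
  then have 3: "sim h ?s2" "nmem ?s2 43 = bn h + 16 * evN e1 h + a" "nmem ?s2 44 = evN e2 h"
    using chg_sim[of 44 100 100 ?s1 ?s2] 1 by (auto simp: chg_def)
  then have "sim (ex F (SetNA a e1 e2) h) (exs F (comp (SetNA a e1 e2) (pc s)) s)"
    using sim_upd_na[OF 3(1) a, of "evN e1 h" "evN e2 h"] SetNA.prems(5)
    by (simp add: exec_defs inputs_first_def)
  moreover have "list_all simple (comp (SetNA a e1 e2) (pc s))" by simp
  ultimately show ?case unfolding scost.simps
    by (intro straight_correct[OF SetNA.prems(2)]) (simp_all only: clen_comp)
next
  case (Out e1 e2)
  let ?s1 = "exs F (cN e1 43 @ iidx 43) s" let ?s2 = "exs F (cN e2 44) ?s1"
  note A = iref_correct[where ar = ar and e = e1 and k = 43 and h = h and s = s and F = F]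
  have 1: "nmem ?s1 43 = evN e1 h + 100" "sim h ?s1"
    using A Out.prems by auto
  have 2: "chg 44 100 100 ?s1 ?s2 \<and> nmem ?s2 44 = evN e2 h"
    by (rule cN_correct[where ar = ar]) (use Out.prems 1 in auto)
  then have 3: "sim h ?s2" "nmem ?s2 43 = evN e1 h + 100" "nmem ?s2 44 = evN e2 h"
    using chg_sim[of 44 100 100 ?s1 ?s2] 1 by (auto simp: chg_def)
  have "sim (ex F (Out e1 e2) h) (exs F (comp (Out e1 e2) (pc s)) s)"
  proof (cases "evN e1 h + 100 < bn h")
    case True
    then show ?thesis using 3 by (auto simp: exec_defs sim_def cell_def)
  next
    case False
    define j where "j = evN e1 h + 100 - bn h"
    have j: "evN e1 h + 100 = bn h + 16 * (j div 16) + j mod 16" using False by (simp add: j_def)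
    have "100 \<le> bn h" using Out.prems(5) by (simp add: inputs_first_def)
    from sim_upd_na[OF 3(1) _ this, of "j mod 16" "j div 16" "evN e2 h" "Suc (pc ?s2)"] show ?thesis
      using 3 False unfolding j[symmetric] by (simp add: exec_defs j_def[symmetric] Let_def)
  qed
  moreover have "list_all simple (comp (Out e1 e2) (pc s))" by simp
  ultimately show ?case unfolding scost.simps
    by (intro straight_correct[OF Out.prems(2)]) (simp_all only: clen_comp)
next
  case (SetF x e)
  let ?s1 = "exs F (cF e 43 8) s"
  have "chg 43 8 100 s ?s1 \<and> fmem ?s1 8 = evF F e h"
    by (rule cF_correct[where ar = ar]) (use SetF.prems in auto)
  then have "sim h ?s1" "fmem ?s1 8 = evF F e h" using chg_sim[of 43 8 100 s ?s1] SetF.prems by auto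
  then have "sim (ex F (SetF x e) h) (exs F (comp (SetF x e) (pc s)) s)"
    using SetF.prems by (auto simp: exec_defs sim_def)
  moreover have "list_all simple (comp (SetF x e) (pc s))" by simp
  ultimately show ?case unfolding scost.simps
    by (intro straight_correct[OF SetF.prems(2)]) (simp_all only: clen_comp)
next
  case (SetFA a e1 e2)
  let ?s1 = "exs F (cN e1 43 @ aidx 41 a 43) s" let ?s2 = "exs F (cF e2 44 8) ?s1"
  have based: "based h" and a: "a < 16" using SetFA.prems by auto
  note A = aref_correct[where ar = ar and e = e1 and k = 43 and h = h and s = s and b = 41 and F = F and a = a]
  have 1: "nmem ?s1 43 = bf h + 16 * evN e1 h + a" "sim h ?s1"
    using A SetFA.prems based by (auto simp: based_def)
  have 2: "chg 44 8 100 ?s1 ?s2 \<and> fmem ?s2 8 = evF F e2 h"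
    by (rule cF_correct[where ar = ar]) (use SetFA.prems 1 in auto)
  then have 3: "sim h ?s2" "nmem ?s2 43 = bf h + 16 * evN e1 h + a" "fmem ?s2 8 = evF F e2 h"
    using chg_sim[of 44 8 100 ?s1 ?s2] 1 by (auto simp: chg_def)
  then have "sim (ex F (SetFA a e1 e2) h) (exs F (comp (SetFA a e1 e2) (pc s)) s)"
    using sim_upd_fa[OF 3(1) a, of "evN e1 h" "evF F e2 h"] SetFA.prems(5)
    by (simp add: exec_defs inputs_first_def)
  moreover have "list_all simple (comp (SetFA a e1 e2) (pc s))" by simp
  ultimately show ?case unfolding scost.simps
    by (intro straight_correct[OF SetFA.prems(2)]) (simp_all only: clen_comp)
next
  case (SetRA a e1 e2)
  let ?s1 = "exs F (cN e1 43 @ aidx 42 a 43) s" let ?s2 = "exs F (cR e2 44 0) ?s1"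
  have based: "based h" and a: "a < 16" using SetRA.prems by auto
  note A = aref_correct[where ar = ar and e = e1 and k = 43 and h = h and s = s and b = 42 and F = F and a = a]
  have 1: "nmem ?s1 43 = br h + 16 * evN e1 h + a" "sim h ?s1"
    using A SetRA.prems based by (auto simp: based_def)
  have 2: "chg 44 100 0 ?s1 ?s2 \<and> rmem ?s2 0 = evR e2 h"
    by (rule cR_correct[where ar = ar]) (use SetRA.prems 1 in auto)
  then have 3: "sim h ?s2" "nmem ?s2 43 = br h + 16 * evN e1 h + a" "rmem ?s2 0 = evR e2 h"
    using chg_sim[of 44 100 0 ?s1 ?s2] 1 by (auto simp: chg_def)
  then have "sim (ex F (SetRA a e1 e2) h) (exs F (comp (SetRA a e1 e2) (pc s)) s)"
    using sim_upd_ra[OF 3(1) a, of "evN e1 h" "evR e2 h"] SetRA.prems(5)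
    by (simp add: exec_defs inputs_first_def)
  moreover have "list_all simple (comp (SetRA a e1 e2) (pc s))" by simp
  ultimately show ?case unfolding scost.simps
    by (intro straight_correct[OF SetRA.prems(2)]) (simp_all only: clen_comp)
next
  case (Seq c1 c2)
  have l: "loaded P (pc s) (comp c1 (pc s))" "loaded P (pc s + clen c1) (comp c2 (pc s + clen c1))"
    using Seq.prems(2) by (auto simp: loaded_append clen_comp)
  obtain t1 s1 where 1: "t1 \<le> scost c1 (nv h)" "reach F P s t1 s1" "pc s1 = pc s + clen c1" "sim (ex F c1 h) s1"
    using Seq.IH(1)[of s h] l Seq.prems by auto
  have b: "ar \<Longrightarrow> based (ex F c1 h)" using Seq.prems based_ex[of c1 h F] by auto
  have c: "scost c2 (nv (ex F c1 h)) = scost c2 (nv h)"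
    using Seq.prems by (intro scost_cong ex_nv) auto
  obtain t2 s2 where 2: "t2 \<le> scost c2 (nv h)" "reach F P s1 t2 s2" "pc s2 = pc s1 + clen c2"
      "sim (ex F c2 (ex F c1 h)) s2"
    using Seq.IH(2)[of s1 "ex F c1 h"] l Seq.prems 1 b c by (auto simp: inputs_first_def)
  show ?case using reach_trans[OF 1(2) 2(2)] 1 2
    by (intro exI[of _ "t1 + t2"] exI[of _ s2]) auto
next
  case (Cond b c1 c2)
  let ?l = "length (cB b)" let ?p = "pc s" let ?s1 = "exs F (cB b) s"
  let ?L1 = "?p + ?l + clen c2 + 2"
  have l: "loaded P ?p (cB b)" "loaded P (?p + ?l) [jB b ?L1]" "loaded P (?p + ?l + 1) (comp c2 (?p + ?l + 1))"
    "loaded P (?p + ?l + 1 + clen c2) [goto (?p + clen (Cond b c1 c2))]" "loaded P ?L1 (comp c1 ?L1)"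
    using Cond.prems(2) by (simp_all add: loaded_append loaded_Cons loaded_Nil clen_comp algebra_simps)
  have r1: "reach F P s ?l ?s1" "pc ?s1 = ?p + ?l" using reach_simple[OF l(1)] by auto
  have s1: "sim h ?s1" "exec F (jB b ?L1) ?s1 = jump_if (evB F b h) ?L1 ?s1"
    by (rule cB_correct[where ar = ar]; use Cond.prems in simp)+
  have r2: "reach F P ?s1 1 (jump_if (evB F b h) ?L1 ?s1)"
    using reach_step[of P ?s1 "jB b ?L1" "[]" F] l(2) r1(2) s1(2) by simp
  let ?s2 = "jump_if (evB F b h) ?L1 ?s1"
  have sim2: "sim h ?s2" using s1 by (simp add: jump_if_def)
  note r12 = reach_trans[OF r1(1) r2]
  show ?case
  proof (cases "evB F b h")
    case True
    then have pc2: "pc ?s2 = ?L1" by (simp add: jump_if_def)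
    obtain t s' where "t \<le> scost c1 (nv h)" "reach F P ?s2 t s'" "pc s' = ?L1 + clen c1" "sim (ex F c1 h) s'"
      using Cond.IH(1)[of ?s2 h] l(5) Cond.prems sim2 unfolding pc2 by auto
    then show ?thesis using reach_trans[OF r12] True
      by (intro exI[of _ "?l + 1 + t"] exI[of _ s']) auto
  next
    case False
    then have pc2: "pc ?s2 = ?p + ?l + 1" using r1 by (simp add: jump_if_def)
    obtain t s' where t: "t \<le> scost c2 (nv h)" "reach F P ?s2 t s'" "pc s' = ?p + ?l + 1 + clen c2" "sim (ex F c2 h) s'"
      using Cond.IH(2)[of ?s2 h] l(3) Cond.prems sim2 unfolding pc2 by auto
    let ?s3 = "s'\<lparr>pc := ?p + clen (Cond b c1 c2)\<rparr>"
    have "reach F P s' 1 ?s3"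
      using reach_step[of P s' "goto (?p + clen (Cond b c1 c2))" "[]" F] l(4) t(3) by (simp add: jump_if_def)
    from reach_trans[OF reach_trans[OF r12 t(2)] this] show ?thesis using False t
      by (intro exI[of _ "?l + 1 + t + 1"] exI[of _ ?s3]) auto
  qed
next
  case (For x y c)
  let ?p = "pc s"
  let ?B = "\<lambda>g. let g' = ex F c g in g'\<lparr>nv := (nv g')(x := Suc (nv g' x))\<rparr>"
  let ?ini = "h\<lparr>nv := (nv h)(x := 0)\<rparr>"
  define H where "H i = (?B ^^ i) ?ini" for i
  have H: "H 0 = ?ini" "H (Suc i) = (ex F c (H i))\<lparr>nv := (nv (ex F c (H i)))(x := Suc (nv (ex F c (H i)) x))\<rparr>" for i
    by (auto simp: H_def Let_def)
  have exH: "ex F (For x y c) h = H (nv h y)" by (simp add: H_def)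
  have xy: "x < 40" "y < 43" "x \<noteq> y" "x \<notin> wN c" "y \<notin> wN c" "okC ar c" using For.prems by auto
  have l: "loaded P ?p [NConst (Dir x) 0]" "loaded P (?p + 1) [NJumpLe (Dir y) (Dir x) (?p + clen c + 5)]"
    "loaded P (?p + 2) (comp c (?p + 2))"
    "loaded P (?p + 2 + clen c) [NConst (Dir 43) 1, NAdd (Dir x) (Dir x) (Dir 43), goto (?p + 1)]"
    using For.prems(2) by (simp_all add: loaded_append loaded_Cons loaded_Nil clen_comp algebra_simps)
  have inv: "nv (H i) x = i \<and> (\<forall>z. z \<notin> wN (For x y c) \<longrightarrow> nv (H i) z = nv h z) \<and>
      inputs_first (H i) \<and> (ar \<longrightarrow> based (H i))" for i
  proof (induction i)
    case 0
    then show ?case using For.prems xy by (auto simp: H inputs_first_def based_def)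
  next
    case (Suc i)
    then have "ar \<longrightarrow> based (ex F c (H i))" using based_ex[of c "H i" F] xy by auto
    then show ?case using Suc xy by (auto simp: H ex_nv inputs_first_def based_def)
  qed
  have sc: "scost c (nv (H i)) = scost c (nv h)" for i
    using inv[of i] For.prems(6) by (intro scost_cong) auto
  \<comment> \<open>The state at the loop test after \<open>i\<close> rounds; the leading 1 is the
    initialization of the counter.\<close>
  have "\<exists>t s'. t \<le> 1 + i * (scost c (nv h) + 4) \<and> reach F P s t s' \<and> pc s' = ?p + 1 \<and> sim (H i) s'"
    if "i \<le> nv h y" for i
    using that
  proof (induction i)
    case 0
    have "reach F P s 1 (exec F (NConst (Dir x) 0) s)" using reach_step[OF l(1)] .
    moreover have "sim ?ini (exec F (NConst (Dir x) 0) s)"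
      unfolding exec.simps setN_def by (rule sim_nv[of h s]) (use For.prems xy in auto)
    ultimately show ?case
      by (intro exI[of _ 1] exI[of _ "exec F (NConst (Dir x) 0) s"]) (auto simp: exec_defs H)
  next
    case (Suc i)
    then obtain t s1 where 1: "t \<le> 1 + i * (scost c (nv h) + 4)" "reach F P s t s1" "pc s1 = ?p + 1"
      "sim (H i) s1" by auto
    have "nmem s1 x = i" "nmem s1 y = nv h y" using 1(4) inv[of i] xy by (auto simp: sim_def)
    then have e: "exec F (NJumpLe (Dir y) (Dir x) (?p + clen c + 5)) s1 = s1\<lparr>pc := ?p + 2\<rparr>"
      using Suc.prems 1(3) by (simp add: jump_if_def)
    have r1: "reach F P s1 1 (s1\<lparr>pc := ?p + 2\<rparr>)"
    proof -
      have "loaded P (pc s1) [NJumpLe (Dir y) (Dir x) (?p + clen c + 5)]" using l(2) 1(3) by simp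
      from reach_step[OF this, of F] show ?thesis unfolding e .
    qed
    have a: "loaded P (pc (s1\<lparr>pc := ?p + 2\<rparr>)) (comp c (pc (s1\<lparr>pc := ?p + 2\<rparr>)))" using l(3) by simp
    have b: "sim (H i) (s1\<lparr>pc := ?p + 2\<rparr>)" using 1(4) by simp
    have c: "ar \<Longrightarrow> based (H i)" "inputs_first (H i)" using inv[of i] by auto
    have d: "bvars c \<inter> wN c = {}" using For.prems(6) by auto
    from For.IH[OF xy(6) a b c d] obtain t2 s2 where "t2 \<le> scost c (nv (H i))"
      "reach F P (s1\<lparr>pc := ?p + 2\<rparr>) t2 s2" "pc s2 = pc (s1\<lparr>pc := ?p + 2\<rparr>) + clen c"
      "sim (ex F c (H i)) s2" by blast
    then have 2: "t2 \<le> scost c (nv h)" "reach F P (s1\<lparr>pc := ?p + 2\<rparr>) t2 s2"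
      "pc s2 = ?p + 2 + clen c" "sim (ex F c (H i)) s2" unfolding sc by simp_all
    define s3 where "s3 = exec F (NConst (Dir 43) 1) s2"
    define s4 where "s4 = exec F (NAdd (Dir x) (Dir x) (Dir 43)) s3"
    define s5 where "s5 = exec F (goto (?p + 1)) s4"
    have pcs: "pc s3 = Suc (pc s2)" "pc s4 = Suc (Suc (pc s2))" "pc s5 = ?p + 1"
      by (simp_all add: s3_def s4_def s5_def exec_defs)
    have l4: "loaded P (pc s2) [NConst (Dir 43) 1, NAdd (Dir x) (Dir x) (Dir 43), goto (?p + 1)]"
      using l(4) unfolding 2(3) .
    then have l5: "loaded P (pc s3) [NAdd (Dir x) (Dir x) (Dir 43), goto (?p + 1)]"
      "loaded P (pc s4) [goto (?p + 1)]" unfolding pcs by (simp_all only: loaded_Cons)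
    have r3: "reach F P s2 1 s3" unfolding s3_def by (rule reach_step[OF l4])
    have r4: "reach F P s3 1 s4" unfolding s4_def by (rule reach_step[OF l5(1)])
    have r5: "reach F P s4 1 s5" unfolding s5_def by (rule reach_step[OF l5(2)])
    have "nmem s5 = (nmem s2)(43 := 1, x := nmem s2 x + 1)" "fmem s5 = fmem s2" "rmem s5 = rmem s2"
      using xy by (simp_all add: s3_def s4_def s5_def exec_defs)
    moreover have "nmem s2 x = nv (ex F c (H i)) x" using 2(4) xy by (simp add: sim_def)
    ultimately have "sim (H (Suc i)) s5"
      using 2(4) xy unfolding sim_def H(2) by simp
    moreover have "reach F P s (t + (1 + (t2 + (1 + (1 + 1))))) s5"
      by (rule reach_trans[OF 1(2) reach_trans[OF r1 reach_trans[OF 2(2) reach_trans[OF r3 reach_trans[OF r4 r5]]]]])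
    moreover have "t + (1 + (t2 + (1 + (1 + 1)))) \<le> 1 + Suc i * (scost c (nv h) + 4)"
      using 1(1) 2(1) by simp
    ultimately show ?case using pcs(3) by blast
  qed
  from this[of "nv h y"] obtain t s1 where 1: "t \<le> 1 + nv h y * (scost c (nv h) + 4)" "reach F P s t s1"
    "pc s1 = ?p + 1" "sim (H (nv h y)) s1" by auto
  have "nmem s1 x = nv h y" "nmem s1 y = nv h y" using 1(4) inv[of "nv h y"] xy by (auto simp: sim_def)
  then have e: "exec F (NJumpLe (Dir y) (Dir x) (?p + clen c + 5)) s1 = s1\<lparr>pc := ?p + clen c + 5\<rparr>"
    by (simp add: jump_if_def)
  have "reach F P s1 1 (s1\<lparr>pc := ?p + clen c + 5\<rparr>)"
  proof -
    have "loaded P (pc s1) [NJumpLe (Dir y) (Dir x) (?p + clen c + 5)]" using l(2) 1(3) by simp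
    from reach_step[OF this, of F] show ?thesis unfolding e .
  qed
  from reach_trans[OF 1(2) this] show ?case using 1 unfolding exH
    by (intro exI[of _ "t + 1"] exI[of _ "s1\<lparr>pc := ?p + clen c + 5\<rparr>"]) auto
qed

section \<open>Reasoning about programs\<close>

declare ex.simps(10) [simp del]

text \<open>\<open>Out\<close> counts as writing every array of numbers, because its address may
  pass the end of the input region.\<close>

primrec wNA :: "com \<Rightarrow> nat set" where
  "wNA Skip = {}"
| "wNA (SetN x e) = {}"
| "wNA (SetNA a e1 e2) = {a}"
| "wNA (Out e1 e2) = UNIV"
| "wNA (SetF x e) = {}"
| "wNA (SetFA a e1 e2) = {}"
| "wNA (SetRA a e1 e2) = {}"
| "wNA (c1 ;; c2) = wNA c1 \<union> wNA c2"
| "wNA (Cond b c1 c2) = wNA c1 \<union> wNA c2"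
| "wNA (For x y c) = wNA c"

primrec wF :: "com \<Rightarrow> nat set" where
  "wF Skip = {}"
| "wF (SetN x e) = {}"
| "wF (SetNA a e1 e2) = {}"
| "wF (Out e1 e2) = {}"
| "wF (SetF x e) = {x}"
| "wF (SetFA a e1 e2) = {}"
| "wF (SetRA a e1 e2) = {}"
| "wF (c1 ;; c2) = wF c1 \<union> wF c2"
| "wF (Cond b c1 c2) = wF c1 \<union> wF c2"
| "wF (For x y c) = wF c"

primrec wFA :: "com \<Rightarrow> nat set" where
  "wFA Skip = {}"
| "wFA (SetN x e) = {}"
| "wFA (SetNA a e1 e2) = {}"
| "wFA (Out e1 e2) = {}"
| "wFA (SetF x e) = {}"
| "wFA (SetFA a e1 e2) = {a}"
| "wFA (SetRA a e1 e2) = {}"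
| "wFA (c1 ;; c2) = wFA c1 \<union> wFA c2"
| "wFA (Cond b c1 c2) = wFA c1 \<union> wFA c2"
| "wFA (For x y c) = wFA c"

primrec wRA :: "com \<Rightarrow> nat set" where
  "wRA Skip = {}"
| "wRA (SetN x e) = {}"
| "wRA (SetNA a e1 e2) = {}"
| "wRA (Out e1 e2) = {}"
| "wRA (SetF x e) = {}"
| "wRA (SetFA a e1 e2) = {}"
| "wRA (SetRA a e1 e2) = {a}"
| "wRA (c1 ;; c2) = wRA c1 \<union> wRA c2"
| "wRA (Cond b c1 c2) = wRA c1 \<union> wRA c2"
| "wRA (For x y c) = wRA c"

primrec no_out :: "com \<Rightarrow> bool" where
  "no_out Skip = True"
| "no_out (SetN x e) = True"
| "no_out (SetNA a e1 e2) = True"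
| "no_out (Out e1 e2) = False"
| "no_out (SetF x e) = True"
| "no_out (SetFA a e1 e2) = True"
| "no_out (SetRA a e1 e2) = True"
| "no_out (c1 ;; c2) = (no_out c1 \<and> no_out c2)"
| "no_out (Cond b c1 c2) = (no_out c1 \<and> no_out c2)"
| "no_out (For x y c) = no_out c"

text \<open>A frame condition that depends on the syntax of \<open>c\<close> alone; it therefore
  also relates the intermediate states of a loop to the start of the loop.\<close>

definition same :: "com \<Rightarrow> 'f store \<Rightarrow> 'f store \<Rightarrow> bool" where
  "same c h g \<longleftrightarrow> (\<forall>z. z \<notin> wN c \<longrightarrow> nv g z = nv h z) \<and> (\<forall>a. a \<notin> wNA c \<longrightarrow> na g a = na h a) \<and>
     (\<forall>z. z \<notin> wF c \<longrightarrow> fv g z = fv h z) \<and> (\<forall>a. a \<notin> wFA c \<longrightarrow> fa g a = fa h a) \<and>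
     (\<forall>a. a \<notin> wRA c \<longrightarrow> ra g a = ra h a) \<and> (no_out c \<longrightarrow> ni g = ni h) \<and>
     fi g = fi h \<and> ri g = ri h \<and> bn g = bn h \<and> bf g = bf h \<and> br g = br h"

lemma same_refl [simp]: "same c h h"
  by (simp add: same_def)

lemma same_trans: "same c h g \<Longrightarrow> same c g k \<Longrightarrow> same c h k"
  by (simp add: same_def)

lemma same_mono:
  "same c h g \<Longrightarrow> wN c \<subseteq> wN d \<Longrightarrow> wNA c \<subseteq> wNA d \<Longrightarrow> wF c \<subseteq> wF d \<Longrightarrow> wFA c \<subseteq> wFA d \<Longrightarrow>
    wRA c \<subseteq> wRA d \<Longrightarrow> (no_out d \<Longrightarrow> no_out c) \<Longrightarrow> same d h g"
  unfolding same_def by blast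

lemma funpow_same:
  assumes "\<And>g. same c g (B g)"
  shows "same c g ((B ^^ n) g)"
proof (induction n)
  case (Suc n)
  then show ?case using same_trans assms by fastforce
qed simp

lemma same_ex: "same c h (ex F c h)"
proof (induction c arbitrary: h)
  case (Seq c1 c2)
  have "same (c1 ;; c2) h (ex F c1 h)" by (rule same_mono[OF Seq(1)]) auto
  moreover have "same (c1 ;; c2) (ex F c1 h) (ex F c2 (ex F c1 h))" by (rule same_mono[OF Seq(2)]) auto
  ultimately show ?case using same_trans by fastforce
next
  case (Cond b c1 c2)
  have "same (Cond b c1 c2) h (ex F c1 h)" by (rule same_mono[OF Cond(1)]) auto
  moreover have "same (Cond b c1 c2) h (ex F c2 h)" by (rule same_mono[OF Cond(2)]) auto
  ultimately show ?case by simp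
next
  case (For x y c)
  have 1: "same (For x y c) g (g\<lparr>nv := (nv g)(x := v)\<rparr>)" for g v by (simp add: same_def)
  have "same (For x y c) g (ex F c g)" for g by (rule same_mono[OF For]) auto
  then have "same (For x y c) g ((ex F c g)\<lparr>nv := (nv (ex F c g))(x := v)\<rparr>)" for g v
    using 1 same_trans by blast
  then have "same (For x y c) (h\<lparr>nv := (nv h)(x := 0)\<rparr>) (ex F (For x y c) h)"
    unfolding ex.simps(10) by (intro funpow_same) (simp add: Let_def)
  then show ?case using 1 same_trans by blast
qed (auto simp: same_def Let_def upd2_def)

lemma sameD:
  assumes "same c h g"
  shows "z \<notin> wN c \<Longrightarrow> nv g z = nv h z" "z \<notin> wNA c \<Longrightarrow> na g z = na h z" "z \<notin> wF c \<Longrightarrow> fv g z = fv h z"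
    "z \<notin> wFA c \<Longrightarrow> fa g z = fa h z" "z \<notin> wRA c \<Longrightarrow> ra g z = ra h z" "no_out c \<Longrightarrow> ni g = ni h"
    "fi g = fi h" "ri g = ri h" "bn g = bn h" "bf g = bf h" "br g = br h"
  using assms by (auto simp: same_def)

text \<open>The body may assume the value of the counter and the frame relative to the start of the
  loop, so an invariant only has to speak about what the loop changes.\<close>

lemma For_rule:
  assumes x: "x \<notin> wN c"
    and init: "I 0 (h\<lparr>nv := (nv h)(x := 0)\<rparr>)"
    and body: "\<And>i g. i < nv h y \<Longrightarrow> nv g x = i \<Longrightarrow> same (For x y c) h g \<Longrightarrow> I i g \<Longrightarrow>
      I (Suc i) ((ex F c g)\<lparr>nv := (nv (ex F c g))(x := Suc i)\<rparr>)"
  shows "I (nv h y) (ex F (For x y c) h)"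
proof -
  let ?B = "\<lambda>g. let g' = ex F c g in g'\<lparr>nv := (nv g')(x := Suc (nv g' x))\<rparr>"
  define H where "H i = (?B ^^ i) (h\<lparr>nv := (nv h)(x := 0)\<rparr>)" for i
  have H: "H 0 = h\<lparr>nv := (nv h)(x := 0)\<rparr>"
    "H (Suc i) = (ex F c (H i))\<lparr>nv := (nv (ex F c (H i)))(x := Suc (nv (ex F c (H i)) x))\<rparr>" for i
    by (auto simp: H_def Let_def)
  have 1: "same (For x y c) g (g\<lparr>nv := (nv g)(x := v)\<rparr>)" for g v by (simp add: same_def)
  have 2: "same (For x y c) g (ex F c g)" for g by (rule same_mono[OF same_ex]) auto
  have "i \<le> nv h y \<Longrightarrow> nv (H i) x = i \<and> same (For x y c) h (H i) \<and> I i (H i)" for i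
  proof (induction i)
    case 0
    then show ?case using init 1 by (simp add: H)
  next
    case (Suc i)
    then have *: "nv (H i) x = i" "same (For x y c) h (H i)" "I i (H i)" by auto
    have 3: "nv (ex F c (H i)) x = i" using *(1) x by (simp add: ex_nv)
    have "same (For x y c) h (H (Suc i))"
      unfolding H(2) by (rule same_trans[OF same_trans[OF *(2) 2] 1])
    moreover have "I (Suc i) (H (Suc i))" using body[of i "H i"] * Suc.prems 3 by (simp add: H(2))
    ultimately show ?case by (simp add: H(2) 3)
  qed
  then show ?thesis by (simp add: H_def ex.simps(10))
qed

text \<open>The type of field elements may be larger than the carrier, so membership of all cells
  has to be known before a law of the field can be applied.\<close>

definition fclosed :: "('f, 'b) ring_scheme \<Rightarrow> 'f store \<Rightarrow> bool" where
  "fclosed F h \<longleftrightarrow> (\<forall>x. fv h x \<in> carrier F) \<and> (\<forall>a k. fa h a k \<in> carrier F) \<and> (\<forall>k. fi h k \<in> carrier F)"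

lemma fclosed_nv [simp]: "fclosed F (h\<lparr>nv := f\<rparr>) = fclosed F h"
  by (simp add: fclosed_def)

lemma (in field) evF_closed: "fclosed R h \<Longrightarrow> evF R e h \<in> carrier R"
  by (induction e) (auto simp: fclosed_def cell_def field_Units)

lemma (in field) ex_closed: "fclosed R h \<Longrightarrow> fclosed R (ex R c h)"
proof (induction c arbitrary: h)
  case (SetF x e)
  then show ?case using evF_closed[OF SetF] by (auto simp: fclosed_def)
next
  case (SetFA a e1 e2)
  then show ?case using evF_closed[OF SetFA] by (auto simp: fclosed_def upd2_def)
next
  case (For x y c)
  let ?B = "\<lambda>g. let g' = ex R c g in g'\<lparr>nv := (nv g')(x := Suc (nv g' x))\<rparr>"
  have "fclosed R ((?B ^^ n) g)" if "fclosed R g" for n g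
  proof (induction n)
    case (Suc n)
    have "fclosed R (ex R c ((?B ^^ n) g))" by (rule For.IH[OF Suc])
    then show ?case unfolding funpow.simps comp_apply Let_def fclosed_nv .
  qed (use that in simp)
  then show ?case using For.prems by (simp add: ex.simps(10))
qed (auto simp: fclosed_def Let_def)

lemma (in field) For_rule_closed:
  assumes "fclosed R h" "x \<notin> wN c" "I 0 (h\<lparr>nv := (nv h)(x := 0)\<rparr>)"
    and "\<And>i g. i < nv h y \<Longrightarrow> nv g x = i \<Longrightarrow> same (For x y c) h g \<Longrightarrow> fclosed R g \<Longrightarrow> I i g \<Longrightarrow>
      I (Suc i) ((ex R c g)\<lparr>nv := (nv (ex R c g))(x := Suc i)\<rparr>)"
  shows "I (nv h y) (ex R (For x y c) h)"
proof -
  have "(\<lambda>i g. fclosed R g \<and> I i g) (nv h y) (ex R (For x y c) h)"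
    by (rule For_rule) (use assms ex_closed in auto)
  then show ?thesis by blast
qed

text \<open>The time is proportional to the value of \<open>z\<close>, and \<open>z\<close> must be
  a variable that the surrounding piece does not assign; these two restrictions decide the order of
  the factors. Variable 39 is the common counter.\<close>

definition mulc :: "nat \<Rightarrow> nat \<Rightarrow> nat \<Rightarrow> com" where
  "mulc x a z = SetN x (NC 0) ;; For 39 z (SetN x (NPlus (NV x) (NV a)))"

lemma ex_mulc:
  assumes "distinct [x, a, 39]" "z \<noteq> x" "z \<noteq> 39"
  shows "ex F (mulc x a z) h = h\<lparr>nv := (nv h)(x := nv h a * nv h z, 39 := nv h z)\<rparr>"
proof -
  let ?h = "h\<lparr>nv := (nv h)(x := 0)\<rparr>"
  have "(\<lambda>i g. g = h\<lparr>nv := (nv h)(x := nv h a * i, 39 := i)\<rparr>) (nv ?h z)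
     (ex F (For 39 z (SetN x (NPlus (NV x) (NV a)))) ?h)"
    by (rule For_rule) (use assms in \<open>auto intro!: store.equality ext simp: algebra_simps\<close>)
  then show ?thesis using assms by (simp add: mulc_def)
qed

definition copyF :: "nat \<Rightarrow> nat \<Rightarrow> nat \<Rightarrow> nexp \<Rightarrow> nat \<Rightarrow> nexp \<Rightarrow> com" where
  "copyF x y a ea b eb = For x y (SetFA a (NPlus ea (NV x)) (FA b (NPlus eb (NV x))))"

definition copyN :: "nat \<Rightarrow> nat \<Rightarrow> nat \<Rightarrow> nexp \<Rightarrow> nat \<Rightarrow> nexp \<Rightarrow> com" where
  "copyN x y a ea b eb = For x y (SetNA a (NPlus ea (NV x)) (NA b (NPlus eb (NV x))))"

text \<open>Start addresses of a copy loop that do not change with its counter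
  \<open>x\<close>.\<close>

definition base :: "nat \<Rightarrow> nexp \<Rightarrow> bool" where
  "base x e \<longleftrightarrow> (\<exists>c. e = NC c) \<or> (\<exists>z. e = NV z \<and> z \<noteq> x)"

lemma base_simps [simp]: "base x (NC c)" "base x (NV z) = (z \<noteq> x)"
  by (auto simp: base_def)

lemma evN_base:
  "base x e \<Longrightarrow> evN e (h\<lparr>nv := (nv h)(x := v), fa := A\<rparr>) = evN e h"
  "base x e \<Longrightarrow> evN e (h\<lparr>nv := (nv h)(x := v), na := B\<rparr>) = evN e h"
  "base x e \<Longrightarrow> evN e (h\<lparr>na := B, nv := (nv h)(x := v)\<rparr>) = evN e h"
  by (auto simp: base_def)

lemma ex_copyF:
  assumes "a \<noteq> b" "base x ea" "base x eb" "x \<noteq> y"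
  shows "ex F (copyF x y a ea b eb) h = h\<lparr>nv := (nv h)(x := nv h y),
    fa := (fa h)(a := \<lambda>k. if evN ea h \<le> k \<and> k < evN ea h + nv h y then fa h b (evN eb h + (k - evN ea h))
      else fa h a k)\<rparr>"
proof -
  have "(\<lambda>i g. g = h\<lparr>nv := (nv h)(x := i),
    fa := (fa h)(a := \<lambda>k. if evN ea h \<le> k \<and> k < evN ea h + i then fa h b (evN eb h + (k - evN ea h))
      else fa h a k)\<rparr>) (nv h y) (ex F (copyF x y a ea b eb) h)"
    unfolding copyF_def
  proof (rule For_rule)
    show "h\<lparr>nv := (nv h)(x := 0)\<rparr> = h\<lparr>nv := (nv h)(x := 0), fa := (fa h)(a := \<lambda>k.
      if evN ea h \<le> k \<and> k < evN ea h + 0 then fa h b (evN eb h + (k - evN ea h)) else fa h a k)\<rparr>"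
      by (auto intro!: store.equality ext)
  next
    fix i g assume "g = h\<lparr>nv := (nv h)(x := i), fa := (fa h)(a := \<lambda>k.
      if evN ea h \<le> k \<and> k < evN ea h + i then fa h b (evN eb h + (k - evN ea h)) else fa h a k)\<rparr>"
    then show "(ex F (SetFA a (NPlus ea (NV x)) (FA b (NPlus eb (NV x)))) g)\<lparr>nv :=
        (nv (ex F (SetFA a (NPlus ea (NV x)) (FA b (NPlus eb (NV x)))) g))(x := Suc i)\<rparr> =
      h\<lparr>nv := (nv h)(x := Suc i), fa := (fa h)(a := \<lambda>k.
      if evN ea h \<le> k \<and> k < evN ea h + Suc i then fa h b (evN eb h + (k - evN ea h)) else fa h a k)\<rparr>"
      using assms by (auto intro!: store.equality ext simp: evN_base upd2_def)
  qed simp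
  then show ?thesis .
qed

lemma ex_copyN:
  assumes "a \<noteq> b" "base x ea" "base x eb" "x \<noteq> y"
  shows "ex F (copyN x y a ea b eb) h = h\<lparr>nv := (nv h)(x := nv h y),
    na := (na h)(a := \<lambda>k. if evN ea h \<le> k \<and> k < evN ea h + nv h y then na h b (evN eb h + (k - evN ea h))
      else na h a k)\<rparr>"
proof -
  have "(\<lambda>i g. g = h\<lparr>nv := (nv h)(x := i),
    na := (na h)(a := \<lambda>k. if evN ea h \<le> k \<and> k < evN ea h + i then na h b (evN eb h + (k - evN ea h))
      else na h a k)\<rparr>) (nv h y) (ex F (copyN x y a ea b eb) h)"
    unfolding copyN_def
  proof (rule For_rule)
    show "h\<lparr>nv := (nv h)(x := 0)\<rparr> = h\<lparr>nv := (nv h)(x := 0), na := (na h)(a := \<lambda>k.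
      if evN ea h \<le> k \<and> k < evN ea h + 0 then na h b (evN eb h + (k - evN ea h)) else na h a k)\<rparr>"
      by (auto intro!: store.equality ext)
  next
    fix i g assume "g = h\<lparr>nv := (nv h)(x := i), na := (na h)(a := \<lambda>k.
      if evN ea h \<le> k \<and> k < evN ea h + i then na h b (evN eb h + (k - evN ea h)) else na h a k)\<rparr>"
    then show "(ex F (SetNA a (NPlus ea (NV x)) (NA b (NPlus eb (NV x)))) g)\<lparr>nv :=
        (nv (ex F (SetNA a (NPlus ea (NV x)) (NA b (NPlus eb (NV x)))) g))(x := Suc i)\<rparr> =
      h\<lparr>nv := (nv h)(x := Suc i), na := (na h)(a := \<lambda>k.
      if evN ea h \<le> k \<and> k < evN ea h + Suc i then na h b (evN eb h + (k - evN ea h)) else na h a k)\<rparr>"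
      using assms by (auto intro!: store.equality ext simp: evN_base upd2_def)
  qed simp
  then show ?thesis .
qed

section \<open>The program\<close>

text \<open>With \<open>L = 2\<^sup>N E\<close>, the number variables 1 to 11 hold \<open>m\<close>, \<open>n\<close>, \<open>\<alpha>\<close>, the number \<open>h\<close> of
  members, the sum \<open>D\<close> of the ranks, the largest size of a member, \<open>N\<close>, \<open>E\<close>, \<open>L\<close>, \<open>L h\<close> and \<open>2\<^sup>N\<close>.
  The arrays of numbers hold: 0 the powers of 2, 1 the partial sums of the ranks, 2 their multiples
  by \<open>n\<close>, 3 the positions of the members in the input, 4 and 5 the selections of the \<open>L\<close> slots and of
  the \<open>L h\<close> candidates. The field arrays hold: 0 the current product, 1 the next one, 2 the
  coefficients of \<open>f\<close>, 3 the vectors of the slots, 4 and 5 the vectors of the candidates before and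
  during the elimination, 6 the normalized pivot row. The real arrays 0 and 1 hold the weights of the
  slots and of the candidates. The coefficient of \<open>x\<^sup>e\<close> at the basis element \<open>T\<close> has index \<open>enc T * E + e\<close>.\<close>

subsection \<open>Multiplication by a vector\<close>

text \<open>The first entry is the most significant bit, in accordance with lists that are read from
  the top generator down.\<close>

fun enc :: "bool list \<Rightarrow> nat" where
  "enc [] = 0"
| "enc (b # bs) = (if b then 2 ^ length bs else 0) + enc bs"

primrec dec :: "nat \<Rightarrow> nat \<Rightarrow> bool list" where
  "dec 0 T = []"
| "dec (Suc N) T = (2 ^ N \<le> T) # dec N (if 2 ^ N \<le> T then T - 2 ^ N else T)"

lemma length_dec [simp]: "length (dec N T) = N"
  by (induction N arbitrary: T) auto

lemma enc_less: "enc bs < 2 ^ length bs"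
  by (induction bs) auto

lemma enc_dec: "T < 2 ^ N \<Longrightarrow> enc (dec N T) = T"
  by (induction N arbitrary: T) auto

lemma dec_enc: "dec (length bs) (enc bs) = bs"
proof (induction bs)
  case (Cons b bs)
  then show ?case using enc_less[of bs] by auto
qed simp

lemma enc_append: "enc (as @ bs) = enc as * 2 ^ length bs + enc bs"
  by (induction as) (auto simp: algebra_simps power_add)

text \<open>One coefficient of \<open>mulx\<close>: variable 25 holds the exponent, 37 the start of
  the block that is read, and 30 the running multiple of the step, which is \<open>N\<close> minus
  variable 26. Field variable 4 collects the sum.\<close>

definition jloop :: com where
  "jloop = SetN 30 (NC 0) ;; SetF 4 F0 ;;
     For 29 5 (Cond (BLe (NV 30) (NV 25))
       (SetF 4 (FPlus (FV 4) (FTimes (FA 2 (NV 29)) (FA 0 (NPlus (NV 37) (NMinus (NV 25) (NV 30)))))))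
       Skip ;;
     SetN 30 (NPlus (NV 30) (NMinus (NV 7) (NV 26))))"

text \<open>One level of the recursion of \<open>wedge\<close>, turned into a loop: variable 28
  holds the bits still to be read, field variable 1 the current sign, field variable 0 the sum so
  far. A bit that is set contributes the term at the subset without it and flips the sign.\<close>

definition tbody :: com where
  "tbody = SetN 27 (NMinus (NMinus (NV 7) (NV 26)) (NC 1)) ;;
     Cond (BLe (NA 0 (NV 27)) (NV 28))
       (SetN 28 (NMinus (NV 28) (NA 0 (NV 27))) ;; SetN 36 (NMinus (NV 24) (NA 0 (NV 27))) ;;
        mulc 37 36 8 ;; jloop ;;
        SetF 0 (FPlus (FV 0) (FTimes (FV 1) (FV 4))) ;; SetF 1 (FMinus F0 (FV 1)))
       Skip"

definition ebody :: com where
  "ebody = SetF 0 F0 ;; SetF 1 F1 ;; SetN 28 (NV 24) ;; For 26 7 tbody ;;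
     SetFA 1 (NPlus (NV 38) (NV 25)) (FV 0)"

text \<open>The result is built in array 1, because array 0 is still being read.\<close>

definition wstep :: com where
  "wstep = For 24 11 (mulc 38 24 8 ;; For 25 8 ebody) ;; copyF 31 9 0 (NC 0) 1 (NC 0)"

lemma frame_tbody [simp]:
  "wN tbody = {27, 28, 36, 37, 39, 30, 29}" "wNA tbody = {}" "wF tbody = {0, 1, 4}" "wFA tbody = {}"
  "wRA tbody = {}" "no_out tbody"
  by (auto simp: tbody_def jloop_def mulc_def)

lemma frame_ebody [simp]:
  "wN ebody = {26, 27, 28, 36, 37, 39, 30, 29}" "wNA ebody = {}" "wF ebody = {0, 1, 4}" "wFA ebody = {1}"
  "wRA ebody = {}" "no_out ebody"
  by (auto simp: ebody_def)

lemma frame_wstep [simp]: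
  "wN wstep = {24, 25, 26, 27, 28, 36, 37, 38, 39, 30, 29, 31}" "wNA wstep = {}" "wF wstep = {0, 1, 4}"
  "wFA wstep = {0, 1}" "wRA wstep = {}" "no_out wstep"
  by (auto simp: wstep_def mulc_def copyF_def)

context field begin

lemma ex_jloop:
  assumes "fclosed R h"
  shows "ex R jloop h = h\<lparr>nv := (nv h)(30 := nv h 5 * (nv h 7 - nv h 26), 29 := nv h 5),
    fv := (fv h)(4 := mulx (nv h 5) (nv h 7 - nv h 26) (fa h 2) (\<lambda>e. fa h 0 (nv h 37 + e)) (nv h 25))\<rparr>"
proof -
  let ?s = "nv h 7 - nv h 26"
  let ?g = "\<lambda>j. if j * ?s \<le> nv h 25 then fa h 2 j \<otimes> fa h 0 (nv h 37 + (nv h 25 - j * ?s)) else \<zero>"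
  let ?h = "h\<lparr>nv := (nv h)(30 := 0), fv := (fv h)(4 := \<zero>)\<rparr>"
  have cl: "fsum n ?g \<in> carrier R" for n using assms by (auto simp: fclosed_def)
  have "(\<lambda>i g. g = h\<lparr>nv := (nv h)(30 := i * ?s, 29 := i), fv := (fv h)(4 := fsum i ?g)\<rparr>) (nv ?h 5)
    (ex R (For 29 5 (Cond (BLe (NV 30) (NV 25))
       (SetF 4 (FPlus (FV 4) (FTimes (FA 2 (NV 29)) (FA 0 (NPlus (NV 37) (NMinus (NV 25) (NV 30)))))))
       Skip ;; SetN 30 (NPlus (NV 30) (NMinus (NV 7) (NV 26))))) ?h)"
    by (rule For_rule) (use cl in \<open>auto intro!: store.equality ext simp: add.commute\<close>)
  then show ?thesis by (simp add: jloop_def mulx_def)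
qed

definition wvec :: "nat \<Rightarrow> (nat \<Rightarrow> 'a) \<Rightarrow> bool list \<Rightarrow> nat \<Rightarrow> 'a" where
  "wvec E a S e = a (enc S * E + e)"

text \<open>The conserved quantity is the sum so far plus the sign times the \<open>wedge\<close>
  over the unread bits, with the bits \<open>pre\<close> already read prefixed to every
  subset.\<close>

lemma ex_tbody:
  assumes h: "fclosed R h" "nv h 26 < N" "nv h 7 = N" "nv h 5 = D" "nv h 8 = E"
    "\<And>t. t < N \<Longrightarrow> na h 0 t = 2 ^ t"
    and T: "nv h 24 = enc (pre @ b # bs)" "N = nv h 26 + Suc (length bs)" "nv h 28 = enc (b # bs)"
  shows "nv (ex R tbody h) 28 = enc bs"
    "fv (ex R tbody h) 0 \<oplus> fv (ex R tbody h) 1 \<otimes> wedge D (fa h 2) (\<lambda>S. wvec E (fa h 0) ((pre @ [b]) @ S)) bs (nv h 25)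
      = fv h 0 \<oplus> fv h 1 \<otimes> wedge D (fa h 2) (\<lambda>S. wvec E (fa h 0) (pre @ S)) (b # bs) (nv h 25)"
proof -
  have t: "nv h 7 - nv h 26 - 1 = length bs" using T h by simp
  have p: "na h 0 (length bs) = 2 ^ length bs" using h T by simp
  have le: "2 ^ length bs \<le> enc (b # bs) \<longleftrightarrow> b" using enc_less[of bs] by auto
  have "nv (ex R tbody h) 28 = enc bs \<and>
    fv (ex R tbody h) 0 \<oplus> fv (ex R tbody h) 1 \<otimes> wedge D (fa h 2) (\<lambda>S. wvec E (fa h 0) ((pre @ [b]) @ S)) bs (nv h 25)
      = fv h 0 \<oplus> fv h 1 \<otimes> wedge D (fa h 2) (\<lambda>S. wvec E (fa h 0) (pre @ S)) (b # bs) (nv h 25)"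
  proof (cases b)
    case False
    then show ?thesis using T le p t by (simp add: tbody_def)
  next
    case True
    have sub: "nv h 24 - 2 ^ length bs = enc (pre @ False # bs)" using T True by (simp add: enc_append)
    let ?m = "mulx D (Suc (length bs)) (fa h 2) (wvec E (fa h 0) (pre @ False # bs)) (nv h 25)"
    let ?w = "wedge D (fa h 2) (\<lambda>S. wvec E (fa h 0) (pre @ True # S)) bs (nv h 25)"
    let ?h1 = "h\<lparr>nv := (nv h)(27 := length bs, 28 := enc bs, 36 := enc (pre @ False # bs),
       37 := enc (pre @ False # bs) * E, 39 := E)\<rparr>"
    have cl1: "fclosed R ?h1" using h(1) by (simp add: fclosed_def)
    have s: "N - nv h 26 = Suc (length bs)" using T by simp
    have wv: "(\<lambda>e. fa h 0 (enc (pre @ False # bs) * E + e)) = wvec E (fa h 0) (pre @ False # bs)"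
      by (auto simp: wvec_def)
    have 1: "ex R tbody h = (let g = ex R jloop ?h1 in
        g\<lparr>fv := (fv g)(0 := fv g 0 \<oplus> fv g 1 \<otimes> fv g 4, 1 := \<zero> \<ominus> fv g 1)\<rparr>)"
      using T p t True le sub h by (simp add: tbody_def ex_mulc Let_def)
    have 2: "nv (ex R tbody h) 28 = enc bs" "fv (ex R tbody h) 0 = fv h 0 \<oplus> fv h 1 \<otimes> ?m"
      "fv (ex R tbody h) 1 = \<zero> \<ominus> fv h 1"
      unfolding 1 ex_jloop[OF cl1] using h s wv by (simp_all add: Let_def)
    have c: "fv h 0 \<in> carrier R" "fv h 1 \<in> carrier R" "?m \<in> carrier R" "?w \<in> carrier R"
      using h(1) by (auto simp: fclosed_def wvec_def)
    have *: "(x \<oplus> y \<otimes> z) \<oplus> (\<zero> \<ominus> y) \<otimes> w = x \<oplus> y \<otimes> (z \<ominus> w)"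
      if "x \<in> carrier R" "y \<in> carrier R" "z \<in> carrier R" "w \<in> carrier R" for x y z w
      using that by algebra
    show ?thesis using 2 True *[OF c] by simp
  qed
  then show "nv (ex R tbody h) 28 = enc bs"
    "fv (ex R tbody h) 0 \<oplus> fv (ex R tbody h) 1 \<otimes> wedge D (fa h 2) (\<lambda>S. wvec E (fa h 0) ((pre @ [b]) @ S)) bs (nv h 25)
      = fv h 0 \<oplus> fv h 1 \<otimes> wedge D (fa h 2) (\<lambda>S. wvec E (fa h 0) (pre @ S)) (b # bs) (nv h 25)"
    by auto
qed

definition dims :: "nat \<Rightarrow> nat \<Rightarrow> nat \<Rightarrow> 'f store \<Rightarrow> bool" where
  "dims D N E h \<longleftrightarrow> nv h 5 = D \<and> nv h 7 = N \<and> nv h 8 = E \<and> nv h 9 = 2 ^ N * E \<and> nv h 11 = 2 ^ N \<and>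
     (\<forall>t\<le>N. na h 0 t = 2 ^ t)"

lemma dims_same:
  "same c h g \<Longrightarrow> dims D N E h \<Longrightarrow> wN c \<inter> {5, 7, 8, 9, 11} = {} \<Longrightarrow> 0 \<notin> wNA c \<Longrightarrow> dims D N E g"
  unfolding dims_def same_def by auto

lemma ex_ebody:
  assumes h: "fclosed R h" "dims D N E h" and T: "nv h 24 < 2 ^ N"
  shows "fa (ex R ebody h) 1 = (fa h 1)(nv h 38 + nv h 25 :=
    wedge D (fa h 2) (wvec E (fa h 0)) (dec N (nv h 24)) (nv h 25))"
proof -
  let ?h = "h\<lparr>fv := (fv h)(0 := \<zero>, 1 := \<one>), nv := (nv h)(28 := nv h 24)\<rparr>"
  let ?f = "fa h 2" and ?v = "wvec E (fa h 0)" and ?e = "nv h 25"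
  let ?W = "wedge D ?f ?v (dec N (nv h 24)) ?e"
  define I where "I i g \<longleftrightarrow> fclosed R g \<and> (\<exists>pre bs. dec N (nv h 24) = pre @ bs \<and> length pre = i \<and> nv g 28 = enc bs \<and>
     fv g 0 \<oplus> fv g 1 \<otimes> wedge D ?f (\<lambda>S. ?v (pre @ S)) bs ?e = ?W)" for i and g :: "'a store"
  have cl: "fclosed R ?h" using h(1) by (simp add: fclosed_def)
  have d: "dims D N E ?h" using h(2) by (simp add: dims_def)
  have Wcl: "?W \<in> carrier R" using h(1) by (simp add: fclosed_def wvec_def)
  have "I (nv ?h 7) (ex R (For 26 7 tbody) ?h)"
  proof (rule For_rule)
    show "I 0 (?h\<lparr>nv := (nv ?h)(26 := 0)\<rparr>)"
      unfolding I_def using cl Wcl T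
      by (auto simp: enc_dec intro!: exI[of _ "[]"] exI[of _ "dec N (nv h 24)"])
  next
    fix i g assume i: "i < nv ?h 7" "nv g 26 = i" and same: "same (For 26 7 tbody) ?h g" and I: "I i g"
    from I obtain pre bs where g: "fclosed R g" "dec N (nv h 24) = pre @ bs" "length pre = i" "nv g 28 = enc bs"
      "fv g 0 \<oplus> fv g 1 \<otimes> wedge D ?f (\<lambda>S. ?v (pre @ S)) bs ?e = ?W" unfolding I_def by blast
    have N: "i < N" "nv h 7 = N" using i d by (auto simp: dims_def)
    have dg: "dims D N E g" by (rule dims_same[OF same d]) auto
    have len: "length pre + length bs = N" using g(2) length_dec[of N "nv h 24"] by (metis length_append)
    then obtain b bs' where bs: "bs = b # bs'" using g(3) N by (cases bs) auto
    have sg: "nv g 24 = nv h 24" "nv g 25 = ?e" "fa g 0 = fa h 0" "fa g 2 = fa h 2"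
      using sameD[OF same] by simp_all
    have Tg: "nv g 24 = enc (pre @ b # bs')" using enc_dec[OF T] g(2) bs sg by simp
    have "nv (ex R tbody g) 28 = enc bs'"
      "fv (ex R tbody g) 0 \<oplus> fv (ex R tbody g) 1 \<otimes> wedge D ?f (\<lambda>S. ?v ((pre @ [b]) @ S)) bs' ?e = ?W"
    proof -
      have g': "nv g 26 < N" "nv g 7 = N" "nv g 5 = D" "nv g 8 = E" "\<And>t. t < N \<Longrightarrow> na g 0 t = 2 ^ t"
        "N = nv g 26 + Suc (length bs')" "nv g 28 = enc (b # bs')"
        using dg N i len g(3,4) bs by (simp_all add: dims_def)
      note tb = ex_tbody[OF g(1) g'(1-5) Tg g'(6,7), unfolded sg]
      show "nv (ex R tbody g) 28 = enc bs'" by (rule tb(1))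
      show "fv (ex R tbody g) 0 \<oplus> fv (ex R tbody g) 1 \<otimes> wedge D ?f (\<lambda>S. ?v ((pre @ [b]) @ S)) bs' ?e = ?W"
        using tb(2) g(5) unfolding bs by (rule trans)
    qed
    then show "I (Suc i) ((ex R tbody g)\<lparr>nv := (nv (ex R tbody g))(26 := Suc i)\<rparr>)"
      unfolding I_def using g bs ex_closed[OF g(1)]
      by (intro conjI exI[of _ "pre @ [b]"] exI[of _ bs']) auto
  qed auto
  then have IN: "I N (ex R (For 26 7 tbody) ?h)" using d by (simp add: dims_def)
  let ?g = "ex R (For 26 7 tbody) ?h"
  from IN obtain pre bs where pb: "dec N (nv h 24) = pre @ bs" "length pre = N" and g: "fclosed R ?g"
    "fv ?g 0 \<oplus> fv ?g 1 \<otimes> wedge D ?f (\<lambda>S. ?v (pre @ S)) bs ?e = ?W" unfolding I_def by blast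
  \<comment> \<open>After \<open>N\<close> rounds no bit is left, the remaining \<open>wedge\<close>
    is zero, and the conserved quantity is the sum itself.\<close>
  have "bs = []" using arg_cong[OF pb(1), of length] pb(2) by simp
  with g have g: "fclosed R ?g" "fv ?g 0 \<oplus> fv ?g 1 \<otimes> \<zero> = ?W" by simp_all
  then have "fv ?g 0 = ?W" by (simp add: fclosed_def)
  moreover have "nv ?g 38 = nv h 38" "nv ?g 25 = ?e" "fa ?g 1 = fa h 1"
    using sameD[OF same_ex[of "For 26 7 tbody" ?h R]] by simp_all
  ultimately show ?thesis unfolding ebody_def by simp
qed

text \<open>Acts on a whole array; the cells from \<open>2 ^ N * E\<close> on lie outside the vector
  and stay as they are.\<close>

definition lmul :: "nat \<Rightarrow> nat \<Rightarrow> nat \<Rightarrow> (nat \<Rightarrow> 'a) \<Rightarrow> (nat \<Rightarrow> 'a) \<Rightarrow> nat \<Rightarrow> 'a" where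
  "lmul D N E f a k =
     (if k < 2 ^ N * E then wedge D f (wvec E a) (dec N (k div E)) (k mod E) else a k)"

lemma ex_wstep:
  assumes h: "fclosed R h" "dims D N E h"
  shows "fa (ex R wstep h) 0 = lmul D N E (fa h 2) (fa h 0)"
proof -
  let ?c = "mulc 38 24 8 ;; For 25 8 ebody"
  let ?W = "\<lambda>T e. wedge D (fa h 2) (wvec E (fa h 0)) (dec N T) e"
  define I where "I i g \<longleftrightarrow> fclosed R g \<and> (\<forall>k<i * E. fa g 1 k = ?W (k div E) (k mod E))" for i and g :: "'a store"
  have "I (nv h 11) (ex R (For 24 11 ?c) h)"
  proof (rule For_rule)
    show "I 0 (h\<lparr>nv := (nv h)(24 := 0)\<rparr>)" using h by (simp add: I_def)
  next
    fix i g assume i: "i < nv h 11" "nv g 24 = i" and same: "same (For 24 11 ?c) h g" and I: "I i g"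
    have dg: "dims D N E g" by (rule dims_same[OF same h(2)]) (auto simp: mulc_def)
    have sg: "fa g 0 = fa h 0" "fa g 2 = fa h 2" using sameD[OF same] by (simp_all add: mulc_def)
    have Eg: "nv g 8 = E" using dg by (simp add: dims_def)
    let ?g = "g\<lparr>nv := (nv g)(38 := i * E, 39 := E)\<rparr>"
    have m: "ex R (mulc 38 24 8) g = ?g" using i Eg by (simp add: ex_mulc)
    have clg: "fclosed R ?g" and dg': "dims D N E ?g" using I dg by (simp_all add: I_def fun_upd_twist dims_def)
    have T: "i < 2 ^ N" using i h(2) by (simp add: dims_def)
    define J where "J e k \<longleftrightarrow> fclosed R k \<and>
      (\<forall>x. fa k 1 x = (if i * E \<le> x \<and> x < i * E + e then ?W i (x - i * E) else fa g 1 x))" for e and k :: "'a store"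
    have "J (nv ?g 8) (ex R (For 25 8 ebody) ?g)"
    proof (rule For_rule)
      show "J 0 (?g\<lparr>nv := (nv ?g)(25 := 0)\<rparr>)" using clg by (auto simp: J_def)
    next
      fix e k assume e: "e < nv ?g 8" "nv k 25 = e" and same': "same (For 25 8 ebody) ?g k" and J: "J e k"
      have dk: "dims D N E k" by (rule dims_same[OF same' dg']) auto
      have sk: "fa k 0 = fa h 0" "fa k 2 = fa h 2" "nv k 24 = i" "nv k 38 = i * E"
        using sameD[OF same'] sg i by simp_all
      have clk: "fclosed R k" using J by (simp add: J_def)
      have "fa (ex R ebody k) 1 = (fa k 1)(i * E + e := ?W i e)"
        using ex_ebody[OF clk dk] sk T e by simp
      then show "J (Suc e) ((ex R ebody k)\<lparr>nv := (nv (ex R ebody k))(25 := Suc e)\<rparr>)"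
        using J ex_closed[OF clk] unfolding J_def by auto
    qed auto
    then have J: "J E (ex R ?c g)" using m Eg by simp
    have "fa (ex R ?c g) 1 k = ?W (k div E) (k mod E)" if k: "k < Suc i * E" for k
    proof (cases "k < i * E")
      case True
      then show ?thesis using J I by (simp add: J_def I_def)
    next
      case False
      define r where "r = k - i * E"
      have r: "k = i * E + r" using False by (simp add: r_def)
      have "r < E" using k r by simp
      then have "k div E = i" "k mod E = k - i * E" unfolding r by simp_all
      then show ?thesis using False k J by (simp add: J_def)
    qed
    then show "I (Suc i) ((ex R ?c g)\<lparr>nv := (nv (ex R ?c g))(24 := Suc i)\<rparr>)"
      using J by (simp add: I_def J_def)
  qed (auto simp: mulc_def)
  moreover define g where "g = ex R (For 24 11 ?c) h"
  ultimately have g1: "\<And>k. k < 2 ^ N * E \<Longrightarrow> fa g 1 k = ?W (k div E) (k mod E)"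
    using h(2) by (simp add: dims_def I_def)
  have g: "fa g 0 = fa h 0" "nv g 9 = 2 ^ N * E"
    using sameD[OF same_ex[of "For 24 11 ?c" h R]] h(2) by (simp_all add: g_def mulc_def dims_def)
  have "fa (ex R wstep h) 0 = (\<lambda>k. if k < nv g 9 then fa g 1 k else fa g 0 k)"
    unfolding wstep_def ex.simps(8) g_def[symmetric] by (simp add: ex_copyF cong: if_cong)
  then show ?thesis using g1 unfolding g by (auto simp: lmul_def)
qed

end

subsection \<open>The dynamic program\<close>

text \<open>The first loop multiplies the position in variable 22 by the rank of the matroid in
  variable 23: of its \<open>D\<close> rounds, exactly as many as the rank add the position. No loop
  over the ground set is spent on an address, as the multiples of \<open>n\<close> are read from
  array 2.\<close>

definition buildf :: com where
  "buildf = SetN 36 (NC 0) ;;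
     For 29 5 (Cond (BLe (NPlus (NPlus (NV 29) (NC 1)) (NA 1 (NV 23))) (NA 1 (NPlus (NV 23) (NC 1))))
       (SetN 36 (NPlus (NV 36) (NV 22))) Skip) ;;
     For 29 5 (Cond (BLe (NA 1 (NV 23)) (NV 29))
       (Cond (BLe (NPlus (NV 29) (NC 1)) (NA 1 (NPlus (NV 23) (NC 1))))
         (SetFA 2 (NV 29) (FI (NPlus (NPlus (NA 2 (NV 23)) (NV 36)) (NMinus (NV 29) (NA 1 (NV 23))))))
         (SetFA 2 (NV 29) F0))
       (SetFA 2 (NV 29) F0))"

text \<open>The loop runs up to the largest size of a member and skips the surplus rounds. The size
  of the current member cannot serve as bound, since it would be assigned within the piece.\<close>

definition app :: com where
  "app = For 21 6 (Cond (BLe (NPlus (NV 21) (NC 1)) (NI (NA 3 (NV 14))))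
     (SetN 22 (NI (NPlus (NPlus (NA 3 (NV 14)) (NC 1)) (NV 21))) ;; For 23 1 (buildf ;; wstep)) Skip)"

text \<open>The candidate with number c h + i extends the selection of slot c by member i. Its
  vector is stored twice: the elimination destroys the copy in array 5, while array 4 supplies the
  vectors of the new slots.\<close>

definition cand :: com where
  "cand = SetN 16 (NPlus (NV 15) (NV 14)) ;; mulc 17 13 9 ;; mulc 18 16 9 ;; mulc 19 13 3 ;; mulc 20 16 3 ;;
     copyF 31 9 0 (NC 0) 3 (NV 17) ;; app ;;
     copyF 31 9 4 (NV 18) 0 (NC 0) ;; copyF 31 9 5 (NV 18) 0 (NC 0) ;;
     SetRA 1 (NV 16) (RPlus (RA 0 (NV 13)) (RI (NV 14))) ;;
     copyN 31 3 5 (NV 20) 4 (NV 19) ;; SetNA 5 (NPlus (NV 20) (NV 12)) (NV 14)"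

definition cands :: com where
  "cands = For 13 9 (mulc 15 13 4 ;; For 14 4 cand)"

text \<open>Variable 34 tells whether column 32 has shown a nonzero entry; if not, variable 33
  remains at its default 0.\<close>

definition findbest :: com where
  "findbest = SetN 33 (NC 0) ;; SetN 34 (NC 0) ;;
     For 16 10 (mulc 18 16 9 ;;
       Cond (BFEq (FA 5 (NPlus (NV 18) (NV 32))) F0) Skip
         (Cond (BLe (NC 1) (NV 34))
           (Cond (BRLe (RA 1 (NV 33)) (RA 1 (NV 16))) (SetN 33 (NV 16)) Skip)
           (SetN 33 (NV 16) ;; SetN 34 (NC 1))))"

definition elimrow :: com where
  "elimrow = mulc 18 16 9 ;; SetF 2 (FA 5 (NPlus (NV 18) (NV 32))) ;;
     For 31 9 (SetFA 5 (NPlus (NV 18) (NV 31))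
       (FMinus (FA 5 (NPlus (NV 18) (NV 31))) (FTimes (FV 2) (FA 6 (NV 31)))))"

text \<open>One slot for each column, hence \<open>L\<close> slots. Slot 32 is filled even if its
  column has become zero, namely with candidate 0: a true candidate does no harm, and if there is
  none the copied vector is zero.\<close>

definition elimcol :: com where
  "elimcol = findbest ;; mulc 17 33 9 ;; SetF 3 (FInverse (FA 5 (NPlus (NV 17) (NV 32)))) ;;
     For 31 9 (SetFA 6 (NV 31) (FTimes (FV 3) (FA 5 (NPlus (NV 17) (NV 31))))) ;;
     For 16 10 elimrow ;;
     mulc 18 32 9 ;; copyF 31 9 3 (NV 18) 4 (NV 17) ;; SetRA 0 (NV 32) (RA 1 (NV 33)) ;;
     mulc 19 32 3 ;; mulc 20 33 3 ;; copyN 31 3 4 (NV 19) 5 (NV 20)"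

definition levels :: com where
  "levels = For 12 3 (cands ;; For 32 9 elimcol)"

text \<open>Variable 0 is the flag for a nonzero slot and, being cell 0, at the same time the answer
  whether a solution exists.\<close>

definition final :: com where
  "final = SetN 0 (NC 0) ;; SetN 33 (NC 0) ;;
     For 13 9 (mulc 17 13 9 ;; For 31 9 (Cond (BFEq (FA 3 (NPlus (NV 17) (NV 31))) F0) Skip
       (Cond (BLe (NC 1) (NV 0))
         (Cond (BRLe (RA 0 (NV 33)) (RA 0 (NV 13))) (SetN 33 (NV 13)) Skip)
         (SetN 0 (NC 1) ;; SetN 33 (NV 13))))) ;;
     mulc 20 33 3"

definition outputs :: com where
  "outputs = For 31 3 (Out (NV 31) (NA 4 (NPlus (NV 20) (NV 31))))"

lemma frame_buildf [simp]:
  "wN buildf = {36, 29}" "wNA buildf = {}" "wF buildf = {}" "wFA buildf = {2}" "wRA buildf = {}" "no_out buildf"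
  by (auto simp: buildf_def)

lemma frame_app [simp]:
  "wN app = {21, 22, 23, 36, 29, 24, 25, 26, 27, 28, 37, 38, 39, 30, 31}" "wNA app = {}" "wF app = {0, 1, 4}"
  "wFA app = {0, 1, 2}" "wRA app = {}" "no_out app"
  by (auto simp: app_def)

lemma frame_cand [simp]:
  "wN cand = {16, 17, 18, 19, 20, 21, 22, 23, 36, 29, 24, 25, 26, 27, 28, 37, 38, 39, 30, 31}"
  "wNA cand = {5}" "wF cand = {0, 1, 4}" "wFA cand = {0, 1, 2, 4, 5}" "wRA cand = {1}" "no_out cand"
  by (auto simp: cand_def mulc_def copyF_def copyN_def)

lemma frame_cands [simp]:
  "wN cands = {13, 14, 15, 16, 17, 18, 19, 20, 21, 22, 23, 36, 29, 24, 25, 26, 27, 28, 37, 38, 39, 30, 31}"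
  "wNA cands = {5}" "wF cands = {0, 1, 4}" "wFA cands = {0, 1, 2, 4, 5}" "wRA cands = {1}" "no_out cands"
  by (auto simp: cands_def mulc_def)

lemma frame_findbest [simp]:
  "wN findbest = {16, 18, 33, 34, 39}" "wNA findbest = {}" "wF findbest = {}" "wFA findbest = {}"
  "wRA findbest = {}" "no_out findbest"
  by (auto simp: findbest_def mulc_def)

lemma frame_elimrow [simp]:
  "wN elimrow = {18, 31, 39}" "wNA elimrow = {}" "wF elimrow = {2}" "wFA elimrow = {5}"
  "wRA elimrow = {}" "no_out elimrow"
  by (auto simp: elimrow_def mulc_def)

lemma frame_elimcol [simp]:
  "wN elimcol = {16, 17, 18, 19, 20, 31, 33, 34, 39}" "wNA elimcol = {4}" "wF elimcol = {2, 3}" "wFA elimcol = {3, 5, 6}"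
  "wRA elimcol = {0}" "no_out elimcol"
  by (auto simp: elimcol_def mulc_def copyF_def copyN_def)

section \<open>Locality and linearity of the multiplication\<close>

context field begin

text \<open>Coefficients from \<open>D\<close> on are never read; \<open>buildf\<close> fills only
  the first \<open>D\<close> cells of its array.\<close>

lemma wedge_cong_left:
  assumes "\<And>j. j < D \<Longrightarrow> f j = f' j"
  shows "wedge D f v T e = wedge D f' v T e"
proof (induction T arbitrary: v)
  case (Cons b bs)
  have "mulx D s f u e = mulx D s f' u e" for s u
    unfolding mulx_def using assms by (intro fsum_cong) auto
  then show ?case using Cons by (cases b) simp_all
qed simp

lemma lmul_cong_left:
  assumes "\<And>j. j < D \<Longrightarrow> f j = f' j"
  shows "lmul D N E f a = lmul D N E f' a"
proof
  fix k
  have "wedge D f v T e = wedge D f' v T e" for v T e using assms by (rule wedge_cong_left)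
  then show "lmul D N E f a k = lmul D N E f' a k" by (simp add: lmul_def)
qed

lemma enc_mult_less: "e < E \<Longrightarrow> enc S * E + e < 2 ^ length S * E"
proof -
  assume "e < E"
  then have "enc S * E + e < Suc (enc S) * E" by simp
  also have "\<dots> \<le> 2 ^ length S * E" using enc_less[of S] by (intro mult_right_mono) auto
  finally show ?thesis .
qed

lemma lmul_cong:
  assumes "\<And>k. k < 2 ^ N * E \<Longrightarrow> a k = a' k" "k < 2 ^ N * E"
  shows "lmul D N E f a k = lmul D N E f a' k"
proof -
  have "E > 0" using assms(2) by (cases E) auto
  have "wedge D f (wvec E a) (dec N (k div E)) (k mod E) = wedge D f (wvec E a') (dec N (k div E)) (k mod E)"
  proof (rule wedge_cong)
    fix S :: "bool list" and e' assume "length S = length (dec N (k div E))" "e' \<le> k mod E"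
    then have "length S = N" "e' < E" using \<open>E > 0\<close> by (auto intro: order_le_less_trans)
    then show "wvec E a S e' = wvec E a' S e'"
      unfolding wvec_def using assms(1) enc_mult_less[of e' E S] by simp
  qed
  then show ?thesis using assms(2) by (simp add: lmul_def)
qed

lemma lmul_closed:
  assumes "\<And>j. f j \<in> carrier R" "\<And>k. a k \<in> carrier R"
  shows "lmul D N E f a k \<in> carrier R"
  using assms by (simp add: lmul_def wvec_def)

lemma lmul_sub_smult:
  assumes "\<And>j. f j \<in> carrier R" "\<And>k. a k \<in> carrier R" "\<And>k. b k \<in> carrier R" "c \<in> carrier R"
  shows "lmul D N E f (\<lambda>x. a x \<ominus> c \<otimes> b x) = (\<lambda>x. lmul D N E f a x \<ominus> c \<otimes> lmul D N E f b x)"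
proof
  fix k
  have "wvec E (\<lambda>x. a x \<ominus> c \<otimes> b x) = (\<lambda>S e. wvec E a S e \<ominus> c \<otimes> wvec E b S e)"
    by (intro ext) (simp add: wvec_def)
  then show "lmul D N E f (\<lambda>x. a x \<ominus> c \<otimes> b x) k = lmul D N E f a k \<ominus> c \<otimes> lmul D N E f b k"
    using assms wedge_sub_smult[of f c "wvec E a" "wvec E b"] by (simp add: lmul_def wvec_def)
qed

definition closed :: "(nat \<Rightarrow> 'a) \<Rightarrow> bool" where
  "closed a \<longleftrightarrow> (\<forall>k. a k \<in> carrier R)"

text \<open>The linear tests by which partial selections are compared. Instances are the coordinates
  and their compositions with the multiplications still to come.\<close>

definition linear :: "((nat \<Rightarrow> 'a) \<Rightarrow> 'a) \<Rightarrow> bool" where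
  "linear \<Phi> \<longleftrightarrow> (\<forall>a. closed a \<longrightarrow> \<Phi> a \<in> carrier R) \<and>
     (\<forall>a b c. closed a \<longrightarrow> closed b \<longrightarrow> c \<in> carrier R \<longrightarrow> \<Phi> (\<lambda>x. a x \<ominus> c \<otimes> b x) = \<Phi> a \<ominus> c \<otimes> \<Phi> b)"

lemma linear_zero:
  assumes "linear \<Phi>"
  shows "\<Phi> (\<lambda>x. \<zero>) = \<zero>"
proof -
  have c: "closed (\<lambda>x. \<zero>)" by (simp add: closed_def)
  then have "\<Phi> (\<lambda>x. \<zero> \<ominus> \<one> \<otimes> \<zero>) = \<Phi> (\<lambda>x. \<zero>) \<ominus> \<one> \<otimes> \<Phi> (\<lambda>x. \<zero>)"
    using assms unfolding linear_def by blast
  moreover have "\<Phi> (\<lambda>x. \<zero>) \<in> carrier R" using assms c unfolding linear_def by blast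
  moreover have "(\<lambda>x. \<zero> \<ominus> \<one> \<otimes> \<zero>) = (\<lambda>x::nat. \<zero>)" by (simp add: minus_eq)
  ultimately show ?thesis by (simp add: minus_eq r_neg)
qed

end

text \<open>The run is studied for plain numbers and lists, with the field input given as a total
  function \<open>Fin\<close>. Matroids enter only when nonzero vectors are identified with feasible
  selections.\<close>

locale spmc_run = field R for R :: "('f, 'b) ring_scheme" (structure) +
  fixes m n al gm :: nat and rk :: "nat \<Rightarrow> nat" and hs :: "nat list list"
    and Fin :: "nat \<Rightarrow> 'f" and wt :: "nat \<Rightarrow> real"
  assumes Fin_closed: "Fin k \<in> carrier R"
    and hs_less: "\<And>h u. h \<in> set hs \<Longrightarrow> u \<in> set h \<Longrightarrow> u < n"
    and hs_len: "\<And>h. h \<in> set hs \<Longrightarrow> length h \<le> gm"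
begin

section \<open>Parameters of a run and the tables it relies on\<close>

definition off :: "nat \<Rightarrow> nat" where "off i = (\<Sum>i'<i. rk i')"
definition DD :: nat where "DD = off m"
definition NN :: nat where "NN = m * al * gm"
definition EE :: nat where "EE = NN * NN * DD + 1"
definition LL :: nat where "LL = 2 ^ NN * EE"
definition NR :: nat where "NR = LL * length hs"
text \<open>The position of the length entry of member \<open>i\<close> in the number input: six
  parameters and \<open>m\<close> ranks come before the members.\<close>

definition hpos :: "nat \<Rightarrow> nat" where "hpos i = 6 + m + (\<Sum>i'<i. Suc (length (hs ! i')))"

definition fvec :: "nat \<Rightarrow> nat \<Rightarrow> nat \<Rightarrow> 'f" where
  "fvec i u j = (if off i \<le> j \<and> j < off (Suc i) then Fin (n * off i + rk i * u + (j - off i)) else \<zero>)"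

text \<open>What the preparation establishes and the later pieces preserve up to the output. The
  comparison with \<open>bn h\<close> guarantees that members are read from the input and not from
  an array.\<close>

definition ready :: "'f store \<Rightarrow> bool" where
  "ready h \<longleftrightarrow> nv h 1 = m \<and> nv h 2 = n \<and> nv h 3 = al \<and> nv h 4 = length hs \<and> nv h 6 = gm \<and> nv h 10 = NR \<and>
     dims DD NN EE h \<and> (\<forall>i\<le>m. na h 1 i = off i \<and> na h 2 i = n * off i) \<and>
     (\<forall>i<length hs. na h 3 i = hpos i \<and> hpos i + length (hs ! i) + 100 < bn h \<and>
        ni h (hpos i) = length (hs ! i) \<and> (\<forall>k<length (hs ! i). ni h (hpos i + 1 + k) = hs ! i ! k)) \<and>
     bf h = 100 + n * DD \<and> fi h = Fin \<and> br h = 100 + length hs \<and> (\<forall>k<length hs. ri h k = wt k) \<and> fclosed R h"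

lemma ready_same:
  assumes "same c h k" "ready h" "fclosed R k" "wN c \<inter> {1..11} = {}" "wNA c \<inter> {0..3} = {}" "no_out c"
  shows "ready k"
proof -
  have nv: "nv k z = nv h z" if "z \<in> {1..11}" for z using assms(1,4) that by (auto simp: same_def)
  have na: "na k z = na h z" if "z \<in> {0..3}" for z using assms(1,5) that by (auto simp: same_def)
  have dims: "dims DD NN EE k"
    by (rule dims_same[OF assms(1)]) (use assms in \<open>auto simp: ready_def\<close>)
  have nvs: "nv k 1 = nv h 1" "nv k 2 = nv h 2" "nv k 3 = nv h 3" "nv k 4 = nv h 4"
    "nv k 6 = nv h 6" "nv k 10 = nv h 10" by (rule nv; simp)+
  have nas: "na k 1 = na h 1" "na k 2 = na h 2" "na k 3 = na h 3" by (rule na; simp)+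
  note eqs = nvs nas sameD(6)[OF assms(1,6)] sameD(7-11)[OF assms(1)]
  show ?thesis unfolding ready_def eqs using assms(2)[unfolded ready_def] assms(3) dims
    by blast
qed

lemma ready_fclosed: "ready h \<Longrightarrow> fclosed R h"
  by (simp add: ready_def)

lemma ready_ex:
  "ready h \<Longrightarrow> wN c \<inter> {1..11} = {} \<Longrightarrow> wNA c \<inter> {0..3} = {} \<Longrightarrow> no_out c \<Longrightarrow> ready (ex R c h)"
  using ready_same[OF same_ex] ex_closed ready_fclosed by blast

lemma ready_nv: "ready h \<Longrightarrow> x \<notin> {1..11} \<Longrightarrow> ready (h\<lparr>nv := (nv h)(x := v)\<rparr>)"
  using ready_ex[of h "SetN x (NC v)"] by simp

lemma off_Suc: "off (Suc i) = off i + rk i"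
  by (simp add: off_def)

lemma off_mono: "i \<le> i' \<Longrightarrow> off i \<le> off i'"
  unfolding off_def by (rule sum_mono2) auto

lemma LL_pos: "0 < LL" by (simp add: LL_def EE_def)

lemma fvec_closed: "fvec i u j \<in> carrier R"
  by (simp add: fvec_def Fin_closed)

lemma ex_buildf:
  assumes h: "ready h" and i: "nv h 23 < m" and u: "nv h 22 < n"
  shows "\<forall>j<DD. fa (ex R buildf h) 2 j = fvec (nv h 23) (nv h 22) j"
proof -
  let ?i = "nv h 23" and ?u = "nv h 22"
  let ?c1 = "Cond (BLe (NPlus (NPlus (NV 29) (NC 1)) (NA 1 (NV 23))) (NA 1 (NPlus (NV 23) (NC 1))))
       (SetN 36 (NPlus (NV 36) (NV 22))) Skip"
  let ?c2 = "Cond (BLe (NA 1 (NV 23)) (NV 29))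
       (Cond (BLe (NPlus (NV 29) (NC 1)) (NA 1 (NPlus (NV 23) (NC 1))))
         (SetFA 2 (NV 29) (FI (NPlus (NPlus (NA 2 (NV 23)) (NV 36)) (NMinus (NV 29) (NA 1 (NV 23))))))
         (SetFA 2 (NV 29) F0))
       (SetFA 2 (NV 29) F0)"
  let ?h = "h\<lparr>nv := (nv h)(36 := 0)\<rparr>"
  have na: "na h 1 ?i = off ?i" "na h (Suc 0) ?i = off ?i" "na h 1 (Suc ?i) = off (Suc ?i)"
    "na h (Suc 0) (Suc ?i) = off (Suc ?i)" "na h 2 ?i = n * off ?i"
    using h i by (auto simp: ready_def)
  have D: "nv h 5 = DD" using h by (simp add: ready_def dims_def)
  have offD: "off (Suc ?i) \<le> DD" unfolding DD_def using i by (intro off_mono) simp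
  have "(\<lambda>j k. k = h\<lparr>nv := (nv h)(36 := min j (rk ?i) * ?u, 29 := j)\<rparr>) (nv ?h 5) (ex R (For 29 5 ?c1) ?h)"
  proof (rule For_rule)
    fix j k assume "k = h\<lparr>nv := (nv h)(36 := min j (rk ?i) * ?u, 29 := j)\<rparr>"
    then show "(ex R ?c1 k)\<lparr>nv := (nv (ex R ?c1 k))(29 := Suc j)\<rparr> =
        h\<lparr>nv := (nv h)(36 := min (Suc j) (rk ?i) * ?u, 29 := Suc j)\<rparr>"
      using na by (cases "j < rk ?i") (auto intro!: store.equality ext simp: off_Suc min_def)
  qed (auto intro!: store.equality ext)
  moreover have "min DD (rk ?i) = rk ?i" using offD by (simp add: off_Suc)
  ultimately have 1: "ex R (For 29 5 ?c1) ?h = h\<lparr>nv := (nv h)(36 := rk ?i * ?u, 29 := DD)\<rparr>"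
    using D by simp
  let ?h1 = "h\<lparr>nv := (nv h)(36 := rk ?i * ?u, 29 := DD)\<rparr>"
  have "\<forall>j'<nv ?h1 5. fa (ex R (For 29 5 ?c2) ?h1) 2 j' = fvec ?i ?u j'"
  proof (rule For_rule[where I = "\<lambda>j k. \<forall>j'<j. fa k 2 j' = fvec ?i ?u j'"])
    fix j k assume j: "j < nv ?h1 5" "nv k 29 = j" and same: "same (For 29 5 ?c2) ?h1 k"
      and I: "\<forall>j'<j. fa k 2 j' = fvec ?i ?u j'"
    have sk: "nv k 23 = ?i" "nv k 36 = rk ?i * ?u" "na k = na h" "bf k = bf h" "fi k = Fin"
      using sameD[OF same] h by (auto simp: ready_def)
    \<comment> \<open>The address stays within the \<open>n * DD\<close> cells of the field input,
      so that \<open>cell\<close> does not read an array instead.\<close>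
    have "n * off ?i + rk ?i * ?u + (j - off ?i) < n * DD" if "off ?i \<le> j" "j < off (Suc ?i)"
    proof -
      have "j - off ?i < rk ?i" using that by (simp add: off_Suc)
      then have "rk ?i * ?u + (j - off ?i) < rk ?i * ?u + rk ?i" by simp
      also have "\<dots> = rk ?i * Suc ?u" by simp
      also have "\<dots> \<le> rk ?i * n" using u by (intro mult_left_mono) auto
      finally have "n * off ?i + rk ?i * ?u + (j - off ?i) < n * off (Suc ?i)"
        by (simp add: off_Suc algebra_simps)
      also have "\<dots> \<le> n * DD" using offD by (intro mult_left_mono) auto
      finally show ?thesis .
    qed
    then have "fa (ex R ?c2 k) 2 j = fvec ?i ?u j"
      using j sk na h by (auto simp: cell_def fvec_def ready_def)
    moreover have "fa (ex R ?c2 k) 2 j' = fa k 2 j'" if "j' \<noteq> j" for j'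
      using j that by auto
    ultimately show "\<forall>j'<Suc j. fa ((ex R ?c2 k)\<lparr>nv := (nv (ex R ?c2 k))(29 := Suc j)\<rparr>) 2 j' = fvec ?i ?u j'"
      using I by (auto simp: less_Suc_eq simp del: ex.simps)
  qed auto
  then show ?thesis using D 1 by (simp add: buildf_def)
qed

definition APP :: "nat list \<Rightarrow> (nat \<Rightarrow> 'f) \<Rightarrow> nat \<Rightarrow> 'f" where
  "APP h = fold (\<lambda>u a. fold (\<lambda>i a. lmul DD NN EE (fvec i u) a) [0..<m] a) h"

lemma ex_app:
  assumes h: "ready h" and hh: "nv h 14 < length hs"
  shows "fa (ex R app h) 0 = APP (hs ! nv h 14) (fa h 0)"
proof -
  let ?H = "hs ! nv h 14"
  let ?b = "For 23 1 (buildf ;; wstep)"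
  let ?c = "Cond (BLe (NPlus (NV 21) (NC 1)) (NI (NA 3 (NV 14))))
     (SetN 22 (NI (NPlus (NPlus (NA 3 (NV 14)) (NC 1)) (NV 21))) ;; ?b) Skip"
  have gm: "nv h 6 = gm" using h by (simp add: ready_def)
  have b: "fa (ex R ?b k) 0 = fold (\<lambda>i a. lmul DD NN EE (fvec i (nv k 22)) a) [0..<m] (fa k 0)"
    if k: "ready k" "nv k 22 < n" for k
  proof -
    let ?W = "\<lambda>i. fold (\<lambda>i a. lmul DD NN EE (fvec i (nv k 22)) a) [0..<i] (fa k 0)"
    have "fa (ex R ?b k) 0 = ?W (nv k 1)"
    proof (rule For_rule_closed[where I = "\<lambda>i k'. fa k' 0 = ?W i"])
      fix i k' assume i: "i < nv k 1" "nv k' 23 = i" and same: "same ?b k k'" and "fclosed R k'" and I: "fa k' 0 = ?W i"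
      have rk': "ready k'" by (rule ready_same[OF same k(1)]) (use \<open>fclosed R k'\<close> in auto)
      have s: "nv k' 22 = nv k 22" using sameD[OF same] by simp
      have i': "i < m" using i k(1) by (simp add: ready_def)
      let ?k = "ex R buildf k'"
      have rk'': "ready ?k" by (rule ready_ex[OF rk']) auto
      have "\<forall>j<DD. fa ?k 2 j = fvec i (nv k 22) j" using ex_buildf[OF rk'] i i' s k(2) by simp
      moreover have "fa (ex R wstep ?k) 0 = lmul DD NN EE (fa ?k 2) (fa ?k 0)"
        by (rule ex_wstep) (use rk'' in \<open>auto simp: ready_def\<close>)
      moreover have "fa ?k 0 = fa k' 0" using sameD[OF same_ex[of buildf k' R]] by simp
      ultimately have "fa (ex R wstep ?k) 0 = lmul DD NN EE (fvec i (nv k 22)) (?W i)"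
        using I lmul_cong_left[of DD "fa ?k 2" "fvec i (nv k 22)" NN EE "?W i"] by metis
      then show "fa ((ex R (buildf ;; wstep) k')\<lparr>nv := (nv (ex R (buildf ;; wstep) k'))(23 := Suc i)\<rparr>) 0 = ?W (Suc i)"
        by simp
    qed (use ready_fclosed[OF k(1)] in auto)
    then show ?thesis using k by (simp add: ready_def)
  qed
  have "fa (ex R (For 21 6 ?c) h) 0 = APP (take (nv h 6) ?H) (fa h 0)"
  proof (rule For_rule_closed[where I = "\<lambda>k s. fa s 0 = APP (take k ?H) (fa h 0)"])
    show "fa (h\<lparr>nv := (nv h)(21 := 0)\<rparr>) 0 = APP (take 0 ?H) (fa h 0)" by (simp add: APP_def)
  next
    fix k s assume k: "k < nv h 6" "nv s 21 = k" and same: "same (For 21 6 ?c) h s" and "fclosed R s"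
      and I: "fa s 0 = APP (take k ?H) (fa h 0)"
    have rs: "ready s" by (rule ready_same[OF same h]) (use \<open>fclosed R s\<close> in auto)
    have s14: "nv s 14 = nv h 14" using sameD[OF same] by simp
    have e: "evN (NI (NA 3 (NV 14))) s = length ?H"
      "k < length ?H \<Longrightarrow> evN (NI (NPlus (NPlus (NA 3 (NV 14)) (NC 1)) (NV 21))) s = ?H ! k"
      using rs hh k(2) s14 by (auto simp: ready_def cell_def algebra_simps)
    show "fa ((ex R ?c s)\<lparr>nv := (nv (ex R ?c s))(21 := Suc k)\<rparr>) 0 = APP (take (Suc k) ?H) (fa h 0)"
    proof (cases "k < length ?H")
      case True
      have u: "?H ! k < n" using hs_less[of ?H "?H ! k"] hh True by auto
      let ?s = "s\<lparr>nv := (nv s)(22 := ?H ! k)\<rparr>"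
      have "ready ?s" by (rule ready_nv[OF rs]) auto
      from b[OF this] have "fa (ex R ?b ?s) 0 = fold (\<lambda>i a. lmul DD NN EE (fvec i (?H ! k)) a) [0..<m] (fa s 0)"
        using u by simp
      moreover have "ex R ?c s = ex R ?b ?s" using e True k(2) by (simp del: evN.simps(4))
      ultimately show ?thesis using I True by (simp add: take_Suc_conv_app_nth APP_def)
    next
      case False
      then have "ex R ?c s = s" using e k(2) by (simp del: evN.simps(4))
      then show ?thesis using I False by simp
    qed
  qed (use ready_fclosed[OF h] in auto)
  moreover have "length ?H \<le> gm" using hs_len hh by simp
  ultimately show ?thesis using gm by (simp add: app_def)
qed

section \<open>Products indexed by labels\<close>

definition labels :: "nat list \<Rightarrow> (nat \<times> nat) list" where
  "labels h = concat (map (\<lambda>u. map (\<lambda>i. (i, u)) [0..<m]) h)"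

text \<open>The nested loops of \<open>APP\<close> flattened to one list of labels, the form that
  can be compared with \<open>wedges\<close>.\<close>

definition LAP :: "(nat \<times> nat) list \<Rightarrow> (nat \<Rightarrow> 'f) \<Rightarrow> nat \<Rightarrow> 'f" where
  "LAP ls = fold (\<lambda>(i, u). lmul DD NN EE (fvec i u)) ls"

lemma APP_LAP: "APP h = LAP (labels h)"
proof
  fix a
  have "fold (\<lambda>i a. lmul DD NN EE (fvec i u) a) is a = LAP (map (\<lambda>i. (i, u)) is) a" for u "is" a
  proof -
    have "(\<lambda>(i, u). lmul DD NN EE (fvec i u)) \<circ> (\<lambda>i. (i, u)) = (\<lambda>i. lmul DD NN EE (fvec i u))" by auto
    then show ?thesis by (simp add: LAP_def fold_map)
  qed
  then show "APP h a = LAP (labels h) a"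
    by (induction h arbitrary: a) (simp_all add: APP_def labels_def LAP_def)
qed

lemma LAP_closed: "closed a \<Longrightarrow> closed (LAP ls a)"
  unfolding LAP_def by (induction ls arbitrary: a) (auto simp: closed_def lmul_closed fvec_closed)

text \<open>Array 0 may carry leftovers beyond the vector, which must not influence the first
  \<open>LL\<close> cells.\<close>

lemma LAP_cong: "(\<And>k. k < LL \<Longrightarrow> a k = a' k) \<Longrightarrow> k < LL \<Longrightarrow> LAP ls a k = LAP ls a' k"
proof (induction ls arbitrary: a a')
  case (Cons p ls)
  obtain i u where p: "p = (i, u)" by (cases p)
  have "lmul DD NN EE (fvec i u) a k = lmul DD NN EE (fvec i u) a' k" if "k < LL" for k
    using that Cons.prems(1) unfolding LL_def by (intro lmul_cong) (auto simp: LL_def)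
  from Cons.IH[OF this Cons.prems(2)] show ?case by (simp add: LAP_def p)
qed (simp add: LAP_def)

lemma LAP_sub_smult:
  "closed a \<Longrightarrow> closed b \<Longrightarrow> c \<in> carrier R \<Longrightarrow>
    LAP ls (\<lambda>x. a x \<ominus> c \<otimes> b x) = (\<lambda>x. LAP ls a x \<ominus> c \<otimes> LAP ls b x)"
proof (induction ls arbitrary: a b)
  case (Cons p ls)
  obtain i u where p: "p = (i, u)" by (cases p)
  have "lmul DD NN EE (fvec i u) (\<lambda>x. a x \<ominus> c \<otimes> b x) =
      (\<lambda>x. lmul DD NN EE (fvec i u) a x \<ominus> c \<otimes> lmul DD NN EE (fvec i u) b x)"
    using Cons.prems by (intro lmul_sub_smult) (auto simp: closed_def fvec_closed)
  moreover have "closed (lmul DD NN EE (fvec i u) a)" "closed (lmul DD NN EE (fvec i u) b)"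
    using Cons.prems by (auto simp: closed_def fvec_closed intro!: lmul_closed)
  ultimately show ?case using Cons.IH Cons.prems(3) by (simp add: LAP_def p)
qed (simp add: LAP_def)

lemma LAP_outside: "\<not> k < LL \<Longrightarrow> LAP ls a k = a k"
proof (induction ls arbitrary: a)
  case (Cons p ls)
  then show ?case by (cases p) (simp add: LAP_def lmul_def LL_def)
qed (simp add: LAP_def)

text \<open>Continued by zero after \<open>LL\<close> cells, so that equality of rows is equality of
  the stored vectors and the neighbouring rows stay out of sight.\<close>

definition row :: "nat \<Rightarrow> 'f store \<Rightarrow> nat \<Rightarrow> nat \<Rightarrow> 'f" where
  "row a h \<rho> x = (if x < LL then fa h a (\<rho> * LL + x) else \<zero>)"

lemma row_closed: "fclosed R h \<Longrightarrow> closed (row a h \<rho>)"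
  by (simp add: closed_def row_def fclosed_def)

lemma row_cong: "fa g a = fa h a \<Longrightarrow> row a g = row a h"
  by (intro ext) (simp add: row_def)

lemma row_nv [simp]: "row a (g\<lparr>nv := f\<rparr>) \<rho> = row a g \<rho>"
  by (intro ext) (simp add: row_def)

section \<open>One level of the dynamic program: candidates and elimination\<close>

lemma block_div: "i < L \<Longrightarrow> (c * L + i) mod L = i" "i < L \<Longrightarrow> (c * L + i) div L = (c::nat)"
  by simp_all

lemma block_iff:
  fixes x L :: nat
  assumes "x < L"
  shows "\<rho> * L \<le> \<rho>' * L + x \<and> \<rho>' * L + x < \<rho> * L + L \<longleftrightarrow> \<rho>' = \<rho>"
proof
  assume a: "\<rho> * L \<le> \<rho>' * L + x \<and> \<rho>' * L + x < \<rho> * L + L"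
  have "\<rho>' * L < Suc \<rho> * L" using a by simp
  then have "\<rho>' \<le> \<rho>" using mult_less_cancel2[of \<rho>' L "Suc \<rho>"] by simp
  have "\<rho> * L < Suc \<rho>' * L" using a assms by simp
  then have "\<rho> \<le> \<rho>'" using mult_less_cancel2[of \<rho> L "Suc \<rho>'"] by simp
  with \<open>\<rho>' \<le> \<rho>\<close> show "\<rho>' = \<rho>" by simp
qed (use assms in simp)

lemma row_block:
  assumes "fa g a = (\<lambda>k. if \<rho> * LL \<le> k \<and> k < \<rho> * LL + LL then f (k - \<rho> * LL) else fa h b k)"
  shows "row a g \<rho>' = (if \<rho>' = \<rho> then (\<lambda>x. if x < LL then f x else \<zero>) else row b h \<rho>')"
proof
  fix x
  show "row a g \<rho>' x = (if \<rho>' = \<rho> then (\<lambda>x. if x < LL then f x else \<zero>) else row b h \<rho>') x"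
    using block_iff[of x LL \<rho> \<rho>'] by (auto simp: row_def assms)
qed

lemma ex_cand:
  assumes h: "ready h" and hh: "nv h 14 < length hs" and lev: "nv h 12 < al"
    and c: "nv h 13 = c" and r: "nv h 15 + nv h 14 = \<rho>"
  shows "row 4 (ex R cand h) \<rho>' = (if \<rho>' = \<rho> then APP (hs ! nv h 14) (row 3 h c) else row 4 h \<rho>')" (is ?A)
    "row 5 (ex R cand h) \<rho>' = (if \<rho>' = \<rho> then APP (hs ! nv h 14) (row 3 h c) else row 5 h \<rho>')" (is ?B)
    "ra (ex R cand h) 1 = (ra h 1)(\<rho> := ra h 0 c + wt (nv h 14))" (is ?C)
    "j < al \<Longrightarrow> na (ex R cand h) 5 (\<rho>' * al + j) =
       (if \<rho>' = \<rho> then if j = nv h 12 then nv h 14 else na h 4 (c * al + j) else na h 5 (\<rho>' * al + j))"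
proof -
  have dm: "nv h 9 = LL" "nv h 3 = al" using h by (auto simp: ready_def dims_def LL_def)
  define h1 where "h1 = ex R (SetN 16 (NPlus (NV 15) (NV 14)) ;; mulc 17 13 9 ;; mulc 18 16 9 ;; mulc 19 13 3 ;; mulc 20 16 3) h"
  have h1: "h1 = h\<lparr>nv := (nv h)(16 := \<rho>, 17 := c * LL, 18 := \<rho> * LL, 19 := c * al, 20 := \<rho> * al, 39 := al)\<rparr>"
    unfolding h1_def using dm c r by (simp add: ex_mulc fun_upd_twist)
  have rh1: "ready h1" unfolding h1_def by (rule ready_ex[OF h]) (auto simp: mulc_def)
  define h2 where "h2 = ex R (copyF 31 9 0 (NC 0) 3 (NV 17)) h1"
  have rh2: "ready h2" unfolding h2_def by (rule ready_ex[OF rh1]) (auto simp: copyF_def)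
  have h2: "fa h2 0 k = row 3 h c k" if "k < LL" for k
    using that dm unfolding h2_def by (simp add: ex_copyF h1 row_def)
  define h3 where "h3 = ex R app h2"
  have rh3: "ready h3" unfolding h3_def by (rule ready_ex[OF rh2]) auto
  have s2: "same (copyF 31 9 0 (NC 0) 3 (NV 17)) h1 h2" unfolding h2_def by (rule same_ex)
  have s3: "same app h2 h3" unfolding h3_def by (rule same_ex)
  have n3: "nv h3 z = nv h1 z" if "z \<in> {3, 9, 12, 13, 14, 16, 18, 19, 20}" for z
    using that sameD(1)[OF s3, of z] sameD(1)[OF s2, of z] by (auto simp: copyF_def)
  have nv3: "nv h3 3 = al" "nv h3 9 = LL" "nv h3 12 = nv h 12" "nv h3 13 = c" "nv h3 14 = nv h 14"
    "nv h3 16 = \<rho>" "nv h3 18 = \<rho> * LL" "nv h3 19 = c * al" "nv h3 20 = \<rho> * al"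
    using n3 dm c by (simp_all add: h1)
  have a3: "fa h3 4 = fa h 4" "fa h3 5 = fa h 5" "ra h3 = ra h" "na h3 = na h"
    using sameD[OF s3] sameD[OF s2] by (auto simp: copyF_def h1)
  have fa0: "fa h3 0 k = APP (hs ! nv h 14) (row 3 h c) k" if "k < LL" for k
  proof -
    have "nv h2 14 = nv h 14" using sameD(1)[OF s2, of 14] by (simp add: copyF_def h1)
    then have "fa h3 0 k = APP (hs ! nv h 14) (fa h2 0) k" using ex_app[OF rh2] hh by (simp add: h3_def)
    also have "\<dots> = APP (hs ! nv h 14) (row 3 h c) k" unfolding APP_LAP by (rule LAP_cong) (use h2 that in auto)
    finally show ?thesis .
  qed
  \<comment> \<open>Beyond \<open>LL\<close> both sides are zero, since \<open>LAP_outside\<close>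
    returns the entry of the truncated row.\<close>
  have tr: "(\<lambda>x. if x < LL then fa h3 0 x else \<zero>) = APP (hs ! nv h 14) (row 3 h c)"
    using fa0 by (auto simp: APP_LAP LAP_outside row_def)
  have ri: "cell (br h3) (ri h3) B (nv h 14 + 100) = wt (nv h 14)" for B
    using rh3 hh by (simp add: ready_def cell_def)
  define h4 where "h4 = ex R (copyF 31 9 4 (NV 18) 0 (NC 0) ;; copyF 31 9 5 (NV 18) 0 (NC 0) ;;
     SetRA 1 (NV 16) (RPlus (RA 0 (NV 13)) (RI (NV 14))) ;;
     copyN 31 3 5 (NV 20) 4 (NV 19) ;; SetNA 5 (NPlus (NV 20) (NV 12)) (NV 14)) h3"
  have cand: "ex R cand h = h4" by (simp add: cand_def h4_def h3_def h2_def h1_def)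
  have f4: "fa h4 4 = (\<lambda>k. if \<rho> * LL \<le> k \<and> k < \<rho> * LL + LL then fa h3 0 (k - \<rho> * LL) else fa h 4 k)"
    "fa h4 5 = (\<lambda>k. if \<rho> * LL \<le> k \<and> k < \<rho> * LL + LL then fa h3 0 (k - \<rho> * LL) else fa h 5 k)"
    by (simp_all add: h4_def ex_copyF ex_copyN nv3 a3 cong: if_cong)
  show ?A unfolding cand using row_block[OF f4(1)] unfolding tr .
  show ?B unfolding cand using row_block[OF f4(2)] unfolding tr .
  show ?C unfolding cand by (simp add: h4_def ex_copyF ex_copyN nv3 a3 ri)
  have n4: "na h4 5 k = (if k = \<rho> * al + nv h 12 then nv h 14
      else if \<rho> * al \<le> k \<and> k < \<rho> * al + al then na h 4 (c * al + (k - \<rho> * al)) else na h 5 k)" for k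
    by (simp add: h4_def ex_copyF ex_copyN nv3 a3 cong: if_cong)
  assume j: "j < al"
  have "\<rho>' * al + j = \<rho> * al + nv h 12 \<longleftrightarrow> \<rho>' = \<rho> \<and> j = nv h 12"
    using block_iff[OF j, of \<rho> \<rho>'] lev by auto
  then show "na (ex R cand h) 5 (\<rho>' * al + j) =
       (if \<rho>' = \<rho> then if j = nv h 12 then nv h 14 else na h 4 (c * al + j) else na h 5 (\<rho>' * al + j))"
    unfolding cand n4 using block_iff[OF j, of \<rho> \<rho>'] by auto
qed

text \<open>Quotient and remainder of the row number recover the slot and the member;
  \<open>h\<close> is the store before the candidates are formed.\<close>

definition cand_ok :: "'f store \<Rightarrow> 'f store \<Rightarrow> nat \<Rightarrow> bool" where
  "cand_ok h g \<rho> \<longleftrightarrow> (let hh = \<rho> mod length hs; c = \<rho> div length hs in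
     row 4 g \<rho> = APP (hs ! hh) (row 3 h c) \<and> row 5 g \<rho> = row 4 g \<rho> \<and> ra g 1 \<rho> = ra h 0 c + wt hh \<and>
     (\<forall>j<al. na g 5 (\<rho> * al + j) = (if j = nv h 12 then hh else na h 4 (c * al + j))))"

lemma cand_ok_nv [simp]: "cand_ok h (g\<lparr>nv := f\<rparr>) \<rho> = cand_ok h g \<rho>"
  by (simp add: cand_ok_def)

text \<open>The second claim is needed for an empty family: no candidate is formed, but the
  elimination still copies row 0 of array 4 into the slots, and this row has to be zero.\<close>

lemma ex_cands:
  assumes h: "ready h" and lev: "nv h 12 < al"
  shows "\<rho> < NR \<Longrightarrow> cand_ok h (ex R cands h) \<rho>"
    "length hs = 0 \<Longrightarrow> fa (ex R cands h) 4 = fa h 4"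
proof -
  let ?nH = "length hs"
  let ?c = "mulc 15 13 4 ;; For 14 4 cand"
  have "(\<forall>\<rho><nv h 9 * ?nH. cand_ok h (ex R (For 13 9 ?c) h) \<rho>) \<and>
    (?nH = 0 \<longrightarrow> fa (ex R (For 13 9 ?c) h) 4 = fa h 4)"
  proof (rule For_rule_closed[where I = "\<lambda>i k. (\<forall>\<rho><i * ?nH. cand_ok h k \<rho>) \<and> (?nH = 0 \<longrightarrow> fa k 4 = fa h 4)"])
    show "fclosed R h" using h by (rule ready_fclosed)
  next
    fix c k assume c: "c < nv h 9" "nv k 13 = c" and same: "same (For 13 9 ?c) h k" and "fclosed R k"
      and I: "(\<forall>\<rho><c * ?nH. cand_ok h k \<rho>) \<and> (?nH = 0 \<longrightarrow> fa k 4 = fa h 4)"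
    have rk: "ready k" by (rule ready_same[OF same h]) (use \<open>fclosed R k\<close> in \<open>auto simp: mulc_def\<close>)
    have nk: "nv k 4 = ?nH" using rk by (simp add: ready_def)
    let ?k = "k\<lparr>nv := (nv k)(15 := c * ?nH, 39 := ?nH)\<rparr>"
    have m: "ex R (mulc 15 13 4) k = ?k" using c nk by (simp add: ex_mulc)
    have rk': "ready ?k" unfolding m[symmetric] by (rule ready_ex[OF rk]) (auto simp: mulc_def)
    have sk: "nv ?k 12 = nv h 12" "fa ?k 3 = fa h 3" "ra ?k 0 = ra h 0" "na ?k 4 = na h 4"
      using sameD[OF same] by (simp_all add: mulc_def)
    have "(\<forall>\<rho><c * ?nH + nv ?k 4. cand_ok h (ex R (For 14 4 cand) ?k) \<rho>) \<and>
       (?nH = 0 \<longrightarrow> fa (ex R (For 14 4 cand) ?k) 4 = fa h 4)"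
    proof (rule For_rule_closed[where I = "\<lambda>i k. (\<forall>\<rho><c * ?nH + i. cand_ok h k \<rho>) \<and> (?nH = 0 \<longrightarrow> fa k 4 = fa h 4)"])
      show "(\<forall>\<rho><c * ?nH + 0. cand_ok h (?k\<lparr>nv := (nv ?k)(14 := 0)\<rparr>) \<rho>) \<and>
        (?nH = 0 \<longrightarrow> fa (?k\<lparr>nv := (nv ?k)(14 := 0)\<rparr>) 4 = fa h 4)"
        using I by simp
    next
      fix i s assume i: "i < nv ?k 4" "nv s 14 = i" and same': "same (For 14 4 cand) ?k s" and "fclosed R s"
        and J: "(\<forall>\<rho><c * ?nH + i. cand_ok h s \<rho>) \<and> (?nH = 0 \<longrightarrow> fa s 4 = fa h 4)"
      have i': "i < ?nH" using i nk by simp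
      have rs: "ready s" by (rule ready_same[OF same' rk']) (use \<open>fclosed R s\<close> in auto)
      have ss: "nv s 12 = nv h 12" "nv s 13 = c" "nv s 15 = c * ?nH" "fa s 3 = fa h 3" "ra s 0 = ra h 0" "na s 4 = na h 4"
        using sameD[OF same'] sk c by simp_all
      have row3: "row 3 s c' = row 3 h c'" for c' using row_cong[OF ss(4)] by simp
      note E = ex_cand[OF rs _ _ ss(2), of "c * ?nH + i", unfolded i(2) ss row3]
      have dm: "(c * ?nH + i) mod ?nH = i" "(c * ?nH + i) div ?nH = c" using block_div[OF i'] .
      have "cand_ok h (ex R cand s) \<rho>" if "\<rho> < c * ?nH + Suc i" for \<rho>
      proof (cases "\<rho> = c * ?nH + i")
        case True
        then show ?thesis using E i' lev dm by (simp add: cand_ok_def)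
      next
        case False
        then have "cand_ok h s \<rho>" using J that by simp
        then show ?thesis using E i' lev False by (simp add: cand_ok_def)
      qed
      then show "(\<forall>\<rho><c * ?nH + Suc i. cand_ok h ((ex R cand s)\<lparr>nv := (nv (ex R cand s))(14 := Suc i)\<rparr>) \<rho>) \<and>
         (?nH = 0 \<longrightarrow> fa ((ex R cand s)\<lparr>nv := (nv (ex R cand s))(14 := Suc i)\<rparr>) 4 = fa h 4)"
        using i' by auto
    qed (use ready_fclosed[OF rk'] in simp_all)
    then show "(\<forall>\<rho><Suc c * ?nH. cand_ok h ((ex R ?c k)\<lparr>nv := (nv (ex R ?c k))(13 := Suc c)\<rparr>) \<rho>) \<and>
         (?nH = 0 \<longrightarrow> fa ((ex R ?c k)\<lparr>nv := (nv (ex R ?c k))(13 := Suc c)\<rparr>) 4 = fa h 4)"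
      using m nk by (simp add: add.commute)
  qed (auto simp: mulc_def)
  moreover have "nv h 9 = LL" using h by (simp add: ready_def dims_def LL_def)
  ultimately show "\<rho> < NR \<Longrightarrow> cand_ok h (ex R cands h) \<rho>"
    "length hs = 0 \<Longrightarrow> fa (ex R cands h) 4 = fa h 4" by (auto simp: cands_def NR_def)
qed

lemma ex_findbest:
  assumes h: "ready h"
  defines "b \<equiv> nv (ex R findbest h) 33"
  shows "b < NR \<or> NR = 0 \<and> b = 0"
    "\<rho> < NR \<Longrightarrow> fa h 5 (\<rho> * LL + nv h 32) \<noteq> \<zero> \<Longrightarrow>
      fa h 5 (b * LL + nv h 32) \<noteq> \<zero> \<and> ra h 1 \<rho> \<le> ra h 1 b"
proof -
  let ?z = "\<lambda>\<rho>. fa h 5 (\<rho> * LL + nv h 32) \<noteq> \<zero>"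
  let ?c = "mulc 18 16 9 ;;
       Cond (BFEq (FA 5 (NPlus (NV 18) (NV 32))) F0) Skip
         (Cond (BLe (NC 1) (NV 34))
           (Cond (BRLe (RA 1 (NV 33)) (RA 1 (NV 16))) (SetN 33 (NV 16)) Skip)
           (SetN 33 (NV 16) ;; SetN 34 (NC 1)))"
  let ?h = "h\<lparr>nv := (nv h)(33 := 0, 34 := 0)\<rparr>"
  define I where "I i g \<longleftrightarrow> (nv g 34 = 0 \<longrightarrow> nv g 33 = 0 \<and> (\<forall>\<rho><i. \<not> ?z \<rho>)) \<and>
    (nv g 34 \<noteq> 0 \<longrightarrow> nv g 33 < i \<and> ?z (nv g 33) \<and> (\<forall>\<rho><i. ?z \<rho> \<longrightarrow> ra h 1 \<rho> \<le> ra h 1 (nv g 33)))"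
    for i and g :: "'f store"
  have "I (nv ?h 10) (ex R (For 16 10 ?c) ?h)"
  proof (rule For_rule)
    show "I 0 (?h\<lparr>nv := (nv ?h)(16 := 0)\<rparr>)" by (simp add: I_def)
  next
    fix i g assume i: "i < nv ?h 10" "nv g 16 = i" and same: "same (For 16 10 ?c) ?h g" and I: "I i g"
    have s: "nv g 32 = nv h 32" "nv g 9 = LL" "fa g = fa h" "ra g = ra h"
      using sameD[OF same] h by (auto simp: mulc_def ready_def dims_def LL_def)
    show "I (Suc i) ((ex R ?c g)\<lparr>nv := (nv (ex R ?c g))(16 := Suc i)\<rparr>)"
    proof (cases "?z i")
      case False
      then show ?thesis using I s i by (simp add: ex_mulc I_def less_Suc_eq)
    next
      case nz: True
      show ?thesis
      proof (cases "nv g 34 = 0")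
        case True
        then show ?thesis using I s i nz by (auto simp: ex_mulc I_def less_Suc_eq)
      next
        case False
        then have I': "nv g 33 < i" "?z (nv g 33)" "\<forall>\<rho><i. ?z \<rho> \<longrightarrow> ra h 1 \<rho> \<le> ra h 1 (nv g 33)"
          using I unfolding I_def by blast+
        show ?thesis
        proof (cases "ra h 1 (nv g 33) \<le> ra h 1 i")
          case True
          then have "\<forall>\<rho><i. ?z \<rho> \<longrightarrow> ra h 1 \<rho> \<le> ra h 1 i" using I'(3) by fastforce
          then show ?thesis using True False s i nz by (auto simp: ex_mulc I_def less_Suc_eq)
        next
          case le: False
          then show ?thesis using I' False s i nz by (auto simp: ex_mulc I_def less_Suc_eq)
        qed
      qed
    qed
  qed (auto simp: mulc_def)
  moreover have "ex R (For 16 10 ?c) ?h = ex R findbest h" by (simp add: findbest_def)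
  moreover have "nv ?h 10 = NR" using h by (simp add: ready_def)
  ultimately have I: "I NR (ex R findbest h)" by simp
  show "b < NR \<or> NR = 0 \<and> b = 0" using I unfolding b_def I_def by (cases "NR = 0") auto
  show "\<rho> < NR \<Longrightarrow> ?z \<rho> \<Longrightarrow> ?z b \<and> ra h 1 \<rho> \<le> ra h 1 b"
    using I unfolding b_def I_def by blast
qed

lemma ex_elimrow:
  assumes h: "ready h"
  shows "row 5 (ex R elimrow h) \<rho> = (if \<rho> = nv h 16 then
     (\<lambda>x. if x < LL then row 5 h \<rho> x \<ominus> fa h 5 (\<rho> * LL + nv h 32) \<otimes> fa h 6 x else \<zero>) else row 5 h \<rho>)"
proof -
  let ?r = "nv h 16"
  let ?fac = "fa h 5 (?r * LL + nv h 32)"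
  let ?c = "SetFA 5 (NPlus (NV 18) (NV 31))
       (FMinus (FA 5 (NPlus (NV 18) (NV 31))) (FTimes (FV 2) (FA 6 (NV 31))))"
  have dm: "nv h 9 = LL" using h by (auto simp: ready_def dims_def LL_def)
  let ?h = "h\<lparr>nv := (nv h)(18 := ?r * LL, 39 := LL), fv := (fv h)(2 := ?fac)\<rparr>"
  let ?A = "\<lambda>i k. if ?r * LL \<le> k \<and> k < ?r * LL + i then fa h 5 k \<ominus> ?fac \<otimes> fa h 6 (k - ?r * LL) else fa h 5 k"
  have "\<forall>x. fa (ex R (For 31 9 ?c) ?h) 5 x = ?A (nv ?h 9) x"
  proof (rule For_rule[where I = "\<lambda>i k. \<forall>x. fa k 5 x = ?A i x"])
    fix i k assume i: "i < nv ?h 9" "nv k 31 = i" and same: "same (For 31 9 ?c) ?h k"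
      and I: "\<forall>x. fa k 5 x = ?A i x"
    have s: "nv k 18 = ?r * LL" "fv k 2 = ?fac" "fa k 6 = fa h 6" using sameD[OF same] by simp_all
    have u: "fa (ex R ?c k) 5 x = (if x = ?r * LL + i then fa h 5 x \<ominus> ?fac \<otimes> fa h 6 i else fa k 5 x)" for x
      using i s I by simp
    show "\<forall>x. fa ((ex R ?c k)\<lparr>nv := (nv (ex R ?c k))(31 := Suc i)\<rparr>) 5 x = ?A (Suc i) x"
    proof
      fix x
      have "fa ((ex R ?c k)\<lparr>nv := (nv (ex R ?c k))(31 := Suc i)\<rparr>) 5 x = fa (ex R ?c k) 5 x"
        by (simp del: ex.simps)
      also have "\<dots> = ?A (Suc i) x" unfolding u using I by auto
      finally show "fa ((ex R ?c k)\<lparr>nv := (nv (ex R ?c k))(31 := Suc i)\<rparr>) 5 x = ?A (Suc i) x" .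
    qed
  qed auto
  moreover have "ex R elimrow h = ex R (For 31 9 ?c) ?h" using dm by (simp add: elimrow_def ex_mulc)
  ultimately have f: "fa (ex R elimrow h) 5 = (\<lambda>k. if ?r * LL \<le> k \<and> k < ?r * LL + LL
      then fa h 5 (?r * LL + (k - ?r * LL)) \<ominus> ?fac \<otimes> fa h 6 (k - ?r * LL) else fa h 5 k)"
    using dm by auto
  show ?thesis
    using row_block[of "ex R elimrow h" 5 ?r "\<lambda>x. fa h 5 (?r * LL + x) \<ominus> ?fac \<otimes> fa h 6 x" h 5 \<rho>] f
    by (auto simp: row_def)
qed

text \<open>The inverse of zero being zero, nothing happens when the chosen column vanishes.\<close>

definition pinv :: "'f \<Rightarrow> 'f" where
  "pinv a = (if a = \<zero> then \<zero> else inv a)"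

lemma pinv: "a \<in> carrier R \<Longrightarrow> pinv a \<in> carrier R" "a \<in> carrier R \<Longrightarrow> a \<noteq> \<zero> \<Longrightarrow> pinv a \<otimes> a = \<one>"
  by (auto simp: pinv_def field_Units)

lemma ex_elimcol:
  assumes h: "ready h" and col: "nv h 32 < LL"
  obtains b where "b < NR \<or> NR = 0 \<and> b = 0"
    "\<And>\<rho>. \<rho> < NR \<Longrightarrow> row 5 h \<rho> (nv h 32) \<noteq> \<zero> \<Longrightarrow>
      row 5 h b (nv h 32) \<noteq> \<zero> \<and> ra h 1 \<rho> \<le> ra h 1 b"
    "\<And>\<rho>. \<rho> < NR \<Longrightarrow> row 5 (ex R elimcol h) \<rho> = (\<lambda>x. row 5 h \<rho> x \<ominus>
       (row 5 h \<rho> (nv h 32) \<otimes> pinv (row 5 h b (nv h 32))) \<otimes> row 5 h b x)"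
    "\<And>c. row 3 (ex R elimcol h) c = (if c = nv h 32 then row 4 h b else row 3 h c)"
    "ra (ex R elimcol h) 0 = (ra h 0)(nv h 32 := ra h 1 b)"
    "\<And>c j. j < al \<Longrightarrow> na (ex R elimcol h) 4 (c * al + j) =
       (if c = nv h 32 then na h 5 (b * al + j) else na h 4 (c * al + j))"
proof -
  let ?col = "nv h 32"
  define h1 where "h1 = ex R findbest h"
  define b where "b = nv h1 33"
  have s1: "same findbest h h1" unfolding h1_def by (rule same_ex)
  have r1: "ready h1" unfolding h1_def by (rule ready_ex[OF h]) auto
  have b: "b < NR \<or> NR = 0 \<and> b = 0"
    "\<And>\<rho>. \<rho> < NR \<Longrightarrow> row 5 h \<rho> ?col \<noteq> \<zero> \<Longrightarrow> row 5 h b ?col \<noteq> \<zero> \<and> ra h 1 \<rho> \<le> ra h 1 b"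
    using ex_findbest[OF h] col by (auto simp: b_def h1_def row_def)
  have e1: "fa h1 = fa h" "ra h1 = ra h" "na h1 = na h" "nv h1 32 = ?col" "nv h1 9 = LL" "nv h1 3 = al" "nv h1 10 = NR"
    using sameD[OF s1] r1 by (auto simp: ready_def dims_def LL_def)
  have cl: "fa h a k \<in> carrier R" for a k using ready_fclosed[OF h] by (simp add: fclosed_def)
  let ?p = "fa h 5 (b * LL + ?col)"
  let ?h2 = "h1\<lparr>nv := (nv h1)(17 := b * LL, 39 := LL), fv := (fv h1)(3 := pinv ?p)\<rparr>"
  have h2: "ex R (mulc 17 33 9 ;; SetF 3 (FInverse (FA 5 (NPlus (NV 17) (NV 32))))) h1 = ?h2"
    using e1 by (simp add: ex_mulc b_def pinv_def)
  \<comment> \<open>The normalized pivot row is saved in array 6 beforehand, because the loop over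
    all rows may turn the pivot row itself into zero.\<close>
  let ?c = "SetFA 6 (NV 31) (FTimes (FV 3) (FA 5 (NPlus (NV 17) (NV 31))))"
  define h3 where "h3 = ex R (For 31 9 ?c) ?h2"
  have s3: "same (For 31 9 ?c) ?h2 h3" unfolding h3_def by (rule same_ex)
  have r2: "ready ?h2" unfolding h2[symmetric] by (rule ready_ex[OF r1]) (auto simp: mulc_def)
  have r3: "ready h3" unfolding h3_def by (rule ready_ex[OF r2]) auto
  have "\<forall>x<nv ?h2 9. fa h3 6 x = pinv ?p \<otimes> fa h 5 (b * LL + x)"
    unfolding h3_def
  proof (rule For_rule[where I = "\<lambda>i k. \<forall>x<i. fa k 6 x = pinv ?p \<otimes> fa h 5 (b * LL + x)"])
    fix i k assume i: "i < nv ?h2 9" "nv k 31 = i" and same: "same (For 31 9 ?c) ?h2 k"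
      and I: "\<forall>x<i. fa k 6 x = pinv ?p \<otimes> fa h 5 (b * LL + x)"
    have "nv k 17 = b * LL" "fv k 3 = pinv ?p" "fa k 5 = fa h 5" using sameD[OF same] e1 by simp_all
    then show "\<forall>x<Suc i. fa ((ex R ?c k)\<lparr>nv := (nv (ex R ?c k))(31 := Suc i)\<rparr>) 6 x = pinv ?p \<otimes> fa h 5 (b * LL + x)"
      using I i by (auto simp: less_Suc_eq)
  qed auto
  then have tmp: "fa h3 6 x = pinv ?p \<otimes> row 5 h b x" if "x < LL" for x using that e1 by (simp add: row_def)
  have e3: "fa h3 3 = fa h 3" "fa h3 4 = fa h 4" "fa h3 5 = fa h 5" "ra h3 = ra h" "na h3 = na h" "nv h3 32 = ?col" "nv h3 9 = LL"
    "nv h3 3 = al" "nv h3 10 = NR" "nv h3 17 = b * LL" "nv h3 33 = b"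
    using sameD[OF s3] e1 by (auto simp: b_def)
  define h4 where "h4 = ex R (For 16 10 elimrow) h3"
  have s4: "same (For 16 10 elimrow) h3 h4" unfolding h4_def by (rule same_ex)
  let ?red = "\<lambda>\<rho> x. if x < LL then row 5 h \<rho> x \<ominus> fa h 5 (\<rho> * LL + ?col) \<otimes> fa h3 6 x else \<zero>"
  have R5: "\<forall>\<rho>. row 5 h4 \<rho> = (if \<rho> < nv h3 10 then ?red \<rho> else row 5 h \<rho>)"
    unfolding h4_def
  proof (rule For_rule_closed[where I = "\<lambda>i k. \<forall>\<rho>. row 5 k \<rho> = (if \<rho> < i then ?red \<rho> else row 5 h \<rho>)"])
    fix i k assume i: "i < nv h3 10" "nv k 16 = i" and same: "same (For 16 10 elimrow) h3 k" and "fclosed R k"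
      and I: "\<forall>\<rho>. row 5 k \<rho> = (if \<rho> < i then ?red \<rho> else row 5 h \<rho>)"
    have rk: "ready k" by (rule ready_same[OF same r3]) (use \<open>fclosed R k\<close> in auto)
    have s: "nv k 32 = ?col" "fa k 6 = fa h3 6" using sameD[OF same] e3 by simp_all
    have Ii: "row 5 k i = row 5 h i" using I by simp
    then have "fa k 5 (i * LL + ?col) = fa h 5 (i * LL + ?col)"
      using fun_cong[OF Ii, of ?col, unfolded row_def] col by simp
    then have "row 5 (ex R elimrow k) \<rho> = (if \<rho> = i then ?red i else row 5 k \<rho>)" for \<rho>
      using ex_elimrow[OF rk, of \<rho>] Ii i s by (cases "\<rho> = i") (simp_all cong: if_cong)
    then show "\<forall>\<rho>. row 5 ((ex R elimrow k)\<lparr>nv := (nv (ex R elimrow k))(16 := Suc i)\<rparr>) \<rho> =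
        (if \<rho> < Suc i then ?red \<rho> else row 5 h \<rho>)"
      using I by (simp add: less_Suc_eq)
  qed (use ready_fclosed[OF r3] row_cong[OF e3(3)] in auto)
  have row5: "row 5 h4 \<rho> = (\<lambda>x. row 5 h \<rho> x \<ominus> (row 5 h \<rho> ?col \<otimes> pinv (row 5 h b ?col)) \<otimes> row 5 h b x)"
    if "\<rho> < NR" for \<rho>
  proof -
    have "row 5 h4 \<rho> = ?red \<rho>" using R5 that e3 by simp
    also have "\<dots> = (\<lambda>x. row 5 h \<rho> x \<ominus> (row 5 h \<rho> ?col \<otimes> pinv (row 5 h b ?col)) \<otimes> row 5 h b x)"
      using col cl pinv(1)[OF cl] by (auto simp: tmp row_def m_assoc minus_eq)
    finally show ?thesis .
  qed
  have e4: "fa h4 3 = fa h 3" "fa h4 4 = fa h 4" "ra h4 = ra h" "na h4 = na h" "nv h4 32 = ?col" "nv h4 9 = LL"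
    "nv h4 3 = al" "nv h4 17 = b * LL" "nv h4 33 = b"
    using sameD[OF s4] e3 by auto
  define h5 where "h5 = ex R (mulc 18 32 9 ;; copyF 31 9 3 (NV 18) 4 (NV 17) ;; SetRA 0 (NV 32) (RA 1 (NV 33)) ;;
     mulc 19 32 3 ;; mulc 20 33 3 ;; copyN 31 3 4 (NV 19) 5 (NV 20)) h4"
  have h5: "ex R elimcol h = h5"
  proof -
    have "ex R elimcol h = ex R (mulc 18 32 9 ;; copyF 31 9 3 (NV 18) 4 (NV 17) ;; SetRA 0 (NV 32) (RA 1 (NV 33)) ;;
     mulc 19 32 3 ;; mulc 20 33 3 ;; copyN 31 3 4 (NV 19) 5 (NV 20)) (ex R (For 16 10 elimrow) (ex R (For 31 9 ?c)
      (ex R (mulc 17 33 9 ;; SetF 3 (FInverse (FA 5 (NPlus (NV 17) (NV 32))))) (ex R findbest h))))"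
      by (simp only: elimcol_def ex.simps(8))
    then show ?thesis unfolding h1_def[symmetric] h2 h3_def[symmetric] h4_def[symmetric] h5_def[symmetric] .
  qed
  have f5: "fa h5 3 = (\<lambda>k. if ?col * LL \<le> k \<and> k < ?col * LL + LL then fa h 4 (b * LL + (k - ?col * LL)) else fa h 3 k)"
    "fa h5 5 = fa h4 5"
    by (simp_all add: h5_def ex_mulc ex_copyF ex_copyN e4 cong: if_cong)
  have row3: "row 3 h5 c = (if c = ?col then row 4 h b else row 3 h c)" for c
    using row_block[OF f5(1), of c] by (auto simp: row_def)
  have ra5: "ra h5 0 = (ra h 0)(?col := ra h 1 b)"
    by (simp add: h5_def ex_mulc ex_copyF ex_copyN e4)
  have n5: "na h5 4 k = (if ?col * al \<le> k \<and> k < ?col * al + al then na h 5 (b * al + (k - ?col * al)) else na h 4 k)" for k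
    by (simp add: h5_def ex_mulc ex_copyF ex_copyN e4)
  have na5: "na h5 4 (c * al + j) = (if c = ?col then na h 5 (b * al + j) else na h 4 (c * al + j))" if "j < al" for c j
    unfolding n5 using block_iff[OF that, of ?col c] by auto
  show ?thesis
  proof (rule that[of b])
    show "\<And>\<rho>. \<rho> < NR \<Longrightarrow> row 5 (ex R elimcol h) \<rho> = (\<lambda>x. row 5 h \<rho> x \<ominus>
       (row 5 h \<rho> ?col \<otimes> pinv (row 5 h b ?col)) \<otimes> row 5 h b x)"
      unfolding h5 using row5 row_cong[OF f5(2)] by simp
  qed (use b row3 ra5 na5 h5 in auto)
qed

lemma linear_combine:
  assumes "linear \<Phi>" "closed a" "closed b" "c \<in> carrier R"
  shows "\<Phi> (\<lambda>x. a x \<ominus> c \<otimes> b x) = \<Phi> a \<ominus> c \<otimes> \<Phi> b"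
  using assms unfolding linear_def by blast

lemma linear_closed: "linear \<Phi> \<Longrightarrow> closed a \<Longrightarrow> \<Phi> a \<in> carrier R"
  unfolding linear_def by blast

text \<open>Spans are handled through their annihilators: a linear functional that vanishes on all chosen
  vectors of weight at least that of a row does not see the elimination steps applied to this row.\<close>

lemma ex_elim:
  assumes h: "ready h" and r5: "\<And>\<rho>. \<rho> < NR \<Longrightarrow> row 5 h \<rho> = row 4 h \<rho>"
  defines "g \<equiv> ex R (For 32 9 elimcol) h"
  shows "\<And>\<rho> \<Phi>. \<rho> < NR \<Longrightarrow> linear \<Phi> \<Longrightarrow> \<Phi> (row 4 h \<rho>) \<noteq> \<zero> \<Longrightarrow>
      \<exists>c<LL. ra h 1 \<rho> \<le> ra g 0 c \<and> \<Phi> (row 3 g c) \<noteq> \<zero>"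
    "\<And>c. c < LL \<Longrightarrow> \<exists>b. (b < NR \<or> NR = 0 \<and> b = 0) \<and> row 3 g c = row 4 h b \<and> ra g 0 c = ra h 1 b \<and>
      (\<forall>j<al. na g 4 (c * al + j) = na h 5 (b * al + j))"
proof -
  have L9: "nv h 9 = LL" using h by (simp add: ready_def dims_def LL_def)
  \<comment> \<open>Three parts: all columns below \<open>i\<close> are cleared; the tests that
    cannot distinguish an original row from its reduced form; and every slot filled so far is a copy
    of a candidate together with its weight and selection.\<close>
  define I where "I i k \<longleftrightarrow> (\<forall>\<rho><NR. \<forall>x<i. row 5 k \<rho> x = \<zero>) \<and>
    (\<forall>\<rho><NR. \<forall>\<Phi>. linear \<Phi> \<longrightarrow> (\<forall>c<i. ra h 1 \<rho> \<le> ra k 0 c \<longrightarrow> \<Phi> (row 3 k c) = \<zero>) \<longrightarrow>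
      \<Phi> (row 4 h \<rho>) = \<Phi> (row 5 k \<rho>)) \<and>
    (\<forall>c<i. \<exists>b. (b < NR \<or> NR = 0 \<and> b = 0) \<and> row 3 k c = row 4 h b \<and> ra k 0 c = ra h 1 b \<and>
      (\<forall>j<al. na k 4 (c * al + j) = na h 5 (b * al + j)))" for i and k :: "'f store"
  have "I (nv h 9) g" unfolding g_def
  proof (rule For_rule_closed)
    show "fclosed R h" using h by (rule ready_fclosed)
    show "I 0 (h\<lparr>nv := (nv h)(32 := 0)\<rparr>)" using r5 by (simp add: I_def row_nv[abs_def])
  next
    fix i k assume i: "i < nv h 9" "nv k 32 = i" and same: "same (For 32 9 elimcol) h k" and clk: "fclosed R k"
      and I: "I i k"
    have rk: "ready k" by (rule ready_same[OF same h]) (use clk in auto)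
    have s: "fa k 4 = fa h 4" "ra k 1 = ra h 1" "na k 5 = na h 5" using sameD[OF same] by simp_all
    have row4: "row 4 k = row 4 h" by (rule row_cong[OF s(1)])
    have i': "i < LL" using i L9 by simp
    let ?k = "ex R elimcol k"
    obtain b where b: "b < NR \<or> NR = 0 \<and> b = 0"
      and best: "\<And>\<rho>. \<rho> < NR \<Longrightarrow> row 5 k \<rho> i \<noteq> \<zero> \<Longrightarrow> row 5 k b i \<noteq> \<zero> \<and> ra h 1 \<rho> \<le> ra h 1 b"
      and n5: "\<And>\<rho>. \<rho> < NR \<Longrightarrow> row 5 ?k \<rho> =
         (\<lambda>x. row 5 k \<rho> x \<ominus> (row 5 k \<rho> i \<otimes> pinv (row 5 k b i)) \<otimes> row 5 k b x)"
      and n3: "\<And>c. row 3 ?k c = (if c = i then row 4 h b else row 3 k c)"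
      and nr: "ra ?k 0 = (ra k 0)(i := ra h 1 b)"
      and nn: "\<And>c j. j < al \<Longrightarrow> na ?k 4 (c * al + j) = (if c = i then na h 5 (b * al + j) else na k 4 (c * al + j))"
      using ex_elimcol[OF rk, unfolded i(2) row4 s, OF i'] by blast
    have cl: "closed (row a k \<rho>)" for a \<rho> by (rule row_closed[OF clk])
    then have cl': "row a k \<rho> x \<in> carrier R" for a \<rho> x by (simp add: closed_def)
    have q: "row 5 k \<rho> i \<otimes> pinv (row 5 k b i) \<in> carrier R" for \<rho> using cl' pinv(1) by simp
    have "row 5 ?k \<rho> x = \<zero>" if "\<rho> < NR" "x < Suc i" for \<rho> x
    proof (cases "x = i")
      case False
      then have "row 5 k \<rho> x = \<zero>" "row 5 k b x = \<zero>" using I b that unfolding I_def by auto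
      then show ?thesis using n5[OF that(1)] q by (simp add: minus_eq)
    next
      case True
      show ?thesis
      proof (cases "row 5 k \<rho> i = \<zero>")
        case z: True
        then show ?thesis using n5[OF that(1)] True cl' pinv(1)[OF cl', of 5 b i] by (simp add: minus_eq)
      next
        case False
        then have "pinv (row 5 k b i) \<otimes> row 5 k b i = \<one>" using best[OF that(1)] cl' pinv(2) by blast
        then show ?thesis using n5[OF that(1)] True cl' pinv(1)[OF cl', of 5 b i] by (simp add: m_assoc minus_eq r_neg)
      qed
    qed
    moreover have "\<Phi> (row 4 h \<rho>) = \<Phi> (row 5 ?k \<rho>)"
      if \<rho>: "\<rho> < NR" and \<Phi>: "linear \<Phi>"
        and kill: "\<forall>c<Suc i. ra h 1 \<rho> \<le> ra ?k 0 c \<longrightarrow> \<Phi> (row 3 ?k c) = \<zero>" for \<rho> \<Phi>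
    proof -
      have kill': "\<forall>c<i. ra h 1 \<rho> \<le> ra k 0 c \<longrightarrow> \<Phi> (row 3 k c) = \<zero>"
        using kill nr n3 by (metis fun_upd_other less_SucI nat_neq_iff)
      have 1: "\<Phi> (row 4 h \<rho>) = \<Phi> (row 5 k \<rho>)" using I \<rho> \<Phi> kill' unfolding I_def by blast
      have 2: "\<Phi> (row 5 ?k \<rho>) = \<Phi> (row 5 k \<rho>) \<ominus> (row 5 k \<rho> i \<otimes> pinv (row 5 k b i)) \<otimes> \<Phi> (row 5 k b)"
        unfolding n5[OF \<rho>] by (rule linear_combine[OF \<Phi> cl cl q])
      have \<Phi>cl: "\<Phi> (row 5 k \<rho>) \<in> carrier R" "\<Phi> (row 5 k b) \<in> carrier R" using linear_closed[OF \<Phi> cl] by auto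
      show ?thesis
      proof (cases "row 5 k \<rho> i = \<zero>")
        case True
        then show ?thesis using 1 2 \<Phi>cl pinv(1)[OF cl', of 5 b i] by (simp add: minus_eq)
      next
        case False
        then have le: "ra h 1 \<rho> \<le> ra h 1 b" using best[OF \<rho>] by blast
        have bN: "b < NR" using b \<rho> by auto
        have "\<Phi> (row 4 h b) = \<zero>" using kill le nr n3 by (metis fun_upd_same lessI)
        \<comment> \<open>The pivot \<open>b\<close> is at least as heavy as row \<rho>, so every
          slot at least as heavy as \<open>b\<close> is among those on which the functional
          vanishes, and the invariant also applies to row \<open>b\<close>.\<close>
        moreover have "\<forall>c<i. ra h 1 b \<le> ra k 0 c \<longrightarrow> \<Phi> (row 3 k c) = \<zero>" using kill' le by fastforce
        then have "\<Phi> (row 4 h b) = \<Phi> (row 5 k b)" using I bN \<Phi> unfolding I_def by blast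
        ultimately have "\<Phi> (row 5 k b) = \<zero>" by simp
        then show ?thesis using 1 2 \<Phi>cl q by (simp add: minus_eq)
      qed
    qed
    moreover have "\<exists>b. (b < NR \<or> NR = 0 \<and> b = 0) \<and> row 3 ?k c = row 4 h b \<and> ra ?k 0 c = ra h 1 b \<and>
      (\<forall>j<al. na ?k 4 (c * al + j) = na h 5 (b * al + j))" if "c < Suc i" for c
    proof (cases "c = i")
      case True
      then show ?thesis using b n3 nr nn by auto
    next
      case False
      then have "c < i" using that by simp
      then show ?thesis using I False n3 nr nn unfolding I_def by simp
    qed
    ultimately show "I (Suc i) (?k\<lparr>nv := (nv ?k)(32 := Suc i)\<rparr>)" by (simp add: I_def)
  qed auto
  then have I: "I LL g" by (simp add: L9)
  show "\<And>c. c < LL \<Longrightarrow> \<exists>b. (b < NR \<or> NR = 0 \<and> b = 0) \<and> row 3 g c = row 4 h b \<and> ra g 0 c = ra h 1 b \<and>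
      (\<forall>j<al. na g 4 (c * al + j) = na h 5 (b * al + j))"
    using I unfolding I_def by blast
  show "\<exists>c<LL. ra h 1 \<rho> \<le> ra g 0 c \<and> \<Phi> (row 3 g c) \<noteq> \<zero>"
    if \<rho>: "\<rho> < NR" and \<Phi>: "linear \<Phi>" and nz: "\<Phi> (row 4 h \<rho>) \<noteq> \<zero>" for \<rho> \<Phi>
  proof (rule ccontr)
    assume "\<not> ?thesis"
    then have "\<Phi> (row 4 h \<rho>) = \<Phi> (row 5 g \<rho>)" using I \<rho> \<Phi> unfolding I_def by blast
    \<comment> \<open>After all \<open>LL\<close> columns the reduced rows are zero, and so is every
      functional on them.\<close>
    moreover have "row 5 g \<rho> = (\<lambda>x. \<zero>)"
    proof
      fix x show "row 5 g \<rho> x = \<zero>" using I \<rho> unfolding I_def by (cases "x < LL") (auto simp: row_def)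
    qed
    ultimately show False using nz linear_zero[OF \<Phi>] by simp
  qed
qed

section \<open>The invariant of the dynamic program and the choice of the best slot\<close>

definition Vec :: "nat list \<Rightarrow> nat \<Rightarrow> 'f" where
  "Vec \<sigma> = foldl (\<lambda>a i. APP (hs ! i) a) (\<lambda>x. if x = 0 then \<one> else \<zero>) \<sigma>"

definition wsum :: "nat list \<Rightarrow> real" where
  "wsum \<sigma> = sum_list (map wt \<sigma>)"

definition seq :: "nat \<Rightarrow> 'f store \<Rightarrow> nat \<Rightarrow> nat list" where
  "seq lev h c = map (\<lambda>j. na h 4 (c * al + j)) [0..<lev]"

text \<open>The representation property: whatever linear test a selection of this length passes,
  some slot passes it with at least the same weight. A slot with nonzero vector holds a selection
  with this vector and weight; the other slots may contain anything.\<close>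

definition slots_ok :: "nat \<Rightarrow> 'f store \<Rightarrow> bool" where
  "slots_ok lev h \<longleftrightarrow>
     (\<forall>c<LL. row 3 h c \<noteq> (\<lambda>x. \<zero>) \<longrightarrow> set (seq lev h c) \<subseteq> {..<length hs} \<and>
        row 3 h c = Vec (seq lev h c) \<and> ra h 0 c = wsum (seq lev h c)) \<and>
     (\<forall>\<sigma> \<Phi>. length \<sigma> = lev \<longrightarrow> set \<sigma> \<subseteq> {..<length hs} \<longrightarrow> linear \<Phi> \<longrightarrow> \<Phi> (Vec \<sigma>) \<noteq> \<zero> \<longrightarrow>
        (\<exists>c<LL. wsum \<sigma> \<le> ra h 0 c \<and> \<Phi> (row 3 h c) \<noteq> \<zero>))"

lemma LAP_zero: "LAP ls (\<lambda>x. \<zero>) = (\<lambda>x. \<zero>)"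
proof -
  have c: "closed (\<lambda>x. \<zero>)" by (simp add: closed_def)
  have "LAP ls (\<lambda>x. \<zero> \<ominus> \<one> \<otimes> \<zero>) = (\<lambda>x. LAP ls (\<lambda>x. \<zero>) x \<ominus> \<one> \<otimes> LAP ls (\<lambda>x. \<zero>) x)"
    using c by (intro LAP_sub_smult) auto
  moreover have "LAP ls (\<lambda>x. \<zero>) x \<in> carrier R" for x using LAP_closed[OF c] by (simp add: closed_def)
  moreover have "(\<lambda>x. \<zero> \<ominus> \<one> \<otimes> \<zero>) = (\<lambda>x::nat. \<zero>)" by (simp add: minus_eq)
  ultimately show ?thesis by (simp add: minus_eq r_neg)
qed

text \<open>A test applied after further members have been added is already a linear test before;
  this is what carries \<open>slots_ok\<close> from level to level.\<close>

lemma linear_LAP: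
  assumes "linear \<Phi>"
  shows "linear (\<lambda>a. \<Phi> (LAP ls a))"
  using assms unfolding linear_def by (simp add: LAP_closed LAP_sub_smult)

text \<open>Split off the last member of a selection. The test pulled back along this member is
  passed by some slot; the candidate formed from that slot and the member passes the original test,
  and by the elimination some new slot that is no lighter passes it too.\<close>

lemma slots_ok_level:
  assumes h: "ready h" and lev: "nv h 12 = lev" "lev < al" and ok: "slots_ok lev h"
    and z: "length hs = 0 \<Longrightarrow> \<forall>k. fa h 4 k = \<zero>"
  defines "g \<equiv> ex R (cands ;; For 32 9 elimcol) h"
  shows "slots_ok (Suc lev) g" "length hs = 0 \<Longrightarrow> \<forall>k. fa g 4 k = \<zero>"
proof -
  let ?nH = "length hs"
  define h' where "h' = ex R cands h"
  have g: "g = ex R (For 32 9 elimcol) h'" by (simp add: g_def h'_def)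
  have r': "ready h'" unfolding h'_def by (rule ready_ex[OF h]) auto
  have ck: "cand_ok h h' \<rho>" if "\<rho> < NR" for \<rho> using ex_cands(1)[OF h] lev that by (simp add: h'_def)
  have z': "\<forall>k. fa h' 4 k = \<zero>" if "?nH = 0" using ex_cands(2)[OF h] lev z that by (simp add: h'_def)
  show "\<forall>k. fa g 4 k = \<zero>" if "?nH = 0"
    using z'[OF that] sameD(4)[OF same_ex[of "For 32 9 elimcol" h' R], of 4] by (simp add: g)
  have r5: "row 5 h' \<rho> = row 4 h' \<rho>" if "\<rho> < NR" for \<rho> using ck[OF that] by (simp add: cand_ok_def Let_def)
  note el = ex_elim[OF r' r5, folded g]
  have "set (seq (Suc lev) g c) \<subseteq> {..<?nH} \<and> row 3 g c = Vec (seq (Suc lev) g c) \<and> ra g 0 c = wsum (seq (Suc lev) g c)"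
    if c: "c < LL" and nz: "row 3 g c \<noteq> (\<lambda>x. \<zero>)" for c
  proof -
    obtain b where b: "b < NR \<or> NR = 0 \<and> b = 0" "row 3 g c = row 4 h' b" "ra g 0 c = ra h' 1 b"
      "\<forall>j<al. na g 4 (c * al + j) = na h' 5 (b * al + j)" using el(2)[OF _ c] by blast
    \<comment> \<open>Without candidates all rows of array 4 vanish, so a nonzero slot stems from a
      true candidate.\<close>
    have bN: "b < NR"
    proof (rule ccontr)
      assume "\<not> b < NR"
      then have "NR = 0" using b(1) by simp
      then have "?nH = 0" using LL_pos by (simp add: NR_def)
      then have "row 4 h' b = (\<lambda>x. \<zero>)" using z' by (auto simp: row_def)
      then show False using nz b(2) by simp
    qed
    define cc hh where "cc = b div ?nH" and "hh = b mod ?nH"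
    have nH: "0 < ?nH" using bN unfolding NR_def by (intro Nat.gr0I) (simp only: mult_0_right less_nat_zero_code)
    have hh: "hh < ?nH" using nH by (simp add: hh_def)
    have cc: "cc < LL" using bN unfolding cc_def NR_def by (simp add: less_mult_imp_div_less)
    have k: "row 4 h' b = APP (hs ! hh) (row 3 h cc)" "ra h' 1 b = ra h 0 cc + wt hh"
      "\<forall>j<al. na h' 5 (b * al + j) = (if j = lev then hh else na h 4 (cc * al + j))"
      using ck[OF bN] lev by (auto simp: cand_ok_def Let_def cc_def hh_def)
    \<comment> \<open>The product is nonzero, so the slot it was formed from was nonzero and held a
      genuine selection.\<close>
    have "row 3 h cc \<noteq> (\<lambda>x. \<zero>)" using nz b(2) k(1) LAP_zero by (auto simp: APP_LAP)
    then have v: "set (seq lev h cc) \<subseteq> {..<?nH}" "row 3 h cc = Vec (seq lev h cc)" "ra h 0 cc = wsum (seq lev h cc)"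
      using ok cc unfolding slots_ok_def by blast+
    have "seq (Suc lev) g c = seq lev h cc @ [hh]"
      using b(4) k(3) lev by (auto simp: seq_def)
    then show ?thesis using v hh b k by (auto simp: Vec_def wsum_def)
  qed
  moreover have "\<exists>c<LL. wsum \<sigma> \<le> ra g 0 c \<and> \<Phi> (row 3 g c) \<noteq> \<zero>"
    if \<sigma>: "length \<sigma> = Suc lev" "set \<sigma> \<subseteq> {..<?nH}" and \<Phi>: "linear \<Phi>" "\<Phi> (Vec \<sigma>) \<noteq> \<zero>" for \<sigma> \<Phi>
  proof -
    obtain \<sigma>' i where si: "\<sigma> = \<sigma>' @ [i]" using \<sigma>(1) by (cases \<sigma> rule: rev_cases) auto
    have i: "i < ?nH" and s': "length \<sigma>' = lev" "set \<sigma>' \<subseteq> {..<?nH}" using \<sigma> si by auto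
    have "\<Phi> (LAP (labels (hs ! i)) (Vec \<sigma>')) \<noteq> \<zero>" using \<Phi>(2) si by (simp add: Vec_def APP_LAP)
    then obtain cc where cc: "cc < LL" "wsum \<sigma>' \<le> ra h 0 cc" "\<Phi> (LAP (labels (hs ! i)) (row 3 h cc)) \<noteq> \<zero>"
      using ok s' linear_LAP[OF \<Phi>(1)] unfolding slots_ok_def by blast
    define \<rho> where "\<rho> = cc * ?nH + i"
    have "cc * ?nH + i < Suc cc * ?nH" using i by simp
    also have "\<dots> \<le> LL * ?nH" using cc by (intro mult_right_mono) auto
    finally have \<rho>: "\<rho> < NR" by (simp add: \<rho>_def NR_def)
    have k: "row 4 h' \<rho> = LAP (labels (hs ! i)) (row 3 h cc)" "ra h' 1 \<rho> = ra h 0 cc + wt i"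
      using ck[OF \<rho>] block_div[OF i] by (auto simp: cand_ok_def Let_def \<rho>_def APP_LAP)
    have "\<Phi> (row 4 h' \<rho>) \<noteq> \<zero>" using cc(3) k(1) by simp
    from el(1)[OF _ \<rho> \<Phi>(1) this] obtain c where "c < LL" "ra h' 1 \<rho> \<le> ra g 0 c" "\<Phi> (row 3 g c) \<noteq> \<zero>" by blast
    then show ?thesis using cc(2) k(2) si by (intro exI[of _ c]) (auto simp: wsum_def)
  qed
  ultimately show "slots_ok (Suc lev) g" unfolding slots_ok_def by blast
qed

lemma ex_levels:
  assumes h: "ready h" and ok: "slots_ok 0 h" and z: "\<forall>k. fa h 4 k = \<zero>"
  shows "slots_ok al (ex R levels h)"
proof -
  let ?c = "cands ;; For 32 9 elimcol"
  have nv: "slots_ok l (k\<lparr>nv := f\<rparr>) = slots_ok l k" for l k f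
    by (simp add: slots_ok_def seq_def)
  have "slots_ok (nv h 3) (ex R (For 12 3 ?c) h) \<and> (length hs = 0 \<longrightarrow> (\<forall>k. fa (ex R (For 12 3 ?c) h) 4 k = \<zero>))"
  proof (rule For_rule_closed[where I = "\<lambda>l k. slots_ok l k \<and> (length hs = 0 \<longrightarrow> (\<forall>x. fa k 4 x = \<zero>))"])
    show "fclosed R h" using h by (rule ready_fclosed)
    show "slots_ok 0 (h\<lparr>nv := (nv h)(12 := 0)\<rparr>) \<and>
      (length hs = 0 \<longrightarrow> (\<forall>x. fa (h\<lparr>nv := (nv h)(12 := 0)\<rparr>) 4 x = \<zero>))" using ok z nv by simp
  next
    fix l k assume l: "l < nv h 3" "nv k 12 = l" and same: "same (For 12 3 ?c) h k" and clk: "fclosed R k"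
      and I: "slots_ok l k \<and> (length hs = 0 \<longrightarrow> (\<forall>x. fa k 4 x = \<zero>))"
    have rk: "ready k" by (rule ready_same[OF same h]) (use clk in auto)
    have l': "l < al" using l h by (simp add: ready_def)
    have "slots_ok (Suc l) (ex R ?c k)" "length hs = 0 \<Longrightarrow> \<forall>x. fa (ex R ?c k) 4 x = \<zero>"
      using slots_ok_level[OF rk l(2) l'] I by blast+
    then show "slots_ok (Suc l) ((ex R ?c k)\<lparr>nv := (nv (ex R ?c k))(12 := Suc l)\<rparr>) \<and>
      (length hs = 0 \<longrightarrow> (\<forall>x. fa ((ex R ?c k)\<lparr>nv := (nv (ex R ?c k))(12 := Suc l)\<rparr>) 4 x = \<zero>))"
      unfolding nv by simp
  qed auto
  moreover have "nv h 3 = al" using h by (simp add: ready_def)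
  ultimately show ?thesis by (simp add: levels_def)
qed

lemma ex_final:
  assumes h: "ready h"
  defines "g \<equiv> ex R final h"
  shows "nv g 0 = 0 \<Longrightarrow> c < LL \<Longrightarrow> row 3 h c = (\<lambda>x. \<zero>)"
    "nv g 0 \<noteq> 0 \<Longrightarrow> nv g 33 < LL \<and> row 3 h (nv g 33) \<noteq> (\<lambda>x. \<zero>)"
    "nv g 0 \<noteq> 0 \<Longrightarrow> c < LL \<Longrightarrow> row 3 h c \<noteq> (\<lambda>x. \<zero>) \<Longrightarrow> ra h 0 c \<le> ra h 0 (nv g 33)"
    "nv g 20 = nv g 33 * al" "na g = na h"
proof -
  let ?i = "Cond (BFEq (FA 3 (NPlus (NV 17) (NV 31))) F0) Skip
       (Cond (BLe (NC 1) (NV 0))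
         (Cond (BRLe (RA 0 (NV 33)) (RA 0 (NV 13))) (SetN 33 (NV 13)) Skip)
         (SetN 0 (NC 1) ;; SetN 33 (NV 13)))"
  let ?c = "mulc 17 13 9 ;; For 31 9 ?i"
  let ?h = "h\<lparr>nv := (nv h)(0 := 0, 33 := 0)\<rparr>"
  \<comment> \<open>One invariant for both loops of the search: the set \<open>S\<close> gains slot
    \<open>c\<close> as soon as a nonzero entry of this slot is met, and further such entries change
    nothing.\<close>
  define Best where "Best S k \<longleftrightarrow> (nv k 0 = 0 \<longrightarrow> S = {}) \<and>
    (nv k 0 \<noteq> 0 \<longrightarrow> nv k 33 \<in> S \<and> (\<forall>c\<in>S. ra h 0 c \<le> ra h 0 (nv k 33)))" for S and k :: "'f store"
  have Best_nv: "Best S (k\<lparr>nv := (nv k)(x := v)\<rparr>) = Best S k" if "x \<noteq> 0" "x \<noteq> 33" for S k x v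
    using that by (simp add: Best_def)
  define S where "S i = {c. c < i \<and> row 3 h c \<noteq> (\<lambda>x. \<zero>)}" for i
  have L9: "nv h 9 = LL" "nv h 3 = al" using h by (auto simp: ready_def dims_def LL_def)
  have "Best (S (nv ?h 9)) (ex R (For 13 9 ?c) ?h)"
  proof (rule For_rule[where I = "\<lambda>i. Best (S i)"])
    show "Best (S 0) (?h\<lparr>nv := (nv ?h)(13 := 0)\<rparr>)" by (simp add: Best_def S_def)
  next
    fix c k assume c: "c < nv ?h 9" "nv k 13 = c" and same: "same (For 13 9 ?c) ?h k" and B: "Best (S c) k"
    have s: "nv k 9 = LL" "fa k 3 = fa h 3" "ra k 0 = ra h 0" using sameD[OF same] L9 by (auto simp: mulc_def)
    let ?k = "k\<lparr>nv := (nv k)(17 := c * LL, 39 := LL)\<rparr>"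
    have m: "ex R (mulc 17 13 9) k = ?k" using s c by (simp add: ex_mulc)
    let ?S = "\<lambda>i. S c \<union> {c'. c' = c \<and> (\<exists>x<i. fa h 3 (c * LL + x) \<noteq> \<zero>)}"
    have "Best (?S (nv ?k 9)) (ex R (For 31 9 ?i) ?k)"
    proof (rule For_rule[where I = "\<lambda>i. Best (?S i)"])
      show "Best (?S 0) (?k\<lparr>nv := (nv ?k)(31 := 0)\<rparr>)" using B by (simp add: Best_def)
    next
      fix x s' assume x: "x < nv ?k 9" "nv s' 31 = x" and same': "same (For 31 9 ?i) ?k s'" and B': "Best (?S x) s'"
      have s': "nv s' 17 = c * LL" "nv s' 13 = c" "fa s' 3 = fa h 3" "ra s' 0 = ra h 0"
        using sameD[OF same'] s c by simp_all
      show "Best (?S (Suc x)) ((ex R ?i s')\<lparr>nv := (nv (ex R ?i s'))(31 := Suc x)\<rparr>)"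
      proof (cases "fa h 3 (c * LL + x) = \<zero>")
        case True
        then have "?S (Suc x) = ?S x" by (auto simp: less_Suc_eq)
        moreover have "ex R ?i s' = s'" using True s' x by simp
        ultimately show ?thesis using B' by (simp add: Best_def)
      next
        case nz: False
        then have S: "?S (Suc x) = insert c (?S x)" by auto
        show ?thesis
        proof (cases "nv s' 0 = 0")
          case True
          then have "?S x = {}" using B' unfolding Best_def by blast
          then show ?thesis using S nz True s' x by (simp add: Best_def)
        next
          case n0: False
          then have B'': "nv s' 33 \<in> ?S x" "\<And>c'. c' \<in> ?S x \<Longrightarrow> ra h 0 c' \<le> ra h 0 (nv s' 33)"
            using B' unfolding Best_def by blast+
          show ?thesis
          proof (cases "ra h 0 (nv s' 33) \<le> ra h 0 c")
            case True
            then have "ra h 0 c' \<le> ra h 0 c" if "c' \<in> ?S x" for c' using B''(2)[OF that] by simp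
            then show ?thesis unfolding S using nz n0 True s' x by (simp add: Best_def)
          next
            case False
            then show ?thesis unfolding S using nz n0 s' x B'' by (auto simp: Best_def)
          qed
        qed
      qed
    qed auto
    moreover have "?S LL = S (Suc c)"
    proof -
      have "row 3 h c \<noteq> (\<lambda>x. \<zero>) \<longleftrightarrow> (\<exists>x<LL. fa h 3 (c * LL + x) \<noteq> \<zero>)"
        unfolding fun_eq_iff by (auto simp: row_def)
      then show ?thesis by (auto simp: S_def less_Suc_eq)
    qed
    ultimately show "Best (S (Suc c)) ((ex R ?c k)\<lparr>nv := (nv (ex R ?c k))(13 := Suc c)\<rparr>)"
      using m s by (simp add: Best_nv)
  qed (auto simp: mulc_def)
  moreover define k where "k = ex R (For 13 9 ?c) ?h"
  ultimately have B: "Best (S LL) k" using L9 by simp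
  have "nv k 3 = al" "na k = na h" using sameD[OF same_ex[of "For 13 9 ?c" ?h R]] L9 by (auto simp: k_def mulc_def)
  moreover have g: "g = ex R (mulc 20 33 3) k" by (simp add: g_def k_def final_def)
  ultimately have gk: "nv g 0 = nv k 0" "nv g 33 = nv k 33" "nv g 20 = nv k 33 * al" "na g = na h"
    by (simp_all add: ex_mulc)
  show "nv g 0 = 0 \<Longrightarrow> c < LL \<Longrightarrow> row 3 h c = (\<lambda>x. \<zero>)"
    "nv g 0 \<noteq> 0 \<Longrightarrow> nv g 33 < LL \<and> row 3 h (nv g 33) \<noteq> (\<lambda>x. \<zero>)"
    "nv g 0 \<noteq> 0 \<Longrightarrow> c < LL \<Longrightarrow> row 3 h c \<noteq> (\<lambda>x. \<zero>) \<Longrightarrow> ra h 0 c \<le> ra h 0 (nv g 33)"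
    "nv g 20 = nv g 33 * al" "na g = na h"
    using B unfolding gk Best_def S_def by auto
qed

end

section \<open>Feasible selections and nonzero products\<close>

lemma nth_concat_sum:
  assumes "i < length xss" "b < length (xss ! i)"
  shows "(\<Sum>i'<i. length (xss ! i')) + b < length (concat xss) \<and>
    concat xss ! ((\<Sum>i'<i. length (xss ! i')) + b) = xss ! i ! b"
  using assms
proof (induction xss arbitrary: i)
  case (Cons xs xss)
  show ?case
  proof (cases i)
    case 0
    then show ?thesis using Cons.prems by (simp add: nth_append)
  next
    case (Suc i')
    have "(\<Sum>j<i. length ((xs # xss) ! j)) = length xs + (\<Sum>j<i'. length (xss ! j))"
      unfolding Suc sum.lessThan_Suc_shift by simp
    then show ?thesis using Cons.IH[of i'] Cons.prems Suc by (simp add: nth_append add.assoc)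
  qed
qed simp

text \<open>Disjointness of the chosen members becomes distinctness of a single list; empty members
  may repeat on both sides.\<close>

lemma distinct_concat_disjoint:
  assumes "\<And>xs. xs \<in> set xss \<Longrightarrow> distinct xs"
  shows "distinct (concat xss) \<longleftrightarrow> disjoint_family_on (\<lambda>j. set (xss ! j)) {..<length xss}"
  using assms
proof (induction xss)
  case (Cons xs xss)
  have "disjoint_family_on (\<lambda>j. set ((xs # xss) ! j)) {..<length (xs # xss)} \<longleftrightarrow>
    (\<forall>j<length xss. set xs \<inter> set (xss ! j) = {}) \<and> disjoint_family_on (\<lambda>j. set (xss ! j)) {..<length xss}"
  proof
    assume a: "disjoint_family_on (\<lambda>j. set ((xs # xss) ! j)) {..<length (xs # xss)}"
    show "(\<forall>j<length xss. set xs \<inter> set (xss ! j) = {}) \<and> disjoint_family_on (\<lambda>j. set (xss ! j)) {..<length xss}"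
      unfolding disjoint_family_on_def
    proof (intro conjI allI ballI impI)
      fix j assume "j < length xss"
      then show "set xs \<inter> set (xss ! j) = {}" using disjoint_family_onD[OF a, of 0 "Suc j"] by simp
    next
      fix i j assume "i \<in> {..<length xss}" "j \<in> {..<length xss}" "i \<noteq> j"
      then show "set (xss ! i) \<inter> set (xss ! j) = {}" using disjoint_family_onD[OF a, of "Suc i" "Suc j"] by simp
    qed
  next
    assume a: "(\<forall>j<length xss. set xs \<inter> set (xss ! j) = {}) \<and> disjoint_family_on (\<lambda>j. set (xss ! j)) {..<length xss}"
    show "disjoint_family_on (\<lambda>j. set ((xs # xss) ! j)) {..<length (xs # xss)}"
      unfolding disjoint_family_on_def
    proof (intro ballI impI)
      fix i j assume ij: "i \<in> {..<length (xs # xss)}" "j \<in> {..<length (xs # xss)}" "i \<noteq> j"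
      show "set ((xs # xss) ! i) \<inter> set ((xs # xss) ! j) = {}"
      proof (cases i)
        case 0
        then obtain j' where "j = Suc j'" using ij(3) by (cases j) auto
        then show ?thesis using 0 a ij by simp
      next
        case i: (Suc i')
        show ?thesis
        proof (cases j)
          case 0
          then show ?thesis using i a ij by (simp add: Int_commute)
        next
          case (Suc j')
          then show ?thesis using i a ij disjoint_family_onD[of "\<lambda>j. set (xss ! j)" "{..<length xss}" i' j'] by simp
        qed
      qed
    qed
  qed
  moreover have "(\<forall>j<length xss. set xs \<inter> set (xss ! j) = {}) \<longleftrightarrow> set xs \<inter> set (concat xss) = {}"
    by (force simp: in_set_conv_nth[of _ xss] simp del: in_set_conv_nth)
  ultimately show ?case using Cons by auto
qed (simp add: disjoint_family_on_def)

lemma enc_eq_0: "enc bs = 0 \<longleftrightarrow> True \<notin> set bs"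
  by (induction bs) auto

lemma (in cring) comb_map:
  assumes "distinct ls" "\<And>l. l \<in> set ls \<Longrightarrow> c l \<in> carrier R" "\<And>l. l \<in> set ls \<Longrightarrow> f l j \<in> carrier R"
  shows "comb (map c ls) (map f ls) j = (\<Oplus>l\<in>set ls. c l \<otimes> f l j)"
  using assms
proof (induction ls)
  case (Cons l ls)
  have "(\<Oplus>l\<in>set (l # ls). c l \<otimes> f l j) = c l \<otimes> f l j \<oplus> (\<Oplus>l\<in>set ls. c l \<otimes> f l j)"
    unfolding list.simps using Cons.prems by (intro finsum_insert) auto
  moreover have "(\<Oplus>l\<in>set ls. c l \<otimes> f l j) \<in> carrier R" using Cons.prems by (intro finsum_closed) auto
  ultimately show ?case using Cons by (simp add: a_comm)
qed simp

section \<open>The vector of a selection as a wedge product\<close>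

context spmc_run begin

definition fv' :: "nat \<times> nat \<Rightarrow> nat \<Rightarrow> 'f" where
  "fv' l = fvec (fst l) (snd l)"

definition labs :: "nat list \<Rightarrow> (nat \<times> nat) list" where
  "labs \<sigma> = concat (map (\<lambda>i. labels (hs ! i)) \<sigma>)"

lemma Vec_LAP: "Vec \<sigma> = LAP (labs \<sigma>) (\<lambda>x. if x = 0 then \<one> else \<zero>)"
proof (induction \<sigma> rule: rev_induct)
  case Nil
  then show ?case by (simp add: Vec_def labs_def LAP_def)
next
  case (snoc i \<sigma>)
  have "Vec (\<sigma> @ [i]) = LAP (labels (hs ! i)) (Vec \<sigma>)" by (simp add: Vec_def APP_LAP)
  then show ?case using snoc by (simp add: labs_def LAP_def)
qed

text \<open>\<open>LAP\<close> applies the first label first, whereas \<open>wedges\<close> has its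
  first factor outermost, hence the reversal. Only exponents below \<open>EE\<close> are stored, and
  by \<open>wedge_cong\<close> no others are ever used.\<close>

lemma LAP_wedges:
  assumes "k < LL"
  shows "LAP ls (\<lambda>x. if x = 0 then \<one> else \<zero>) k =
    wedges DD (rev (map fv' ls)) (dec NN (k div EE)) (k mod EE)"
  using assms
proof (induction ls arbitrary: k rule: rev_induct)
  case Nil
  have "EE > 0" by (simp add: EE_def)
  have "k div EE < 2 ^ NN" using Nil by (simp add: LL_def less_mult_imp_div_less)
  then have "True \<notin> set (dec NN (k div EE)) \<longleftrightarrow> k div EE = 0" using enc_eq_0[of "dec NN (k div EE)"] enc_dec by simp
  moreover have "k = EE * (k div EE) + k mod EE" by simp
  then have "k mod EE = 0 \<and> k div EE = 0 \<longleftrightarrow> k = 0" by (metis add_0_right div_0 mod_0 mult_0_right)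
  ultimately have "k mod EE = 0 \<and> True \<notin> set (dec NN (k div EE)) \<longleftrightarrow> k = 0" by metis
  then show ?case by (auto simp: LAP_def)
next
  case (snoc p ls)
  have "EE > 0" by (simp add: EE_def)
  let ?a = "LAP ls (\<lambda>x. if x = 0 then \<one> else \<zero>)"
  have "LAP (ls @ [p]) (\<lambda>x. if x = 0 then \<one> else \<zero>) k = lmul DD NN EE (fv' p) ?a k"
    by (simp add: LAP_def fv'_def split_def)
  also have "\<dots> = wedge DD (fv' p) (wvec EE ?a) (dec NN (k div EE)) (k mod EE)"
    using snoc.prems by (simp add: lmul_def LL_def)
  also have "\<dots> = wedge DD (fv' p) (wedges DD (rev (map fv' ls))) (dec NN (k div EE)) (k mod EE)"
  proof (rule wedge_cong)
    fix S :: "bool list" and e assume S: "length S = length (dec NN (k div EE))" "e \<le> k mod EE"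
    then have e: "length S = NN" "e < EE" using \<open>EE > 0\<close> by (auto intro: order_le_less_trans)
    then have "enc S * EE + e < LL" using enc_mult_less[of e EE S] by (simp add: LL_def)
    from snoc.IH[OF this] show "wvec EE ?a S e = wedges DD (rev (map fv' ls)) S e"
      using block_div[OF e(2), of "enc S"] dec_enc[of S] e(1) by (simp add: wvec_def)
  qed
  finally show ?case by simp
qed

lemma Vec_nonzero_iff:
  "Vec \<sigma> \<noteq> (\<lambda>x. \<zero>) \<longleftrightarrow>
    (\<exists>T e. length T = NN \<and> e < EE \<and> wedges DD (rev (map fv' (labs \<sigma>))) T e \<noteq> \<zero>)"
proof
  assume "Vec \<sigma> \<noteq> (\<lambda>x. \<zero>)"
  then obtain k where k: "Vec \<sigma> k \<noteq> \<zero>" by auto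
  have "k < LL"
  proof (rule ccontr)
    assume n: "\<not> k < LL"
    then have "k \<noteq> 0" using LL_pos by auto
    then show False using k LAP_outside[OF n] by (simp add: Vec_LAP)
  qed
  moreover have "EE > 0" by (simp add: EE_def)
  ultimately show "\<exists>T e. length T = NN \<and> e < EE \<and> wedges DD (rev (map fv' (labs \<sigma>))) T e \<noteq> \<zero>"
    using k LAP_wedges[of k "labs \<sigma>"] by (intro exI[of _ "dec NN (k div EE)"] exI[of _ "k mod EE"]) (simp add: Vec_LAP)
next
  assume "\<exists>T e. length T = NN \<and> e < EE \<and> wedges DD (rev (map fv' (labs \<sigma>))) T e \<noteq> \<zero>"
  then obtain T e where T: "length T = NN" "e < EE" "wedges DD (rev (map fv' (labs \<sigma>))) T e \<noteq> \<zero>" by blast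
  have "enc T * EE + e < LL" using enc_mult_less[OF T(2), of T] T(1) by (simp add: LL_def)
  from LAP_wedges[OF this, of "labs \<sigma>"] have "Vec \<sigma> (enc T * EE + e) = wedges DD (rev (map fv' (labs \<sigma>))) T e"
    using block_div[OF T(2), of "enc T"] dec_enc[of T] T(1) by (simp add: Vec_LAP)
  then show "Vec \<sigma> \<noteq> (\<lambda>x. \<zero>)" using T(3) by auto
qed

lemma set_labels: "set (labels h) = {..<m} \<times> set h"
  by (auto simp: labels_def image_iff)

text \<open>Every position occurs once with each matroid; without any matroid the list of labels
  would be empty and forget repetitions.\<close>

lemma distinct_labels: "0 < m \<Longrightarrow> distinct (labels h) \<longleftrightarrow> distinct h"
proof (induction h)
  case (Cons u h)
  have "labels (u # h) = map (\<lambda>i. (i, u)) [0..<m] @ labels h" by (simp add: labels_def)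
  moreover have "set (map (\<lambda>i. (i, u)) [0..<m]) = {..<m} \<times> {u}" by auto
  then have "set (map (\<lambda>i. (i, u)) [0..<m]) \<inter> set (labels h) = {} \<longleftrightarrow> u \<notin> set h"
    using Cons.prems by (auto simp: set_labels)
  moreover have "distinct (map (\<lambda>i. (i, u)) [0..<m])" by (simp add: distinct_map inj_on_def)
  ultimately show ?case using Cons by auto
qed (simp add: labels_def)

lemma labs_labels: "labs \<sigma> = labels (concat (map ((!) hs) \<sigma>))"
  by (induction \<sigma>) (simp_all add: labs_def labels_def)

lemma set_labs: "set (labs \<sigma>) = {..<m} \<times> set (concat (map ((!) hs) \<sigma>))"
  by (simp only: labs_labels set_labels)

text \<open>The origin of \<open>NN\<close>: \<open>al\<close> members with at most
  \<open>gm\<close> elements, each of which has \<open>m\<close> labels.\<close>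

lemma length_labs:
  assumes "length \<sigma> = al" "set \<sigma> \<subseteq> {..<length hs}"
  shows "length (labs \<sigma>) \<le> NN"
proof -
  have l: "length (labels h) = m * length h" for h by (induction h) (simp_all add: labels_def)
  have "length (concat (map ((!) hs) \<sigma>)) \<le> length \<sigma> * gm"
    using assms(2)
  proof (induction \<sigma>)
    case (Cons i \<sigma>)
    then have "length (hs ! i) \<le> gm" using hs_len by simp
    then show ?case using Cons by simp
  qed simp
  then have "length (labs \<sigma>) \<le> m * (length \<sigma> * gm)" unfolding labs_labels l by (rule mult_left_mono) simp
  then show ?thesis using assms by (simp add: NN_def)
qed

section \<open>Independence of the labels, matroid by matroid\<close>

lemma fvec_zero: "i < m \<Longrightarrow> DD \<le> j \<Longrightarrow> fvec i u j = \<zero>"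
  using off_mono[of "Suc i" m] by (auto simp: fvec_def DD_def)

lemma off_disjoint: "k < rk i \<Longrightarrow> off i' \<le> off i + k \<and> off i + k < off (Suc i') \<longleftrightarrow> i' = i"
proof
  assume k: "k < rk i" and a: "off i' \<le> off i + k \<and> off i + k < off (Suc i')"
  have "off i + k < off (Suc i)" using k by (simp add: off_Suc)
  then have "\<not> Suc i \<le> i'" using a off_mono[of "Suc i" i'] by linarith
  moreover have "\<not> Suc i' \<le> i" using a off_mono[of "Suc i'" i] by linarith
  ultimately show "i' = i" by simp
qed (simp add: off_Suc)

text \<open>The matrix of coefficients is block diagonal, since at the exponents of block
  \<open>i\<close> only labels of matroid \<open>i\<close> are nonzero. A relation among the columns
  of one matroid is extended by zero, and a relation among all labels is restricted to each
  block.\<close>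

lemma lin_indep_blocks:
  fixes A :: "nat \<Rightarrow> nat \<Rightarrow> 'a \<Rightarrow> 'f" and us :: "'a list"
  assumes A: "\<And>i u k. i < m \<Longrightarrow> u < n \<Longrightarrow> k < rk i \<Longrightarrow> Fin (n * off i + rk i * u + k) = A i k (us ! u)"
    and us: "distinct us" "length us = n"
    and ls: "distinct ls" "set ls = {..<m} \<times> S" "S \<subseteq> {..<n}"
  shows "lin_indep (map fv' ls) \<longleftrightarrow> (\<forall>i<m. columns_independent R (rk i) (A i) ((!) us ` S))"
proof -
  have finS: "finite S" using ls(3) finite_subset by blast
  have fvA: "fv' (i', u) (off i + k) = (if i' = i then A i k (us ! u) else \<zero>)" if "k < rk i" "i < m" "u \<in> S" for i i' k u
    using off_disjoint[OF that(1), of i'] A[OF that(2) _ that(1), of u] ls(3) that(3) by (auto simp: fv'_def fvec_def)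
  have fcl: "fv' l j \<in> carrier R" for l j by (simp add: fv'_def fvec_closed)
  have inj: "inj_on ((!) us) S" using us ls(3) by (intro inj_on_nth) auto
  have sum_block: "(\<Oplus>l\<in>set ls. c l \<otimes> fv' l j) = (\<Oplus>u\<in>S. c (i, u) \<otimes> fv' (i, u) j)"
    if c: "\<And>l. l \<in> set ls \<Longrightarrow> c l \<in> carrier R" and i: "i < m"
      and z: "\<And>i' u. i' < m \<Longrightarrow> u \<in> S \<Longrightarrow> i' \<noteq> i \<Longrightarrow> c (i', u) \<otimes> fv' (i', u) j = \<zero>" for c i j
  proof -
    have "(\<Oplus>l\<in>{i} \<times> S. c l \<otimes> fv' l j) = (\<Oplus>l\<in>set ls. c l \<otimes> fv' l j)"
      using c i z finS fcl ls(2) by (intro add.finprod_mono_neutral_cong_left) auto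
    moreover have "(\<Oplus>l\<in>(\<lambda>u. (i, u)) ` S. c l \<otimes> fv' l j) = (\<Oplus>u\<in>S. c (i, u) \<otimes> fv' (i, u) j)"
      using c i fcl ls(2) by (intro finsum_reindex) (auto simp: inj_on_def)
    moreover have "(\<lambda>u. (i, u)) ` S = {i} \<times> S" by auto
    ultimately show ?thesis by simp
  qed
  have sum_us: "(\<Oplus>x\<in>(!) us ` S. c x \<otimes> A i k x) = (\<Oplus>u\<in>S. c (us ! u) \<otimes> A i k (us ! u))"
    if "c \<in> (!) us ` S \<rightarrow> carrier R" "i < m" "k < rk i" for c i k
  proof (rule finsum_reindex[OF _ inj])
    show "(\<lambda>x. c x \<otimes> A i k x) \<in> (!) us ` S \<rightarrow> carrier R"
    proof
      fix x assume "x \<in> (!) us ` S"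
      then obtain u where "u \<in> S" "x = us ! u" by auto
      then have "A i k x \<in> carrier R" using A[OF that(2) _ that(3), of u] ls(3) Fin_closed by (metis lessThan_iff subset_iff)
      then show "c x \<otimes> A i k x \<in> carrier R" using that(1) \<open>x \<in> _\<close> by auto
    qed
  qed
  show ?thesis
  proof
    assume li: "lin_indep (map fv' ls)"
    show "\<forall>i<m. columns_independent R (rk i) (A i) ((!) us ` S)"
      unfolding columns_independent_def
    proof (intro allI impI ballI)
      fix i c x assume i: "i < m" and c: "c \<in> (!) us ` S \<rightarrow> carrier R"
        and z: "\<forall>k<rk i. (\<Oplus>u\<in>(!) us ` S. c u \<otimes> A i k u) = \<zero>" and x: "x \<in> (!) us ` S"
      define d where "d l = (if fst l = i then c (us ! snd l) else \<zero>)" for l :: "nat \<times> nat"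
      have dcl: "d l \<in> carrier R" if "l \<in> set ls" for l using that c ls(2) by (auto simp: d_def)
      have "comb (map d ls) (map fv' ls) j = \<zero>" for j
      proof -
        have "comb (map d ls) (map fv' ls) j = (\<Oplus>l\<in>set ls. d l \<otimes> fv' l j)"
          using ls(1) dcl fcl by (rule comb_map)
        also have "\<dots> = (\<Oplus>u\<in>S. d (i, u) \<otimes> fv' (i, u) j)"
          using dcl i by (rule sum_block) (use fcl in \<open>auto simp: d_def\<close>)
        also have "\<dots> = \<zero>"
        proof (cases "off i \<le> j \<and> j < off (Suc i)")
          case True
          define k where "k = j - off i"
          have k: "k < rk i" "j = off i + k" using True by (auto simp: k_def off_Suc)
          have "(\<Oplus>u\<in>S. d (i, u) \<otimes> fv' (i, u) j) = (\<Oplus>u\<in>S. c (us ! u) \<otimes> A i k (us ! u))"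
          proof (rule finsum_cong')
            fix u assume u: "u \<in> S"
            then show "d (i, u) \<otimes> fv' (i, u) j = c (us ! u) \<otimes> A i k (us ! u)"
              using fvA[OF k(1) i u, of i] k(2) by (simp add: d_def)
          next
            show "(\<lambda>u. c (us ! u) \<otimes> A i k (us ! u)) \<in> S \<rightarrow> carrier R"
            proof
              fix u assume u: "u \<in> S"
              have "A i k (us ! u) = fv' (i, u) j" using fvA[OF k(1) i u, of i] k(2) by simp
              then show "c (us ! u) \<otimes> A i k (us ! u) \<in> carrier R" using funcset_mem[OF c, of "us ! u"] u fcl by simp
            qed
          qed simp
          then show ?thesis using sum_us[OF c i k(1)] z k(1) by simp
        next
          case False
          then have "fv' (i, u) j = \<zero>" for u by (auto simp: fv'_def fvec_def)
          then have "(\<Oplus>u\<in>S. d (i, u) \<otimes> fv' (i, u) j) = (\<Oplus>u\<in>S. \<zero>)"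
            using dcl i ls(2) by (intro finsum_cong') auto
          then show ?thesis by simp
        qed
        finally show ?thesis .
      qed
      moreover have "set (map d ls) \<subseteq> carrier R" using dcl by auto
      ultimately have "set (map d ls) \<subseteq> {\<zero>}" using li unfolding lin_indep_def by (metis length_map)
      moreover obtain u where u: "u \<in> S" "x = us ! u" using x by auto
      moreover have "(i, u) \<in> set ls" using ls(2) i u by simp
      ultimately have "d (i, u) = \<zero>" by auto
      then show "c x = \<zero>" using u by (simp add: d_def)
    qed
  next
    assume ci: "\<forall>i<m. columns_independent R (rk i) (A i) ((!) us ` S)"
    show "lin_indep (map fv' ls)"
      unfolding lin_indep_def
    proof (intro allI impI)
      fix cs assume cs: "length cs = length (map fv' ls)" "set cs \<subseteq> carrier R" "\<forall>j. comb cs (map fv' ls) j = \<zero>"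
      define c where "c l = the (map_of (zip ls cs) l)" for l
      have csc: "cs = map c ls"
      proof (rule nth_equalityI)
        show "length cs = length (map c ls)" using cs by simp
        fix k assume "k < length cs"
        then show "cs ! k = map c ls ! k" using cs(1) ls(1) by (simp add: c_def map_of_zip_nth)
      qed
      have ccl: "c l \<in> carrier R" if "l \<in> set ls" for l using cs(2) csc that by auto
      have sum0: "(\<Oplus>l\<in>set ls. c l \<otimes> fv' l j) = \<zero>" for j
        using comb_map[OF ls(1), of c fv' j] ccl fcl cs(3) csc by simp
      have "c (i, u) = \<zero>" if i: "i < m" and u: "u \<in> S" for i u
      proof -
        \<comment> \<open>Coefficients are indexed by positions and columns by ground elements; the
          enumeration is injective on \<open>S\<close>, which allows passing back.\<close>
        define pos where "pos = inv_into S ((!) us)"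
        have pos: "pos (us ! u) = u" if "u \<in> S" for u using inv_into_f_f[OF inj that] by (simp add: pos_def)
        define d where "d x = c (i, pos x)" for x
        have d: "d (us ! u) = c (i, u)" if "u \<in> S" for u using pos[OF that] by (simp add: d_def)
        have dcl: "d \<in> (!) us ` S \<rightarrow> carrier R" using d ccl ls(2) i by auto
        have "(\<Oplus>x\<in>(!) us ` S. d x \<otimes> A i k x) = \<zero>" if k: "k < rk i" for k
        proof -
          have Acl: "A i k (us ! u) \<in> carrier R" if "u \<in> S" for u
            using fvA[OF k i that, of i] fcl[of "(i, u)" "off i + k"] by simp
          have "(\<Oplus>x\<in>(!) us ` S. d x \<otimes> A i k x) = (\<Oplus>u\<in>S. d (us ! u) \<otimes> A i k (us ! u))"
            by (rule sum_us[OF dcl i k])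
          also have "\<dots> = (\<Oplus>u\<in>S. c (i, u) \<otimes> fv' (i, u) (off i + k))"
            using d ccl Acl ls(2) i fvA[OF k i] by (intro finsum_cong') auto
          also have "\<dots> = (\<Oplus>l\<in>set ls. c l \<otimes> fv' l (off i + k))"
            using ccl i by (rule sum_block[symmetric]) (use fvA[OF k i] ccl ls(2) in auto)
          finally show ?thesis using sum0 by simp
        qed
        then have "\<forall>x\<in>(!) us ` S. d x = \<zero>" using ci i dcl unfolding columns_independent_def by blast
        then show ?thesis using d u by auto
      qed
      then show "set cs \<subseteq> {\<zero>}" using csc ls(2) by auto
    qed
  qed
qed

text \<open>Independence of the label polynomials expresses both requirements at once: overlapping
  members repeat a label, which makes the product vanish, and for distinct labels the blocks give
  independence in each matroid.\<close>

lemma Vec_feasible: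
  fixes X :: "'a spmc" and A :: "nat \<Rightarrow> nat \<Rightarrow> 'a \<Rightarrow> 'f" and us :: "'a list"
  assumes A: "\<And>i u k. i < m \<Longrightarrow> u < n \<Longrightarrow> k < rk i \<Longrightarrow> Fin (n * off i + rk i * u + k) = A i k (us ! u)"
    and X: "m = num_matroids X" "n = length us" "al = alpha X" "\<And>i. i < m \<Longrightarrow> rk i = matroid_rank (indeps X i)"
      "0 < m" "encodes us hs X" "\<And>i. i < m \<Longrightarrow> represents R (ground X) (indeps X i) (A i)"
    and \<sigma>: "length \<sigma> = al" "set \<sigma> \<subseteq> {..<length hs}"
  shows "Vec \<sigma> \<noteq> (\<lambda>x. \<zero>) \<longleftrightarrow> feasible X (map (\<lambda>i. set_at us (hs ! i)) \<sigma>)"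
proof -
  let ?P = "concat (map ((!) hs) \<sigma>)"
  let ?Hs = "map (\<lambda>i. set_at us (hs ! i)) \<sigma>"
  define ls where "ls = rev (labs \<sigma>)"
  have us: "distinct us" "set us = ground X" using X(6) by (auto simp: encodes_def)
  have hd: "distinct h" if "h \<in> set hs" for h using X(6) that by (auto simp: encodes_def)
  have P: "set ?P \<subseteq> {..<n}"
  proof
    fix u assume "u \<in> set ?P"
    then obtain i where i: "i \<in> set \<sigma>" "u \<in> set (hs ! i)" by auto
    then have "hs ! i \<in> set hs" using \<sigma>(2) by auto
    then show "u \<in> {..<n}" using hs_less i(2) by auto
  qed
  have fcl: "fv' l j \<in> carrier R" for l j by (simp add: fv'_def fvec_closed)
  have fs: "\<And>f j. f \<in> set (map fv' ls) \<Longrightarrow> f j \<in> carrier R" "\<And>f j. f \<in> set (map fv' ls) \<Longrightarrow> DD \<le> j \<Longrightarrow> f j = \<zero>"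
    using fcl set_labs[of \<sigma>] by (auto simp: ls_def fv'_def fvec_zero)
  have len: "length (map fv' ls) \<le> NN" using length_labs[OF \<sigma>] by (simp add: ls_def)
  have W: "(\<exists>T e. length T = NN \<and> e < NN * NN * DD + 1 \<and> wedges DD (map fv' ls) T e \<noteq> \<zero>) \<longleftrightarrow> lin_indep (map fv' ls)"
    by (rule wedges_nonzero_iff) (erule fs(1), erule (1) fs(2), rule len)
  have nz: "Vec \<sigma> \<noteq> (\<lambda>x. \<zero>) \<longleftrightarrow> lin_indep (map fv' ls)"
    using W unfolding Vec_nonzero_iff EE_def ls_def by (simp add: rev_map)
  have union: "\<Union>(set ?Hs) = (!) us ` set ?P" by (auto simp: set_at_def)
  have dist: "distinct ls \<longleftrightarrow> distinct ?P" using X(5) by (simp add: ls_def labs_labels distinct_labels)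
  have "distinct ?P \<longleftrightarrow> disjoint_family_on (\<lambda>j. set (map ((!) hs) \<sigma> ! j)) {..<length (map ((!) hs) \<sigma>)}"
    using hd \<sigma>(2) by (intro distinct_concat_disjoint) auto
  also have "\<dots> \<longleftrightarrow> disjoint_family_on (\<lambda>j. ?Hs ! j) {..<length ?Hs}"
  proof -
    have sub: "set (hs ! (\<sigma> ! j)) \<subseteq> {..<n}" if "j < length \<sigma>" for j
      using hs_less \<sigma>(2) that by (metis lessThan_iff nth_mem subsetD subsetI)
    have inj: "inj_on ((!) us) {..<n}" using us X(2) by (auto simp: inj_on_def nth_eq_iff_index_eq)
    have "set (hs ! (\<sigma> ! i)) \<inter> set (hs ! (\<sigma> ! j)) = {} \<longleftrightarrow> ?Hs ! i \<inter> ?Hs ! j = {}"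
      if "i < length \<sigma>" "j < length \<sigma>" for i j
    proof -
      have "?Hs ! i \<inter> ?Hs ! j = (!) us ` (set (hs ! (\<sigma> ! i)) \<inter> set (hs ! (\<sigma> ! j)))"
        using inj_on_image_Int[OF inj sub[OF that(1)] sub[OF that(2)]] that by (simp add: set_at_def)
      then show ?thesis by auto
    qed
    then show ?thesis unfolding disjoint_family_on_def by auto
  qed
  finally have disj: "distinct ls \<longleftrightarrow> disjoint_family_on (\<lambda>j. ?Hs ! j) {..<length ?Hs}" using dist by simp
  have sub: "(!) us ` set ?P \<subseteq> ground X"
  proof (rule image_subsetI)
    fix u assume "u \<in> set ?P"
    then have "u < length us" using P X(2) by auto
    then show "us ! u \<in> ground X" using us(2) nth_mem by metis
  qed
  have ind: "(!) us ` set ?P \<in> indeps X i \<longleftrightarrow> columns_independent R (rk i) (A i) ((!) us ` set ?P)" if "i < m" for i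
    using X(7)[OF that] sub X(4)[OF that] unfolding represents_def by simp
  have blocks: "lin_indep (map fv' ls) \<longleftrightarrow> (\<forall>i<m. (!) us ` set ?P \<in> indeps X i)" if "distinct ls"
  proof -
    have "set ls = {..<m} \<times> set ?P" by (simp add: ls_def set_labs)
    from lin_indep_blocks[OF A us(1) X(2)[symmetric] that this P] show ?thesis using ind by auto
  qed
  have "distinct ls" if "lin_indep (map fv' ls)"
  proof (rule ccontr)
    assume "\<not> distinct ls"
    then obtain xs ys zs y where ls': "ls = xs @ [y] @ ys @ [y] @ zs" using not_distinct_decomp by blast
    have "wedges DD (map fv' ls) T e = \<zero>" for T e
    proof -
      have c: "f j \<in> carrier R" if "f \<in> range fv'" for f j using that fcl by (elim imageE) simp
      have "wedges DD (fv' y # map fv' (ys @ [y] @ zs)) T e = \<zero>" for T e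
        by (rule wedges_repeat) (simp, rule c, auto)
      then have "wedges DD (map fv' xs @ (fv' y # map fv' (ys @ [y] @ zs))) T e = \<zero>"
        by (rule wedges_append_zero) (rule c, auto)
      then show ?thesis using ls' by simp
    qed
    then show False using that W by simp
  qed
  then have "lin_indep (map fv' ls) \<longleftrightarrow> distinct ls \<and> (\<forall>i<m. (!) us ` set ?P \<in> indeps X i)" using blocks by blast
  moreover have "set ?Hs \<subseteq> family X"
  proof
    fix H assume "H \<in> set ?Hs"
    then obtain i where "i < length hs" "H = set_at us (hs ! i)" using \<sigma>(2) by auto
    then have "H \<in> set (map (set_at us) hs)" by simp
    then show "H \<in> family X" using X(6) by (simp add: encodes_def)
  qed
  ultimately show ?thesis unfolding nz feasible_def union disj using \<sigma>(1) X(1,3) by auto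
qed

end

section \<open>Preparation of the tables\<close>

text \<open>The preparation is cut into pieces because the cost of a piece is evaluated in the store
  in which it starts, so the piece must not assign its own loop bounds. The first three pieces use
  no arrays and determine the array bases.\<close>

definition p0 :: com where
  "p0 = SetN 1 (NI (NC 0)) ;; SetN 2 (NI (NC 1)) ;; SetN 3 (NI (NC 2)) ;; SetN 4 (NI (NC 5))"

definition p1 :: com where
  "p1 = For 23 1 (SetN 5 (NPlus (NV 5) (NI (NPlus (NC 6) (NV 23)))))"

text \<open>The base of the number arrays leaves room for \<open>alpha\<close> cells behind the
  input, so that the answer, written from the first input cell on, cannot run into an array.\<close>

definition p2 :: com where
  "p2 = mulc 36 2 5 ;; SetN 41 (NPlus (NV 36) (NC 100)) ;; SetN 42 (NPlus (NV 4) (NC 100)) ;;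
     SetN 35 (NPlus (NC 6) (NV 1)) ;;
     For 14 4 (SetN 37 (NI (NV 35)) ;; Cond (BLe (NV 37) (NV 6)) Skip (SetN 6 (NV 37)) ;;
       SetN 35 (NPlus (NV 35) (NPlus (NV 37) (NC 1)))) ;;
     SetN 40 (NPlus (NPlus (NV 35) (NV 3)) (NC 100))"

definition p3 :: com where
  "p3 = mulc 36 1 3 ;; mulc 7 36 6"

definition p4 :: com where
  "p4 = mulc 36 7 7 ;; mulc 37 36 5 ;; SetN 8 (NPlus (NV 37) (NC 1)) ;;
     SetNA 0 (NC 0) (NC 1) ;;
     For 27 7 (SetNA 0 (NPlus (NV 27) (NC 1)) (NPlus (NA 0 (NV 27)) (NA 0 (NV 27)))) ;;
     SetN 11 (NA 0 (NV 7))"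

definition p5 :: com where
  "p5 = mulc 9 11 8"

text \<open>The last command puts the unit, the product over the empty selection, into slot
  0.\<close>

definition p6 :: com where
  "p6 = mulc 10 9 4 ;; SetN 35 (NPlus (NC 6) (NV 1)) ;;
     For 14 4 (SetNA 3 (NV 14) (NV 35) ;; SetN 35 (NPlus (NV 35) (NPlus (NI (NV 35)) (NC 1)))) ;;
     SetFA 3 (NC 0) F1"

text \<open>The only loop over the ground set in the whole program: once for each matroid, its rank
  is multiplied by \<open>n\<close>.\<close>

definition p7 :: com where
  "p7 = For 23 1 (SetNA 1 (NPlus (NV 23) (NC 1)) (NPlus (NA 1 (NV 23)) (NI (NPlus (NC 6) (NV 23)))) ;;
     SetN 37 (NI (NPlus (NC 6) (NV 23))) ;; mulc 36 37 2 ;;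
     SetNA 2 (NPlus (NV 23) (NC 1)) (NPlus (NA 2 (NV 23)) (NV 36)))"

definition main :: com where
  "main = levels ;; final ;; outputs"

section \<open>Correctness of the preparation and of the output\<close>

context spmc_run begin

definition start :: "'f store \<Rightarrow> bool" where
  "start h \<longleftrightarrow> (\<forall>x. nv h x = 0) \<and> (\<forall>a k. na h a k = 0) \<and> (\<forall>a k. fa h a k = \<zero>) \<and> (\<forall>a k. ra h a k = 0) \<and>
     (\<forall>x. fv h x = \<zero>) \<and> ni h 0 = m \<and> ni h 1 = n \<and> ni h 2 = al \<and> ni h 5 = length hs \<and>
     (\<forall>i<m. ni h (6 + i) = rk i) \<and>
     (\<forall>i<length hs. ni h (hpos i) = length (hs ! i) \<and> (\<forall>k<length (hs ! i). ni h (hpos i + 1 + k) = hs ! i ! k)) \<and>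
     bn h = 100 + (hpos (length hs) + al) \<and> bf h = 100 + n * DD \<and> br h = 100 + length hs \<and>
     fi h = Fin \<and> (\<forall>k<length hs. ri h k = wt k)"

lemma hpos_Suc: "hpos (Suc i) = hpos i + Suc (length (hs ! i))"
  by (simp add: hpos_def)

lemma hpos_mono: "i \<le> i' \<Longrightarrow> hpos i \<le> hpos i'"
  unfolding hpos_def by (intro add_mono sum_mono2) auto

lemma hpos_ge: "6 + m \<le> hpos i"
  by (simp add: hpos_def)

definition maxlen :: "nat \<Rightarrow> nat" where
  "maxlen i = fold max (map length (take i hs)) 0"

lemma maxlen_Suc: "i < length hs \<Longrightarrow> maxlen (Suc i) = max (maxlen i) (length (hs ! i))"
  by (simp add: maxlen_def take_Suc_conv_app_nth max.commute)

lemma cell_input: "k + 100 < b \<Longrightarrow> cell b inp arr (k + 100) = inp k" "k + 100 < b \<Longrightarrow> cell b inp arr (100 + k) = inp k"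
  by (simp_all add: cell_def)

text \<open>Besides readiness it records the values of the loop bounds at the start of each piece,
  where the cost of that piece is evaluated.\<close>

lemma prologue:
  assumes h: "start h" and gm: "gm = maxlen (length hs)"
  defines "h1 \<equiv> ex R p0 h"
  defines "h2 \<equiv> ex R p1 h1"
  defines "h3 \<equiv> ex R p2 h2"
  defines "h4 \<equiv> ex R p3 h3"
  defines "h5 \<equiv> ex R p4 h4"
  defines "h6 \<equiv> ex R p5 h5"
  defines "h7 \<equiv> ex R p6 h6"
  defines "h8 \<equiv> ex R p7 h7"
  shows "ready h8" "slots_ok 0 h8" "\<forall>k. fa h8 4 k = \<zero>" "based h3"
    "nv h1 1 = m" "nv h2 5 = DD" "nv h2 4 = length hs" "nv h3 3 = al" "nv h3 6 = gm" "nv h4 7 = NN" "nv h4 5 = DD"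
    "nv h5 8 = EE" "nv h6 4 = length hs" "nv h7 1 = m" "nv h7 2 = n"
proof -
  have bn: "bn h = 100 + (hpos (length hs) + al)" and bf: "bf h = 100 + n * DD" and br: "br h = 100 + length hs"
    using h by (auto simp: start_def)
  have clh: "fclosed R h" using h Fin_closed by (simp add: start_def fclosed_def)
  have b6: "k + 100 < bn h" if "k < 6 + m" for k using hpos_ge[of "length hs"] that bn by simp
  have bh: "hpos i + length (hs ! i) + 100 < bn h" if "i < length hs" for i
    using hpos_mono[of "Suc i" "length hs"] that bn by (simp add: hpos_Suc)
  have nv1: "nv h1 = (nv h)(1 := m, 2 := n, 3 := al, 4 := length hs)"
    and st1: "na h1 = na h" "ni h1 = ni h" "bn h1 = bn h" "fa h1 = fa h" "ra h1 = ra h" "bf h1 = bf h" "br h1 = br h"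
      "fi h1 = fi h" "ri h1 = ri h"
    using h b6[of 0] b6[of 1] b6[of 2] b6[of 5] by (simp_all add: h1_def p0_def cell_def start_def)
  let ?c1 = "SetN 5 (NPlus (NV 5) (NI (NPlus (NC 6) (NV 23))))"
  have "h2 = h1\<lparr>nv := (nv h1)(5 := off (nv h1 1), 23 := nv h1 1)\<rparr>"
    unfolding h2_def p1_def
  proof (rule For_rule[where I = "\<lambda>i k. k = h1\<lparr>nv := (nv h1)(5 := off i, 23 := i)\<rparr>"])
    show "h1\<lparr>nv := (nv h1)(23 := 0)\<rparr> = h1\<lparr>nv := (nv h1)(5 := off 0, 23 := 0)\<rparr>"
      using h nv1 by (auto intro!: store.equality ext simp: off_def start_def)
  next
    fix i k assume i: "i < nv h1 1" and k: "k = h1\<lparr>nv := (nv h1)(5 := off i, 23 := i)\<rparr>"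
    have "cell (bn h1) (ni h1) (na h1) (6 + i + 100) = rk i"
      using i h b6[of "6 + i"] nv1 st1 by (subst cell_input) (simp_all add: start_def)
    then show "(ex R ?c1 k)\<lparr>nv := (nv (ex R ?c1 k))(23 := Suc i)\<rparr> = h1\<lparr>nv := (nv h1)(5 := off (Suc i), 23 := Suc i)\<rparr>"
      unfolding k by (auto intro!: store.equality ext simp: off_Suc)
  qed simp
  then have nv2: "nv h2 = (nv h1)(5 := DD, 23 := m)"
    and st2: "na h2 = na h" "ni h2 = ni h" "bn h2 = bn h" "fa h2 = fa h" "ra h2 = ra h" "bf h2 = bf h" "br h2 = br h"
      "fi h2 = fi h" "ri h2 = ri h"
    using nv1 st1 by (simp_all add: DD_def)
  show "nv h1 1 = m" "nv h2 5 = DD" "nv h2 4 = length hs" by (simp_all add: nv1 nv2)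
  let ?c2 = "SetN 37 (NI (NV 35)) ;; Cond (BLe (NV 37) (NV 6)) Skip (SetN 6 (NV 37)) ;;
       SetN 35 (NPlus (NV 35) (NPlus (NV 37) (NC 1)))"
  define k2 where "k2 = h2\<lparr>nv := (nv h2)(36 := n * DD, 39 := DD, 41 := n * DD + 100, 42 := length hs + 100, 35 := 6 + m)\<rparr>"
  have k2: "ex R (mulc 36 2 5 ;; SetN 41 (NPlus (NV 36) (NC 100)) ;; SetN 42 (NPlus (NV 4) (NC 100)) ;;
     SetN 35 (NPlus (NC 6) (NV 1))) h2 = k2"
    by (simp add: k2_def ex_mulc nv2 nv1)
  define k3 where "k3 = ex R (For 14 4 ?c2) k2"
  have nk2: "nv k2 4 = length hs" "nv k2 6 = 0" "nv k2 35 = 6 + m" using h by (simp_all add: k2_def nv2 nv1 start_def)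
  have "nv k3 35 = hpos (nv k2 4) \<and> nv k3 6 = maxlen (nv k2 4)"
    unfolding k3_def
  proof (rule For_rule[where I = "\<lambda>i k. nv k 35 = hpos i \<and> nv k 6 = maxlen i"])
    show "nv (k2\<lparr>nv := (nv k2)(14 := 0)\<rparr>) 35 = hpos 0 \<and> nv (k2\<lparr>nv := (nv k2)(14 := 0)\<rparr>) 6 = maxlen 0"
      using nk2 by (simp add: hpos_def maxlen_def)
  next
    fix i k assume i: "i < nv k2 4" and same: "same (For 14 4 ?c2) k2 k" and I: "nv k 35 = hpos i \<and> nv k 6 = maxlen i"
    have i': "i < length hs" using i nk2 by simp
    have "ni k = ni h" "na k = na h" "bn k = bn h" using sameD[OF same] st2 by (auto simp: k2_def)
    then have "cell (bn k) (ni k) (na k) (hpos i + 100) = length (hs ! i)"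
      using bh[OF i'] h i' by (subst cell_input) (simp_all add: start_def)
    then show "nv ((ex R ?c2 k)\<lparr>nv := (nv (ex R ?c2 k))(14 := Suc i)\<rparr>) 35 = hpos (Suc i) \<and>
        nv ((ex R ?c2 k)\<lparr>nv := (nv (ex R ?c2 k))(14 := Suc i)\<rparr>) 6 = maxlen (Suc i)"
      using I i' by (auto simp: hpos_Suc maxlen_Suc max_def)
  qed simp
  then have k3: "nv k3 35 = hpos (length hs)" "nv k3 6 = gm" using nk2 gm by auto
  have same3: "same (For 14 4 ?c2) k2 k3" unfolding k3_def by (rule same_ex)
  have sk3: "nv k3 z = nv k2 z" if "z \<notin> {14, 37, 6, 35}" for z using sameD(1)[OF same3, of z] that by simp
  have stk3: "na k3 = na h" "ni k3 = ni h" "bn k3 = bn h" "fa k3 = fa h" "ra k3 = ra h" "bf k3 = bf h" "br k3 = br h"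
    "fi k3 = fi h" "ri k3 = ri h"
    using sameD[OF same3] st2 by (auto simp: k2_def)
  have h3: "h3 = k3\<lparr>nv := (nv k3)(40 := hpos (length hs) + al + 100)\<rparr>"
  proof -
    have "h3 = ex R (SetN 40 (NPlus (NPlus (NV 35) (NV 3)) (NC 100))) (ex R (For 14 4 ?c2)
      (ex R (mulc 36 2 5 ;; SetN 41 (NPlus (NV 36) (NC 100)) ;; SetN 42 (NPlus (NV 4) (NC 100)) ;;
     SetN 35 (NPlus (NC 6) (NV 1))) h2))" by (simp only: h3_def p2_def ex.simps(8))
    also have "\<dots> = ex R (SetN 40 (NPlus (NPlus (NV 35) (NV 3)) (NC 100))) k3" unfolding k2 k3_def ..
    also have "\<dots> = k3\<lparr>nv := (nv k3)(40 := hpos (length hs) + al + 100)\<rparr>"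
      using k3(1) sk3[of 3] by (simp add: k2_def nv2 nv1)
    finally show ?thesis .
  qed
  have n3: "nv h3 1 = m" "nv h3 2 = n" "nv h3 3 = al" "nv h3 4 = length hs" "nv h3 5 = DD" "nv h3 6 = gm"
    "nv h3 40 = bn h" "nv h3 41 = bf h" "nv h3 42 = br h"
    using sk3 k3 bn bf br by (simp_all add: h3 k2_def nv2 nv1)
  have st3: "na h3 = na h" "ni h3 = ni h" "bn h3 = bn h" "fa h3 = fa h" "ra h3 = ra h" "bf h3 = bf h" "br h3 = br h"
    "fi h3 = fi h" "ri h3 = ri h" using stk3 by (simp_all add: h3)
  show "based h3" using n3 st3 by (simp add: based_def)
  show "nv h3 3 = al" "nv h3 6 = gm" using n3 by auto
  have h4: "h4 = h3\<lparr>nv := (nv h3)(36 := m * al, 7 := NN, 39 := gm)\<rparr>"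
    using n3 by (auto intro!: store.equality ext simp: h4_def p3_def ex_mulc NN_def)
  show "nv h4 7 = NN" "nv h4 5 = DD" using n3 by (simp_all add: h4)
  define k4 where "k4 = h4\<lparr>nv := (nv h4)(36 := NN * NN, 37 := NN * NN * DD, 39 := DD, 8 := EE), na := upd2 (na h4) 0 0 1\<rparr>"
  have k4: "ex R (mulc 36 7 7 ;; mulc 37 36 5 ;; SetN 8 (NPlus (NV 37) (NC 1)) ;; SetNA 0 (NC 0) (NC 1)) h4 = k4"
    using n3 by (auto intro!: store.equality ext simp: k4_def h4 ex_mulc EE_def)
  let ?c4 = "SetNA 0 (NPlus (NV 27) (NC 1)) (NPlus (NA 0 (NV 27)) (NA 0 (NV 27)))"
  define k5 where "k5 = ex R (For 27 7 ?c4) k4"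
  have "\<forall>t\<le>nv k4 7. na k5 0 t = 2 ^ t"
    unfolding k5_def
    by (rule For_rule[where I = "\<lambda>i k. \<forall>t\<le>i. na k 0 t = 2 ^ t"]) (auto simp: k4_def le_Suc_eq)
  moreover have "nv k4 7 = NN" by (simp add: k4_def h4)
  ultimately have P2: "\<forall>t\<le>NN. na k5 0 t = 2 ^ t" by simp
  have same5: "same (For 27 7 ?c4) k4 k5" unfolding k5_def by (rule same_ex)
  have h5: "h5 = k5\<lparr>nv := (nv k5)(11 := 2 ^ NN)\<rparr>"
  proof -
    have "h5 = ex R (SetN 11 (NA 0 (NV 7))) (ex R (For 27 7 ?c4)
      (ex R (mulc 36 7 7 ;; mulc 37 36 5 ;; SetN 8 (NPlus (NV 37) (NC 1)) ;; SetNA 0 (NC 0) (NC 1)) h4))"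
      by (simp only: h5_def p4_def ex.simps(8))
    also have "\<dots> = ex R (SetN 11 (NA 0 (NV 7))) k5" unfolding k4 k5_def ..
    also have "\<dots> = k5\<lparr>nv := (nv k5)(11 := 2 ^ NN)\<rparr>"
      using P2 sameD(1)[OF same5, of 7] by (simp add: k4_def h4)
    finally show ?thesis .
  qed
  have n5: "nv h5 1 = m" "nv h5 2 = n" "nv h5 3 = al" "nv h5 4 = length hs" "nv h5 5 = DD" "nv h5 6 = gm"
    "nv h5 7 = NN" "nv h5 8 = EE" "nv h5 11 = 2 ^ NN"
    using sameD(1)[OF same5] n3 by (simp_all add: h5 k4_def h4)
  have st5: "na h5 1 = na h 1" "na h5 2 = na h 2" "na h5 3 = na h 3" "na h5 4 = na h 4" "na h5 0 = na k5 0"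
    "ni h5 = ni h" "bn h5 = bn h" "fa h5 = fa h" "ra h5 = ra h" "bf h5 = bf h" "br h5 = br h" "fi h5 = fi h" "ri h5 = ri h"
    using sameD[OF same5] st3 by (auto simp: h5 k4_def h4)
  show "nv h5 8 = EE" by (rule n5)
  have h6: "h6 = h5\<lparr>nv := (nv h5)(9 := LL, 39 := EE)\<rparr>" using n5 by (simp add: h6_def p5_def ex_mulc LL_def)
  show "nv h6 4 = length hs" using n5 by (simp add: h6)
  define k6 where "k6 = h6\<lparr>nv := (nv h6)(10 := NR, 39 := length hs, 35 := 6 + m)\<rparr>"
  have k6: "ex R (mulc 10 9 4 ;; SetN 35 (NPlus (NC 6) (NV 1))) h6 = k6"
    using n5 by (simp add: k6_def h6 ex_mulc NR_def)
  let ?c6 = "SetNA 3 (NV 14) (NV 35) ;; SetN 35 (NPlus (NV 35) (NPlus (NI (NV 35)) (NC 1)))"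
  define k7 where "k7 = ex R (For 14 4 ?c6) k6"
  have "nv k7 35 = hpos (nv k6 4) \<and> (\<forall>i<nv k6 4. na k7 3 i = hpos i)"
    unfolding k7_def
  proof (rule For_rule[where I = "\<lambda>i k. nv k 35 = hpos i \<and> (\<forall>i'<i. na k 3 i' = hpos i')"])
    fix i k assume i: "i < nv k6 4" "nv k 14 = i" and same: "same (For 14 4 ?c6) k6 k"
      and I: "nv k 35 = hpos i \<and> (\<forall>i'<i. na k 3 i' = hpos i')"
    have i': "i < length hs" using i n5 by (simp add: k6_def h6)
    have "ni k = ni h" "bn k = bn h" using sameD[OF same] st5 by (auto simp: k6_def h6)
    then have "cell (bn k) (ni k) B (hpos i + 100) = length (hs ! i)" for B
      using bh[OF i'] h i' by (subst cell_input) (simp_all add: start_def)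
    then show "nv ((ex R ?c6 k)\<lparr>nv := (nv (ex R ?c6 k))(14 := Suc i)\<rparr>) 35 = hpos (Suc i) \<and>
        (\<forall>i'<Suc i. na ((ex R ?c6 k)\<lparr>nv := (nv (ex R ?c6 k))(14 := Suc i)\<rparr>) 3 i' = hpos i')"
      using I i by (auto simp: hpos_Suc less_Suc_eq)
  qed (simp_all add: k6_def hpos_def)
  then have HP: "\<forall>i<length hs. na k7 3 i = hpos i" using n5 by (simp add: k6_def h6)
  have same7: "same (For 14 4 ?c6) k6 k7" unfolding k7_def by (rule same_ex)
  have h7: "h7 = k7\<lparr>fa := upd2 (fa k7) 3 0 \<one>\<rparr>"
  proof -
    have "h7 = ex R (SetFA 3 (NC 0) F1) (ex R (For 14 4 ?c6) (ex R (mulc 10 9 4 ;; SetN 35 (NPlus (NC 6) (NV 1))) h6))"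
      by (simp only: h7_def p6_def ex.simps(8))
    also have "\<dots> = ex R (SetFA 3 (NC 0) F1) k7" unfolding k6 k7_def ..
    finally show ?thesis by simp
  qed
  have n7: "nv h7 1 = m" "nv h7 2 = n" "nv h7 3 = al" "nv h7 4 = length hs" "nv h7 5 = DD" "nv h7 6 = gm"
    "nv h7 7 = NN" "nv h7 8 = EE" "nv h7 9 = LL" "nv h7 10 = NR" "nv h7 11 = 2 ^ NN"
    using sameD(1)[OF same7] n5 by (simp_all add: h7 k6_def h6)
  have st7: "na h7 1 = na h 1" "na h7 2 = na h 2" "na h7 3 = na k7 3" "na h7 4 = na h 4" "na h7 0 = na k5 0"
    "ni h7 = ni h" "bn h7 = bn h" "fa h7 = upd2 (fa h) 3 0 \<one>" "ra h7 = ra h" "bf h7 = bf h" "br h7 = br h" "fi h7 = fi h" "ri h7 = ri h"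
  proof -
    have "fa k7 = fa h" "ra k7 = ra h" using sameD[OF same7] st5 by (auto simp: k6_def h6)
    then show "na h7 1 = na h 1" "na h7 2 = na h 2" "na h7 3 = na k7 3" "na h7 4 = na h 4" "na h7 0 = na k5 0"
      "ni h7 = ni h" "bn h7 = bn h" "fa h7 = upd2 (fa h) 3 0 \<one>" "ra h7 = ra h" "bf h7 = bf h" "br h7 = br h" "fi h7 = fi h" "ri h7 = ri h"
      using sameD[OF same7] st5 by (simp_all add: h7 k6_def h6)
  qed
  show "nv h7 1 = m" "nv h7 2 = n" using n7 by auto
  let ?c8 = "SetNA 1 (NPlus (NV 23) (NC 1)) (NPlus (NA 1 (NV 23)) (NI (NPlus (NC 6) (NV 23)))) ;;
     SetN 37 (NI (NPlus (NC 6) (NV 23))) ;; mulc 36 37 2 ;;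
     SetNA 2 (NPlus (NV 23) (NC 1)) (NPlus (NA 2 (NV 23)) (NV 36))"
  have "\<forall>i\<le>nv h7 1. na h8 1 i = off i \<and> na h8 2 i = n * off i"
    unfolding h8_def p7_def
  proof (rule For_rule[where I = "\<lambda>i k. \<forall>i'\<le>i. na k 1 i' = off i' \<and> na k 2 i' = n * off i'"])
    show "\<forall>i'\<le>0. na (h7\<lparr>nv := (nv h7)(23 := 0)\<rparr>) 1 i' = off i' \<and> na (h7\<lparr>nv := (nv h7)(23 := 0)\<rparr>) 2 i' = n * off i'"
      using h st7(1,2) by (simp add: start_def off_def)
  next
    fix i k assume i: "i < nv h7 1" "nv k 23 = i" and same: "same (For 23 1 ?c8) h7 k"
      and I: "\<forall>i'\<le>i. na k 1 i' = off i' \<and> na k 2 i' = n * off i'"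
    have s: "ni k = ni h" "bn k = bn h" "nv k 2 = n" using sameD[OF same] st7 n7 by (auto simp: mulc_def)
    have "cell (bn k) (ni k) B (6 + i + 100) = rk i" for B
      using i s h b6[of "6 + i"] n7(1) by (subst cell_input) (simp_all add: start_def)
    then have "na (ex R ?c8 k) 1 = (na k 1)(Suc i := off i + rk i)" "na (ex R ?c8 k) 2 = (na k 2)(Suc i := n * off i + rk i * n)"
      using I i s by (auto simp: ex_mulc)
    then show "\<forall>i'\<le>Suc i. na ((ex R ?c8 k)\<lparr>nv := (nv (ex R ?c8 k))(23 := Suc i)\<rparr>) 1 i' = off i' \<and>
        na ((ex R ?c8 k)\<lparr>nv := (nv (ex R ?c8 k))(23 := Suc i)\<rparr>) 2 i' = n * off i'"
      using I by (simp add: le_Suc_eq off_Suc algebra_simps del: ex.simps)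
  qed (simp add: mulc_def)
  then have OFF: "\<forall>i\<le>m. na h8 1 i = off i \<and> na h8 2 i = n * off i" using n7 by simp
  have same8: "same p7 h7 h8" unfolding h8_def by (rule same_ex)
  have s8: "nv h8 z = nv h7 z" if "z \<in> {1..11}" for z using sameD(1)[OF same8, of z] that by (auto simp: p7_def mulc_def)
  have st8: "na h8 3 = na k7 3" "na h8 4 = na h 4" "na h8 0 = na k5 0" "ni h8 = ni h" "bn h8 = bn h"
    "fa h8 = upd2 (fa h) 3 0 \<one>" "ra h8 = ra h" "bf h8 = bf h" "br h8 = br h" "fi h8 = fi h" "ri h8 = ri h"
    using sameD[OF same8] st7 by (auto simp: p7_def mulc_def)
  have cl8: "fclosed R h8" unfolding h8_def h7_def h6_def h5_def h4_def h3_def h2_def h1_def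
    by (intro ex_closed clh)
  have dims: "dims DD NN EE h8" using P2 n7 s8 st8 by (simp add: dims_def LL_def)
  show "ready h8"
    unfolding ready_def using n7 s8 dims OFF HP st8 cl8 h bh by (simp add: start_def)
  have fa8: "fa h8 3 k = (if k = 0 then \<one> else \<zero>)" "fa h8 4 k = \<zero>" for k using st8 h by (auto simp: start_def)
  show "\<forall>k. fa h8 4 k = \<zero>" using fa8 by simp
  \<comment> \<open>Slot 0 represents the empty selection, the only one at level 0; the other slots
    are zero and therefore unconstrained.\<close>
  have row0: "row 3 h8 c = (if c = 0 then Vec [] else (\<lambda>x. \<zero>))" for c
    using LL_pos by (auto simp: row_def fa8 Vec_def)
  have ra8: "ra h8 0 c = 0" for c using st8 h by (simp add: start_def)
  show "slots_ok 0 h8"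
    unfolding slots_ok_def
  proof (intro conjI allI impI)
    fix c assume "row 3 h8 c \<noteq> (\<lambda>x. \<zero>)"
    then have "c = 0" using row0 by metis
    then show "set (seq 0 h8 c) \<subseteq> {..<length hs}" "row 3 h8 c = Vec (seq 0 h8 c)" "ra h8 0 c = wsum (seq 0 h8 c)"
      using row0 ra8 by (simp_all add: seq_def wsum_def)
  next
    fix \<sigma> :: "nat list" and \<Phi> assume "length \<sigma> = 0" "\<Phi> (Vec \<sigma>) \<noteq> \<zero>"
    then show "\<exists>c<LL. wsum \<sigma> \<le> ra h8 0 c \<and> \<Phi> (row 3 h8 c) \<noteq> \<zero>"
      using row0 ra8 LL_pos by (intro exI[of _ 0]) (simp add: wsum_def)
  qed
qed

text \<open>The input is overwritten, which is safe as the answer is copied from array 4, and the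
  assumption on \<open>bn h\<close> keeps the arrays intact.\<close>

lemma ex_outputs:
  assumes "nv h 3 = al" "100 + al \<le> bn h"
  shows "\<forall>j<al. ni (ex R outputs h) j = na h 4 (nv h 20 + j)" "nv (ex R outputs h) 0 = nv h 0"
proof -
  let ?c = "Out (NV 31) (NA 4 (NPlus (NV 20) (NV 31)))"
  have "(\<forall>j<nv h 3. ni (ex R (For 31 3 ?c) h) j = na h 4 (nv h 20 + j)) \<and> na (ex R (For 31 3 ?c) h) = na h"
  proof (rule For_rule[where I = "\<lambda>i k. (\<forall>j<i. ni k j = na h 4 (nv h 20 + j)) \<and> na k = na h"])
    fix i k assume i: "i < nv h 3" "nv k 31 = i" and same: "same (For 31 3 ?c) h k"
      and I: "(\<forall>j<i. ni k j = na h 4 (nv h 20 + j)) \<and> na k = na h"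
    have "nv k 20 = nv h 20" "bn k = bn h" using sameD[OF same] by simp_all
    then have "ex R ?c k = k\<lparr>ni := (ni k)(i := na h 4 (nv h 20 + i))\<rparr>"
      using i I assms by (simp add: Let_def)
    then show "(\<forall>j<Suc i. ni ((ex R ?c k)\<lparr>nv := (nv (ex R ?c k))(31 := Suc i)\<rparr>) j = na h 4 (nv h 20 + j)) \<and>
        na ((ex R ?c k)\<lparr>nv := (nv (ex R ?c k))(31 := Suc i)\<rparr>) = na h"
      using I by (simp add: less_Suc_eq)
  qed auto
  then show "\<forall>j<al. ni (ex R outputs h) j = na h 4 (nv h 20 + j)" using assms by (simp add: outputs_def)
  show "nv (ex R outputs h) 0 = nv h 0" by (rule ex_nv) (simp add: outputs_def)
qed

lemma frame_levels [simp]: "wN levels = insert 12 (wN cands \<union> insert 32 (wN elimcol))" "wNA levels = {4, 5}" "no_out levels"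
  by (auto simp: levels_def)

lemma frame_final [simp]: "wN final = {0, 13, 17, 20, 31, 33, 39}" "no_out final"
  by (auto simp: final_def mulc_def)

section \<open>Correctness of the main part\<close>

lemma run_main:
  assumes h: "ready h" and ok: "slots_ok 0 h" and z: "\<forall>k. fa h 4 k = \<zero>" and b: "100 + al \<le> bn h"
  defines "g \<equiv> ex R main h"
  shows "nv g 0 = 0 \<Longrightarrow> length \<sigma> = al \<Longrightarrow> set \<sigma> \<subseteq> {..<length hs} \<Longrightarrow> Vec \<sigma> = (\<lambda>x. \<zero>)"
    "nv g 0 \<noteq> 0 \<Longrightarrow> set (map (ni g) [0..<al]) \<subseteq> {..<length hs} \<and> Vec (map (ni g) [0..<al]) \<noteq> (\<lambda>x. \<zero>)"
    "nv g 0 \<noteq> 0 \<Longrightarrow> length \<sigma> = al \<Longrightarrow> set \<sigma> \<subseteq> {..<length hs} \<Longrightarrow> Vec \<sigma> \<noteq> (\<lambda>x. \<zero>) \<Longrightarrow>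
      wsum \<sigma> \<le> wsum (map (ni g) [0..<al])"
proof -
  define h1 where "h1 = ex R levels h"
  define h2 where "h2 = ex R final h1"
  have g: "g = ex R outputs h2" by (simp add: g_def main_def h1_def h2_def)
  have r1: "ready h1" unfolding h1_def by (rule ready_ex[OF h]) auto
  have ok1: "slots_ok al h1" unfolding h1_def by (rule ex_levels[OF h ok z])
  note fin = ex_final[OF r1, folded h2_def]
  have n2: "nv h2 3 = al" "bn h2 = bn h"
    using ex_nv[of 3 final R h1] r1 by (simp_all add: h2_def h1_def ready_def)
  note out = ex_outputs[of h2, OF n2(1), folded g]
  have b2: "100 + al \<le> bn h2" using b n2 by simp
  have ng: "nv g 0 = nv h2 0" using out(2)[OF b2] .
  have seq: "map (ni g) [0..<al] = seq al h1 (nv h2 33)"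
    using out(1)[OF b2] fin(4,5) by (simp add: seq_def)
  have rep: "\<exists>c<LL. wsum \<sigma> \<le> ra h1 0 c \<and> row 3 h1 c \<noteq> (\<lambda>x. \<zero>)"
    if \<sigma>: "length \<sigma> = al" "set \<sigma> \<subseteq> {..<length hs}" and nz: "Vec \<sigma> \<noteq> (\<lambda>x. \<zero>)" for \<sigma>
  proof -
    obtain x where x: "Vec \<sigma> x \<noteq> \<zero>" using nz by auto
    \<comment> \<open>At the end coordinates suffice as tests: a nonzero vector has a nonzero
      coordinate.\<close>
    have "linear (\<lambda>a. a x)" by (simp add: linear_def closed_def)
    from ok1[unfolded slots_ok_def, THEN conjunct2, rule_format, OF \<sigma> this x]
    show ?thesis by auto
  qed
  show "Vec \<sigma> = (\<lambda>x. \<zero>)" if "nv g 0 = 0" "length \<sigma> = al" "set \<sigma> \<subseteq> {..<length hs}"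
    using rep[OF that(2,3)] fin(1) that(1) ng by metis
  show "set (map (ni g) [0..<al]) \<subseteq> {..<length hs} \<and> Vec (map (ni g) [0..<al]) \<noteq> (\<lambda>x. \<zero>)" if "nv g 0 \<noteq> 0"
    using fin(2) that ok1 unfolding seq ng slots_ok_def by metis
  show "wsum \<sigma> \<le> wsum (map (ni g) [0..<al])"
    if A: "nv g 0 \<noteq> 0" "length \<sigma> = al" "set \<sigma> \<subseteq> {..<length hs}" "Vec \<sigma> \<noteq> (\<lambda>x. \<zero>)"
  proof -
    obtain c where c: "c < LL" "wsum \<sigma> \<le> ra h1 0 c" "row 3 h1 c \<noteq> (\<lambda>x. \<zero>)" using rep[OF A(2-4)] by blast
    have n: "nv h2 0 \<noteq> 0" using A(1) ng by simp
    have "ra h1 0 c \<le> ra h1 0 (nv h2 33)" using fin(3)[OF n c(1,3)] .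
    moreover have "ra h1 0 (nv h2 33) = wsum (seq al h1 (nv h2 33))"
      using fin(2)[OF n] ok1 unfolding slots_ok_def by blast
    ultimately show ?thesis using c(2) seq by simp
  qed
qed

end

section \<open>Running time\<close>

text \<open>A loop with bound 0 is not entered, so the bounds of the loops inside it do not matter.\<close>

primrec live :: "com \<Rightarrow> (nat \<Rightarrow> nat) \<Rightarrow> nat set" where
  "live Skip \<sigma> = {}"
| "live (SetN x e) \<sigma> = {}"
| "live (SetNA a e1 e2) \<sigma> = {}"
| "live (Out e1 e2) \<sigma> = {}"
| "live (SetF x e) \<sigma> = {}"
| "live (SetFA a e1 e2) \<sigma> = {}"
| "live (SetRA a e1 e2) \<sigma> = {}"
| "live (c1 ;; c2) \<sigma> = live c1 \<sigma> \<union> live c2 \<sigma>"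
| "live (Cond b c1 c2) \<sigma> = live c1 \<sigma> \<union> live c2 \<sigma>"
| "live (For x y c) \<sigma> = insert y (if \<sigma> y = 0 then {} else live c \<sigma>)"

primrec size_of :: "com \<Rightarrow> nat" where
  "size_of Skip = 0"
| "size_of (SetN x e) = clen (SetN x e)"
| "size_of (SetNA a e1 e2) = clen (SetNA a e1 e2)"
| "size_of (Out e1 e2) = clen (Out e1 e2)"
| "size_of (SetF x e) = clen (SetF x e)"
| "size_of (SetFA a e1 e2) = clen (SetFA a e1 e2)"
| "size_of (SetRA a e1 e2) = clen (SetRA a e1 e2)"
| "size_of (c1 ;; c2) = size_of c1 + size_of c2"
| "size_of (Cond b c1 c2) = length (cB b) + 2 + size_of c1 + size_of c2"
| "size_of (For x y c) = size_of c + 6"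

text \<open>The degree of the bound on the cost: it counts nested loops bounded by a variable in
  \<open>S\<close>, and all nested loops for \<open>UNIV\<close>.\<close>

primrec nesting :: "nat set \<Rightarrow> com \<Rightarrow> nat" where
  "nesting S Skip = 0"
| "nesting S (SetN x e) = 0"
| "nesting S (SetNA a e1 e2) = 0"
| "nesting S (Out e1 e2) = 0"
| "nesting S (SetF x e) = 0"
| "nesting S (SetFA a e1 e2) = 0"
| "nesting S (SetRA a e1 e2) = 0"
| "nesting S (c1 ;; c2) = max (nesting S c1) (nesting S c2)"
| "nesting S (Cond b c1 c2) = max (nesting S c1) (nesting S c2)"
| "nesting S (For x y c) = (if y \<in> S then 1 else 0) + nesting S c"

text \<open>Each nested loop multiplies the cost by at most \<open>Y\<close>, and by a further
  \<open>H\<close> if its bound lies in \<open>S\<close>. By the use of \<open>live\<close>, nothing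
  is asked of loops that are never entered.\<close>

lemma scost_bound:
  assumes "1 \<le> Y" "1 \<le> H" "\<And>y. y \<in> live c \<sigma> \<Longrightarrow> \<sigma> y \<le> (if y \<in> S then Y * H else Y)"
  shows "scost c \<sigma> \<le> size_of c * (Y ^ nesting UNIV c * H ^ nesting S c)"
  using assms(3)
proof (induction c)
  case (Seq c1 c2)
  let ?N = "nesting UNIV (c1 ;; c2)" and ?M = "nesting S (c1 ;; c2)"
  have "scost c1 \<sigma> \<le> size_of c1 * (Y ^ nesting UNIV c1 * H ^ nesting S c1)" using Seq by simp
  also have "\<dots> \<le> size_of c1 * (Y ^ ?N * H ^ ?M)" using assms by (intro mult_le_mono power_increasing) auto
  finally have 1: "scost c1 \<sigma> \<le> size_of c1 * (Y ^ ?N * H ^ ?M)" .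
  have "scost c2 \<sigma> \<le> size_of c2 * (Y ^ nesting UNIV c2 * H ^ nesting S c2)" using Seq by simp
  also have "\<dots> \<le> size_of c2 * (Y ^ ?N * H ^ ?M)" using assms by (intro mult_le_mono power_increasing) auto
  finally have 2: "scost c2 \<sigma> \<le> size_of c2 * (Y ^ ?N * H ^ ?M)" .
  have "scost (c1 ;; c2) \<sigma> \<le> size_of c1 * (Y ^ ?N * H ^ ?M) + size_of c2 * (Y ^ ?N * H ^ ?M)"
    using add_le_mono[OF 1 2] by simp
  then show ?case by (simp only: size_of.simps distrib_right)
next
  case (Cond b c1 c2)
  let ?N = "nesting UNIV (Cond b c1 c2)" and ?M = "nesting S (Cond b c1 c2)"
  have "scost c1 \<sigma> \<le> size_of c1 * (Y ^ nesting UNIV c1 * H ^ nesting S c1)" using Cond by simp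
  also have "\<dots> \<le> size_of c1 * (Y ^ ?N * H ^ ?M)" using assms by (intro mult_le_mono power_increasing) auto
  finally have 1: "scost c1 \<sigma> \<le> size_of c1 * (Y ^ ?N * H ^ ?M)" .
  have "scost c2 \<sigma> \<le> size_of c2 * (Y ^ nesting UNIV c2 * H ^ nesting S c2)" using Cond by simp
  also have "\<dots> \<le> size_of c2 * (Y ^ ?N * H ^ ?M)" using assms by (intro mult_le_mono power_increasing) auto
  finally have 2: "scost c2 \<sigma> \<le> size_of c2 * (Y ^ ?N * H ^ ?M)" .
  have "1 \<le> Y ^ ?N * H ^ ?M" using assms by (simp add: Suc_le_eq)
  then have 3: "length (cB b) + 2 \<le> (length (cB b) + 2) * (Y ^ ?N * H ^ ?M)"
    using mult_le_mono2[of 1 "Y ^ ?N * H ^ ?M" "length (cB b) + 2"] by simp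
  have "scost (Cond b c1 c2) \<sigma> \<le> (length (cB b) + 2) * (Y ^ ?N * H ^ ?M) +
      size_of c1 * (Y ^ ?N * H ^ ?M) + size_of c2 * (Y ^ ?N * H ^ ?M)"
    using add_le_mono[OF add_le_mono[OF 3 1] 2] by simp
  then show ?case by (simp only: size_of.simps distrib_right)
next
  case (For x y c)
  let ?e = "if y \<in> S then 1 else 0 :: nat"
  let ?A = "Y ^ nesting UNIV c * H ^ nesting S c"
  let ?B = "Y * H ^ ?e"
  have pos: "1 \<le> ?A" "1 \<le> ?B" using assms by (auto simp: Suc_le_eq)
  have eq: "Y ^ nesting UNIV (For x y c) * H ^ nesting S (For x y c) = ?B * ?A"
    by (simp add: power_add)
  show ?case
  proof (cases "\<sigma> y = 0")
    case True
    have "1 \<le> ?B * ?A" using mult_le_mono[OF pos(2,1)] by simp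
    then have "2 \<le> (size_of c + 6) * (?B * ?A)" using mult_le_mono[of 2 "size_of c + 6" 1 "?B * ?A"] by simp
    then show ?thesis unfolding eq using True by simp
  next
    case False
    then have "scost c \<sigma> \<le> size_of c * ?A" using For by simp
    then have "scost c \<sigma> + 4 * 1 \<le> size_of c * ?A + 4 * ?A"
      by (rule add_le_mono[OF _ mult_le_mono2[OF pos(1)]])
    then have "scost c \<sigma> + 4 \<le> (size_of c + 4) * ?A" unfolding distrib_right by simp
    moreover have "\<sigma> y \<le> ?B" using For.prems[of y] by (auto split: if_splits)
    ultimately have 1: "\<sigma> y * (scost c \<sigma> + 4) \<le> ?B * ((size_of c + 4) * ?A)" by (intro mult_le_mono)
    have "2 * (1 * 1) \<le> 2 * (?B * ?A)" by (intro mult_le_mono2 mult_le_mono pos)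
    then have "2 \<le> 2 * (?B * ?A)" by (simp only: mult_1_right)
    from add_le_mono[OF this 1] have "scost (For x y c) \<sigma> \<le> 2 * (?B * ?A) + ?B * ((size_of c + 4) * ?A)"
      unfolding scost.simps .
    also have "\<dots> = (size_of c + 6) * (?B * ?A)" by (simp add: algebra_simps)
    finally show ?thesis unfolding eq by simp
  qed
qed simp_all

lemma live_subset: "live c \<sigma> \<subseteq> bvars c"
  by (induction c) auto

lemma live_app: "live app \<sigma> \<subseteq> {6} \<union> (if \<sigma> 6 = 0 then {} else {1, 5, 7, 8, 9, 11})"
proof -
  have "bvars app \<subseteq> {1, 5, 6, 7, 8, 9, 11}"
    by (auto simp: app_def buildf_def wstep_def ebody_def tbody_def jloop_def mulc_def copyF_def)
  moreover have "live app \<sigma> = {6}" if "\<sigma> 6 = 0" using that by (simp add: app_def)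
  ultimately show ?thesis using live_subset[of app \<sigma>] by auto
qed

text \<open>The two case distinctions are those in which \<open>N\<close> is 0. The factor
  \<open>2 ^ N\<close> then pays for nothing, so the loops over \<open>m\<close>, \<open>D\<close>
  and the like must be seen not to run.\<close>

lemma live_main: "live main \<sigma> \<subseteq> {3, 9} \<union> (if \<sigma> 3 = 0 then {} else {4, 6, 10} \<union> (if \<sigma> 6 = 0 then {} else {1, 5, 7, 8, 11}))"
proof -
  have c: "live cand \<sigma> \<subseteq> {3, 4, 6, 9, 10} \<union> (if \<sigma> 6 = 0 then {} else {1, 5, 7, 8, 11})"
    using live_app[of \<sigma>] by (auto simp: cand_def mulc_def copyF_def copyN_def)
  have cs: "live cands \<sigma> \<subseteq> {3, 4, 6, 9, 10} \<union> (if \<sigma> 6 = 0 then {} else {1, 5, 7, 8, 11})"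
    using c by (auto simp: cands_def mulc_def)
  have "bvars elimcol \<subseteq> {3, 9, 10}"
    by (auto simp: elimcol_def findbest_def elimrow_def mulc_def copyF_def copyN_def)
  then have e: "live elimcol \<sigma> \<subseteq> {3, 9, 10}" using live_subset[of elimcol \<sigma>] by auto
  have "live levels \<sigma> \<subseteq> {3, 9} \<union> (if \<sigma> 3 = 0 then {} else {4, 6, 10} \<union> (if \<sigma> 6 = 0 then {} else {1, 5, 7, 8, 11}))"
    using cs e by (auto simp: levels_def split: if_splits)
  moreover have "live (final ;; outputs) \<sigma> \<subseteq> {3, 9}"
    by (auto simp: final_def outputs_def mulc_def split: if_splits)
  ultimately show ?thesis by (auto simp: main_def)
qed

text \<open>Variables 4 and 10, the numbers of members and of candidates, are the bounds in
  \<open>main\<close> that grow with the family; their nesting limits the exponent of its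
  size.\<close>

lemma nesting_main: "nesting {4, 10} main \<le> 2"
  by (simp add: main_def levels_def cands_def cand_def app_def buildf_def wstep_def ebody_def tbody_def jloop_def
      elimcol_def findbest_def elimrow_def final_def outputs_def mulc_def copyF_def copyN_def)

lemmas com_defs = p0_def p1_def p2_def p3_def p4_def p5_def p6_def p7_def main_def levels_def cands_def cand_def
  app_def buildf_def wstep_def ebody_def tbody_def jloop_def elimcol_def findbest_def elimrow_def final_def
  outputs_def mulc_def copyF_def copyN_def

lemma ok_pieces:
  "okC False p0" "okC False p1" "okC False p2" "okC True p3" "okC True p4" "okC True p5" "okC True p6" "okC True p7"
  "okC True main"
  by (simp_all add: com_defs)

lemma bounds_pieces:
  "bvars p0 \<inter> wN p0 = {}" "bvars p1 \<inter> wN p1 = {}" "bvars p2 \<inter> wN p2 = {}" "bvars p3 \<inter> wN p3 = {}"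
  "bvars p4 \<inter> wN p4 = {}" "bvars p5 \<inter> wN p5 = {}" "bvars p6 \<inter> wN p6 = {}" "bvars p7 \<inter> wN p7 = {}"
  "bvars main \<inter> wN main = {}"
  by (simp_all add: com_defs)

section \<open>Composition of the pieces and the total cost\<close>

lemma run_piece:
  assumes "loaded P (pc s) (comp (c1 ;; c2) (pc s))" "okC ar c1" "sim h s" "ar \<Longrightarrow> based h" "inputs_first h"
    "bvars c1 \<inter> wN c1 = {}"
  obtains t s' where "t \<le> scost c1 (nv h)" "reach F P s t s'" "sim (ex F c1 h) s'"
    "loaded P (pc s') (comp c2 (pc s'))" "pc s' = pc s + clen c1"
proof -
  have l: "loaded P (pc s) (comp c1 (pc s))" "loaded P (pc s + clen c1) (comp c2 (pc s + clen c1))"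
    using assms(1) by (auto simp: loaded_append clen_comp)
  from comp_correct[OF assms(2) l(1) assms(3-6), where F = F] obtain t s' where
    "t \<le> scost c1 (nv h)" "reach F P s t s'" "pc s' = pc s + clen c1" "sim (ex F c1 h) s'" by blast
  then show ?thesis using l(2) by (intro that[of t s']) auto
qed

text \<open>The final \<open>Skip\<close> lets every piece, the last one included, be split off by
  \<open>run_piece\<close>.\<close>

definition program :: com where
  "program = p0 ;; p1 ;; p2 ;; p3 ;; p4 ;; p5 ;; p6 ;; p7 ;; main ;; Skip"

text \<open>The successor makes the exponent positive, so that a positive base is at most its
  power.\<close>

definition depth :: nat where
  "depth = Suc (nesting UNIV main)"

lemma nesting_pieces:
  "nesting UNIV p1 = 1" "nesting UNIV p2 = 1" "nesting UNIV p3 = 1" "nesting UNIV p4 = 1" "nesting UNIV p5 = 1"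
  "nesting UNIV p6 = 1" "nesting UNIV p7 = 2" "nesting {2} p7 = 1"
  by (simp_all add: com_defs)

lemma bvars_pieces:
  "bvars p1 = {1}" "bvars p2 = {5, 4}" "bvars p3 = {3, 6}" "bvars p4 = {7, 5}" "bvars p5 = {8}" "bvars p6 = {4}"
  "bvars p7 = {1, 2}"
  by (auto simp: com_defs)

lemma scost_linear:
  assumes "nesting UNIV c = 1" "\<And>y. y \<in> bvars c \<Longrightarrow> \<sigma> y \<le> Y" "1 \<le> Y"
  shows "scost c \<sigma> \<le> size_of c * Y"
  using scost_bound[of Y 1 c \<sigma> "{}"] assms live_subset[of c \<sigma>] by auto

definition total_size :: nat where
  "total_size = scost p0 (\<lambda>x. 0) + size_of p1 + 2 * size_of p2 + size_of p3 + 2 * size_of p4 + size_of p5 +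
     2 * size_of p6 + size_of p7 + size_of main"

context spmc_run begin

text \<open>There are two budgets. \<open>T1\<close>, exponential in \<open>NN\<close> and quadratic
  in the family, pays for the main part if \<open>NN\<close> is positive; \<open>T2\<close>, linear
  in \<open>n\<close>, pays for it if \<open>NN\<close> is 0. The preparation draws on both.\<close>

lemma total_cost:
  assumes m: "1 \<le> m" and n: "1 \<le> n" and rk: "\<And>i. i < m \<Longrightarrow> rk i \<le> r"
    and nH: "gm = 0 \<Longrightarrow> length hs \<le> 1" "length hs = 0 \<Longrightarrow> gm = 0"
    and v: "\<sigma>1 1 = m" "\<sigma>2 5 = DD" "\<sigma>2 4 = length hs" "\<sigma>3 3 = al" "\<sigma>3 6 = gm" "\<sigma>4 7 = NN" "\<sigma>4 5 = DD"
      "\<sigma>5 8 = EE" "\<sigma>6 4 = length hs" "\<sigma>7 1 = m" "\<sigma>7 2 = n"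
    and v8: "\<sigma>8 1 = m" "\<sigma>8 3 = al" "\<sigma>8 4 = length hs" "\<sigma>8 5 = DD" "\<sigma>8 6 = gm" "\<sigma>8 7 = NN" "\<sigma>8 8 = EE"
      "\<sigma>8 9 = LL" "\<sigma>8 10 = NR" "\<sigma>8 11 = 2 ^ NN"
  shows "scost p0 \<sigma>0 + scost p1 \<sigma>1 + scost p2 \<sigma>2 + scost p3 \<sigma>3 + scost p4 \<sigma>4 + scost p5 \<sigma>5 + scost p6 \<sigma>6 +
      scost p7 \<sigma>7 + scost main \<sigma>8 \<le>
    total_size * ((2 ^ (4 * NN) * (r + 1)) ^ depth * (length hs)\<^sup>2 + m\<^sup>2 * n * (r + al + gm + 1) ^ depth)"
proof -
  \<comment> \<open>The 4 in the exponent: \<open>LL\<close> is \<open>2 ^ NN\<close> times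
    \<open>EE\<close>, and \<open>EE\<close> is at most \<open>2 ^ (3 * NN) * (r + 1)\<close>,
    because its factors \<open>NN\<close>, \<open>NN\<close> and \<open>m\<close> are each at most
    \<open>2 ^ NN\<close> when \<open>NN\<close> is positive.\<close>
  define E where "E = 2 ^ (4 * NN) * (r + 1)"
  define T1 where "T1 = E ^ depth * (length hs)\<^sup>2"
  define T2 where "T2 = m\<^sup>2 * n * (r + al + gm + 1) ^ depth"
  have DD: "DD \<le> m * r"
    unfolding DD_def off_def using sum_bounded_above[of "{..<m}" rk r] rk by simp
  have le2: "k \<le> NN \<Longrightarrow> k \<le> 2 ^ NN" for k using less_exp[of NN] by linarith
  have E1: "1 \<le> E" by (simp add: E_def Suc_le_eq)
  have E4: "2 ^ NN * x \<le> E" if "x \<le> 2 ^ (3 * NN) * (r + 1)" for x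
  proof -
    have "2 ^ NN * x \<le> 2 ^ NN * (2 ^ (3 * NN) * (r + 1))" using that by simp
    also have "\<dots> = E" by (simp add: E_def power_add[symmetric] mult.assoc[symmetric] del: mult_Suc_right)
    finally show ?thesis .
  qed
  have EE': "EE \<le> 2 ^ (3 * NN) * (r + 1)"
  proof (cases "NN = 0")
    case False
    then have "m \<le> NN" by (simp add: NN_def)
    then have "NN * NN * DD \<le> 2 ^ NN * 2 ^ NN * (2 ^ NN * r)"
      using DD le2 by (intro mult_le_mono order_trans[OF DD]) auto
    also have "\<dots> = 2 ^ (3 * NN) * r" by (simp add: power_add numeral_3_eq_3)
    finally have "NN * NN * DD + 1 \<le> 2 ^ (3 * NN) * r + 2 ^ (3 * NN)" by (intro add_le_mono) (simp_all add: Suc_le_eq)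
    then show ?thesis by (simp add: EE_def)
  qed (simp add: EE_def)
  have LLE: "LL \<le> E" unfolding LL_def by (rule E4[OF EE'])
  have EEL: "EE \<le> LL" by (simp add: LL_def)
  have NNE: "2 ^ NN \<le> E" using E4[of 1] by (simp add: Suc_le_eq)
  have dE: "E \<le> E ^ depth" using E1 power_increasing[of 1 depth E] by (simp add: depth_def)
  have E1': "1 \<le> E ^ depth" using E1 dE by linarith
  \<comment> \<open>An empty family makes \<open>T1\<close> zero; then \<open>NN\<close> is zero as
    well, and \<open>T2\<close> pays alone.\<close>
  have NN0: "length hs = 0 \<Longrightarrow> NN = 0" using nH(2) unfolding NN_def by auto
  have ET1: "E ^ depth \<le> T1" if "length hs \<noteq> 0"
    using that mult_le_mono2[of 1 "(length hs)\<^sup>2" "E ^ depth"] by (simp add: T1_def Suc_le_eq)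
  have B: "1 \<le> (r + al + gm + 1) ^ depth" by (simp add: Suc_le_eq)
  have dB: "r + al + gm + 1 \<le> (r + al + gm + 1) ^ depth"
    using power_increasing[of 1 depth "r + al + gm + 1"] by (simp add: depth_def)
  have mm: "m \<le> m\<^sup>2 * n" "1 \<le> m\<^sup>2 * n" using m n by (simp_all add: power2_eq_square Suc_le_eq)
  have T2a: "m\<^sup>2 * n \<le> T2" using mult_le_mono2[OF B] by (simp add: T2_def)
  have T2b: "x * y \<le> T2" if "x \<le> m\<^sup>2 * n" "y \<le> (r + al + gm + 1) ^ depth" for x y
    unfolding T2_def by (rule mult_le_mono[OF that])
  have T2m: "m \<le> T2" "1 \<le> T2" using mm T2a by linarith+
  have T2D: "DD \<le> T2"
    using DD by (rule order_trans[OF _ T2b]) (use mm dB in linarith)+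
  have T2g: "al + gm + 1 \<le> T2" using mm dB by (intro order_trans[OF _ T2b[of 1]]) simp_all
  have T1h: "length hs \<le> T1"
  proof -
    have "length hs \<le> (length hs)\<^sup>2" by (simp only: power2_eq_square le_square)
    also have "\<dots> \<le> T1" using mult_le_mono1[OF E1', of "(length hs)\<^sup>2"] by (simp add: T1_def)
    finally show ?thesis .
  qed
  have T1N: "NN \<le> T1"
  proof (cases "length hs = 0")
    case False
    have "NN \<le> 2 ^ NN" by (rule le2) simp
    then show ?thesis using ET1[OF False] NNE dE by linarith
  qed (use NN0 in simp)
  have TE: "EE \<le> T1 + T2"
    using ET1 dE LLE EEL NN0 T2m by (cases "length hs = 0") (auto simp: EE_def)
  have c0: "scost p0 \<sigma>0 \<le> scost p0 (\<lambda>x. 0) * (T1 + T2)"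
  proof -
    have "scost p0 \<sigma>0 = scost p0 (\<lambda>x. 0)" by (simp add: p0_def)
    then show ?thesis using T2m by simp
  qed
  have c1: "scost p1 \<sigma>1 \<le> size_of p1 * (T1 + T2)"
    using T2m v by (intro scost_linear nesting_pieces) (auto simp: bvars_pieces)
  have c2: "scost p2 \<sigma>2 \<le> size_of p2 * (2 * (T1 + T2))"
    using T2m T2D T1h v by (intro scost_linear nesting_pieces) (auto simp: bvars_pieces)
  have c3: "scost p3 \<sigma>3 \<le> size_of p3 * (T1 + T2)"
    using T2m T2g v by (intro scost_linear nesting_pieces) (auto simp: bvars_pieces)
  have c4: "scost p4 \<sigma>4 \<le> size_of p4 * (2 * (T1 + T2))"
    using T2m T2D T1N v by (intro scost_linear nesting_pieces) (auto simp: bvars_pieces)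
  have c5: "scost p5 \<sigma>5 \<le> size_of p5 * (T1 + T2)"
    using T2m TE v by (intro scost_linear nesting_pieces) (auto simp: bvars_pieces)
  have c6: "scost p6 \<sigma>6 \<le> size_of p6 * (2 * (T1 + T2))"
    using T2m T1h v by (intro scost_linear nesting_pieces) (auto simp: bvars_pieces)
  have c7: "scost p7 \<sigma>7 \<le> size_of p7 * (T1 + T2)"
  proof -
    have "scost p7 \<sigma>7 \<le> size_of p7 * (m ^ nesting UNIV p7 * n ^ nesting {2} p7)"
      using m n v live_subset[of p7 \<sigma>7] by (intro scost_bound) (auto simp: bvars_pieces)
    also have "\<dots> \<le> size_of p7 * (T1 + T2)" using T2a by (simp add: nesting_pieces)
    finally show ?thesis .
  qed
  have c8: "scost main \<sigma>8 \<le> size_of main * (T1 + T2)"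
  proof (cases "NN = 0")
    \<comment> \<open>Now \<open>LL\<close> is 1. Either \<open>al\<close> is 0, or all members are
      empty and there is at most one of them; in both cases every loop that is reached has a bound
      of at most \<open>al + 1\<close>.\<close>
    case True
    then have L1: "LL = 1" by (simp add: LL_def EE_def)
    have "\<sigma>8 y \<le> al + 1" if "y \<in> live main \<sigma>8" for y
    proof (cases "al = 0")
      case True
      then show ?thesis using that live_main[of \<sigma>8] v8 L1 by auto
    next
      case False
      then have "gm = 0" using \<open>NN = 0\<close> m by (simp add: NN_def)
      then have "y \<in> {3, 9, 4, 6, 10}" using that live_main[of \<sigma>8] v8 by (auto split: if_splits)
      moreover have "NR \<le> 1" using nH(1)[OF \<open>gm = 0\<close>] L1 by (simp add: NR_def)
      ultimately show ?thesis using v8(2-5,8,9) L1 \<open>gm = 0\<close> nH(1)[OF \<open>gm = 0\<close>] by auto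
    qed
    then have "scost main \<sigma>8 \<le> size_of main * ((al + 1) ^ nesting UNIV main * 1 ^ nesting {} main)"
      by (intro scost_bound) auto
    also have "(al + 1) ^ nesting UNIV main * 1 ^ nesting {} main \<le> (r + al + gm + 1) ^ depth"
    proof -
      have "(al + 1) ^ nesting UNIV main \<le> (r + al + gm + 1) ^ nesting UNIV main" by (intro power_mono) auto
      also have "\<dots> \<le> (r + al + gm + 1) ^ depth" by (intro power_increasing) (auto simp: depth_def)
      finally show ?thesis by simp
    qed
    also have "(r + al + gm + 1) ^ depth \<le> T1 + T2" using T2b[of 1 "(r + al + gm + 1) ^ depth"] mm by simp
    finally show ?thesis by simp
  next
    \<comment> \<open>Now \<open>m\<close>, \<open>al\<close> and \<open>gm\<close> are positive, so
      each of them is at most their product \<open>NN\<close>.\<close>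
    case False
    then have le: "m \<le> NN" "al \<le> NN" "gm \<le> NN" and h1: "1 \<le> length hs" using NN0
      by (auto simp: NN_def Suc_le_eq)
    have le': "m \<le> E" "al \<le> E" "gm \<le> E" "NN \<le> E" "EE \<le> E"
      using le le2 NNE EEL LLE order_trans by (meson order_refl)+
    have "DD \<le> E"
    proof -
      have "DD \<le> 2 ^ NN * r" using DD mult_le_mono1[OF le2[OF le(1)], of r] by linarith
      also have "1 * r \<le> 2 ^ (3 * NN) * (r + 1)" by (intro mult_le_mono) (simp_all add: Suc_le_eq)
      then have "2 ^ NN * r \<le> E" by (intro E4) simp
      finally show ?thesis .
    qed
    moreover have "length hs \<le> E * length hs" "NR \<le> E * length hs"
      using E1 LLE by (simp_all add: NR_def)
    moreover have "live main \<sigma>8 \<subseteq> {3, 9, 4, 6, 10, 1, 5, 7, 8, 11}" using live_main[of \<sigma>8] by (auto split: if_splits)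
    ultimately have "\<sigma>8 y \<le> (if y \<in> {4, 10} then E * length hs else E)" if "y \<in> live main \<sigma>8" for y
      using subsetD[OF _ that] v8 le' LLE NNE by (smt (verit) insert_iff empty_iff)
    then have "scost main \<sigma>8 \<le> size_of main * (E ^ nesting UNIV main * length hs ^ nesting {4, 10} main)"
      using E1 h1 by (intro scost_bound) auto
    also have "\<dots> \<le> size_of main * (E ^ depth * length hs ^ 2)"
      using E1 h1 nesting_main by (intro mult_le_mono power_increasing) (auto simp: depth_def)
    also have "\<dots> \<le> size_of main * (T1 + T2)" by (simp add: T1_def)
    finally show ?thesis .
  qed
  have "scost p0 \<sigma>0 + scost p1 \<sigma>1 + scost p2 \<sigma>2 + scost p3 \<sigma>3 + scost p4 \<sigma>4 + scost p5 \<sigma>5 + scost p6 \<sigma>6 +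
      scost p7 \<sigma>7 + scost main \<sigma>8 \<le> total_size * (T1 + T2)"
    using c0 c1 c2 c3 c4 c5 c6 c7 c8 unfolding total_size_def by (simp only: distrib_right mult.assoc mult.left_commute[of _ 2])
  then show ?thesis unfolding T1_def T2_def E_def .
qed

end

context spmc_run begin

lemma run_program:
  assumes P: "P = comp program 0" and s: "pc s = 0" "sim h s" and h: "start h" and gm: "gm = maxlen (length hs)"
    and m: "1 \<le> m" and n: "1 \<le> n" and rk: "\<And>i. i < m \<Longrightarrow> rk i \<le> r" and nH: "gm = 0 \<Longrightarrow> length hs \<le> 1"
  obtains t s' where
    "t \<le> total_size * ((2 ^ (4 * NN) * (r + 1)) ^ depth * (length hs)\<^sup>2 + m\<^sup>2 * n * (r + al + gm + 1) ^ depth)"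
    "reach R P s t s'" "halted P s'"
    "nmem s' 0 = 0 \<Longrightarrow> \<forall>\<sigma>. length \<sigma> = al \<longrightarrow> set \<sigma> \<subseteq> {..<length hs} \<longrightarrow> Vec \<sigma> = (\<lambda>x. \<zero>)"
    "nmem s' 0 \<noteq> 0 \<Longrightarrow> set (map (\<lambda>j. nmem s' (100 + j)) [0..<al]) \<subseteq> {..<length hs} \<and>
       Vec (map (\<lambda>j. nmem s' (100 + j)) [0..<al]) \<noteq> (\<lambda>x. \<zero>) \<and>
       (\<forall>\<sigma>. length \<sigma> = al \<longrightarrow> set \<sigma> \<subseteq> {..<length hs} \<longrightarrow> Vec \<sigma> \<noteq> (\<lambda>x. \<zero>) \<longrightarrow>
         wsum \<sigma> \<le> wsum (map (\<lambda>j. nmem s' (100 + j)) [0..<al]))"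
proof -
  define h1 where "h1 = ex R p0 h"
  define h2 where "h2 = ex R p1 h1"
  define h3 where "h3 = ex R p2 h2"
  define h4 where "h4 = ex R p3 h3"
  define h5 where "h5 = ex R p4 h4"
  define h6 where "h6 = ex R p5 h5"
  define h7 where "h7 = ex R p6 h6"
  define h8 where "h8 = ex R p7 h7"
  define g where "g = ex R main h8"
  note defs = h1_def h2_def h3_def h4_def h5_def h6_def h7_def h8_def g_def
  note pro = prologue[OF h gm, folded defs]
  have bn: "bn h = 100 + (hpos (length hs) + al)" and bf: "bf h = 100 + n * DD" and br: "br h = 100 + length hs"
    using h by (auto simp: start_def)
  have bs: "bn k = bn h" "bf k = bf h" "br k = br h" if "k \<in> {h1, h2, h3, h4, h5, h6, h7, h8, g}" for k
    using that by (auto simp: defs)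
  have inf: "inputs_first k" if "k \<in> {h, h1, h2, h3, h4, h5, h6, h7, h8, g}" for k
    using that bs[of k] bn bf br by (auto simp: inputs_first_def)
  have b3: "based h3" by (rule pro)
  have b4: "based h4" unfolding h4_def by (rule based_ex[OF ok_pieces(4) b3])
  have b5: "based h5" unfolding h5_def by (rule based_ex[OF ok_pieces(5) b4])
  have b6: "based h6" unfolding h6_def by (rule based_ex[OF ok_pieces(6) b5])
  have b7: "based h7" unfolding h7_def by (rule based_ex[OF ok_pieces(7) b6])
  have b8: "based h8" unfolding h8_def by (rule based_ex[OF ok_pieces(8) b7])
  have l0: "loaded P (pc s) (comp (p0 ;; p1 ;; p2 ;; p3 ;; p4 ;; p5 ;; p6 ;; p7 ;; main ;; Skip) (pc s))"
    unfolding P program_def s(1) loaded_def by simp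
  obtain t1 s1 where 1: "t1 \<le> scost p0 (nv h)" "reach R P s t1 s1" "sim h1 s1"
    "loaded P (pc s1) (comp (p1 ;; p2 ;; p3 ;; p4 ;; p5 ;; p6 ;; p7 ;; main ;; Skip) (pc s1))" "pc s1 = pc s + clen p0"
    by (rule run_piece[OF l0 ok_pieces(1) s(2) _ inf bounds_pieces(1), where F = R, folded h1_def]) auto
  obtain t2 s2 where 2: "t2 \<le> scost p1 (nv h1)" "reach R P s1 t2 s2" "sim h2 s2"
    "loaded P (pc s2) (comp (p2 ;; p3 ;; p4 ;; p5 ;; p6 ;; p7 ;; main ;; Skip) (pc s2))" "pc s2 = pc s1 + clen p1"
    by (rule run_piece[OF 1(4) ok_pieces(2) 1(3) _ inf bounds_pieces(2), where F = R, folded h2_def]) auto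
  obtain t3 s3 where 3: "t3 \<le> scost p2 (nv h2)" "reach R P s2 t3 s3" "sim h3 s3"
    "loaded P (pc s3) (comp (p3 ;; p4 ;; p5 ;; p6 ;; p7 ;; main ;; Skip) (pc s3))" "pc s3 = pc s2 + clen p2"
    by (rule run_piece[OF 2(4) ok_pieces(3) 2(3) _ inf bounds_pieces(3), where F = R, folded h3_def]) auto
  obtain t4 s4 where 4: "t4 \<le> scost p3 (nv h3)" "reach R P s3 t4 s4" "sim h4 s4"
    "loaded P (pc s4) (comp (p4 ;; p5 ;; p6 ;; p7 ;; main ;; Skip) (pc s4))" "pc s4 = pc s3 + clen p3"
    by (rule run_piece[OF 3(4) ok_pieces(4) 3(3) b3 inf bounds_pieces(4), where F = R, folded h4_def]) auto
  obtain t5 s5 where 5: "t5 \<le> scost p4 (nv h4)" "reach R P s4 t5 s5" "sim h5 s5"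
    "loaded P (pc s5) (comp (p5 ;; p6 ;; p7 ;; main ;; Skip) (pc s5))" "pc s5 = pc s4 + clen p4"
    by (rule run_piece[OF 4(4) ok_pieces(5) 4(3) b4 inf bounds_pieces(5), where F = R, folded h5_def]) auto
  obtain t6 s6 where 6: "t6 \<le> scost p5 (nv h5)" "reach R P s5 t6 s6" "sim h6 s6"
    "loaded P (pc s6) (comp (p6 ;; p7 ;; main ;; Skip) (pc s6))" "pc s6 = pc s5 + clen p5"
    by (rule run_piece[OF 5(4) ok_pieces(6) 5(3) b5 inf bounds_pieces(6), where F = R, folded h6_def]) auto
  obtain t7 s7 where 7: "t7 \<le> scost p6 (nv h6)" "reach R P s6 t7 s7" "sim h7 s7"
    "loaded P (pc s7) (comp (p7 ;; main ;; Skip) (pc s7))" "pc s7 = pc s6 + clen p6"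
    by (rule run_piece[OF 6(4) ok_pieces(7) 6(3) b6 inf bounds_pieces(7), where F = R, folded h7_def]) auto
  obtain t8 s8 where 8: "t8 \<le> scost p7 (nv h7)" "reach R P s7 t8 s8" "sim h8 s8"
    "loaded P (pc s8) (comp (main ;; Skip) (pc s8))" "pc s8 = pc s7 + clen p7"
    by (rule run_piece[OF 7(4) ok_pieces(8) 7(3) b7 inf bounds_pieces(8), where F = R, folded h8_def]) auto
  obtain t9 s9 where 9: "t9 \<le> scost main (nv h8)" "reach R P s8 t9 s9" "sim g s9" "pc s9 = pc s8 + clen main"
    by (rule run_piece[OF 8(4) ok_pieces(9) 8(3) b8 inf bounds_pieces(9), where F = R, folded g_def]) auto
  have reach: "reach R P s (t1 + (t2 + (t3 + (t4 + (t5 + (t6 + (t7 + (t8 + t9)))))))) s9"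
    by (rule reach_trans 1 2 3 4 5 6 7 8 9)+
  have n8: "nv h8 1 = m" "nv h8 3 = al" "nv h8 4 = length hs" "nv h8 5 = DD" "nv h8 6 = gm" "nv h8 7 = NN"
      "nv h8 8 = EE" "nv h8 9 = LL" "nv h8 10 = NR" "nv h8 11 = 2 ^ NN"
    using pro(1) by (auto simp: ready_def dims_def LL_def)
  have nH': "gm = 0" if "length hs = 0" unfolding gm maxlen_def using that by simp
  have "t1 + (t2 + (t3 + (t4 + (t5 + (t6 + (t7 + (t8 + t9))))))) \<le>
      scost p0 (nv h) + scost p1 (nv h1) + scost p2 (nv h2) + scost p3 (nv h3) + scost p4 (nv h4) +
      scost p5 (nv h5) + scost p6 (nv h6) + scost p7 (nv h7) + scost main (nv h8)"
    using 1(1) 2(1) 3(1) 4(1) 5(1) 6(1) 7(1) 8(1) 9(1) by linarith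
  also have "\<dots> \<le> total_size * ((2 ^ (4 * NN) * (r + 1)) ^ depth * (length hs)\<^sup>2 + m\<^sup>2 * n * (r + al + gm + 1) ^ depth)"
    by (rule total_cost[OF m n]) (fact rk nH nH' pro n8 | simp add: rk nH nH')+
  finally have time: "t1 + (t2 + (t3 + (t4 + (t5 + (t6 + (t7 + (t8 + t9))))))) \<le>
    total_size * ((2 ^ (4 * NN) * (r + 1)) ^ depth * (length hs)\<^sup>2 + m\<^sup>2 * n * (r + al + gm + 1) ^ depth)" .
  have halt: "halted P s9"
    using s(1) 1(5) 2(5) 3(5) 4(5) 5(5) 6(5) 7(5) 8(5) 9(4) by (simp add: halted_def P clen_comp program_def)
  have bal: "100 + al \<le> bn h8" using bs[of h8] bn by simp
  note out = run_main[OF pro(1-3) bal, folded g_def]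
  have bg: "100 + al \<le> bn g" using bs[of g] bn by simp
  have n0: "nmem s9 0 = nv g 0" using 9(3) by (simp add: sim_def)
  have "nmem s9 (100 + j) = ni g j" if "j < al" for j
    using 9(3) bg that by (simp add: sim_def cell_def)
  then have seq: "map (\<lambda>j. nmem s9 (100 + j)) [0..<al] = map (ni g) [0..<al]" by simp
  show ?thesis
    using that[OF time reach halt, unfolded n0 seq] out by blast
qed

section \<open>The initial state and the layout of the input\<close>

definition store0 :: "nat list \<Rightarrow> 'f list \<Rightarrow> real list \<Rightarrow> 'f store" where
  "store0 xs ys zs = \<lparr>nv = \<lambda>x. 0, na = \<lambda>a k. 0, ni = \<lambda>k. if k < length xs then xs ! k else 0,
     fv = \<lambda>x. \<zero>, fa = \<lambda>a k. \<zero>, fi = \<lambda>k. if k < length ys then ys ! k else \<zero>,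
     ra = \<lambda>a k. 0, ri = \<lambda>k. if k < length zs then zs ! k else 0,
     bn = 100 + (length xs + al), bf = 100 + length ys, br = 100 + length zs\<rparr>"

lemma sim_store0:
  "sim (store0 xs ys zs) \<lparr>pc = 0, nmem = memory_of 0 100 xs, fmem = memory_of \<zero> 100 ys, rmem = memory_of 0 100 zs\<rparr>"
  by (auto simp: sim_def store0_def cell_def memory_of_def)

lemma nth_input:
  fixes p d :: nat
  defines "xs \<equiv> [m, n, al, p, d, length hs] @ map rk [0..<m] @ concat (map (\<lambda>h. length h # h) hs)"
  shows "length xs = hpos (length hs)" "i < m \<Longrightarrow> xs ! (6 + i) = rk i"
    "i < length hs \<Longrightarrow> k < Suc (length (hs ! i)) \<Longrightarrow> hpos i + k < length xs \<and> xs ! (hpos i + k) = (length (hs ! i) # hs ! i) ! k"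
proof -
  let ?c = "map (\<lambda>h. length h # h) hs"
  have hp: "hpos i = 6 + m + (\<Sum>i'<i. length (?c ! i'))" if "i \<le> length hs" for i
    unfolding hpos_def using that by (intro arg_cong2[where f = "(+)"] sum.cong) auto
  have "length (concat ?c) = (\<Sum>i'<length hs. length (?c ! i'))"
    unfolding length_concat sum_list_sum_nth by (simp add: atLeast0LessThan)
  then show "length xs = hpos (length hs)" using hp[of "length hs"] by (simp add: xs_def)
  show "xs ! (6 + i) = rk i" if "i < m" using that by (simp add: xs_def nth_append)
  show "hpos i + k < length xs \<and> xs ! (hpos i + k) = (length (hs ! i) # hs ! i) ! k"
    if "i < length hs" "k < Suc (length (hs ! i))"
    using nth_concat_sum[of i ?c k] that hp[of i] by (simp add: xs_def nth_append)
qed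

lemma start_store0:
  assumes "length ys = n * DD" "Fin = (\<lambda>k. if k < length ys then ys ! k else \<zero>)"
  shows "start (store0 ([m, n, al, p, d, length hs] @ map rk [0..<m] @ concat (map (\<lambda>h. length h # h) hs)) ys (map wt [0..<length hs]))"
proof -
  let ?xs = "[m, n, al, p, d, length hs] @ map rk [0..<m] @ concat (map (\<lambda>h. length h # h) hs)"
  have 1: "hpos i < length ?xs \<and> ?xs ! hpos i = length (hs ! i)" if "i < length hs" for i
    using nth_input(3)[OF that, of 0 p d] by simp
  have 2: "hpos i + 1 + k < length ?xs \<and> ?xs ! (hpos i + 1 + k) = hs ! i ! k" if "i < length hs" "k < length (hs ! i)" for i k
    using nth_input(3)[OF that(1), of "Suc k" p d] that(2) by simp
  have 3: "6 + i < length ?xs \<and> ?xs ! (6 + i) = rk i" if "i < m" for i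
    using nth_input(2)[OF that, of p d] that by simp
  have 4: "length ?xs = hpos (length hs)" by (rule nth_input)
  define xs where "xs = ?xs"
  have 5: "6 \<le> length xs" "xs ! 0 = m" "xs ! 1 = n" "xs ! 2 = al" "xs ! 5 = length hs" by (simp_all add: xs_def)
  show ?thesis unfolding xs_def[symmetric] start_def store0_def
    using 1[folded xs_def] 2[folded xs_def] 3[folded xs_def] 4[folded xs_def] 5 assms by auto
qed

end

text \<open>Matroid \<open>i\<close> occupies \<open>length us * rk i\<close> cells, so the offset
  of its block is \<open>length us\<close> times the sum of the earlier ranks.\<close>

lemma nth_matrices:
  fixes A :: "nat \<Rightarrow> nat \<Rightarrow> 'a \<Rightarrow> 'f" and rk :: "nat \<Rightarrow> nat" and us :: "'a list" and m :: nat
  defines "ys \<equiv> concat (map (\<lambda>i. concat (map (\<lambda>u. map (\<lambda>k. A i k u) [0..<rk i]) us)) [0..<m])"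
  shows "length ys = length us * (\<Sum>i<m. rk i)"
    "i < m \<Longrightarrow> u < length us \<Longrightarrow> k < rk i \<Longrightarrow> length us * (\<Sum>i'<i. rk i') + rk i * u + k < length ys \<and>
      ys ! (length us * (\<Sum>i'<i. rk i') + rk i * u + k) = A i k (us ! u)"
proof -
  define b where "b i = concat (map (\<lambda>u. map (\<lambda>k. A i k u) [0..<rk i]) us)" for i
  have lb: "length (b i) = length us * rk i" for i
    by (simp add: b_def length_concat o_def sum_list_triv)
  have ys: "ys = concat (map b [0..<m])" by (simp add: ys_def b_def[abs_def])
  show "length ys = length us * (\<Sum>i<m. rk i)"
    by (simp add: ys length_concat o_def lb sum_list_distinct_conv_sum_set sum_distrib_left atLeast0LessThan)
  show "length us * (\<Sum>i'<i. rk i') + rk i * u + k < length ys \<and>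
      ys ! (length us * (\<Sum>i'<i. rk i') + rk i * u + k) = A i k (us ! u)" if i: "i < m" "u < length us" "k < rk i"
  proof -
    let ?c = "map (\<lambda>u. map (\<lambda>k. A i k u) [0..<rk i]) us"
    have "(\<Sum>u'<u. length (?c ! u')) = rk i * u" using i by simp
    then have 1: "rk i * u + k < length (b i)" "b i ! (rk i * u + k) = A i k (us ! u)"
      using nth_concat_sum[of u ?c k] i by (auto simp: b_def mult.commute)
    have "(\<Sum>i'<i. length (map b [0..<m] ! i')) = length us * (\<Sum>i'<i. rk i')"
      using i by (simp add: lb sum_distrib_left)
    then show ?thesis using nth_concat_sum[of i "map b [0..<m]" "rk i * u + k"] i 1 by (simp add: ys add.assoc)
  qed
qed

text \<open>Used to see that optimality among lists of positions is optimality among all feasible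
  choices of members.\<close>

lemma ex_positions:
  assumes "set Hs \<subseteq> set (map f xs)"
  obtains \<sigma> where "length \<sigma> = length Hs" "set \<sigma> \<subseteq> {..<length xs}" "Hs = map (\<lambda>i. f (xs ! i)) \<sigma>"
proof -
  have "\<forall>H\<in>set Hs. \<exists>i<length xs. H = f (xs ! i)" using assms by (force simp: in_set_conv_nth)
  then obtain g where "\<forall>H\<in>set Hs. g H < length xs \<and> H = f (xs ! g H)" by metis
  then show ?thesis by (intro that[of "map g Hs"]) (auto intro!: map_idI[symmetric])
qed

theorem theorem4p2:
  "\<exists>(P :: prog) (R :: nat) (c :: nat) (q :: nat poly) (Q :: nat poly).
     \<forall>(F :: 'f ring) (p :: nat) (d :: nat) (X :: 'a spmc) (A :: nat \<Rightarrow> nat \<Rightarrow> 'a \<Rightarrow> 'f)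
      (r :: nat) (\<gamma> :: nat) (us :: 'a list) (hs :: nat list list).
       field F \<longrightarrow> prime p \<longrightarrow> 0 < d \<longrightarrow> finite (carrier F) \<longrightarrow> card (carrier F) = p ^ d \<longrightarrow>
       spmc_instance X \<longrightarrow> ground X \<noteq> {} \<longrightarrow> 1 \<le> num_matroids X \<longrightarrow>
       (\<forall>H \<in> family X. card H \<le> \<gamma>) \<longrightarrow>
       (\<forall>i<num_matroids X. matroid_rank (indeps X i) \<le> r \<and>
                            represents F (ground X) (indeps X i) (A i)) \<longrightarrow>
       encodes us hs X \<longrightarrow>
       solves_within P R F p d X A us hs
         (2 ^ (c * (alpha X * \<gamma> * num_matroids X)) * card (family X) ^ 2 * poly q r
          + num_matroids X ^ 2 * card (ground X) * poly Q (r + alpha X + \<gamma> + p + d))"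
proof (intro exI allI impI)
  fix F :: "'f ring" and p d :: nat and X :: "'a spmc" and A :: "nat \<Rightarrow> nat \<Rightarrow> 'a \<Rightarrow> 'f" and r \<gamma> :: nat
    and us :: "'a list" and hs :: "nat list list"
  assume F: "field F" and X: "spmc_instance X" "ground X \<noteq> {}" "1 \<le> num_matroids X"
    and \<gamma>: "\<forall>H \<in> family X. card H \<le> \<gamma>"
    and A: "\<forall>i<num_matroids X. matroid_rank (indeps X i) \<le> r \<and> represents F (ground X) (indeps X i) (A i)"
    and enc: "encodes us hs X"
  define m n al where "m = num_matroids X" and "n = length us" and "al = alpha X"
  \<comment> \<open>The bound \<gamma> is not part of the input. The machine works with the largest
    size that occurs, which is at most \<gamma>.\<close>
  define gm where "gm = fold max (map length hs) 0"
  define rk where "rk i = matroid_rank (indeps X i)" for i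
  define wt where "wt k = weight X (set_at us (hs ! k))" for k
  define ys where "ys = concat (map (\<lambda>i. concat (map (\<lambda>u. map (\<lambda>k. A i k u) [0..<rk i]) us)) [0..<m])"
  define Fin where "Fin k = (if k < length ys then ys ! k else \<zero>\<^bsub>F\<^esub>)" for k
  have us: "distinct us" "set us = ground X" and hd: "\<And>h. h \<in> set hs \<Longrightarrow> distinct h \<and> set h \<subseteq> {..<n}"
    and fam: "distinct (map (set_at us) hs)" "set (map (set_at us) hs) = family X"
    using enc by (auto simp: encodes_def n_def)
  have gm: "gm = Max (insert 0 (length ` set hs))"
    unfolding gm_def by (metis Max.set_eq_fold image_set list.simps(15))
  have ysF: "set ys \<subseteq> carrier F"
    using A us by (fastforce simp: ys_def represents_def rk_def m_def)
  interpret spmc_run F m n al gm rk hs Fin wt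
  proof (intro spmc_run.intro spmc_run_axioms.intro F)
    interpret field F by (rule F)
    show "Fin k \<in> carrier F" for k using ysF by (auto simp: Fin_def)
    show "u < n" if "h \<in> set hs" "u \<in> set h" for h u using hd[OF that(1)] that(2) by auto
    show "length h \<le> gm" if "h \<in> set hs" for h using that by (auto simp: gm)
  qed
  have card_at: "card (set_at us h) = length h" if "h \<in> set hs" for h
    unfolding set_at_def using hd[OF that] us(1)
    by (subst card_image) (auto simp: inj_on_def n_def nth_eq_iff_index_eq distinct_card subset_iff)
  have gm\<gamma>: "gm \<le> \<gamma>"
  proof -
    have "length h \<le> \<gamma>" if "h \<in> set hs" for h
    proof -
      have "set_at us h \<in> family X" unfolding fam(2)[symmetric] using that by simp
      then show ?thesis using \<gamma> card_at[OF that] by auto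
    qed
    then show ?thesis by (auto simp: gm Max_le_iff)
  qed
  \<comment> \<open>The members are pairwise different sets, so at most one of them is
    empty.\<close>
  have nH: "length hs \<le> 1" if "gm = 0"
  proof (rule ccontr)
    assume "\<not> length hs \<le> 1"
    then have l: "0 < length hs" "1 < length hs" by linarith+
    have "hs ! 0 = []" "hs ! 1 = []" using hs_len[OF nth_mem[OF l(1)]] hs_len[OF nth_mem[OF l(2)]] that by simp_all
    then show False using l nth_eq_iff_index_eq[OF fam(1), of 0 1] by simp
  qed
  have ys: "length ys = n * DD" "\<And>i u k. i < m \<Longrightarrow> u < n \<Longrightarrow> k < rk i \<Longrightarrow> Fin (n * off i + rk i * u + k) = A i k (us ! u)"
    using nth_matrices[where A = A and rk = rk and us = us and m = m]
    by (auto simp: ys_def n_def DD_def off_def Fin_def)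
  define s0 where "s0 = init_state 100 F p d X A us hs"
  define h0 where "h0 = store0 ([m, n, al, p, d, length hs] @ map rk [0..<m] @ concat (map (\<lambda>h. length h # h) hs)) ys
    (map wt [0..<length hs])"
  have s0: "pc s0 = 0" by (simp add: s0_def init_state_def)
  have wts: "map (\<lambda>h. weight X (set_at us h)) hs = map wt [0..<length hs]"
    by (auto intro!: nth_equalityI simp: wt_def)
  have sim0: "sim h0 s0"
    unfolding h0_def s0_def init_state_def wts m_def[symmetric] n_def[symmetric] al_def[symmetric]
      rk_def[symmetric] ys_def[symmetric] by (rule sim_store0)
  have start0: "start h0" unfolding h0_def by (rule start_store0[OF ys(1)]) (simp add: Fin_def fun_eq_iff)
  have m1: "1 \<le> m" using X by (simp add: m_def)
  have n1: "1 \<le> n" using X us by (cases us) (auto simp: n_def)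
  have rkr: "rk i \<le> r" if "i < m" for i using A that by (simp add: rk_def m_def)
  have gm': "gm = maxlen (length hs)" by (simp add: maxlen_def gm_def)
  obtain t s' where t: "t \<le> total_size * ((2 ^ (4 * NN) * (r + 1)) ^ depth * (length hs)\<^sup>2 + m\<^sup>2 * n * (r + al + gm + 1) ^ depth)"
    and run: "reach F (comp program 0) s0 t s'" "halted (comp program 0) s'"
    and out: "nmem s' 0 = 0 \<Longrightarrow> \<forall>\<sigma>. length \<sigma> = al \<longrightarrow> set \<sigma> \<subseteq> {..<length hs} \<longrightarrow> Vec \<sigma> = (\<lambda>x. \<zero>\<^bsub>F\<^esub>)"
    "nmem s' 0 \<noteq> 0 \<Longrightarrow> set (map (\<lambda>j. nmem s' (100 + j)) [0..<al]) \<subseteq> {..<length hs} \<and>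
       Vec (map (\<lambda>j. nmem s' (100 + j)) [0..<al]) \<noteq> (\<lambda>x. \<zero>\<^bsub>F\<^esub>) \<and>
       (\<forall>\<sigma>. length \<sigma> = al \<longrightarrow> set \<sigma> \<subseteq> {..<length hs} \<longrightarrow> Vec \<sigma> \<noteq> (\<lambda>x. \<zero>\<^bsub>F\<^esub>) \<longrightarrow>
         wsum \<sigma> \<le> wsum (map (\<lambda>j. nmem s' (100 + j)) [0..<al]))"
    by (rule run_program[OF refl s0 sim0 start0 gm' m1 n1 rkr nH]) (assumption | rule that)+
  have feas: "Vec \<sigma> \<noteq> (\<lambda>x. \<zero>\<^bsub>F\<^esub>) \<longleftrightarrow> feasible X (map (\<lambda>i. set_at us (hs ! i)) \<sigma>)"
    if "length \<sigma> = al" "set \<sigma> \<subseteq> {..<length hs}" for \<sigma>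
    using m1 A enc that by (intro Vec_feasible[OF ys(2)]) (auto simp: m_def n_def al_def rk_def)
  have all: "\<exists>\<sigma>. length \<sigma> = al \<and> set \<sigma> \<subseteq> {..<length hs} \<and> Hs = map (\<lambda>i. set_at us (hs ! i)) \<sigma>" if "feasible X Hs" for Hs
    using that fam(2) ex_positions[of Hs "set_at us" hs] by (metis al_def feasible_def)
  have ws: "sum_list (map (weight X) (map (\<lambda>i. set_at us (hs ! i)) \<sigma>)) = wsum \<sigma>" for \<sigma>
    unfolding wsum_def by (simp add: wt_def[abs_def] o_def)
  have correct: "correct_output 100 X us hs s'"
  proof (cases "nmem s' 0 = 0")
    case True
    have "\<not> feasible X Hs" for Hs using out(1)[OF True] feas all by metis
    then show ?thesis using True by (simp add: correct_output_def)
  next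
    case False
    let ?\<sigma> = "map (\<lambda>j. nmem s' (100 + j)) [0..<al]"
    have \<sigma>: "length ?\<sigma> = al" "set ?\<sigma> \<subseteq> {..<length hs}" "Vec ?\<sigma> \<noteq> (\<lambda>x. \<zero>\<^bsub>F\<^esub>)" using out(2)[OF False] by auto
    have eq: "map (\<lambda>j. set_at us (hs ! nmem s' (100 + j))) [0..<al] = map (\<lambda>i. set_at us (hs ! i)) ?\<sigma>" by simp
    have "optimal X (map (\<lambda>i. set_at us (hs ! i)) ?\<sigma>)"
      unfolding optimal_def using feas[OF \<sigma>(1,2)] \<sigma>(3) all feas out(2)[OF False] ws by metis
    moreover have "\<forall>j<al. nmem s' (100 + j) < length hs" using \<sigma>(2) by (auto simp: image_subset_iff)
    ultimately show ?thesis using False unfolding correct_output_def al_def[symmetric] eq by simp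
  qed
  have cf: "card (family X) = length hs" using fam distinct_card by fastforce
  have cg: "card (ground X) = n" using us distinct_card by (fastforce simp: n_def)
  have "NN \<le> m * al * \<gamma>" unfolding NN_def using gm\<gamma> by simp
  \<comment> \<open>This yields the constant in the exponent: each of the \<open>depth\<close>
    factors of the time bound contributes \<open>2 ^ (4 * NN)\<close>, and \<open>NN\<close> is at
    most the product in the claim.\<close>
  then have N: "4 * NN * depth \<le> 4 * depth * (alpha X * \<gamma> * num_matroids X)"
    unfolding m_def al_def by (simp add: mult.commute mult.left_commute)
  have "(2 ^ (4 * NN) * (r + 1)) ^ depth = 2 ^ (4 * NN * depth) * (r + 1) ^ depth"
    by (simp only: power_mult_distrib power_mult)
  also have "\<dots> \<le> 2 ^ (4 * depth * (alpha X * \<gamma> * num_matroids X)) * (r + 1) ^ depth"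
    using N by (intro mult_le_mono1 power_increasing) auto
  finally have B: "(2 ^ (4 * NN) * (r + 1)) ^ depth \<le> 2 ^ (4 * depth * (alpha X * \<gamma> * num_matroids X)) * (r + 1) ^ depth" .
  have "total_size * ((2 ^ (4 * NN) * (r + 1)) ^ depth * (length hs)\<^sup>2) \<le>
      2 ^ (4 * depth * (alpha X * \<gamma> * num_matroids X)) * (length hs)\<^sup>2 * (total_size * (r + 1) ^ depth)"
    using mult_le_mono2[OF mult_le_mono1[OF B, of "(length hs)\<^sup>2"], of total_size] by (simp only: ac_simps)
  moreover have "total_size * (m\<^sup>2 * n * (r + al + gm + 1) ^ depth) \<le>
      m\<^sup>2 * n * (total_size * (r + alpha X + \<gamma> + p + d + 1) ^ depth)"
    using gm\<gamma> by (simp add: al_def power_mono)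
  ultimately have "t \<le> 2 ^ (4 * depth * (alpha X * \<gamma> * num_matroids X)) * (length hs)\<^sup>2 * (total_size * (r + 1) ^ depth) +
      m\<^sup>2 * n * (total_size * (r + alpha X + \<gamma> + p + d + 1) ^ depth)"
    using t unfolding distrib_left by linarith
  then have "t \<le> 2 ^ (4 * depth * (alpha X * \<gamma> * num_matroids X)) * card (family X) ^ 2 * poly ([:total_size:] * [:1, 1:] ^ depth) r
          + num_matroids X ^ 2 * card (ground X) * poly ([:total_size:] * [:1, 1:] ^ depth) (r + alpha X + \<gamma> + p + d)"
    by (simp add: cf cg m_def add.commute)
  \<comment> \<open>The witnesses left open at the start are fixed here: the compiled program, 100
    registers, and polynomials that are both \<open>total_size\<close> times the power
    \<open>depth\<close> of 1 + x. None of them depends on the field or the instance.\<close>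
  then show "solves_within (comp program 0) 100 F p d X A us hs
         (2 ^ (4 * depth * (alpha X * \<gamma> * num_matroids X)) * card (family X) ^ 2 * poly ([:total_size:] * [:1, 1:] ^ depth) r
          + num_matroids X ^ 2 * card (ground X) * poly ([:total_size:] * [:1, 1:] ^ depth) (r + alpha X + \<gamma> + p + d))"
    using run correct unfolding solves_within_def s0_def reach_def Let_def by blast
qed

end
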